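(* Let $X_{n,1},\dots,X_{n,k_n}$ be a triangular array of random variables in a Polish space $\mathcal X$; for each $n$ let $\mathcal F_n=\{f_{n,t}:t\in T\}$ be a set of measurable functions $\mathcal X\to\mathbb R$, and suppose $\bigcup_n\mathcal F_n$ has a finite envelope $F:\mathcal X\to\mathbb R$, i.e. $\sup_{n\in\mathbb N,f\in\mathcal F_n}|f(x)|\le F(x)$ for all $x\in\mathcal X$. Let $\mathbb G_n\in\ell^\infty(T)$, $$\mathbb G_n(t)=\frac1{\sqrt{k_n}}\sum_{i=1}^{k_n}\bigl(f_{n,t}(X_{n,i})-\mathbb E[f_{n,t}(X_{n,i})]\bigr).$$ Assume that for some $\gamma>2$: (i) $\|F\|_{\gamma,\infty}<\infty$; (ii) $\sup_{n\in\mathbb N}\max_{m\le k_n}m^\rho\beta_n(m)<\infty$ for some $\rho>\gamma/(\gamma-2)$; (iii) $\int_0^{\delta_n}\sqrt{\ln N_{[]}(\epsilon,\mathcal F_n,\|\cdot\|_{\gamma,n})}\,d\epsilon\to0$ for all $\delta_n\downarrow0$, and the integrals are finite for all $n$. Write $d_n(s,t)=\|f_{n,s}-f_{n,t}\|_{\gamma,n}$ for $s,t\in T$, and assume that there is a semi-metric $d$ on $T$ such that $(T,d)$ is totally bounded and $\lim_{n\to\infty}\sup_{d(s,t)<\delta_n}d_n(s,t)=0$ for all $\delta_n\downarrow0$. Then $\mathbb G_n$ is asymptotically tight, and there exists an asymptotically tight sequence of tight Borel measurable Gaussian processes $N_n$ corresponding to $\mathbb G_n$.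
   Context: Throughout $k_n\to\infty$. Semi-norms: $\|h\|_{\gamma,n}=\bigl(\frac1{k_n}\sum_{i=1}^{k_n}\mathbb E[|h(X_{n,i})|^\gamma]\bigr)^{1/\gamma}$ and $\|h\|_{\gamma,\infty}=\sup_n\|h\|_{\gamma,n}$. Bracketing numbers: $N_{[]}(\epsilon,\mathcal G,\|\cdot\|)$ is the minimal number of brackets $[l_i,u_i]=\{g\in\mathcal G: l_i\le g\le u_i\}$, with $l_i,u_i:\mathcal X\to\mathbb R$ measurable and $\|l_i-u_i\|\le\epsilon$, whose union is $\mathcal G$. Mixing: for sub-$\sigma$-algebras, $\beta(\mathcal A_1,\mathcal A_2)=\frac12\sup\sum_{(i,j)\in I\times J}|\mathbb P(A_i\cap B_j)-\mathbb P(A_i)\mathbb P(B_j)|$, the supremum being over all finite partitions $(A_i)_{i\in I}\subset\mathcal A_1$, $(B_j)_{j\in J}\subset\mathcal A_2$ of $\Omega$; $\beta_n(p)=\sup_{k\le k_n-p}\beta(\sigma(X_{n,1},\dots,X_{n,k}),\sigma(X_{n,k+p},\dots,X_{n,k_n}))$ (supremum over an empty index set is $0$). $\ell^\infty(T)$ is the space of bounded functions $T\to\mathbb R$ with the uniform metric. A sequence of (not necessarily measurable) maps $X_n$ with values in a metric space $\mathbb D$ is asymptotically tight if for all $\varepsilon>0$ there is a compact $K\subseteq\mathbb D$ with $\liminf_n\mathbb P_*(X_n\in K^\delta)\ge1-\varepsilon$ for all $\delta>0$, where $\mathbb P_*$ is inner probability and $K^\delta=\{y:\exists x\in K,\ d(x,y)<\delta\}$.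 A Gaussian process (GP) corresponding to a stochastic process $Y\in\ell^\infty(T)$ with finite second moments is a map $N_Y$ with values in $\ell^\infty(T)$ such that $\{N_Y(t):t\in T\}$ is a centered GP with covariance function $(s,t)\mapsto\mathrm{Cov}[Y(s),Y(t)]$. *)

theory Defs
  imports "HOL-Probability.Probability"
begin

text \<open>
  The bounded functions on an arbitrary index type \<^typ>\<open>'t\<close> with the uniform metric are the bounded
  continuous functions on \<^typ>\<open>'t discrete\<close>, on which every function is continuous.
\<close>

type_synonym 't linf = "'t discrete \<Rightarrow>\<^sub>C real"

definition linf_eval :: "'t linf \<Rightarrow> 't \<Rightarrow> real" where
  "linf_eval x t = apply_bcontfun x (discrete t)"

text \<open>Only meaningful for bounded \<open>h\<close>; see \<open>linf_eval_to_linf\<close>.\<close>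

definition to_linf :: "('t \<Rightarrow> real) \<Rightarrow> 't linf" where
  "to_linf h = Bcontfun (\<lambda>t. h (of_discrete t))"

lemma linf_eval_to_linf:
  assumes "bounded (range h)"
  shows "linf_eval (to_linf h) t = h t"
proof -
  have "range (\<lambda>t. h (of_discrete t)) \<subseteq> range h"
    by auto
  with assms have "bounded (range (\<lambda>t. h (of_discrete t)))"
    by (rule bounded_subset)
  moreover have "continuous_on UNIV (\<lambda>t. h (of_discrete t))"
    by (auto simp: continuous_on_open_vimage open_discrete)
  ultimately have "(\<lambda>t. h (of_discrete t)) \<in> bcontfun"
    by (simp add: bcontfun_def)
  then show ?thesis
    by (simp add: linf_eval_def to_linf_def Bcontfun_inverse discrete_inverse)
qed

lemma dist_linf: "dist x y = (SUP t. \<bar>linf_eval x t - linf_eval y t\<bar>)"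
proof -
  have "range discrete = (UNIV :: 'a discrete set)"
    by (metis of_discrete_inverse surjI)
  then have "(SUP t. dist (apply_bcontfun x t) (apply_bcontfun y t)) =
      (SUP t \<in> range discrete. dist (apply_bcontfun x t) (apply_bcontfun y t))"
    by simp
  then show ?thesis
    by (simp add: dist_bcontfun.rep_eq linf_eval_def dist_real_def image_image)
qed

definition empirical_process ::
  "'w measure \<Rightarrow> nat \<Rightarrow> (nat \<Rightarrow> 'w \<Rightarrow> 'x) \<Rightarrow> ('t \<Rightarrow> 'x \<Rightarrow> real) \<Rightarrow> 'w \<Rightarrow> 't linf" where
  "empirical_process M k X f \<omega> =
     to_linf (\<lambda>t. 1 / sqrt (real k) *
       (\<Sum>i=1..k. f t (X i \<omega>) - (\<integral>\<omega>'. f t (X i \<omega>') \<partial>M)))"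

lemma linf_eval_empirical_process:
  assumes f: "\<And>t x. \<bar>f t x\<bar> \<le> F x" "\<And>t. f t \<in> borel_measurable borel"
    and X: "\<And>i. i \<in> {1..k} \<Longrightarrow> X i \<in> borel_measurable M"
    and F: "\<And>i. i \<in> {1..k} \<Longrightarrow> integrable M (\<lambda>\<omega>. F (X i \<omega>))"
  shows "linf_eval (empirical_process M k X f \<omega>) t =
     1 / sqrt (real k) * (\<Sum>i=1..k. f t (X i \<omega>) - (\<integral>\<omega>'. f t (X i \<omega>') \<partial>M))"
  unfolding empirical_process_def
proof (rule linf_eval_to_linf, rule boundedI, safe)
  fix t
  have E: "\<bar>\<integral>\<omega>'. f t (X i \<omega>') \<partial>M\<bar> \<le> (\<integral>\<omega>'. F (X i \<omega>') \<partial>M)" if i: "i \<in> {1..k}" for i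
  proof -
    have "(\<lambda>\<omega>. f t (X i \<omega>)) \<in> borel_measurable M"
      using f(2) X[OF i] by measurable
    then have "integrable M (\<lambda>\<omega>. f t (X i \<omega>))"
      using F[OF i] f(1) by (rule_tac Bochner_Integration.integrable_bound[OF F[OF i]])
        (auto intro!: AE_I2 order_trans[OF f(1)])
    then show ?thesis
      using F[OF i] f(1)
      by (intro order_trans[OF integral_abs_bound] integral_mono) auto
  qed
  have "\<bar>\<Sum>i=1..k. f t (X i \<omega>) - (\<integral>\<omega>'. f t (X i \<omega>') \<partial>M)\<bar> \<le>
      (\<Sum>i=1..k. F (X i \<omega>) + (\<integral>\<omega>'. F (X i \<omega>') \<partial>M))"
  proof (rule order_trans[OF sum_abs], rule sum_mono)
    fix i assume "i \<in> {1..k}"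
    from E[OF this] f(1)[of t "X i \<omega>"]
    show "\<bar>f t (X i \<omega>) - (\<integral>\<omega>'. f t (X i \<omega>') \<partial>M)\<bar> \<le> F (X i \<omega>) + (\<integral>\<omega>'. F (X i \<omega>') \<partial>M)"
      by linarith
  qed
  then show "norm (1 / sqrt (real k) * (\<Sum>i=1..k. f t (X i \<omega>) - (\<integral>\<omega>'. f t (X i \<omega>') \<partial>M))) \<le>
      1 / sqrt (real k) * (\<Sum>i=1..k. F (X i \<omega>) + (\<integral>\<omega>'. F (X i \<omega>') \<partial>M))"
    by (simp add: abs_mult divide_right_mono)
qed

text \<open>Meant for exponents \<open>p > 0\<close>.\<close>

definition ennreal_powr :: "ennreal \<Rightarrow> real \<Rightarrow> ennreal" where
  "ennreal_powr x p = (if x = \<infinity> then \<infinity> else ennreal (enn2real x powr p))"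

text \<open>Extended-valued, because bracket functions need not have finite moments.\<close>

definition row_seminorm ::
  "'w measure \<Rightarrow> nat \<Rightarrow> (nat \<Rightarrow> 'w \<Rightarrow> 'x) \<Rightarrow> real \<Rightarrow> ('x \<Rightarrow> real) \<Rightarrow> ennreal" where
  "row_seminorm M k X \<gamma> h =
     ennreal_powr ((\<Sum>i=1..k. \<integral>\<^sup>+ \<omega>. ennreal (\<bar>h (X i \<omega>)\<bar> powr \<gamma>) \<partial>M) / of_nat k) (1 / \<gamma>)"

definition bracket :: "('x \<Rightarrow> real) set \<Rightarrow> ('x \<Rightarrow> real) \<Rightarrow> ('x \<Rightarrow> real) \<Rightarrow> ('x \<Rightarrow> real) set" where
  "bracket G l u = {g \<in> G. \<forall>x. l x \<le> g x \<and> g x \<le> u x}"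

text \<open>The value is \<open>\<infinity>\<close> if no finite family of brackets suffices.\<close>

definition bracketing_number ::
  "real \<Rightarrow> ('x::topological_space \<Rightarrow> real) set \<Rightarrow> (('x \<Rightarrow> real) \<Rightarrow> ennreal) \<Rightarrow> enat" where
  "bracketing_number \<epsilon> G nrm = Inf {enat m | m.
     \<exists>l u. (\<forall>i<m. l i \<in> borel_measurable borel \<and> u i \<in> borel_measurable borel \<and>
                   nrm (\<lambda>x. l i x - u i x) \<le> ennreal \<epsilon>) \<and>
           (\<Union>i<m. bracket G (l i) (u i)) = G}"

definition sqrt_ln :: "enat \<Rightarrow> ennreal" where
  "sqrt_ln N = (case N of enat m \<Rightarrow> ennreal (sqrt (ln (real m))) | \<infinity> \<Rightarrow> \<infinity>)"

definition bracketing_integral ::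
  "real \<Rightarrow> ('x::topological_space \<Rightarrow> real) set \<Rightarrow> (('x \<Rightarrow> real) \<Rightarrow> ennreal) \<Rightarrow> ennreal" where
  "bracketing_integral \<delta> G nrm = (\<integral>\<^sup>+ \<epsilon>\<in>{0..\<delta>}. sqrt_ln (bracketing_number \<epsilon> G nrm) \<partial>lborel)"

text \<open>Admitting only nonempty partition blocks changes nothing, as empty blocks contribute \<open>0\<close>.\<close>

definition beta_coeff :: "'w measure \<Rightarrow> 'w set set \<Rightarrow> 'w set set \<Rightarrow> ennreal" where
  "beta_coeff M \<A> \<B> = (1 / 2) *
     (SUP (P, R) \<in> {(P, R). finite P \<and> partition_on (space M) P \<and> P \<subseteq> \<A> \<and>
                             finite R \<and> partition_on (space M) R \<and> R \<subseteq> \<B>}.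
        ennreal (\<Sum>(A, B) \<in> P \<times> R.
          \<bar>measure M (A \<inter> B) - measure M A * measure M B\<bar>))"

definition generated_sigma ::
  "'w measure \<Rightarrow> (nat \<Rightarrow> 'w \<Rightarrow> 'x::topological_space) \<Rightarrow> nat set \<Rightarrow> 'w set set" where
  "generated_sigma M X I =
     sigma_sets (space M) {X i -` B \<inter> space M | i B. i \<in> I \<and> B \<in> sets borel}"

text \<open>For \<open>p \<ge> k\<close> the index set is empty and the value is \<open>0\<close>, the least element of \<^typ>\<open>ennreal\<close>.\<close>

definition row_beta ::
  "'w measure \<Rightarrow> nat \<Rightarrow> (nat \<Rightarrow> 'w \<Rightarrow> 'x::topological_space) \<Rightarrow> nat \<Rightarrow> ennreal" where
  "row_beta M k X p =
     (SUP j \<in> {1..k - p}. beta_coeff M (generated_sigma M X {1..j}) (generated_sigma M X {j + p..k}))"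

text \<open>Distinct points may have distance \<open>0\<close>.\<close>

definition semimetric :: "('t \<Rightarrow> 't \<Rightarrow> real) \<Rightarrow> bool" where
  "semimetric d \<longleftrightarrow> (\<forall>s t. 0 \<le> d s t) \<and> (\<forall>t. d t t = 0) \<and> (\<forall>s t. d s t = d t s) \<and>
     (\<forall>r s t. d r t \<le> d r s + d s t)"

definition semimetric_totally_bounded :: "('t \<Rightarrow> 't \<Rightarrow> real) \<Rightarrow> bool" where
  "semimetric_totally_bounded d \<longleftrightarrow> (\<forall>e>0. \<exists>S. finite S \<and> (\<forall>t. \<exists>s\<in>S. d s t < e))"

definition decreases_to_zero :: "(nat \<Rightarrow> real) \<Rightarrow> bool" where
  "decreases_to_zero \<delta> \<longleftrightarrow> (\<forall>n. 0 < \<delta> n) \<and> decseq \<delta> \<and> \<delta> \<longlonglongrightarrow> 0"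

definition inner_measure_of :: "'w measure \<Rightarrow> 'w set \<Rightarrow> ennreal" where
  "inner_measure_of M A = (SUP B \<in> {B \<in> sets M. B \<subseteq> A}. emeasure M B)"

definition asymptotically_tight ::
  "(nat \<Rightarrow> 'w measure) \<Rightarrow> (nat \<Rightarrow> 'w \<Rightarrow> 'd::metric_space) \<Rightarrow> bool" where
  "asymptotically_tight M X \<longleftrightarrow> (\<forall>\<epsilon>>0. \<exists>K. compact K \<and> (\<forall>\<delta>>0.
     ennreal (1 - \<epsilon>) \<le>
       liminf (\<lambda>n. inner_measure_of (M n) {\<omega> \<in> space (M n). X n \<omega> \<in> (\<Union>x\<in>K. ball x \<delta>)})))"

definition tight_borel_measurable :: "'w measure \<Rightarrow> ('w \<Rightarrow> 'd::metric_space) \<Rightarrow> bool" where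
  "tight_borel_measurable M X \<longleftrightarrow> X \<in> borel_measurable M \<and>
     (\<forall>\<epsilon>>0. \<exists>K. compact K \<and> 1 - \<epsilon> \<le> measure (distr M borel X) K)"

definition covariance :: "'w measure \<Rightarrow> ('w \<Rightarrow> real) \<Rightarrow> ('w \<Rightarrow> real) \<Rightarrow> real" where
  "covariance M Y Z =
     (\<integral>\<omega>. (Y \<omega> - (\<integral>\<omega>'. Y \<omega>' \<partial>M)) * (Z \<omega> - (\<integral>\<omega>'. Z \<omega>' \<partial>M)) \<partial>M)"

text \<open>Normal laws with standard deviation \<open>\<sigma> \<ge> 0\<close>, including the degenerate ones.\<close>

definition normal_law :: "real \<Rightarrow> real \<Rightarrow> real measure" where
  "normal_law \<mu> \<sigma> =
     (if \<sigma> = 0 then return borel \<mu> else density lborel (\<lambda>x. ennreal (normal_density \<mu> \<sigma> x)))"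

text \<open>
  All finite-dimensional marginals are (possibly degenerate) multivariate normal, i.e. all their
  linear combinations are normal.
\<close>

definition gaussian_process :: "'w measure \<Rightarrow> ('t \<Rightarrow> 'w \<Rightarrow> real) \<Rightarrow> bool" where
  "gaussian_process M Z \<longleftrightarrow> (\<forall>t. Z t \<in> borel_measurable M) \<and>
     (\<forall>S a. finite S \<longrightarrow>
        (\<exists>\<mu> \<sigma>. 0 \<le> \<sigma> \<and> distr M borel (\<lambda>\<omega>. \<Sum>t\<in>S. a t * Z t \<omega>) = normal_law \<mu> \<sigma>))"

definition corresponding_gaussian_process ::
  "'v measure \<Rightarrow> ('v \<Rightarrow> 't linf) \<Rightarrow> 'w measure \<Rightarrow> ('w \<Rightarrow> 't linf) \<Rightarrow> bool" where
  "corresponding_gaussian_process Q N M Y \<longleftrightarrow>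
     (\<forall>t. (\<lambda>\<omega>. linf_eval (Y \<omega>) t) \<in> borel_measurable M \<and>
          integrable M (\<lambda>\<omega>. (linf_eval (Y \<omega>) t)\<^sup>2)) \<and>
     gaussian_process Q (\<lambda>t \<omega>. linf_eval (N \<omega>) t) \<and>
     (\<forall>t. (\<integral>\<omega>. linf_eval (N \<omega>) t \<partial>Q) = 0) \<and>
     (\<forall>s t. covariance Q (\<lambda>\<omega>. linf_eval (N \<omega>) s) (\<lambda>\<omega>. linf_eval (N \<omega>) t) =
            covariance M (\<lambda>\<omega>. linf_eval (Y \<omega>) s) (\<lambda>\<omega>. linf_eval (Y \<omega>) t))"

end

theory Submission
  imports Defs
begin

text \<open>
  Both \<open>G n\<close> and the Gaussian processes are asymptotically tight for the same reason: for large
  \<open>n\<close> they oscillate little, uniformly over all pairs \<open>s, t\<close> with \<open>d s t\<close> small, they are bounded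
  in probability at each point, and \<open>d\<close> is totally bounded. The passage from this equicontinuity
  to compact sets of bounded functions is \<open>linf_asymptotically_tightI_semimetric\<close>.

  For the equicontinuity the index set is split into the cells of a fixed bracketing level. The
  entropy condition bounds the number \<open>m\<close> of cells independently of \<open>n\<close> and yields, by chaining, a
  majorant of small mean for the oscillation within a cell (\<open>small_on_cells\<close>). A pair of \<open>d\<close>-close
  points in two different cells is compared with one fixed pair of \<open>d\<close>-close points in the same
  two cells. There are at most \<open>m\<^sup>2\<close> such pairs, and the increment over each has second moment at
  most a constant times the square of the distance \<open>d_n\<close>, which is small uniformly over \<open>d\<close>-close
  pairs (\<open>cell_increments\<close>, \<open>equicontinuity_of_cells\<close>).

  Mixing enters in two ways. First, a covariance inequality under moments of order \<open>\<gamma>\<close> with the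
  rate \<open>m powr - (\<rho> * (\<gamma> - 2) / \<gamma>)\<close>; it is summable exactly when \<open>\<rho> > \<gamma> / (\<gamma> - 2)\<close>, and then the
  variance of the empirical process is controlled by the \<open>\<gamma>\<close>-seminorm (\<open>cov_le\<close>, \<open>sum_cov_le\<close>).
  Second, a maximal inequality for finite classes. Instead of coupling a row with independent
  blocks, a soft maximum of the partial block sums is followed as one block after another is
  added. A block changes the soft maximum by at most its bound \<open>c\<close>, so replacing the joint law of
  the past and the block by the product law costs at most \<open>2 * c\<close> times the mixing coefficient,
  and under the product law a moment generating function bound and Jensen's inequality apply
  (\<open>softmax_decoupling\<close>, \<open>finite_class_maximal_ineq\<close>).

  Chaining with brackets of size \<open>\<delta> j\<close> requires truncation, because links of the chain must be
  bounded. At each level the block length \<open>q j\<close> and the truncation level \<open>a j\<close> are chosen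
  together: the Bernstein condition \<open>q j * a j * sqrt L = sqrt k * \<delta> j\<close>, with \<open>L\<close> the
  log-cardinality of the level, fixes \<open>a j\<close> in terms of \<open>q j\<close>, and \<open>q j\<close> is about \<open>(k / L) powr (1
  / (1 + \<rho>))\<close>, which makes the decoupling cost of the order \<open>\<delta> j * sqrt L\<close>. The mean of the part
  cut off is then of the order \<open>\<delta> j * sqrt L * (k / L) powr - kappa\<close> with \<open>kappa = (\<gamma> - 2) / 2 -
  (\<gamma> - 1) / (1 + \<rho>)\<close>, and \<open>kappa > 0\<close> is again the condition \<open>\<rho> > \<gamma> / (\<gamma> - 2)\<close>. The gain for \<open>k\<close>
  tending to infinity absorbs a union bound over the cells of the coarsest level, where no earlier
  truncation helps (\<open>base_mean\<close>). The outcome is \<open>bracketing_maximal_ineq\<close>.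

  The Gaussian processes are constructed explicitly. Gram-Schmidt orthogonalisation of the values
  of \<open>G n\<close> at countably many representatives of the bracket cells gives coefficients that
  reproduce their covariances; using them with independent standard normal variables instead of
  the orthonormal system gives a Gaussian process on the representatives. Its step functions along
  the bracketing levels converge uniformly almost surely, by chaining with the Gaussian maximal
  inequality, and characteristic functions identify the law of the limit (\<open>N_law\<close>). As a uniform
  limit of step functions with finitely many steps the process is Borel measurable and tight
  (\<open>N_measurable\<close>, \<open>N_tight\<close>).
\<close>

section \<open>Decoupling\<close>

lemma beta_coeff_le_D:
  assumes "beta_coeff M A B \<le> ennreal b" "0 \<le> b"
    and "finite P" "partition_on (space M) P" "P \<subseteq> A"
    and "finite R" "partition_on (space M) R" "R \<subseteq> B"
  shows "(\<Sum>(A, B)\<in>P \<times> R. \<bar>measure M (A \<inter> B) - measure M A * measure M B\<bar>) \<le> 2 * b"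
proof -
  let ?s = "(\<Sum>(A, B)\<in>P \<times> R. \<bar>measure M (A \<inter> B) - measure M A * measure M B\<bar>)"
  have s0: "0 \<le> ?s" by (auto intro!: sum_nonneg)
  have "ennreal ?s \<le> (SUP (P, R) \<in> {(P, R). finite P \<and> partition_on (space M) P \<and> P \<subseteq> A \<and>
                             finite R \<and> partition_on (space M) R \<and> R \<subseteq> B}.
        ennreal (\<Sum>(A, B) \<in> P \<times> R. \<bar>measure M (A \<inter> B) - measure M A * measure M B\<bar>))"
    using assms(3-) by (intro SUP_upper2[of "(P, R)"]) auto
  then have "(1/2) * ennreal ?s \<le> beta_coeff M A B"
    unfolding beta_coeff_def by (intro mult_left_mono) auto
  also have "(1/2) * ennreal ?s = ennreal (?s / 2)"
    using s0 by (simp add: divide_ennreal[symmetric] ennreal_times_divide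
      flip: ennreal_numeral) (simp add: ennreal_divide_times)
  finally have "ennreal (?s / 2) \<le> ennreal b" using assms(1) by (rule order_trans)
  then show ?thesis using assms(2) by simp
qed

lemma partition_on_simple_vimage:
  "partition_on \<Omega> ((\<lambda>x. U -` {x} \<inter> \<Omega>) ` (U ` \<Omega>))"
  by (auto simp: partition_on_def disjoint_def)

text \<open>
  The level sets of two simple functions are partitions of the kind over which the mixing
  coefficient is a supremum, so the coefficient bounds the total variation distance between the
  joint law of the two functions and the product of their laws.
\<close>

lemma beta_simple_function_le:
  fixes U :: "'w \<Rightarrow> 'a" and V :: "'w \<Rightarrow> 'b"
  assumes b: "beta_coeff M (sets NA) (sets NB) \<le> ennreal b" "0 \<le> b"
    and sp: "space NA = space M" "space NB = space M"
    and U: "simple_function NA U" and V: "simple_function NB V"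
  shows "(\<Sum>x\<in>U ` space M. \<Sum>y\<in>V ` space M.
     \<bar>measure M (U -` {x} \<inter> V -` {y} \<inter> space M) -
      measure M (U -` {x} \<inter> space M) * measure M (V -` {y} \<inter> space M)\<bar>) \<le> 2 * b"
proof -
  let ?A = "\<lambda>x. U -` {x} \<inter> space M" and ?B = "\<lambda>y. V -` {y} \<inter> space M"
  have fin: "finite (U ` space M)" "finite (V ` space M)"
    using U V sp by (auto simp: simple_function_def)
  have injA: "inj_on ?A (U ` space M)" and injB: "inj_on ?B (V ` space M)"
    by (auto simp: inj_on_def)
  have "(\<Sum>(A, B)\<in>(?A ` U ` space M) \<times> (?B ` V ` space M).
      \<bar>measure M (A \<inter> B) - measure M A * measure M B\<bar>) \<le> 2 * b"
    using U V sp fin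
    by (intro beta_coeff_le_D[OF b] partition_on_simple_vimage) (auto simp: simple_function_def)
  also have "(\<Sum>(A, B)\<in>(?A ` U ` space M) \<times> (?B ` V ` space M).
      \<bar>measure M (A \<inter> B) - measure M A * measure M B\<bar>) =
    (\<Sum>A\<in>?A ` U ` space M. \<Sum>B\<in>?B ` V ` space M. \<bar>measure M (A \<inter> B) - measure M A * measure M B\<bar>)"
    by (rule sum.cartesian_product[symmetric])
  also have "\<dots> = (\<Sum>x\<in>U ` space M. \<Sum>y\<in>V ` space M. \<bar>measure M (?A x \<inter> ?B y) - measure M (?A x) * measure M (?B y)\<bar>)"
    by (simp add: sum.reindex[OF injA] sum.reindex[OF injB])
  also have "\<dots> = (\<Sum>x\<in>U ` space M. \<Sum>y\<in>V ` space M.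
     \<bar>measure M (U -` {x} \<inter> V -` {y} \<inter> space M) -
      measure M (U -` {x} \<inter> space M) * measure M (V -` {y} \<inter> space M)\<bar>)"
    by (intro sum.cong refl arg_cong[of _ _ abs] arg_cong2[of _ _ _ _ "(-)"] arg_cong[of _ _ "measure M"]) auto
  finally show ?thesis .
qed

lemma integrable_bound_real:
  fixes f g :: "'a \<Rightarrow> real"
  assumes "integrable M g" "f \<in> borel_measurable M" "\<And>x. x \<in> space M \<Longrightarrow> \<bar>f x\<bar> \<le> g x"
  shows "integrable M f"
  using assms(1,2)
proof (rule Bochner_Integration.integrable_bound)
  show "AE x in M. norm (f x) \<le> norm (g x)"
    using assms(3) by (intro AE_I2) (simp add: order_trans[OF _ abs_ge_self])
qed

lemma integrable_Max_abs:
  fixes f :: "'b \<Rightarrow> 'a \<Rightarrow> real"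
  assumes A: "finite A" "A \<noteq> {}" and f: "\<And>h. h \<in> A \<Longrightarrow> integrable M (f h)"
  shows "integrable M (\<lambda>\<omega>. Max ((\<lambda>h. \<bar>f h \<omega>\<bar>) ` A))"
proof (rule integrable_bound_real[where g = "\<lambda>\<omega>. \<Sum>h\<in>A. \<bar>f h \<omega>\<bar>"])
  show "integrable M (\<lambda>\<omega>. \<Sum>h\<in>A. \<bar>f h \<omega>\<bar>)" using f by (intro Bochner_Integration.integrable_sum integrable_abs)
  show "(\<lambda>\<omega>. Max ((\<lambda>h. \<bar>f h \<omega>\<bar>) ` A)) \<in> borel_measurable M"
    using f A(1) by (intro borel_measurable_Max) (auto intro!: borel_measurable_abs)
  fix \<omega>
  have "Max ((\<lambda>h. \<bar>f h \<omega>\<bar>) ` A) \<in> (\<lambda>h. \<bar>f h \<omega>\<bar>) ` A" using A by (intro Max_in) auto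
  then obtain h where h: "h \<in> A" "Max ((\<lambda>h. \<bar>f h \<omega>\<bar>) ` A) = \<bar>f h \<omega>\<bar>" by auto
  have "\<bar>f h \<omega>\<bar> \<le> (\<Sum>h\<in>A. \<bar>f h \<omega>\<bar>)" using h A by (intro member_le_sum) auto
  then show "\<bar>Max ((\<lambda>h. \<bar>f h \<omega>\<bar>) ` A)\<bar> \<le> (\<Sum>h\<in>A. \<bar>f h \<omega>\<bar>)" using h by simp
qed

context prob_space
begin

lemma integral_simple:
  fixes g :: "'c \<Rightarrow> real"
  assumes U: "simple_function M U"
  shows "(\<integral>\<omega>. g (U \<omega>) \<partial>M) = (\<Sum>x\<in>U ` space M. g x * prob (U -` {x} \<inter> space M))"
proof -
  have fin: "finite (U ` space M)" and ms: "\<And>x. U -` {x} \<inter> space M \<in> sets M"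
    using simple_functionD[OF U] by auto
  have "(\<integral>\<omega>. g (U \<omega>) \<partial>M) = (\<integral>\<omega>. (\<Sum>x\<in>U ` space M. g x * indicator (U -` {x} \<inter> space M) \<omega>) \<partial>M)"
  proof (rule Bochner_Integration.integral_cong[OF refl])
    fix \<omega> assume w: "\<omega> \<in> space M"
    have "(\<Sum>x\<in>U ` space M. g x * indicator (U -` {x} \<inter> space M) \<omega>) =
      (\<Sum>x\<in>U ` space M. if x = U \<omega> then g x else 0)"
      using w by (intro sum.cong) (auto simp: indicator_def)
    also have "\<dots> = g (U \<omega>)" using fin w by simp
    finally show "g (U \<omega>) = (\<Sum>x\<in>U ` space M. g x * indicator (U -` {x} \<inter> space M) \<omega>)" ..
  qed
  also have "\<dots> = (\<Sum>x\<in>U ` space M. g x * prob (U -` {x} \<inter> space M))"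
    using ms by (subst Bochner_Integration.integral_sum) (auto simp: less_top[symmetric] intro!: integrable_mult_right)
  finally show ?thesis .
qed

lemma integral_simple_pair:
  fixes g :: "'c \<Rightarrow> 'd \<Rightarrow> real"
  assumes U: "simple_function M U" and V: "simple_function M V"
  shows "(\<integral>\<omega>. g (U \<omega>) (V \<omega>) \<partial>M) =
    (\<Sum>x\<in>U ` space M. \<Sum>y\<in>V ` space M. g x y * prob (U -` {x} \<inter> V -` {y} \<inter> space M))"
proof -
  have fin: "finite (U ` space M)" "finite (V ` space M)"
    and mU: "\<And>x. U -` {x} \<inter> space M \<in> sets M" and mV: "\<And>y. V -` {y} \<inter> space M \<in> sets M"
    using simple_functionD[OF U] simple_functionD[OF V] by auto
  have ms: "U -` {x} \<inter> V -` {y} \<inter> space M \<in> sets M" for x y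
  proof -
    have "U -` {x} \<inter> V -` {y} \<inter> space M = (U -` {x} \<inter> space M) \<inter> (V -` {y} \<inter> space M)" by auto
    then show ?thesis using sets.Int[OF mU mV] by simp
  qed
  have "(\<integral>\<omega>. g (U \<omega>) (V \<omega>) \<partial>M) = (\<integral>\<omega>. (\<Sum>x\<in>U ` space M. \<Sum>y\<in>V ` space M. g x y * indicator (U -` {x} \<inter> V -` {y} \<inter> space M) \<omega>) \<partial>M)"
  proof (rule Bochner_Integration.integral_cong[OF refl])
    fix \<omega> assume w: "\<omega> \<in> space M"
    have "(\<Sum>x\<in>U ` space M. \<Sum>y\<in>V ` space M. g x y * indicator (U -` {x} \<inter> V -` {y} \<inter> space M) \<omega>) =
      (\<Sum>x\<in>U ` space M. \<Sum>y\<in>V ` space M. if y = V \<omega> then (if x = U \<omega> then g x y else 0) else 0)"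
      using w by (intro sum.cong) (auto simp: indicator_def)
    also have "\<dots> = g (U \<omega>) (V \<omega>)" using fin w by simp
    finally show "g (U \<omega>) (V \<omega>) = (\<Sum>x\<in>U ` space M. \<Sum>y\<in>V ` space M. g x y * indicator (U -` {x} \<inter> V -` {y} \<inter> space M) \<omega>)" ..
  qed
  also have "\<dots> = (\<Sum>x\<in>U ` space M. \<Sum>y\<in>V ` space M. g x y * prob (U -` {x} \<inter> V -` {y} \<inter> space M))"
    using ms by (simp add: Bochner_Integration.integral_sum integrable_mult_right less_top[symmetric])
  finally show ?thesis .
qed

lemma simple_function_subalgebra:
  assumes "simple_function N U" "space N = space M" "sets N \<subseteq> sets M"
  shows "simple_function M U"
  using assms by (auto simp: simple_function_def)

text \<open>
  Passing from the joint law of \<open>U\<close> and \<open>V\<close> to the product law, written as an iterated integral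
  with an independent copy of \<open>V\<close>. Restricted to simple functions, everything is a finite sum and
  the conclusion holds for arbitrary \<open>g\<close>.
\<close>

lemma decoupling_simple:
  fixes g :: "'c \<Rightarrow> 'd \<Rightarrow> real"
  assumes sub: "space NA = space M" "sets NA \<subseteq> sets M" "space NB = space M" "sets NB \<subseteq> sets M"
    and U: "simple_function NA U" and V: "simple_function NB V"
  shows "\<bar>(\<integral>\<omega>. g (U \<omega>) (V \<omega>) \<partial>M) - (\<integral>\<omega>. (\<integral>\<omega>'. g (U \<omega>) (V \<omega>') \<partial>M) \<partial>M)\<bar> \<le>
     (\<Sum>x\<in>U ` space M. \<Sum>y\<in>V ` space M. \<bar>g x y\<bar> *
        \<bar>prob (U -` {x} \<inter> V -` {y} \<inter> space M) - prob (U -` {x} \<inter> space M) * prob (V -` {y} \<inter> space M)\<bar>)"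
proof -
  have U': "simple_function M U" and V': "simple_function M V"
    using simple_function_subalgebra U V sub by auto
  have 1: "(\<integral>\<omega>. g (U \<omega>) (V \<omega>) \<partial>M) =
    (\<Sum>x\<in>U ` space M. \<Sum>y\<in>V ` space M. g x y * prob (U -` {x} \<inter> V -` {y} \<inter> space M))"
    by (rule integral_simple_pair[OF U' V'])
  have 2: "(\<integral>\<omega>. (\<integral>\<omega>'. g (U \<omega>) (V \<omega>') \<partial>M) \<partial>M) =
    (\<Sum>x\<in>U ` space M. \<Sum>y\<in>V ` space M. g x y * (prob (U -` {x} \<inter> space M) * prob (V -` {y} \<inter> space M)))"
    by (subst integral_simple[OF U', of "\<lambda>x. (\<integral>\<omega>'. g x (V \<omega>') \<partial>M)"])
      (simp add: integral_simple[OF V'] sum_distrib_right sum_distrib_left mult_ac)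
  show ?thesis unfolding 1 2 sum_subtractf[symmetric] right_diff_distrib[symmetric]
    by (rule order_trans[OF sum_abs], rule sum_mono, rule order_trans[OF sum_abs], rule sum_mono)
       (simp add: abs_mult)
qed

lemma decoupling_bounded:
  fixes g :: "'c \<Rightarrow> 'd \<Rightarrow> real"
  assumes b: "beta_coeff M (sets NA) (sets NB) \<le> ennreal b" "0 \<le> b"
    and sub: "space NA = space M" "sets NA \<subseteq> sets M" "space NB = space M" "sets NB \<subseteq> sets M"
    and U: "simple_function NA U" and V: "simple_function NB V"
    and g: "\<And>\<omega> \<omega>'. \<omega> \<in> space M \<Longrightarrow> \<omega>' \<in> space M \<Longrightarrow> \<bar>g (U \<omega>) (V \<omega>')\<bar> \<le> c" and c: "0 \<le> c"
  shows "\<bar>(\<integral>\<omega>. g (U \<omega>) (V \<omega>) \<partial>M) - (\<integral>\<omega>. (\<integral>\<omega>'. g (U \<omega>) (V \<omega>') \<partial>M) \<partial>M)\<bar> \<le> 2 * c * b"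
proof -
  have "\<bar>(\<integral>\<omega>. g (U \<omega>) (V \<omega>) \<partial>M) - (\<integral>\<omega>. (\<integral>\<omega>'. g (U \<omega>) (V \<omega>') \<partial>M) \<partial>M)\<bar> \<le>
     (\<Sum>x\<in>U ` space M. \<Sum>y\<in>V ` space M. \<bar>g x y\<bar> *
        \<bar>prob (U -` {x} \<inter> V -` {y} \<inter> space M) - prob (U -` {x} \<inter> space M) * prob (V -` {y} \<inter> space M)\<bar>)"
    by (rule decoupling_simple[OF sub U V])
  also have "\<dots> \<le> (\<Sum>x\<in>U ` space M. \<Sum>y\<in>V ` space M. c *
        \<bar>prob (U -` {x} \<inter> V -` {y} \<inter> space M) - prob (U -` {x} \<inter> space M) * prob (V -` {y} \<inter> space M)\<bar>)"
    using g by (intro sum_mono mult_right_mono) auto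
  also have "\<dots> \<le> c * (2 * b)"
    unfolding sum_distrib_left[symmetric]
    using beta_simple_function_le[OF b sub(1,3) U V] c by (intro mult_left_mono) auto
  finally show ?thesis by simp
qed

text \<open>
  With \<open>z\<close> the larger of the two absolute values, either \<open>z \<le> T\<close>, or \<open>z\<^sup>2 = z powr (2 - \<gamma>) * z
  powr \<gamma>\<close> and the first factor is at most \<open>T powr (2 - \<gamma>)\<close>. This replaces a truncation of the
  variables at level \<open>T\<close> in the covariance inequality.
\<close>

lemma mult_le_threshold:
  fixes x y :: real
  assumes "2 < \<gamma>" "0 < T"
  shows "\<bar>x * y\<bar> \<le> T^2 + T powr (2 - \<gamma>) * (\<bar>x\<bar> powr \<gamma> + \<bar>y\<bar> powr \<gamma>)"
proof -
  define z where "z = max \<bar>x\<bar> \<bar>y\<bar>"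
  have z0: "0 \<le> z" by (simp add: z_def)
  have "\<bar>x * y\<bar> \<le> z * z" unfolding abs_mult z_def by (intro mult_mono) auto
  also have "z * z \<le> T^2 + T powr (2 - \<gamma>) * z powr \<gamma>"
  proof (cases "z \<le> T")
    case True
    then have "z * z \<le> T * T" using z0 assms by (intro mult_mono) auto
    then show ?thesis by (simp add: power2_eq_square add_increasing2)
  next
    case False
    then have zT: "T < z" by simp
    have "z * z = z powr 2" using zT assms by (simp add: powr_numeral power2_eq_square)
    also have "\<dots> = z powr (2 - \<gamma>) * z powr \<gamma>" using zT assms by (simp flip: powr_add)
    also have "\<dots> \<le> T powr (2 - \<gamma>) * z powr \<gamma>"
      using zT assms by (intro mult_right_mono powr_mono2') auto
    finally show ?thesis by (simp add: add_increasing)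
  qed
  also have "z powr \<gamma> \<le> \<bar>x\<bar> powr \<gamma> + \<bar>y\<bar> powr \<gamma>" by (simp add: z_def max_def)
  finally show ?thesis by (simp add: mult_left_mono)
qed

text \<open>
  The signed measure that is the joint law minus the product law has total mass at most \<open>2 * b\<close>,
  and each of its marginals is at most twice the law of the corresponding variable. The mass bound
  is used for the part \<open>T\<^sup>2\<close> of \<open>mult_le_threshold\<close>, the marginals for the \<open>\<gamma>\<close>-th powers.
\<close>

lemma covariance_simple_le:
  fixes U V :: "'a \<Rightarrow> real"
  assumes b: "beta_coeff M (sets NA) (sets NB) \<le> ennreal b" "0 \<le> b"
    and sub: "space NA = space M" "sets NA \<subseteq> sets M" "space NB = space M" "sets NB \<subseteq> sets M"
    and U: "simple_function NA U" and V: "simple_function NB V" and T: "2 < \<gamma>" "0 < T"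
  shows "\<bar>(\<integral>\<omega>. U \<omega> * V \<omega> \<partial>M) - (\<integral>\<omega>. U \<omega> \<partial>M) * (\<integral>\<omega>. V \<omega> \<partial>M)\<bar> \<le>
    2 * b * T^2 + 2 * T powr (2 - \<gamma>) * ((\<integral>\<omega>. \<bar>U \<omega>\<bar> powr \<gamma> \<partial>M) + (\<integral>\<omega>. \<bar>V \<omega>\<bar> powr \<gamma> \<partial>M))"
proof -
  have U': "simple_function M U" and V': "simple_function M V"
    using simple_function_subalgebra U V sub by auto
  have fin: "finite (U ` space M)" "finite (V ` space M)"
    and mU: "\<And>x. U -` {x} \<inter> space M \<in> sets M" and mV: "\<And>x. V -` {x} \<inter> space M \<in> sets M"
    using simple_functionD[OF U'] simple_functionD[OF V'] by auto
  define p where "p x y = prob (U -` {x} \<inter> V -` {y} \<inter> space M)" for x y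
  define pU where "pU x = prob (U -` {x} \<inter> space M)" for x
  define pV where "pV x = prob (V -` {x} \<inter> space M)" for x
  define w where "w x y = \<bar>p x y - pU x * pV y\<bar>" for x y
  define D where "D = T powr (2 - \<gamma>)"
  have D0: "0 \<le> D" by (simp add: D_def)
  have sumU: "(\<Sum>x\<in>U ` space M. pU x) = 1" and sumV: "(\<Sum>x\<in>V ` space M. pV x) = 1"
    using integral_simple[OF U', of "\<lambda>_. 1"] integral_simple[OF V', of "\<lambda>_. 1"] prob_space
    by (auto simp: pU_def pV_def)
  have py: "(\<Sum>y\<in>V ` space M. p x y) = pU x" if x: "x \<in> U ` space M" for x
  proof -
    have "(\<Sum>y\<in>V ` space M. p x y) = (\<Sum>x'\<in>U ` space M. if x' = x then \<Sum>y\<in>V ` space M. p x' y else 0)"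
      using x fin by simp
    also have "\<dots> = (\<Sum>x'\<in>U ` space M. \<Sum>y\<in>V ` space M. (if x' = x then 1 else 0) * p x' y)"
      by (intro sum.cong) auto
    also have "\<dots> = (\<integral>\<omega>. (if U \<omega> = x then 1 else 0) \<partial>M)"
      unfolding p_def by (rule integral_simple_pair[OF U' V', symmetric])
    also have "\<dots> = (\<Sum>x'\<in>U ` space M. (if x' = x then 1 else 0) * pU x')"
      unfolding pU_def by (rule integral_simple[OF U'])
    also have "\<dots> = (\<Sum>x'\<in>U ` space M. if x' = x then pU x' else 0)"
      by (intro sum.cong) auto
    also have "\<dots> = pU x" using x fin by simp
    finally show ?thesis .
  qed
  have px: "(\<Sum>x\<in>U ` space M. p x y) = pV y" if y: "y \<in> V ` space M" for y
  proof -
    have "(\<Sum>x\<in>U ` space M. p x y) = (\<Sum>x\<in>U ` space M. \<Sum>y'\<in>V ` space M. if y' = y then p x y' else 0)"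
      using y fin by simp
    also have "\<dots> = (\<Sum>x\<in>U ` space M. \<Sum>y'\<in>V ` space M. (if y' = y then 1 else 0) * p x y')"
      by (intro sum.cong) auto
    also have "\<dots> = (\<integral>\<omega>. (if V \<omega> = y then 1 else 0) \<partial>M)"
      unfolding p_def by (rule integral_simple_pair[OF U' V', symmetric])
    also have "\<dots> = (\<Sum>y'\<in>V ` space M. (if y' = y then 1 else 0) * pV y')"
      unfolding pV_def by (rule integral_simple[OF V'])
    also have "\<dots> = (\<Sum>y'\<in>V ` space M. if y' = y then pV y' else 0)"
      by (intro sum.cong) auto
    also have "\<dots> = pV y" using y fin by simp
    finally show ?thesis .
  qed
  have nn: "0 \<le> p x y" "0 \<le> pU x" "0 \<le> pV y" for x y by (auto simp: p_def pU_def pV_def)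
  have wle: "w x y \<le> p x y + pU x * pV y" for x y
    using nn(1)[of x y] mult_nonneg_nonneg[OF nn(2)[of x] nn(3)[of y]] unfolding w_def by linarith
  have w1: "(\<Sum>y\<in>V ` space M. w x y) \<le> 2 * pU x" if x: "x \<in> U ` space M" for x
  proof -
    have "(\<Sum>y\<in>V ` space M. w x y) \<le> (\<Sum>y\<in>V ` space M. p x y + pU x * pV y)"
      by (intro sum_mono wle)
    then show ?thesis by (simp add: sum.distrib py[OF x] sumV flip: sum_distrib_left)
  qed
  have w2: "(\<Sum>x\<in>U ` space M. w x y) \<le> 2 * pV y" if y: "y \<in> V ` space M" for y
  proof -
    have "(\<Sum>x\<in>U ` space M. w x y) \<le> (\<Sum>x\<in>U ` space M. p x y + pU x * pV y)"
      by (intro sum_mono wle)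
    then show ?thesis by (simp add: sum.distrib px[OF y] sumU flip: sum_distrib_right)
  qed
  have w0: "(\<Sum>x\<in>U ` space M. \<Sum>y\<in>V ` space M. w x y) \<le> 2 * b"
    using beta_simple_function_le[OF b sub(1,3) U V] by (simp add: w_def p_def pU_def pV_def)
  have "(\<integral>\<omega>. U \<omega> \<partial>M) * (\<integral>\<omega>. V \<omega> \<partial>M) = (\<integral>\<omega>. (\<integral>\<omega>'. U \<omega> * V \<omega>' \<partial>M) \<partial>M)" by simp
  then have "\<bar>(\<integral>\<omega>. U \<omega> * V \<omega> \<partial>M) - (\<integral>\<omega>. U \<omega> \<partial>M) * (\<integral>\<omega>. V \<omega> \<partial>M)\<bar> \<le>
     (\<Sum>x\<in>U ` space M. \<Sum>y\<in>V ` space M. \<bar>x * y\<bar> * w x y)"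
    using decoupling_simple[OF sub U V, of "\<lambda>x y. x * y"] by (simp add: w_def p_def pU_def pV_def)
  also have "\<dots> \<le> (\<Sum>x\<in>U ` space M. \<Sum>y\<in>V ` space M. (T^2 + D * (\<bar>x\<bar> powr \<gamma> + \<bar>y\<bar> powr \<gamma>)) * w x y)"
    unfolding D_def by (intro sum_mono mult_right_mono mult_le_threshold[OF T]) (simp add: w_def)
  also have "\<dots> = T^2 * (\<Sum>x\<in>U ` space M. \<Sum>y\<in>V ` space M. w x y)
     + D * (\<Sum>x\<in>U ` space M. \<bar>x\<bar> powr \<gamma> * (\<Sum>y\<in>V ` space M. w x y))
     + D * (\<Sum>x\<in>U ` space M. \<Sum>y\<in>V ` space M. \<bar>y\<bar> powr \<gamma> * w x y)"
    by (simp add: sum.distrib sum_distrib_left algebra_simps)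
  also have "(\<Sum>x\<in>U ` space M. \<Sum>y\<in>V ` space M. \<bar>y\<bar> powr \<gamma> * w x y) =
     (\<Sum>y\<in>V ` space M. \<bar>y\<bar> powr \<gamma> * (\<Sum>x\<in>U ` space M. w x y))"
    by (subst sum.swap) (simp add: sum_distrib_left)
  also have "T^2 * (\<Sum>x\<in>U ` space M. \<Sum>y\<in>V ` space M. w x y)
     + D * (\<Sum>x\<in>U ` space M. \<bar>x\<bar> powr \<gamma> * (\<Sum>y\<in>V ` space M. w x y))
     + D * (\<Sum>y\<in>V ` space M. \<bar>y\<bar> powr \<gamma> * (\<Sum>x\<in>U ` space M. w x y)) \<le>
     T^2 * (2 * b) + D * (\<Sum>x\<in>U ` space M. \<bar>x\<bar> powr \<gamma> * (2 * pU x))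
     + D * (\<Sum>y\<in>V ` space M. \<bar>y\<bar> powr \<gamma> * (2 * pV y))"
    using w0 w1 w2 D0 by (intro add_mono mult_left_mono sum_mono) auto
  also have "(\<Sum>x\<in>U ` space M. \<bar>x\<bar> powr \<gamma> * (2 * pU x)) = 2 * (\<integral>\<omega>. \<bar>U \<omega>\<bar> powr \<gamma> \<partial>M)"
    by (subst integral_simple[OF U', of "\<lambda>x. \<bar>x\<bar> powr \<gamma>"]) (simp add: pU_def sum_distrib_left mult_ac)
  also have "(\<Sum>x\<in>V ` space M. \<bar>x\<bar> powr \<gamma> * (2 * pV x)) = 2 * (\<integral>\<omega>. \<bar>V \<omega>\<bar> powr \<gamma> \<partial>M)"
    by (subst integral_simple[OF V', of "\<lambda>x. \<bar>x\<bar> powr \<gamma>"]) (simp add: pV_def sum_distrib_left mult_ac)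
  finally show ?thesis by (simp add: D_def algebra_simps)
qed

text \<open>
  The inequality for simple functions extends by approximation. The approximating functions are
  dominated by \<open>2 * \<bar>U\<bar>\<close> and \<open>2 * \<bar>V\<bar>\<close>, which accounts for the additional factor \<open>2 powr \<gamma>\<close>.
\<close>

lemma covariance_mixing_le:
  fixes U V :: "'a \<Rightarrow> real"
  assumes b: "beta_coeff M (sets NA) (sets NB) \<le> ennreal b" "0 \<le> b"
    and sub: "space NA = space M" "sets NA \<subseteq> sets M" "space NB = space M" "sets NB \<subseteq> sets M"
    and U: "U \<in> borel_measurable NA" and V: "V \<in> borel_measurable NB" and T: "2 < \<gamma>" "0 < T"
    and iU: "integrable M (\<lambda>\<omega>. \<bar>U \<omega>\<bar> powr \<gamma>)" and iV: "integrable M (\<lambda>\<omega>. \<bar>V \<omega>\<bar> powr \<gamma>)"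
  shows "\<bar>(\<integral>\<omega>. U \<omega> * V \<omega> \<partial>M) - (\<integral>\<omega>. U \<omega> \<partial>M) * (\<integral>\<omega>. V \<omega> \<partial>M)\<bar> \<le>
    2 * b * T^2 + 2 powr (\<gamma> + 1) * T powr (2 - \<gamma>) * ((\<integral>\<omega>. \<bar>U \<omega>\<bar> powr \<gamma> \<partial>M) + (\<integral>\<omega>. \<bar>V \<omega>\<bar> powr \<gamma> \<partial>M))"
proof -
  obtain u where u: "\<And>i. simple_function NA (u i)" "\<And>x. x \<in> space M \<Longrightarrow> (\<lambda>i. u i x) \<longlonglongrightarrow> U x"
      "\<And>i x. x \<in> space M \<Longrightarrow> \<bar>u i x\<bar> \<le> 2 * \<bar>U x\<bar>"
  proof -
    obtain u where "\<forall>i. simple_function NA (u i)" "\<forall>x\<in>space NA. (\<lambda>i. u i x) \<longlonglongrightarrow> U x"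
      "\<forall>i. \<forall>x\<in>space NA. dist (u i x) 0 \<le> 2 * dist (U x) 0"
      using borel_measurable_implies_sequence_metric[OF U, of 0] by blast
    then show ?thesis using that[of u] sub(1) by simp
  qed
  obtain v where v: "\<And>i. simple_function NB (v i)" "\<And>x. x \<in> space M \<Longrightarrow> (\<lambda>i. v i x) \<longlonglongrightarrow> V x"
      "\<And>i x. x \<in> space M \<Longrightarrow> \<bar>v i x\<bar> \<le> 2 * \<bar>V x\<bar>"
  proof -
    obtain v where "\<forall>i. simple_function NB (v i)" "\<forall>x\<in>space NB. (\<lambda>i. v i x) \<longlonglongrightarrow> V x"
      "\<forall>i. \<forall>x\<in>space NB. dist (v i x) 0 \<le> 2 * dist (V x) 0"
      using borel_measurable_implies_sequence_metric[OF V, of 0] by blast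
    then show ?thesis using that[of v] sub(3) by simp
  qed
  have subA: "subalgebra M NA" "subalgebra M NB" using sub by (auto simp: subalgebra_def)
  have mU[measurable]: "U \<in> borel_measurable M" "V \<in> borel_measurable M"
    using measurable_from_subalg[OF subA(1) U] measurable_from_subalg[OF subA(2) V] by auto
  have mu[measurable]: "u i \<in> borel_measurable M" "v i \<in> borel_measurable M" for i
    using borel_measurable_simple_function[OF simple_function_subalgebra[OF u(1) sub(1,2)]]
      borel_measurable_simple_function[OF simple_function_subalgebra[OF v(1) sub(3,4)]] by auto
  have small: "integrable M W" if [measurable]: "W \<in> borel_measurable M" and i: "integrable M (\<lambda>\<omega>. \<bar>W \<omega>\<bar> powr \<gamma>)" for W :: "'a \<Rightarrow> real"
  proof (rule integrable_bound_real[of M "\<lambda>\<omega>. 2 + \<bar>W \<omega>\<bar> powr \<gamma>"])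
    show "\<bar>W \<omega>\<bar> \<le> 2 + \<bar>W \<omega>\<bar> powr \<gamma>" for \<omega>
      using mult_le_threshold[OF T(1), of 1 1 "W \<omega>"] by simp
  qed (use i in auto)
  have iUV: "integrable M (\<lambda>\<omega>. U \<omega> * V \<omega>)"
  proof (rule integrable_bound_real[of M "\<lambda>\<omega>. 1 + (\<bar>U \<omega>\<bar> powr \<gamma> + \<bar>V \<omega>\<bar> powr \<gamma>)"])
    show "\<bar>U \<omega> * V \<omega>\<bar> \<le> 1 + (\<bar>U \<omega>\<bar> powr \<gamma> + \<bar>V \<omega>\<bar> powr \<gamma>)" for \<omega>
      using mult_le_threshold[OF T(1), of 1 "U \<omega>" "V \<omega>"] by simp
  qed (use iU iV in auto)
  have 1: "(\<lambda>i. \<integral>\<omega>. u i \<omega> * v i \<omega> \<partial>M) \<longlonglongrightarrow> (\<integral>\<omega>. U \<omega> * V \<omega> \<partial>M)"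
  proof (rule integral_dominated_convergence[where w = "\<lambda>\<omega>. 4 * \<bar>U \<omega> * V \<omega>\<bar>"])
    show "AE \<omega> in M. norm (u i \<omega> * v i \<omega>) \<le> 4 * \<bar>U \<omega> * V \<omega>\<bar>" for i
    proof (rule AE_I2)
      fix \<omega> assume "\<omega> \<in> space M"
      then show "norm (u i \<omega> * v i \<omega>) \<le> 4 * \<bar>U \<omega> * V \<omega>\<bar>"
        using mult_mono[OF u(3)[of \<omega> i] v(3)[of \<omega> i]] by (simp add: abs_mult)
    qed
    show "AE \<omega> in M. (\<lambda>i. u i \<omega> * v i \<omega>) \<longlonglongrightarrow> U \<omega> * V \<omega>"
      by (intro AE_I2 tendsto_mult u v)
  qed (use iUV in auto)
  have 2: "(\<lambda>i. \<integral>\<omega>. u i \<omega> \<partial>M) \<longlonglongrightarrow> (\<integral>\<omega>. U \<omega> \<partial>M)"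
    using u small[OF _ iU]
    by (intro integral_dominated_convergence[where w = "\<lambda>\<omega>. 2 * \<bar>U \<omega>\<bar>"]) (auto intro!: AE_I2)
  have 3: "(\<lambda>i. \<integral>\<omega>. v i \<omega> \<partial>M) \<longlonglongrightarrow> (\<integral>\<omega>. V \<omega> \<partial>M)"
    using v small[OF _ iV]
    by (intro integral_dominated_convergence[where w = "\<lambda>\<omega>. 2 * \<bar>V \<omega>\<bar>"]) (auto intro!: AE_I2)
  have pw: "(\<integral>\<omega>. \<bar>w \<omega>\<bar> powr \<gamma> \<partial>M) \<le> 2 powr \<gamma> * (\<integral>\<omega>. \<bar>W \<omega>\<bar> powr \<gamma> \<partial>M)"
    if [measurable]: "w \<in> borel_measurable M" "W \<in> borel_measurable M" and i: "integrable M (\<lambda>\<omega>. \<bar>W \<omega>\<bar> powr \<gamma>)"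
     and le: "\<And>x. x \<in> space M \<Longrightarrow> \<bar>w x\<bar> \<le> 2 * \<bar>W x\<bar>" for w W :: "'a \<Rightarrow> real"
  proof -
    have *: "\<bar>w x\<bar> powr \<gamma> \<le> 2 powr \<gamma> * \<bar>W x\<bar> powr \<gamma>" if "x \<in> space M" for x
      using powr_mono2[of \<gamma>, OF _ _ le[OF that]] T by (simp add: powr_mult)
    have "integrable M (\<lambda>\<omega>. \<bar>w \<omega>\<bar> powr \<gamma>)"
      by (rule integrable_bound_real[OF integrable_mult_right[OF i, of "2 powr \<gamma>"]]) (simp_all add: *)
    then have "(\<integral>\<omega>. \<bar>w \<omega>\<bar> powr \<gamma> \<partial>M) \<le> (\<integral>\<omega>. 2 powr \<gamma> * \<bar>W \<omega>\<bar> powr \<gamma> \<partial>M)"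
      by (rule integral_mono[OF _ integrable_mult_right[OF i] *])
    then show ?thesis by simp
  qed
  have "\<bar>(\<integral>\<omega>. u i \<omega> * v i \<omega> \<partial>M) - (\<integral>\<omega>. u i \<omega> \<partial>M) * (\<integral>\<omega>. v i \<omega> \<partial>M)\<bar> \<le>
    2 * b * T^2 + 2 powr (\<gamma> + 1) * T powr (2 - \<gamma>) * ((\<integral>\<omega>. \<bar>U \<omega>\<bar> powr \<gamma> \<partial>M) + (\<integral>\<omega>. \<bar>V \<omega>\<bar> powr \<gamma> \<partial>M))" for i
  proof -
    have "2 * T powr (2 - \<gamma>) * ((\<integral>\<omega>. \<bar>u i \<omega>\<bar> powr \<gamma> \<partial>M) + (\<integral>\<omega>. \<bar>v i \<omega>\<bar> powr \<gamma> \<partial>M)) \<le>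
      2 * T powr (2 - \<gamma>) * (2 powr \<gamma> * (\<integral>\<omega>. \<bar>U \<omega>\<bar> powr \<gamma> \<partial>M) + 2 powr \<gamma> * (\<integral>\<omega>. \<bar>V \<omega>\<bar> powr \<gamma> \<partial>M))"
      using u v iU iV by (intro mult_left_mono add_mono pw) auto
    also have "\<dots> = 2 powr (\<gamma> + 1) * T powr (2 - \<gamma>) * ((\<integral>\<omega>. \<bar>U \<omega>\<bar> powr \<gamma> \<partial>M) + (\<integral>\<omega>. \<bar>V \<omega>\<bar> powr \<gamma> \<partial>M))"
      by (simp add: powr_add algebra_simps)
    finally show ?thesis
      using covariance_simple_le[OF b sub u(1)[of i] v(1)[of i] T] by linarith
  qed
  moreover have "(\<lambda>i. \<bar>(\<integral>\<omega>. u i \<omega> * v i \<omega> \<partial>M) - (\<integral>\<omega>. u i \<omega> \<partial>M) * (\<integral>\<omega>. v i \<omega> \<partial>M)\<bar>) \<longlonglongrightarrow>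
     \<bar>(\<integral>\<omega>. U \<omega> * V \<omega> \<partial>M) - (\<integral>\<omega>. U \<omega> \<partial>M) * (\<integral>\<omega>. V \<omega> \<partial>M)\<bar>"
    by (intro tendsto_intros 1 2 3)
  ultimately show ?thesis by (intro LIMSEQ_le_const2) auto
qed

end

section \<open>Rows of a mixing array\<close>

text \<open>
  One row of the array, with a mixing rate whose constant \<open>K\<close> is to be the same for all rows.
\<close>

locale mixing_row = prob_space M for M :: "'w measure" +
  fixes k :: nat and X :: "nat \<Rightarrow> 'w \<Rightarrow> 'x::polish_space" and \<gamma> \<rho> K :: real
  assumes k_pos: "0 < k"
    and X_measurable: "\<And>i. i \<in> {1..k} \<Longrightarrow> X i \<in> borel_measurable M"
    and gamma: "2 < \<gamma>" and rho: "\<gamma> / (\<gamma> - 2) < \<rho>" and K_nonneg: "0 \<le> K"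
    and beta: "\<And>m. 1 \<le> m \<Longrightarrow> m \<le> k \<Longrightarrow> row_beta M k X m \<le> ennreal (K * real m powr - \<rho>)"
begin

definition gen :: "nat set \<Rightarrow> 'w measure" where
  "gen I = sigma (space M) {X i -` B \<inter> space M | i B. i \<in> I \<and> B \<in> sets borel}"

lemma space_gen [simp]: "space (gen I) = space M"
  by (simp add: gen_def space_measure_of_conv)

lemma sets_gen: "sets (gen I) = generated_sigma M X I"
  unfolding gen_def generated_sigma_def by (rule sets_measure_of) auto

lemma sets_gen_subset: "I \<subseteq> {1..k} \<Longrightarrow> sets (gen I) \<subseteq> sets M"
  unfolding sets_gen generated_sigma_def
  by (rule sets.sigma_sets_subset) (auto intro!: measurable_sets[OF X_measurable])

lemma measurable_gen: "i \<in> I \<Longrightarrow> X i \<in> borel_measurable (gen I)"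
  by (rule measurableI) (auto simp: sets_gen generated_sigma_def)

lemma beta_gen_le:
  assumes "1 \<le> j" "1 \<le> p" "j + p \<le> k"
  shows "beta_coeff M (sets (gen {1..j})) (sets (gen {j + p..k})) \<le> ennreal (K * real p powr - \<rho>)"
proof -
  have "beta_coeff M (sets (gen {1..j})) (sets (gen {j + p..k})) \<le> row_beta M k X p"
    unfolding row_beta_def sets_gen using assms by (intro SUP_upper) auto
  also have "\<dots> \<le> ennreal (K * real p powr - \<rho>)" using assms by (intro beta) auto
  finally show ?thesis .
qed

text \<open>
  The seminorm bound \<open>\<parallel>h\<parallel> \<le> \<sigma>\<close>, raised to the power \<open>\<gamma>\<close> so that no root of an
  extended number occurs.
\<close>

definition moment_le :: "('x \<Rightarrow> real) \<Rightarrow> real \<Rightarrow> bool" where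
  "moment_le h \<sigma> \<longleftrightarrow> (\<Sum>i=1..k. \<integral>\<^sup>+\<omega>. ennreal (\<bar>h (X i \<omega>)\<bar> powr \<gamma>) \<partial>M) \<le> ennreal (real k * \<sigma> powr \<gamma>)"

lemma moment_le_mono:
  assumes "moment_le g \<sigma>" "\<And>x. \<bar>h x\<bar> \<le> \<bar>g x\<bar>" "\<sigma> \<le> \<tau>" "0 \<le> \<sigma>"
  shows "moment_le h \<tau>"
proof -
  have "(\<Sum>i=1..k. \<integral>\<^sup>+\<omega>. ennreal (\<bar>h (X i \<omega>)\<bar> powr \<gamma>) \<partial>M) \<le> (\<Sum>i=1..k. \<integral>\<^sup>+\<omega>. ennreal (\<bar>g (X i \<omega>)\<bar> powr \<gamma>) \<partial>M)"
    using assms gamma by (intro sum_mono nn_integral_mono ennreal_leI powr_mono2) auto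
  also have "\<dots> \<le> ennreal (real k * \<sigma> powr \<gamma>)" using assms by (simp add: moment_le_def)
  also have "\<dots> \<le> ennreal (real k * \<tau> powr \<gamma>)"
    using assms gamma by (intro ennreal_leI mult_left_mono powr_mono2) auto
  finally show ?thesis by (simp add: moment_le_def)
qed

lemma moment_leD:
  assumes "moment_le h \<sigma>" and h[measurable]: "h \<in> borel_measurable borel"
  shows "\<And>i. i \<in> {1..k} \<Longrightarrow> integrable M (\<lambda>\<omega>. \<bar>h (X i \<omega>)\<bar> powr \<gamma>)"
    and "(\<Sum>i=1..k. \<integral>\<omega>. \<bar>h (X i \<omega>)\<bar> powr \<gamma> \<partial>M) \<le> real k * \<sigma> powr \<gamma>"
proof -
  note X_measurable[measurable]
  show i: "integrable M (\<lambda>\<omega>. \<bar>h (X i \<omega>)\<bar> powr \<gamma>)" if i[measurable]: "i \<in> {1..k}" for i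
  proof (rule integrableI_bounded)
    show "(\<lambda>\<omega>. \<bar>h (X i \<omega>)\<bar> powr \<gamma>) \<in> borel_measurable M" by measurable
    have "(\<integral>\<^sup>+\<omega>. ennreal (\<bar>h (X i \<omega>)\<bar> powr \<gamma>) \<partial>M) \<le> (\<Sum>i=1..k. \<integral>\<^sup>+\<omega>. ennreal (\<bar>h (X i \<omega>)\<bar> powr \<gamma>) \<partial>M)"
      using i by (intro member_le_sum) auto
    also have "\<dots> < \<infinity>" using assms(1) unfolding moment_le_def by (rule le_less_trans) simp
    finally show "(\<integral>\<^sup>+\<omega>. ennreal (norm (\<bar>h (X i \<omega>)\<bar> powr \<gamma>)) \<partial>M) < \<infinity>" by simp
  qed
  have "ennreal (\<Sum>i=1..k. \<integral>\<omega>. \<bar>h (X i \<omega>)\<bar> powr \<gamma> \<partial>M) = (\<Sum>i=1..k. ennreal (\<integral>\<omega>. \<bar>h (X i \<omega>)\<bar> powr \<gamma> \<partial>M))"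
    by (rule sum_ennreal[symmetric]) auto
  also have "\<dots> = (\<Sum>i=1..k. \<integral>\<^sup>+\<omega>. ennreal (\<bar>h (X i \<omega>)\<bar> powr \<gamma>) \<partial>M)"
    by (intro sum.cong refl nn_integral_eq_integral[symmetric] i) auto
  also have "\<dots> \<le> ennreal (real k * \<sigma> powr \<gamma>)" using assms by (simp add: moment_le_def)
  finally show "(\<Sum>i=1..k. \<integral>\<omega>. \<bar>h (X i \<omega>)\<bar> powr \<gamma> \<partial>M) \<le> real k * \<sigma> powr \<gamma>"
    by (subst (asm) ennreal_le_iff) auto
qed

lemma moment_integrable:
  assumes "moment_le h \<sigma>" "h \<in> borel_measurable borel" "i \<in> {1..k}"
  shows "integrable M (\<lambda>\<omega>. h (X i \<omega>))" "integrable M (\<lambda>\<omega>. (h (X i \<omega>))\<^sup>2)"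
proof -
  note [measurable] = X_measurable[OF assms(3)] assms(2)
  have i: "integrable M (\<lambda>\<omega>. 2 + \<bar>h (X i \<omega>)\<bar> powr \<gamma>)" "integrable M (\<lambda>\<omega>. 1 + 2 * \<bar>h (X i \<omega>)\<bar> powr \<gamma>)"
    using moment_leD(1)[OF assms] by auto
  show "integrable M (\<lambda>\<omega>. h (X i \<omega>))"
  proof (rule integrable_bound_real[OF i(1)])
    show "\<bar>h (X i \<omega>)\<bar> \<le> 2 + \<bar>h (X i \<omega>)\<bar> powr \<gamma>" for \<omega>
      using mult_le_threshold[OF gamma, of 1 1 "h (X i \<omega>)"] by simp
  qed simp
  show "integrable M (\<lambda>\<omega>. (h (X i \<omega>))\<^sup>2)"
  proof (rule integrable_bound_real[OF i(2)])
    show "\<bar>(h (X i \<omega>))\<^sup>2\<bar> \<le> 1 + 2 * \<bar>h (X i \<omega>)\<bar> powr \<gamma>" for \<omega>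
      using mult_le_threshold[OF gamma, of 1 "h (X i \<omega>)" "h (X i \<omega>)"] by (simp add: power2_eq_square)
  qed simp
qed

definition cov :: "('x \<Rightarrow> real) \<Rightarrow> nat \<Rightarrow> nat \<Rightarrow> real" where
  "cov h i j = (\<integral>\<omega>. h (X i \<omega>) * h (X j \<omega>) \<partial>M) - (\<integral>\<omega>. h (X i \<omega>) \<partial>M) * (\<integral>\<omega>. h (X j \<omega>) \<partial>M)"

text \<open>
  The rate of decay of covariances at distance \<open>m\<close>; the value at \<open>0\<close> covers the variances.
\<close>

definition zeta :: "nat \<Rightarrow> real" where
  "zeta m = (if m = 0 then 1 else real m powr - (\<rho> * (\<gamma> - 2) / \<gamma>))"

lemma zeta_summable: "summable zeta"
proof -
  have "1 < \<rho> * (\<gamma> - 2) / \<gamma>" using rho gamma by (simp add: field_simps)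
  then have "summable (\<lambda>m. real m powr - (\<rho> * (\<gamma> - 2) / \<gamma>))" by (simp add: summable_real_powr_iff)
  then show ?thesis
    by (rule summable_cong[THEN iffD1, rotated]) (auto simp: zeta_def intro: eventually_sequentiallyI[of 1])
qed

lemma zeta_nonneg: "0 \<le> zeta m" by (simp add: zeta_def)

lemma rho_pos: "0 < \<rho>" using rho gamma by (smt (verit) divide_pos_pos)

text \<open>
  In \<open>covariance_mixing_le\<close> the two terms are of the order \<open>m powr - \<rho> * T\<^sup>2\<close> and \<open>T powr (2 -
  \<gamma>)\<close>. The choice \<open>T = \<sigma> * m powr (\<rho> / \<gamma>)\<close> makes both of them multiples of \<open>zeta m\<close>.
\<close>

lemma cov_le:
  assumes h: "moment_le h \<sigma>" "h \<in> borel_measurable borel" and s: "0 < \<sigma>"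
    and ij: "i \<in> {1..k}" "j \<in> {1..k}" "i \<le> j"
  shows "\<bar>cov h i j\<bar> \<le> zeta (j - i) * (2 * (K + 1) * \<sigma>\<^sup>2 + 2 powr (\<gamma> + 1) * \<sigma> powr (2 - \<gamma>) *
     ((\<integral>\<omega>. \<bar>h (X i \<omega>)\<bar> powr \<gamma> \<partial>M) + (\<integral>\<omega>. \<bar>h (X j \<omega>)\<bar> powr \<gamma> \<partial>M)))"
proof (cases "i = j")
  case False
  define m where "m = j - i"
  have m: "1 \<le> m" "i + m = j" "m \<le> k" using False ij by (auto simp: m_def)
  define T where "T = \<sigma> * real m powr (\<rho> / \<gamma>)"
  have T0: "0 < T" using s m by (simp add: T_def)
  have exps: "- \<rho> + 2 * \<rho> / \<gamma> = - (\<rho> * (\<gamma> - 2) / \<gamma>)" "\<rho> * (2 - \<gamma>) / \<gamma> = - (\<rho> * (\<gamma> - 2) / \<gamma>)"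
    using gamma by (auto simp: field_simps)
  have "T^2 = \<sigma>^2 * real m powr (2 * \<rho> / \<gamma>)"
    unfolding T_def power_mult_distrib by (subst powr_power) (use m in \<open>auto simp: mult_ac\<close>)
  then have 1: "K * real m powr - \<rho> * T^2 = K * \<sigma>^2 * zeta m"
    using m unfolding zeta_def exps(1)[symmetric] powr_add by simp
  have 2: "T powr (2 - \<gamma>) = \<sigma> powr (2 - \<gamma>) * zeta m"
    using m s by (simp add: T_def powr_mult powr_powr zeta_def exps(2))
  have "\<bar>cov h i j\<bar> \<le> 2 * (K * real m powr - \<rho>) * T^2 + 2 powr (\<gamma> + 1) * T powr (2 - \<gamma>) *
     ((\<integral>\<omega>. \<bar>h (X i \<omega>)\<bar> powr \<gamma> \<partial>M) + (\<integral>\<omega>. \<bar>h (X j \<omega>)\<bar> powr \<gamma> \<partial>M))"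
    unfolding cov_def
  proof (rule covariance_mixing_le[where NA = "gen {1..i}" and NB = "gen {i + m..k}"])
    show "beta_coeff M (sets (gen {1..i})) (sets (gen {i + m..k})) \<le> ennreal (K * real m powr - \<rho>)"
      using m ij by (intro beta_gen_le) auto
    show "sets (gen {1..i}) \<subseteq> sets M" "sets (gen {i + m..k}) \<subseteq> sets M"
      using ij m by (auto intro!: sets_gen_subset)
    show "(\<lambda>\<omega>. h (X i \<omega>)) \<in> borel_measurable (gen {1..i})"
      using h(2) ij by (intro measurable_compose[OF measurable_gen]) auto
    show "(\<lambda>\<omega>. h (X j \<omega>)) \<in> borel_measurable (gen {i + m..k})"
      using h(2) ij m by (intro measurable_compose[OF measurable_gen]) auto
  qed (use gamma T0 ij moment_leD(1)[OF h] K_nonneg in auto)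
  also have "\<dots> = zeta m * (2 * K * \<sigma>\<^sup>2 + 2 powr (\<gamma> + 1) * \<sigma> powr (2 - \<gamma>) *
     ((\<integral>\<omega>. \<bar>h (X i \<omega>)\<bar> powr \<gamma> \<partial>M) + (\<integral>\<omega>. \<bar>h (X j \<omega>)\<bar> powr \<gamma> \<partial>M)))"
    using 1 unfolding 2 by (simp add: algebra_simps)
  also have "\<dots> \<le> zeta m * (2 * (K + 1) * \<sigma>\<^sup>2 + 2 powr (\<gamma> + 1) * \<sigma> powr (2 - \<gamma>) *
     ((\<integral>\<omega>. \<bar>h (X i \<omega>)\<bar> powr \<gamma> \<partial>M) + (\<integral>\<omega>. \<bar>h (X j \<omega>)\<bar> powr \<gamma> \<partial>M)))"
    by (intro mult_left_mono add_right_mono zeta_nonneg) (auto intro: mult_right_mono)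
  finally show ?thesis by (simp add: m_def)
next
  case True
  note [measurable] = X_measurable[OF ij(1)] h(2)
  note i = moment_integrable[OF h ij(1)] moment_leD(1)[OF h ij(1)]
  define E where "E = (\<integral>\<omega>. \<bar>h (X i \<omega>)\<bar> powr \<gamma> \<partial>M)"
  have E0: "0 \<le> E" by (simp add: E_def)
  have "cov h i i = variance (\<lambda>\<omega>. h (X i \<omega>))"
    using variance_eq[OF i(1,2)] by (simp add: cov_def power2_eq_square)
  then have "\<bar>cov h i i\<bar> = cov h i i" by simp
  also have "\<dots> \<le> (\<integral>\<omega>. (h (X i \<omega>))\<^sup>2 \<partial>M)" by (simp add: cov_def power2_eq_square)
  also have "\<dots> \<le> (\<integral>\<omega>. \<sigma>\<^sup>2 + \<sigma> powr (2 - \<gamma>) * (2 * \<bar>h (X i \<omega>)\<bar> powr \<gamma>) \<partial>M)"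
  proof (rule integral_mono)
    show "(h (X i \<omega>))\<^sup>2 \<le> \<sigma>\<^sup>2 + \<sigma> powr (2 - \<gamma>) * (2 * \<bar>h (X i \<omega>)\<bar> powr \<gamma>)" for \<omega>
      using mult_le_threshold[OF gamma s, of "h (X i \<omega>)" "h (X i \<omega>)"] by (simp add: power2_eq_square)
  qed (use i in auto)
  also have "\<dots> = \<sigma>\<^sup>2 + 2 * \<sigma> powr (2 - \<gamma>) * E"
    using i by (subst Bochner_Integration.integral_add) (auto simp: E_def prob_space)
  also have "\<dots> \<le> 2 * (K + 1) * \<sigma>\<^sup>2 + 2 powr (\<gamma> + 1) * \<sigma> powr (2 - \<gamma>) * (E + E)"
  proof (rule add_mono)
    show "\<sigma>\<^sup>2 \<le> 2 * (K + 1) * \<sigma>\<^sup>2" using K_nonneg by (simp add: algebra_simps)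
    have "1 \<le> 2 powr (\<gamma> + 1)" using gamma by (intro ge_one_powr_ge_zero) auto
    then have "1 * (2 * \<sigma> powr (2 - \<gamma>) * E) \<le> 2 powr (\<gamma> + 1) * (2 * \<sigma> powr (2 - \<gamma>) * E)"
      using E0 by (intro mult_right_mono) auto
    then show "2 * \<sigma> powr (2 - \<gamma>) * E \<le> 2 powr (\<gamma> + 1) * \<sigma> powr (2 - \<gamma>) * (E + E)"
      by (simp add: algebra_simps)
  qed
  finally show ?thesis using True by (simp add: E_def zeta_def)
qed

definition Cvar :: real where
  "Cvar = (4 * (K + 1) + 2 powr (\<gamma> + 3)) * (\<Sum>m. zeta m)"

lemma sum_zeta_le:
  assumes "i \<in> {1..k}"
  shows "(\<Sum>j=1..k. zeta (if i \<le> j then j - i else i - j)) \<le> 2 * (\<Sum>m. zeta m)"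
proof -
  have "(\<Sum>j=1..k. zeta (if i \<le> j then j - i else i - j)) =
    (\<Sum>j\<in>{j\<in>{1..k}. i \<le> j}. zeta (j - i)) + (\<Sum>j\<in>{j\<in>{1..k}. \<not> i \<le> j}. zeta (i - j))"
    by (simp add: sum.If_cases if_distrib[of zeta] Int_def cong: if_cong)
  also have "(\<Sum>j\<in>{j\<in>{1..k}. i \<le> j}. zeta (j - i)) = (\<Sum>m\<in>(\<lambda>j. j - i) ` {j\<in>{1..k}. i \<le> j}. zeta m)"
    by (subst sum.reindex) (auto simp: inj_on_def)
  also have "\<dots> \<le> (\<Sum>m. zeta m)"
    by (intro sum_le_suminf zeta_summable zeta_nonneg) auto
  also have "(\<Sum>j\<in>{j\<in>{1..k}. \<not> i \<le> j}. zeta (i - j)) = (\<Sum>m\<in>(\<lambda>j. i - j) ` {j\<in>{1..k}. \<not> i \<le> j}. zeta m)"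
    by (subst sum.reindex) (auto simp: inj_on_def)
  also have "\<dots> \<le> (\<Sum>m. zeta m)"
    by (intro sum_le_suminf zeta_summable zeta_nonneg) auto
  finally show ?thesis by simp
qed

lemma Cvar_nonneg: "0 \<le> Cvar"
  unfolding Cvar_def using K_nonneg by (intro mult_nonneg_nonneg suminf_nonneg zeta_summable zeta_nonneg) auto

lemma cov_commute: "cov h i j = cov h j i" by (simp add: cov_def mult.commute)

text \<open>
  Summability of \<open>zeta\<close> turns the pairwise bounds into a variance bound of the same form as under
  independence: \<open>k\<close> times the squared seminorm.
\<close>

lemma sum_cov_le:
  assumes h: "moment_le h \<sigma>" "h \<in> borel_measurable borel" and s: "0 < \<sigma>"
  shows "(\<Sum>i=1..k. \<Sum>j=1..k. \<bar>cov h i j\<bar>) \<le> Cvar * real k * \<sigma>\<^sup>2"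
proof -
  define e where "e i = (\<integral>\<omega>. \<bar>h (X i \<omega>)\<bar> powr \<gamma> \<partial>M)" for i
  define z where "z i j = zeta (if i \<le> j then j - i else i - j)" for i j
  define Z where "Z = (\<Sum>m. zeta m)"
  define A where "A = 2 * (K + 1) * \<sigma>\<^sup>2"
  define B where "B = 2 powr (\<gamma> + 1) * \<sigma> powr (2 - \<gamma>)"
  have A0: "0 \<le> A" "0 \<le> B" using K_nonneg by (auto simp: A_def B_def)
  have Z0: "0 \<le> Z" unfolding Z_def by (intro suminf_nonneg zeta_summable zeta_nonneg)
  have e0: "0 \<le> e i" for i by (simp add: e_def)
  have zsym: "z i j = z j i" for i j by (auto simp: z_def)
  have zle: "(\<Sum>j=1..k. z i j) \<le> 2 * Z" if "i \<in> {1..k}" for i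
    using sum_zeta_le[OF that] by (simp add: z_def Z_def)
  have c: "\<bar>cov h i j\<bar> \<le> z i j * (A + B * (e i + e j))" if "i \<in> {1..k}" "j \<in> {1..k}" for i j
  proof (cases "i \<le> j")
    case True
    then show ?thesis using cov_le[OF h s that] by (simp add: z_def e_def A_def B_def)
  next
    case False
    then show ?thesis using cov_le[OF h s that(2,1)] by (simp add: cov_commute[of h i j] z_def e_def A_def B_def add.commute)
  qed
  have "(\<Sum>i=1..k. \<Sum>j=1..k. \<bar>cov h i j\<bar>) \<le> (\<Sum>i=1..k. \<Sum>j=1..k. z i j * (A + B * (e i + e j)))"
    using c by (intro sum_mono) auto
  also have "\<dots> = A * (\<Sum>i=1..k. \<Sum>j=1..k. z i j) + B * (\<Sum>i=1..k. \<Sum>j=1..k. z i j * e i)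
      + B * (\<Sum>i=1..k. \<Sum>j=1..k. z i j * e j)"
    by (simp add: sum.distrib sum_distrib_left algebra_simps)
  also have "(\<Sum>i=1..k. \<Sum>j=1..k. z i j * e j) = (\<Sum>i=1..k. \<Sum>j=1..k. z i j * e i)"
    by (subst sum.swap) (simp add: zsym)
  also have "A * (\<Sum>i=1..k. \<Sum>j=1..k. z i j) + B * (\<Sum>i=1..k. \<Sum>j=1..k. z i j * e i) + B * (\<Sum>i=1..k. \<Sum>j=1..k. z i j * e i) \<le>
     A * (\<Sum>i=1..k. 2 * Z) + B * (\<Sum>i=1..k. 2 * Z * e i) + B * (\<Sum>i=1..k. 2 * Z * e i)"
  proof -
    have "(\<Sum>i=1..k. \<Sum>j=1..k. z i j) \<le> (\<Sum>i=1..k. 2 * Z)" by (intro sum_mono zle)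
    moreover have "(\<Sum>i=1..k. \<Sum>j=1..k. z i j * e i) \<le> (\<Sum>i=1..k. 2 * Z * e i)"
    proof (rule sum_mono)
      fix i assume "i \<in> {1..k}"
      then show "(\<Sum>j=1..k. z i j * e i) \<le> 2 * Z * e i"
        using mult_right_mono[OF zle e0, of i i] by (simp add: sum_distrib_right)
    qed
    ultimately show ?thesis using A0 by (intro add_mono mult_left_mono) auto
  qed
  also have "\<dots> = 2 * Z * A * real k + 4 * B * Z * (\<Sum>i=1..k. e i)"
    by (simp add: sum_distrib_left mult_ac)
  also have "\<dots> \<le> 2 * Z * A * real k + 4 * B * Z * (real k * \<sigma> powr \<gamma>)"
    using moment_leD(2)[OF h] A0 Z0 by (intro add_left_mono mult_left_mono) (auto simp: e_def)
  also have "\<dots> = 2 * Z * A * real k + 4 * 2 powr (\<gamma> + 1) * Z * real k * (\<sigma> powr (2 - \<gamma>) * \<sigma> powr \<gamma>)"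
    by (simp add: B_def mult_ac)
  also have "\<sigma> powr (2 - \<gamma>) * \<sigma> powr \<gamma> = \<sigma>\<^sup>2" using s by (simp flip: powr_add)
  also have "2 * Z * A * real k + 4 * 2 powr (\<gamma> + 1) * Z * real k * \<sigma>\<^sup>2 = Cvar * real k * \<sigma>\<^sup>2"
    by (simp add: Cvar_def Z_def A_def powr_add algebra_simps)
  finally show ?thesis .
qed

end

section \<open>Soft maximum\<close>

lemma exp_le_quadratic:
  fixes x :: real
  assumes "\<bar>x\<bar> \<le> 1"
  shows "exp x \<le> 1 + x + x\<^sup>2"
proof (cases "0 \<le> x")
  case True
  then show ?thesis using exp_bound[of x] assms by simp
next
  case False
  define y where "y = - x"
  have y: "0 < y" "y \<le> 1" using False assms by (auto simp: y_def)
  have e: "1 + y + y\<^sup>2 / 2 \<le> exp y" using y by (intro exp_lower_Taylor_quadratic) auto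
  have p: "0 < 1 + y + y\<^sup>2 / 2" using y by (simp add: add_pos_nonneg)
  have "exp x = 1 / exp y" by (simp add: y_def exp_minus field_simps)
  also have "\<dots> \<le> 1 / (1 + y + y\<^sup>2 / 2)" using e p by (intro divide_left_mono mult_pos_pos) auto
  also have "\<dots> \<le> 1 - y + y\<^sup>2"
  proof -
    have "(1 - y + y\<^sup>2) * (1 + y + y\<^sup>2 / 2) = 1 + (y\<^sup>2 + y^3 + y^4) / 2"
      by (simp add: field_simps power2_eq_square power3_eq_cube power4_eq_xxxx)
    moreover have "0 \<le> (y\<^sup>2 + y^3 + y^4) / 2" using y by auto
    ultimately have "1 \<le> (1 - y + y\<^sup>2) * (1 + y + y\<^sup>2 / 2)" by simp
    then show ?thesis using p by (simp add: divide_le_eq)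
  qed
  finally show ?thesis by (simp add: y_def)
qed

lemma ln_le_tangent:
  fixes x w :: real
  assumes "0 < x" "0 < w"
  shows "ln x \<le> ln w + (x - w) / w"
  using ln_le_minus_one[of "x / w"] assms by (simp add: ln_div diff_divide_distrib)

context prob_space
begin

lemma integrable_simple:
  fixes U :: "'a \<Rightarrow> real"
  assumes "simple_function M U"
  shows "integrable M U"
proof -
  have fin: "finite (U ` space M)" using assms by (rule simple_functionD)
  show ?thesis
  proof (rule integrable_const_bound)
    show "AE x in M. norm (U x) \<le> Max ((\<lambda>x. \<bar>x\<bar>) ` U ` space M)"
      using fin by (intro AE_I2) (auto intro!: Max_ge)
  qed (use assms in \<open>rule borel_measurable_simple_function\<close>)
qed

lemma simple_function_restrict_family:
  assumes "finite A" "\<And>a. a \<in> A \<Longrightarrow> simple_function N (f a)"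
  shows "simple_function N (\<lambda>\<omega> a. if a \<in> A then f a \<omega> else 0)"
  using assms
proof (induction A rule: finite_induct)
  case empty
  then show ?case by simp
next
  case (insert x A)
  have "simple_function N (\<lambda>\<omega>. ((\<lambda>a. if a \<in> A then f a \<omega> else 0)(x := f x \<omega>)))"
    using insert by (intro simple_function_compose2[where h = "\<lambda>g v. g(x := v)"]) auto
  also have "(\<lambda>\<omega>. ((\<lambda>a. if a \<in> A then f a \<omega> else 0)(x := f x \<omega>))) = (\<lambda>\<omega> a. if a \<in> insert x A then f a \<omega> else 0)"
    by (auto simp: fun_eq_iff)
  finally show ?case .
qed

text \<open>
  The soft maximum after \<open>r\<close> summands is \<open>\<Psi> r s\<close>, the logarithm of the sum of \<open>exp (\<plusminus> \<theta> * s a +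
  \<theta>\<^sup>2 * kap r a)\<close> over the class, divided by \<open>\<theta>\<close>. The compensator \<open>kap r a\<close> is the variance still
  to come, so that adding one centred summand independent of the past does not increase the mean
  of \<open>\<Psi>\<close>: the sum of exponentials does not increase in mean by a moment generating function bound,
  and the logarithm is concave. Since \<open>\<Psi>\<close> is Lipschitz for the maximum norm, a summand bounded by
  \<open>c\<close> changes it by at most \<open>c\<close>, and the dependence on the past costs at most \<open>2 * c * b\<close> per
  summand. At the end \<open>\<Psi>\<close> dominates the maximum, at the start it is \<open>ln (2 * card A) / \<theta> + \<theta> * V\<close>
  at most.

  The sigma-algebra \<open>NA r\<close> carries the past of the summand \<open>r\<close> and \<open>NB r\<close> the summand itself.
\<close>

lemma softmax_decoupling:
  fixes U :: "nat \<Rightarrow> 'h \<Rightarrow> 'a \<Rightarrow> real" and A :: "'h set" and NA NB :: "nat \<Rightarrow> 'a measure"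
  assumes A: "finite A" "A \<noteq> {}"
    and sub: "\<And>r. r < m \<Longrightarrow> space (NA r) = space M" "\<And>r. r < m \<Longrightarrow> sets (NA r) \<subseteq> sets M"
      "\<And>r. r < m \<Longrightarrow> space (NB r) = space M" "\<And>r. r < m \<Longrightarrow> sets (NB r) \<subseteq> sets M"
    and past: "\<And>r a. r < m \<Longrightarrow> a \<in> A \<Longrightarrow> simple_function (NA r) (\<lambda>\<omega>. \<Sum>r'<r. U r' a \<omega>)"
    and cur: "\<And>r a. r < m \<Longrightarrow> a \<in> A \<Longrightarrow> simple_function (NB r) (U r a)"
    and b: "\<And>r. r < m \<Longrightarrow> beta_coeff M (sets (NA r)) (sets (NB r)) \<le> ennreal b" "0 \<le> b"
    and bd: "\<And>r a \<omega>. r < m \<Longrightarrow> a \<in> A \<Longrightarrow> \<omega> \<in> space M \<Longrightarrow> \<bar>U r a \<omega>\<bar> \<le> c" and c: "0 \<le> c"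
    and mean: "\<And>r a. r < m \<Longrightarrow> a \<in> A \<Longrightarrow> (\<integral>\<omega>. U r a \<omega> \<partial>M) = 0"
    and var: "\<And>a. a \<in> A \<Longrightarrow> (\<Sum>r<m. \<integral>\<omega>. (U r a \<omega>)\<^sup>2 \<partial>M) \<le> V"
    and lam: "0 < \<theta>" "\<theta> * c \<le> 1"
  shows "(\<integral>\<omega>. Max ((\<lambda>a. \<bar>\<Sum>r<m. U r a \<omega>\<bar>) ` A) \<partial>M) \<le> ln (2 * real (card A)) / \<theta> + \<theta> * V + 2 * c * real m * b"
proof -
  define kap where "kap r a = (\<Sum>r'\<in>{r..<m}. \<integral>\<omega>. (U r' a \<omega>)\<^sup>2 \<partial>M)" for r a
  define E1 where "E1 r s a = exp (\<theta> * s a + \<theta>\<^sup>2 * kap r a)" for r a and s :: "'h \<Rightarrow> real"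
  define E2 where "E2 r s a = exp (- (\<theta> * s a) + \<theta>\<^sup>2 * kap r a)" for r a and s :: "'h \<Rightarrow> real"
  define Q where "Q r s = (\<Sum>a\<in>A. E1 r s a + E2 r s a)" for r and s :: "'h \<Rightarrow> real"
  define \<Psi> where "\<Psi> r s = ln (Q r s) / \<theta>" for r and s :: "'h \<Rightarrow> real"
  define S where "S r \<omega> a = (if a \<in> A then \<Sum>r'<r. U r' a \<omega> else 0)" for r \<omega> a
  define Y where "Y r \<omega> a = (if a \<in> A then U r a \<omega> else 0)" for r \<omega> a
  define g where "g r x y = \<Psi> (Suc r) (\<lambda>a. x a + y a) - \<Psi> (Suc r) x" for r and x y :: "'h \<Rightarrow> real"
  have Qpos: "0 < Q r s" for r s
    unfolding Q_def E1_def E2_def using A by (intro sum_pos) (auto intro: add_pos_pos)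
  have sNA: "simple_function (NA r) (S r)" if "r < m" for r
    unfolding S_def using past[OF that] by (intro simple_function_restrict_family[OF A(1)])
  have sNB: "simple_function (NB r) (Y r)" if "r < m" for r
    unfolding Y_def using cur[OF that] by (intro simple_function_restrict_family[OF A(1)])
  have sUa: "simple_function M (U r a)" if "r < m" "a \<in> A" for r a
    using simple_function_subalgebra[OF cur[OF that] sub(3,4)[OF that(1)]] .
  have sM: "simple_function M (S r)" if "r \<le> m" for r
    unfolding S_def using that by (intro simple_function_restrict_family[OF A(1)] simple_function_sum sUa) auto
  have sY: "simple_function M (Y r)" if "r < m" for r
    unfolding Y_def using that by (intro simple_function_restrict_family[OF A(1)] sUa) auto
  have SSuc: "S (Suc r) \<omega> = (\<lambda>a. S r \<omega> a + Y r \<omega> a)" for r \<omega> by (auto simp: S_def Y_def fun_eq_iff)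
  have kapSuc: "kap r a = (\<integral>\<omega>. (U r a \<omega>)\<^sup>2 \<partial>M) + kap (Suc r) a" if "r < m" for r a
    unfolding kap_def using that by (simp add: sum.atLeast_Suc_lessThan)
  have mgf: "(\<integral>\<omega>. exp (t * Y r \<omega> a) \<partial>M) \<le> exp (\<theta>\<^sup>2 * (\<integral>\<omega>. (U r a \<omega>)\<^sup>2 \<partial>M))"
    if r: "r < m" and a: "a \<in> A" and t: "t = \<theta> \<or> t = - \<theta>" for t r a
  proof -
    have le1: "\<bar>t * U r a \<omega>\<bar> \<le> 1" if "\<omega> \<in> space M" for \<omega>
      using bd[OF r a that] lam t c
      by (auto simp: abs_mult intro!: order_trans[OF mult_left_mono[of _ c \<theta>]])
    have "(\<integral>\<omega>. exp (t * Y r \<omega> a) \<partial>M) \<le> (\<integral>\<omega>. 1 + t * U r a \<omega> + t\<^sup>2 * (U r a \<omega>)\<^sup>2 \<partial>M)"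
    proof (rule integral_mono)
      show "integrable M (\<lambda>\<omega>. exp (t * Y r \<omega> a))"
        using simple_function_compose1[OF sY[OF r], of "\<lambda>y. exp (t * y a)"] by (rule integrable_simple)
      show "integrable M (\<lambda>\<omega>. 1 + t * U r a \<omega> + t\<^sup>2 * (U r a \<omega>)\<^sup>2)"
        using simple_function_compose1[OF sUa[OF r a], of "\<lambda>y. 1 + t * y + t\<^sup>2 * y\<^sup>2"] by (rule integrable_simple)
      show "exp (t * Y r \<omega> a) \<le> 1 + t * U r a \<omega> + t\<^sup>2 * (U r a \<omega>)\<^sup>2" if "\<omega> \<in> space M" for \<omega>
        using exp_le_quadratic[OF le1[OF that]] a by (simp add: Y_def power_mult_distrib)
    qed
    also have "\<dots> = 1 + \<theta>\<^sup>2 * (\<integral>\<omega>. (U r a \<omega>)\<^sup>2 \<partial>M)"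
    proof -
      have i: "integrable M (U r a)" "integrable M (\<lambda>\<omega>. (U r a \<omega>)\<^sup>2)"
        using simple_function_compose1[OF sUa[OF r a], of "\<lambda>y. y\<^sup>2"] sUa[OF r a] by (auto intro: integrable_simple)
      have "(\<integral>\<omega>. 1 + t * U r a \<omega> + t\<^sup>2 * (U r a \<omega>)\<^sup>2 \<partial>M) = 1 + t * (\<integral>\<omega>. U r a \<omega> \<partial>M) + t\<^sup>2 * (\<integral>\<omega>. (U r a \<omega>)\<^sup>2 \<partial>M)"
        using i by (simp add: prob_space)
      moreover have "t\<^sup>2 = \<theta>\<^sup>2" using t by auto
      ultimately show ?thesis using mean[OF r a] by simp
    qed
    also have "\<dots> \<le> exp (\<theta>\<^sup>2 * (\<integral>\<omega>. (U r a \<omega>)\<^sup>2 \<partial>M))" by (rule exp_ge_add_one_self)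
    finally show ?thesis .
  qed
  have QI: "(\<integral>\<omega>. Q (Suc r) (\<lambda>a. x a + Y r \<omega> a) \<partial>M) \<le> Q r x" if r: "r < m" for r x
  proof -
    have i: "integrable M (\<lambda>\<omega>. exp (t * Y r \<omega> a))" for t a
      using simple_function_compose1[OF sY[OF r], of "\<lambda>y. exp (t * y a)"] by (rule integrable_simple)
    have e1: "E1 (Suc r) (\<lambda>a. x a + Y r \<omega> a) a = E1 (Suc r) x a * exp (\<theta> * Y r \<omega> a)" for \<omega> a
      by (simp add: E1_def exp_add[symmetric] algebra_simps)
    have e2: "E2 (Suc r) (\<lambda>a. x a + Y r \<omega> a) a = E2 (Suc r) x a * exp (- \<theta> * Y r \<omega> a)" for \<omega> a
      by (simp add: E2_def exp_add[symmetric] algebra_simps)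
    have "(\<integral>\<omega>. Q (Suc r) (\<lambda>a. x a + Y r \<omega> a) \<partial>M) =
      (\<Sum>a\<in>A. E1 (Suc r) x a * (\<integral>\<omega>. exp (\<theta> * Y r \<omega> a) \<partial>M) + E2 (Suc r) x a * (\<integral>\<omega>. exp (- \<theta> * Y r \<omega> a) \<partial>M))"
      unfolding Q_def e1 e2
      by (subst Bochner_Integration.integral_sum) (auto intro!: sum.cong Bochner_Integration.integral_add i simp: i[of "- \<theta>", simplified] i)
    also have "\<dots> \<le> (\<Sum>a\<in>A. E1 (Suc r) x a * exp (\<theta>\<^sup>2 * (\<integral>\<omega>. (U r a \<omega>)\<^sup>2 \<partial>M)) + E2 (Suc r) x a * exp (\<theta>\<^sup>2 * (\<integral>\<omega>. (U r a \<omega>)\<^sup>2 \<partial>M)))"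
      by (intro sum_mono add_mono mult_left_mono mgf r) (auto simp: E1_def E2_def)
    also have "\<dots> = Q r x"
      unfolding Q_def E1_def E2_def kapSuc[OF r] by (intro sum.cong) (auto simp: exp_add[symmetric] algebra_simps)
    finally show ?thesis .
  qed
  \<comment> \<open>the increment of the soft maximum is bounded although the soft maximum itself is
    not, and only the increment is decoupled\<close>
  have glip: "\<bar>g r (S r \<omega>) (Y r \<omega>')\<bar> \<le> c" if r: "r < m" and w: "\<omega> \<in> space M" "\<omega>' \<in> space M" for r \<omega> \<omega>'
  proof -
    let ?x = "S r \<omega>" and ?y = "Y r \<omega>'"
    have y: "\<bar>?y a\<bar> \<le> c" for a using bd[OF r _ w(2)] c by (auto simp: Y_def)
    have l: "\<theta> * ?y a \<le> \<theta> * c" "- (\<theta> * ?y a) \<le> \<theta> * c" for a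
    proof -
      have "?y a \<le> c" "- c \<le> ?y a" using y[of a] by linarith+
      then have "\<theta> * ?y a \<le> \<theta> * c" "\<theta> * (- c) \<le> \<theta> * ?y a" using lam by (intro mult_left_mono; simp)+
      then show "\<theta> * ?y a \<le> \<theta> * c" "- (\<theta> * ?y a) \<le> \<theta> * c" by simp_all
    qed
    have up: "Q (Suc r) (\<lambda>a. ?x a + ?y a) \<le> exp (\<theta> * c) * Q (Suc r) ?x"
      unfolding Q_def sum_distrib_left
    proof (intro sum_mono, unfold distrib_left, intro add_mono)
      fix a
      show "E1 (Suc r) (\<lambda>a. ?x a + ?y a) a \<le> exp (\<theta> * c) * E1 (Suc r) ?x a"
        using l(1)[of a] by (simp add: E1_def exp_add[symmetric] algebra_simps)
      show "E2 (Suc r) (\<lambda>a. ?x a + ?y a) a \<le> exp (\<theta> * c) * E2 (Suc r) ?x a"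
        using l(2)[of a] by (simp add: E2_def exp_add[symmetric] algebra_simps)
    qed
    have lo: "Q (Suc r) ?x \<le> exp (\<theta> * c) * Q (Suc r) (\<lambda>a. ?x a + ?y a)"
      unfolding Q_def sum_distrib_left
    proof (intro sum_mono, unfold distrib_left, intro add_mono)
      fix a
      show "E1 (Suc r) ?x a \<le> exp (\<theta> * c) * E1 (Suc r) (\<lambda>a. ?x a + ?y a) a"
        using l(2)[of a] by (simp add: E1_def exp_add[symmetric] algebra_simps)
      show "E2 (Suc r) ?x a \<le> exp (\<theta> * c) * E2 (Suc r) (\<lambda>a. ?x a + ?y a) a"
        using l(1)[of a] by (simp add: E2_def exp_add[symmetric] algebra_simps)
    qed
    have "ln (Q (Suc r) (\<lambda>a. ?x a + ?y a)) \<le> ln (exp (\<theta> * c) * Q (Suc r) ?x)"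
      using up Qpos by (subst ln_le_cancel_iff) (auto intro: mult_pos_pos)
    then have 1: "ln (Q (Suc r) (\<lambda>a. ?x a + ?y a)) \<le> \<theta> * c + ln (Q (Suc r) ?x)"
      using Qpos by (subst (asm) ln_mult_pos) auto
    have "ln (Q (Suc r) ?x) \<le> ln (exp (\<theta> * c) * Q (Suc r) (\<lambda>a. ?x a + ?y a))"
      using lo Qpos by (subst ln_le_cancel_iff) (auto intro: mult_pos_pos)
    then have 2: "ln (Q (Suc r) ?x) \<le> \<theta> * c + ln (Q (Suc r) (\<lambda>a. ?x a + ?y a))"
      using Qpos by (subst (asm) ln_mult_pos) auto
    have "\<bar>ln (Q (Suc r) (\<lambda>a. ?x a + ?y a)) - ln (Q (Suc r) ?x)\<bar> \<le> \<theta> * c" using 1 2 by linarith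
    then show ?thesis
      unfolding g_def \<Psi>_def diff_divide_distrib[symmetric] using lam
      by (simp add: abs_divide divide_le_eq mult.commute)
  qed
  \<comment> \<open>Jensen's inequality for the logarithm, by the tangent at \<open>Q r
    x\<close>\<close>
  have jensen: "(\<integral>\<omega>. \<Psi> (Suc r) (\<lambda>a. x a + Y r \<omega> a) \<partial>M) \<le> \<Psi> r x" if r: "r < m" for r x
  proof -
    let ?W = "\<lambda>\<omega>. Q (Suc r) (\<lambda>a. x a + Y r \<omega> a)" and ?w = "Q r x"
    have i: "integrable M (\<lambda>\<omega>. G (Y r \<omega>))" for G :: "('h \<Rightarrow> real) \<Rightarrow> real"
      using simple_function_compose1[OF sY[OF r]] by (rule integrable_simple)
    have "(\<integral>\<omega>. ln (?W \<omega>) \<partial>M) \<le> (\<integral>\<omega>. ln ?w + (?W \<omega> - ?w) / ?w \<partial>M)"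
      using ln_le_tangent[OF Qpos Qpos] i[of "\<lambda>y. ln (Q (Suc r) (\<lambda>a. x a + y a))"]
         i[of "\<lambda>y. ln ?w + (Q (Suc r) (\<lambda>a. x a + y a) - ?w) / ?w"] by (intro integral_mono) auto
    also have "\<dots> = ln ?w + ((\<integral>\<omega>. ?W \<omega> \<partial>M) - ?w) / ?w"
      using i[of "\<lambda>y. Q (Suc r) (\<lambda>a. x a + y a)"] by (simp add: prob_space)
    also have "\<dots> \<le> ln ?w" using QI[OF r, of x] Qpos[of r x] by (simp add: divide_nonpos_pos)
    finally show ?thesis unfolding \<Psi>_def using lam by (simp add: divide_right_mono)
  qed
  have step: "(\<integral>\<omega>. \<Psi> (Suc r) (S (Suc r) \<omega>) \<partial>M) \<le> (\<integral>\<omega>. \<Psi> r (S r \<omega>) \<partial>M) + 2 * c * b" if r: "r < m" for r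
  proof -
    have r': "r \<le> m" using r by simp
    have iS: "integrable M (\<lambda>\<omega>. G (S r \<omega>))" for G :: "('h \<Rightarrow> real) \<Rightarrow> real"
      using simple_function_compose1[OF sM[OF r']] by (rule integrable_simple)
    have iY: "integrable M (\<lambda>\<omega>. G (Y r \<omega>))" for G :: "('h \<Rightarrow> real) \<Rightarrow> real"
      using simple_function_compose1[OF sY[OF r]] by (rule integrable_simple)
    have ig: "integrable M (\<lambda>\<omega>. g r (S r \<omega>) (Y r \<omega>))"
      using simple_function_compose2[OF sM[OF r'] sY[OF r]] by (rule integrable_simple)
    have "(\<integral>\<omega>. \<Psi> (Suc r) (S (Suc r) \<omega>) \<partial>M) = (\<integral>\<omega>. \<Psi> (Suc r) (S r \<omega>) + g r (S r \<omega>) (Y r \<omega>) \<partial>M)"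
      by (simp add: SSuc g_def)
    also have "\<dots> = (\<integral>\<omega>. \<Psi> (Suc r) (S r \<omega>) \<partial>M) + (\<integral>\<omega>. g r (S r \<omega>) (Y r \<omega>) \<partial>M)"
      by (rule Bochner_Integration.integral_add[OF iS ig])
    also have "(\<integral>\<omega>. g r (S r \<omega>) (Y r \<omega>) \<partial>M) \<le> (\<integral>\<omega>. (\<integral>\<omega>'. g r (S r \<omega>) (Y r \<omega>') \<partial>M) \<partial>M) + 2 * c * b"
    proof -
      have "\<bar>(\<integral>\<omega>. g r (S r \<omega>) (Y r \<omega>) \<partial>M) - (\<integral>\<omega>. (\<integral>\<omega>'. g r (S r \<omega>) (Y r \<omega>') \<partial>M) \<partial>M)\<bar> \<le> 2 * c * b"
        by (rule decoupling_bounded[where NA = "NA r" and NB = "NB r" and U = "S r" and V = "Y r" and g = "g r"])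
          (use b r sub sNA sNB glip c in auto)
      then show ?thesis by linarith
    qed
    also have "(\<integral>\<omega>. \<Psi> (Suc r) (S r \<omega>) \<partial>M) + ((\<integral>\<omega>. (\<integral>\<omega>'. g r (S r \<omega>) (Y r \<omega>') \<partial>M) \<partial>M) + 2 * c * b) =
      (\<integral>\<omega>. \<Psi> (Suc r) (S r \<omega>) + (\<integral>\<omega>'. g r (S r \<omega>) (Y r \<omega>') \<partial>M) \<partial>M) + 2 * c * b"
      using iS[of "\<Psi> (Suc r)"] iS[of "\<lambda>x. \<integral>\<omega>'. g r x (Y r \<omega>') \<partial>M"] by simp
    also have "\<dots> \<le> (\<integral>\<omega>. \<Psi> r (S r \<omega>) \<partial>M) + 2 * c * b"
    proof -
      have "\<Psi> (Suc r) x + (\<integral>\<omega>'. g r x (Y r \<omega>') \<partial>M) \<le> \<Psi> r x" for x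
        using jensen[OF r, of x] iY[of "\<lambda>y. \<Psi> (Suc r) (\<lambda>a. x a + y a)"] by (simp add: g_def prob_space)
      then show ?thesis
        using iS[of "\<lambda>x. \<Psi> (Suc r) x + (\<integral>\<omega>'. g r x (Y r \<omega>') \<partial>M)"] iS[of "\<Psi> r"]
        by (intro add_right_mono integral_mono) auto
    qed
    finally show ?thesis by simp
  qed
  have ind: "(\<integral>\<omega>. \<Psi> r (S r \<omega>) \<partial>M) \<le> \<Psi> 0 (\<lambda>_. 0) + 2 * c * real r * b" if "r \<le> m" for r
    using that
  proof (induction r)
    case 0
    have "S 0 \<omega> = (\<lambda>_. 0)" for \<omega> by (auto simp: S_def fun_eq_iff)
    then show ?case by (simp add: prob_space)
  next
    case (Suc r)
    then show ?case using step[of r] by (simp add: algebra_simps)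
  qed
  have "Max ((\<lambda>a. \<bar>\<Sum>r<m. U r a \<omega>\<bar>) ` A) \<le> \<Psi> m (S m \<omega>)" for \<omega>
  proof (subst Max_le_iff, use A in simp, use A in simp, intro ballI, elim imageE)
    fix z a assume z: "z = \<bar>\<Sum>r<m. U r a \<omega>\<bar>" and a: "a \<in> A"
    have "exp (\<theta> * z) \<le> E1 m (S m \<omega>) a + E2 m (S m \<omega>) a"
      using a by (auto simp: E1_def E2_def kap_def S_def z abs_if)
    also have "\<dots> \<le> Q m (S m \<omega>)" unfolding Q_def
      using A a by (intro member_le_sum) (auto simp: E1_def E2_def)
    finally have "ln (exp (\<theta> * z)) \<le> ln (Q m (S m \<omega>))" using Qpos by (subst ln_le_cancel_iff) auto
    then show "z \<le> \<Psi> m (S m \<omega>)" using lam by (simp add: \<Psi>_def le_divide_eq mult.commute)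
  qed
  then have "(\<integral>\<omega>. Max ((\<lambda>a. \<bar>\<Sum>r<m. U r a \<omega>\<bar>) ` A) \<partial>M) \<le> (\<integral>\<omega>. \<Psi> m (S m \<omega>) \<partial>M)"
  proof (intro integral_mono)
    have "simple_function M (\<lambda>\<omega>. Max ((\<lambda>a. \<bar>S m \<omega> a\<bar>) ` A))"
      by (rule simple_function_compose1[OF sM, of m]) simp
    then have "integrable M (\<lambda>\<omega>. Max ((\<lambda>a. \<bar>S m \<omega> a\<bar>) ` A))" by (rule integrable_simple)
    also have "(\<lambda>\<omega>. Max ((\<lambda>a. \<bar>S m \<omega> a\<bar>) ` A)) = (\<lambda>\<omega>. Max ((\<lambda>a. \<bar>\<Sum>r<m. U r a \<omega>\<bar>) ` A))"
      by (auto simp: S_def fun_eq_iff intro!: arg_cong[of _ _ Max])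
    finally show "integrable M (\<lambda>\<omega>. Max ((\<lambda>a. \<bar>\<Sum>r<m. U r a \<omega>\<bar>) ` A))" .
    show "integrable M (\<lambda>\<omega>. \<Psi> m (S m \<omega>))"
      by (rule integrable_simple, rule simple_function_compose1[OF sM, of m]) simp
  qed
  also have "\<dots> \<le> \<Psi> 0 (\<lambda>_. 0) + 2 * c * real m * b" by (rule ind) simp
  also have "\<Psi> 0 (\<lambda>_. 0) \<le> ln (2 * real (card A)) / \<theta> + \<theta> * V"
  proof -
    have "Q 0 (\<lambda>_. 0) \<le> (\<Sum>a\<in>A. 2 * exp (\<theta>\<^sup>2 * V))"
      unfolding Q_def using var lam by (intro sum_mono) (auto simp: E1_def E2_def kap_def atLeast0LessThan mult_left_mono)
    also have "\<dots> = 2 * real (card A) * exp (\<theta>\<^sup>2 * V)" by simp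
    finally have "ln (Q 0 (\<lambda>_. 0)) \<le> ln (2 * real (card A) * exp (\<theta>\<^sup>2 * V))"
      using Qpos A by (subst ln_le_cancel_iff) (auto simp: card_gt_0_iff)
    also have "\<dots> = ln (2 * real (card A)) + \<theta>\<^sup>2 * V"
      using A by (subst ln_mult_pos) (auto simp: card_gt_0_iff)
    finally have "\<Psi> 0 (\<lambda>_. 0) \<le> (ln (2 * real (card A)) + \<theta>\<^sup>2 * V) / \<theta>"
      unfolding \<Psi>_def using lam by (intro divide_right_mono) auto
    also have "\<dots> = ln (2 * real (card A)) / \<theta> + \<theta> * V"
      using lam by (simp add: add_divide_distrib power2_eq_square)
    finally show ?thesis .
  qed
  finally show ?thesis by simp
qed

end

section \<open>Finite classes over a mixing row\<close>

lemma even_odd_split: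
  fixes F :: "nat \<Rightarrow> real"
  shows "(\<Sum>b<2 * m. F b) = (\<Sum>r<m. F (2 * r)) + (\<Sum>r<m. F (2 * r + 1))"
  by (induction m) (auto simp: algebra_simps)

text \<open>
  This covers the first block, which has no past, and blocks beyond the end of the row, to which
  the mixing coefficients of the row do not refer.
\<close>

lemma beta_coeff_trivial:
  assumes "prob_space M" "A \<subseteq> {{}, space M} \<or> B \<subseteq> {{}, space M}" "A \<subseteq> sets M" "B \<subseteq> sets M"
  shows "beta_coeff M A B = 0"
proof -
  interpret prob_space M by fact
  have "prob (a \<inter> b) - prob a * prob b = 0" if "a \<in> A" "b \<in> B" for a b
  proof -
    have "a \<subseteq> space M" "b \<subseteq> space M" using that assms sets.sets_into_space by blast+
    then have "a \<inter> space M = a" "space M \<inter> b = b" by auto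
    then show ?thesis using that assms(2) prob_space by auto
  qed
  then have "(\<Sum>(a, b)\<in>P \<times> R. \<bar>prob (a \<inter> b) - prob a * prob b\<bar>) = 0" if "P \<subseteq> A" "R \<subseteq> B" for P R
    using that by (intro sum.neutral) auto
  then show ?thesis unfolding beta_coeff_def
    by (auto intro!: antisym SUP_least simp del: sum.cartesian_product)
qed

context mixing_row
begin

text \<open>
  One coordinate of the empirical process, as a function of the integrand.
\<close>

definition emp :: "('x \<Rightarrow> real) \<Rightarrow> 'w \<Rightarrow> real" where
  "emp h \<omega> = 1 / sqrt (real k) * (\<Sum>i=1..k. h (X i \<omega>) - (\<integral>\<omega>'. h (X i \<omega>') \<partial>M))"

abbreviation max_emp :: "('x \<Rightarrow> real) set \<Rightarrow> 'w \<Rightarrow> real" where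
  "max_emp A \<omega> \<equiv> Max ((\<lambda>h. \<bar>emp h \<omega>\<bar>) ` A)"

lemma cov_eq:
  assumes h: "h \<in> borel_measurable borel" and i: "\<And>i. i \<in> {1..k} \<Longrightarrow> integrable M (\<lambda>\<omega>. h (X i \<omega>))"
      "\<And>i. i \<in> {1..k} \<Longrightarrow> integrable M (\<lambda>\<omega>. (h (X i \<omega>))\<^sup>2)"
    and ij: "i \<in> {1..k}" "j \<in> {1..k}"
  shows "integrable M (\<lambda>\<omega>. (h (X i \<omega>) - (\<integral>\<omega>'. h (X i \<omega>') \<partial>M)) * (h (X j \<omega>) - (\<integral>\<omega>'. h (X j \<omega>') \<partial>M)))" (is ?A)
    and "(\<integral>\<omega>. (h (X i \<omega>) - (\<integral>\<omega>'. h (X i \<omega>') \<partial>M)) * (h (X j \<omega>) - (\<integral>\<omega>'. h (X j \<omega>') \<partial>M)) \<partial>M) = cov h i j"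
proof -
  note [measurable] = h X_measurable[OF ij(1)] X_measurable[OF ij(2)]
  have p: "integrable M (\<lambda>\<omega>. h (X i \<omega>) * h (X j \<omega>))"
  proof (rule integrable_bound_real[of M "\<lambda>\<omega>. (h (X i \<omega>))\<^sup>2 + (h (X j \<omega>))\<^sup>2"])
    show "\<bar>h (X i \<omega>) * h (X j \<omega>)\<bar> \<le> (h (X i \<omega>))\<^sup>2 + (h (X j \<omega>))\<^sup>2" for \<omega>
    proof -
      have "2 * \<bar>h (X i \<omega>)\<bar> * \<bar>h (X j \<omega>)\<bar> \<le> \<bar>h (X i \<omega>)\<bar>\<^sup>2 + \<bar>h (X j \<omega>)\<bar>\<^sup>2" by (rule sum_squares_bound)
      moreover have "0 \<le> \<bar>h (X i \<omega>)\<bar> * \<bar>h (X j \<omega>)\<bar>" by simp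
      ultimately show ?thesis unfolding abs_mult power2_abs mult.assoc by linarith
    qed
  qed (use i ij in auto)
  define a b where "a = (\<integral>\<omega>. h (X i \<omega>) \<partial>M)" and "b = (\<integral>\<omega>. h (X j \<omega>) \<partial>M)"
  have e: "(h (X i \<omega>) - a) * (h (X j \<omega>) - b) = h (X i \<omega>) * h (X j \<omega>) - b * h (X i \<omega>) - a * h (X j \<omega>) + a * b" for \<omega>
    by (simp add: algebra_simps)
  show ?A unfolding a_def[symmetric] b_def[symmetric] e using p i ij by auto
  show "(\<integral>\<omega>. (h (X i \<omega>) - (\<integral>\<omega>'. h (X i \<omega>') \<partial>M)) * (h (X j \<omega>) - (\<integral>\<omega>'. h (X j \<omega>') \<partial>M)) \<partial>M) = cov h i j"
    unfolding a_def[symmetric] b_def[symmetric] e using p i(1)[OF ij(1)] i(1)[OF ij(2)]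
    by (simp add: cov_def prob_space flip: a_def b_def)
qed

lemma sum_square_cov:
  assumes h: "h \<in> borel_measurable borel" and i: "\<And>i. i \<in> {1..k} \<Longrightarrow> integrable M (\<lambda>\<omega>. h (X i \<omega>))"
      "\<And>i. i \<in> {1..k} \<Longrightarrow> integrable M (\<lambda>\<omega>. (h (X i \<omega>))\<^sup>2)"
    and I: "I \<subseteq> {1..k}"
  shows "integrable M (\<lambda>\<omega>. (\<Sum>i\<in>I. h (X i \<omega>) - (\<integral>\<omega>'. h (X i \<omega>') \<partial>M))\<^sup>2)" (is ?A)
    and "(\<integral>\<omega>. (\<Sum>i\<in>I. h (X i \<omega>) - (\<integral>\<omega>'. h (X i \<omega>') \<partial>M))\<^sup>2 \<partial>M) = (\<Sum>i\<in>I. \<Sum>j\<in>I. cov h i j)"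
proof -
  have e: "(\<Sum>i\<in>I. h (X i \<omega>) - (\<integral>\<omega>'. h (X i \<omega>') \<partial>M))\<^sup>2 =
    (\<Sum>i\<in>I. \<Sum>j\<in>I. (h (X i \<omega>) - (\<integral>\<omega>'. h (X i \<omega>') \<partial>M)) * (h (X j \<omega>) - (\<integral>\<omega>'. h (X j \<omega>') \<partial>M)))" for \<omega>
    by (simp add: power2_eq_square sum_product)
  have ii: "integrable M (\<lambda>\<omega>. (h (X i \<omega>) - (\<integral>\<omega>'. h (X i \<omega>') \<partial>M)) * (h (X j \<omega>) - (\<integral>\<omega>'. h (X j \<omega>') \<partial>M)))"
    if "i \<in> I" "j \<in> I" for i j
    by (rule cov_eq(1)[OF h i]) (use that I in auto)
  show ?A unfolding e by (intro Bochner_Integration.integrable_sum ii)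
  have "(\<integral>\<omega>. (\<Sum>i\<in>I. h (X i \<omega>) - (\<integral>\<omega>'. h (X i \<omega>') \<partial>M))\<^sup>2 \<partial>M) =
    (\<Sum>i\<in>I. \<Sum>j\<in>I. \<integral>\<omega>. (h (X i \<omega>) - (\<integral>\<omega>'. h (X i \<omega>') \<partial>M)) * (h (X j \<omega>) - (\<integral>\<omega>'. h (X j \<omega>') \<partial>M)) \<partial>M)"
    unfolding e
    by (subst Bochner_Integration.integral_sum; intro sum.cong refl Bochner_Integration.integral_sum Bochner_Integration.integrable_sum ii; assumption)
  also have "\<dots> = (\<Sum>i\<in>I. \<Sum>j\<in>I. cov h i j)"
    using I by (intro sum.cong refl cov_eq(2)[OF h i]) auto
  finally show "(\<integral>\<omega>. (\<Sum>i\<in>I. h (X i \<omega>) - (\<integral>\<omega>'. h (X i \<omega>') \<partial>M))\<^sup>2 \<partial>M) = (\<Sum>i\<in>I. \<Sum>j\<in>I. cov h i j)" .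
qed

lemma beta_gen_trivial:
  assumes "I = {} \<or> J = {}" "I \<subseteq> {1..k}" "J \<subseteq> {1..k}"
  shows "beta_coeff M (sets (gen I)) (sets (gen J)) = 0"
proof (rule beta_coeff_trivial)
  have "sets (gen {}) \<subseteq> {{}, space M}"
    unfolding sets_gen generated_sigma_def by (simp add: sigma_sets_empty_eq)
  then show "sets (gen I) \<subseteq> {{}, space M} \<or> sets (gen J) \<subseteq> {{}, space M}" using assms(1) by auto
qed (use assms sets_gen_subset in \<open>auto intro: prob_space_axioms\<close>)

text \<open>
  The row is cut into consecutive blocks of length \<open>q\<close>. Among the blocks of even number any two
  neighbours are separated by a whole block, so the mixing coefficient at distance \<open>q\<close> decouples
  them, and likewise for the odd ones; this is the factor \<open>2\<close>. The variances of the block sums add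
  up to at most \<open>Cvar * \<sigma>\<^sup>2\<close> because each covariance of the row is counted at most once.
\<close>

lemma block_maximal_ineq:
  fixes A :: "('x \<Rightarrow> real) set"
  assumes A: "finite A" "A \<noteq> {}" "\<And>h. h \<in> A \<Longrightarrow> h \<in> borel_measurable borel" "\<And>h. h \<in> A \<Longrightarrow> finite (range h)"
    and bd: "\<And>h x. h \<in> A \<Longrightarrow> \<bar>h x\<bar> \<le> B" and mom: "\<And>h. h \<in> A \<Longrightarrow> moment_le h \<sigma>" and s: "0 < \<sigma>"
    and q: "1 \<le> q" "q \<le> k" and th: "0 < \<theta>" "\<theta> * (2 * real q * B / sqrt (real k)) \<le> 1"
  shows "(\<integral>\<omega>. max_emp A \<omega> \<partial>M) \<le>
     2 * (ln (2 * real (card A)) / \<theta> + \<theta> * Cvar * \<sigma>\<^sup>2 + 8 * B * sqrt (real k) * (K * real q powr - \<rho>))"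
proof -
  define blk where "blk b = {i \<in> {1..k}. (i - 1) div q = b}" for b
  define m where "m = k div q + 1"
  define c where "c = 2 * real q * B / sqrt (real k)"
  define U where "U p r h \<omega> = 1 / sqrt (real k) * (\<Sum>i\<in>blk (2 * r + p). h (X i \<omega>) - (\<integral>\<omega>'. h (X i \<omega>') \<partial>M))"
    for p r and h :: "'x \<Rightarrow> real" and \<omega>
  have sk: "0 < sqrt (real k)" using k_pos by simp
  have B0: "0 \<le> B" using A(2) bd abs_ge_zero order_trans by blast
  have c0: "0 \<le> c" using B0 by (simp add: c_def)
  have blk_sub: "blk b \<subseteq> {1..k}" for b by (auto simp: blk_def)
  have blk_bounds: "b * q < i \<and> i \<le> (b + 1) * q" if "i \<in> blk b" for b i
  proof -
    have "b * q \<le> i - 1" "i - 1 < (b + 1) * q" and "1 \<le> i"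
      using that q div_times_less_eq_dividend[of "i - 1" q] dividend_less_div_times[of q "i - 1"]
      by (auto simp: blk_def)
    then show ?thesis by linarith
  qed
  have blk_card: "card (blk b) \<le> q" for b
  proof -
    have "blk b \<subseteq> {b * q <.. (b + 1) * q}" using blk_bounds by auto
    then have "card (blk b) \<le> card {b * q <.. (b + 1) * q}" by (intro card_mono) auto
    then show ?thesis by (simp add: algebra_simps)
  qed
  have all: "(\<Sum>b<2 * m. \<Sum>i\<in>blk b. G i) = (\<Sum>i=1..k. G i)" for G :: "nat \<Rightarrow> real"
  proof -
    have "(\<lambda>i. (i - 1) div q) ` {1..k} \<subseteq> {..<2 * m}"
    proof safe
      fix i assume "i \<in> {1..k}"
      then have "(i - 1) div q \<le> k div q" by (intro div_le_mono) auto
      then show "(i - 1) div q < 2 * m" by (simp add: m_def)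
    qed
    from sum.group[OF _ _ this] show ?thesis by (simp add: blk_def)
  qed
  have inth: "integrable M (\<lambda>\<omega>. h (X i \<omega>))" "integrable M (\<lambda>\<omega>. (h (X i \<omega>))\<^sup>2)" if "h \<in> A" "i \<in> {1..k}" for h i
    using moment_integrable[OF mom A(3)] that by auto
  have mle: "real m \<le> 2 * real k / real q"
  proof -
    have "real (k div q) \<le> real k / real q" by (rule of_nat_div_le_of_nat)
    moreover have "1 \<le> real k / real q" using q by simp
    ultimately show ?thesis by (simp add: m_def)
  qed
  have parity: "(\<integral>\<omega>. Max ((\<lambda>h. \<bar>\<Sum>r<m. U p r h \<omega>\<bar>) ` A) \<partial>M) \<le>
     ln (2 * real (card A)) / \<theta> + \<theta> * (Cvar * \<sigma>\<^sup>2) + 2 * c * real m * (K * real q powr - \<rho>)" if p: "p \<le> 1" for p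
  proof -
    define I where "I r = (if r = 0 then {} else {1..min k ((2 * r + p - 1) * q)})" for r
    define J where "J r = {(2 * r + p) * q + 1..k}" for r
    have IJ: "I r \<subseteq> {1..k}" "J r \<subseteq> {1..k}" for r by (auto simp: I_def J_def)
    have simp1: "simple_function (gen I) (\<lambda>\<omega>. h (X i \<omega>) - (\<integral>\<omega>'. h (X i \<omega>') \<partial>M))" if "i \<in> I" "h \<in> A" for i I h
    proof -
      have "simple_function (gen I) (\<lambda>\<omega>. h (X i \<omega>))"
      proof (rule simple_function_borel_measurable)
        show "(\<lambda>\<omega>. h (X i \<omega>)) \<in> borel_measurable (gen I)"
          using measurable_compose[OF measurable_gen[OF that(1)] A(3)[OF that(2)]] .
        show "finite ((\<lambda>\<omega>. h (X i \<omega>)) ` space (gen I))"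
          by (rule finite_subset[OF _ A(4)[OF that(2)]]) auto
      qed
      then show ?thesis by (rule simple_function_compose1[of _ _ "\<lambda>x. x - _"])
    qed
    have simpU: "simple_function (gen I) (U p r h)" if "blk (2 * r + p) \<subseteq> I" "h \<in> A" for r I h
      unfolding U_def using that
      by (intro simple_function_compose1[of _ _ "\<lambda>x. 1 / sqrt (real k) * x"] simple_function_sum simp1) auto
    show ?thesis
    proof (rule softmax_decoupling[where NA = "\<lambda>r. gen (I r)" and NB = "\<lambda>r. gen (J r)"])
      show "simple_function (gen (I r)) (\<lambda>\<omega>. \<Sum>r'<r. U p r' h \<omega>)" if "r < m" "h \<in> A" for r h
      proof (rule simple_function_sum, rule simpU[OF _ that(2)])
        fix r' assume r': "r' \<in> {..<r}"
        show "blk (2 * r' + p) \<subseteq> I r"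
        proof
          fix i assume i: "i \<in> blk (2 * r' + p)"
          have "i \<le> (2 * r' + p + 1) * q" using blk_bounds[OF i] by simp
          also have "\<dots> \<le> (2 * r + p - 1) * q" using r' by (intro mult_right_mono) auto
          finally show "i \<in> I r" using r' i by (auto simp: I_def blk_def)
        qed
      qed
      show "simple_function (gen (J r)) (U p r h)" if "r < m" "h \<in> A" for r h
      proof (rule simpU[OF _ that(2)])
        show "blk (2 * r + p) \<subseteq> J r" using blk_bounds[of _ "2 * r + p"] blk_sub[of "2 * r + p"] by (auto simp: J_def Suc_le_eq)
      qed
      show "beta_coeff M (sets (gen (I r))) (sets (gen (J r))) \<le> ennreal (K * real q powr - \<rho>)" if "r < m" for r
      proof (cases "I r = {} \<or> J r = {}")
        case True
        then show ?thesis using beta_gen_trivial[OF _ IJ] by simp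
      next
        case False
        define j where "j = (2 * r + p - 1) * q"
        have r0: "r \<noteq> 0" using False by (auto simp: I_def)
        \<comment> \<open>the past ends at \<open>j\<close> and the block starts at \<open>j + (q +
          1)\<close>; for \<open>r = 0\<close> the subtraction in the definition of \<open>j\<close>
          could truncate, which is why that case is separate\<close>
        have lo: "(2 * r + p) * q + 1 = j + (q + 1)"
        proof -
          obtain e where "2 * r + p = Suc e" using r0 by (cases "2 * r + p") auto
          then show ?thesis by (simp add: j_def)
        qed
        have jk: "j + (q + 1) \<le> k" using False lo by (auto simp: J_def)
        have j1: "1 \<le> j" using r0 q by (simp add: j_def)
        have "I r = {1..j}" "J r = {j + (q + 1)..k}" using r0 lo jk by (auto simp: I_def J_def j_def)
        then have "beta_coeff M (sets (gen (I r))) (sets (gen (J r))) \<le> ennreal (K * real (q + 1) powr - \<rho>)"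
          using beta_gen_le[OF j1 _ jk] by simp
        also have "\<dots> \<le> ennreal (K * real q powr - \<rho>)"
          using q rho_pos K_nonneg by (intro ennreal_leI mult_left_mono powr_mono2') auto
        finally show ?thesis .
      qed
      show "\<bar>U p r h \<omega>\<bar> \<le> c" if "r < m" "h \<in> A" "\<omega> \<in> space M" for r h \<omega>
      proof -
        have "\<bar>\<integral>\<omega>'. h (X i \<omega>') \<partial>M\<bar> \<le> B" if i: "i \<in> {1..k}" for i
        proof -
          have "\<bar>\<integral>\<omega>'. h (X i \<omega>') \<partial>M\<bar> \<le> (\<integral>\<omega>'. \<bar>h (X i \<omega>')\<bar> \<partial>M)" by (rule integral_abs_bound)
          also have "\<dots> \<le> (\<integral>\<omega>'. B \<partial>M)" using inth(1)[OF \<open>h \<in> A\<close> i] bd[OF \<open>h \<in> A\<close>] by (intro integral_mono) auto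
          finally show ?thesis by (simp add: prob_space)
        qed
        then have E: "\<bar>\<integral>\<omega>'. h (X i \<omega>') \<partial>M\<bar> \<le> B" if "i \<in> blk (2 * r + p)" for i
          using that blk_sub by blast
        have "\<bar>h (X i \<omega>) - (\<integral>\<omega>'. h (X i \<omega>') \<partial>M)\<bar> \<le> 2 * B" if "i \<in> blk (2 * r + p)" for i
          using bd[OF \<open>h \<in> A\<close>, of "X i \<omega>"] E[OF that] by linarith
        then have "\<bar>\<Sum>i\<in>blk (2 * r + p). h (X i \<omega>) - (\<integral>\<omega>'. h (X i \<omega>') \<partial>M)\<bar> \<le> (\<Sum>i\<in>blk (2 * r + p). 2 * B)"
          by (intro order_trans[OF sum_abs] sum_mono) auto
        also have "\<dots> \<le> real q * (2 * B)" using blk_card[of "2 * r + p"] B0 by (simp add: mult_right_mono)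
        finally show ?thesis using sk by (simp add: U_def c_def abs_mult divide_right_mono)
      qed
      show "(\<integral>\<omega>. U p r h \<omega> \<partial>M) = 0" if "r < m" "h \<in> A" for r h
      proof -
        have ii: "integrable M (\<lambda>\<omega>. h (X i \<omega>))" if "i \<in> blk b" for i b
          using inth(1)[OF \<open>h \<in> A\<close>] that blk_sub by blast
        have "(\<integral>\<omega>. (\<Sum>i\<in>blk (2 * r + p). h (X i \<omega>) - (\<integral>\<omega>'. h (X i \<omega>') \<partial>M)) \<partial>M) =
          (\<Sum>i\<in>blk (2 * r + p). (\<integral>\<omega>. h (X i \<omega>) - (\<integral>\<omega>'. h (X i \<omega>') \<partial>M) \<partial>M))"
          by (intro Bochner_Integration.integral_sum Bochner_Integration.integrable_diff integrable_const ii)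
        also have "\<dots> = 0" using ii by (intro sum.neutral) (simp add: prob_space)
        finally show ?thesis by (simp add: U_def)
      qed
      show "(\<Sum>r<m. \<integral>\<omega>. (U p r h \<omega>)\<^sup>2 \<partial>M) \<le> Cvar * \<sigma>\<^sup>2" if h: "h \<in> A" for h
      proof -
        have "(\<Sum>r<m. \<integral>\<omega>. (U p r h \<omega>)\<^sup>2 \<partial>M) = (\<Sum>r<m. (1 / real k) * (\<Sum>i\<in>blk (2 * r + p). \<Sum>j\<in>blk (2 * r + p). cov h i j))"
        proof (rule sum.cong[OF refl])
          fix r
          show "(\<integral>\<omega>. (U p r h \<omega>)\<^sup>2 \<partial>M) = (1 / real k) * (\<Sum>i\<in>blk (2 * r + p). \<Sum>j\<in>blk (2 * r + p). cov h i j)"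
            using sum_square_cov(2)[OF A(3)[OF h] inth[OF h] blk_sub] by (simp add: U_def power_mult_distrib power_divide)
        qed
        also have "\<dots> = (1 / real k) * (\<Sum>r<m. (\<Sum>i\<in>blk (2 * r + p). \<Sum>j\<in>blk (2 * r + p). cov h i j))"
          by (simp add: sum_distrib_left)
        also have "(\<Sum>r<m. (\<Sum>i\<in>blk (2 * r + p). \<Sum>j\<in>blk (2 * r + p). cov h i j)) \<le> (\<Sum>r<m. (\<Sum>i\<in>blk (2 * r + p). \<Sum>j=1..k. \<bar>cov h i j\<bar>))"
        proof (intro sum_mono)
          fix i b
          have "(\<Sum>j\<in>blk b. cov h i j) \<le> (\<Sum>j\<in>blk b. \<bar>cov h i j\<bar>)" by (intro sum_mono) auto
          also have "\<dots> \<le> (\<Sum>j=1..k. \<bar>cov h i j\<bar>)" using blk_sub by (intro sum_mono2) auto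
          finally show "(\<Sum>j\<in>blk b. cov h i j) \<le> (\<Sum>j=1..k. \<bar>cov h i j\<bar>)" .
        qed
        also have "\<dots> \<le> (\<Sum>b<2 * m. (\<Sum>i\<in>blk b. \<Sum>j=1..k. \<bar>cov h i j\<bar>))"
        proof -
          have nn: "0 \<le> (\<Sum>r<m. \<Sum>i\<in>blk (2 * r + e). \<Sum>j=1..k. \<bar>cov h i j\<bar>)" for e
            by (intro sum_nonneg) auto
          have "p = 0 \<or> p = 1" using p by auto
          then show ?thesis
            unfolding even_odd_split using nn[of 0] nn[of 1] by (elim disjE) (simp_all only: add_0_right)
        qed
        also have "\<dots> = (\<Sum>i=1..k. \<Sum>j=1..k. \<bar>cov h i j\<bar>)" by (rule all)
        also have "\<dots> \<le> Cvar * real k * \<sigma>\<^sup>2" by (rule sum_cov_le[OF mom[OF h] A(3)[OF h] s])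
        finally show ?thesis using k_pos by (simp add: divide_right_mono pos_divide_le_eq mult_ac)
      qed
    qed (use A c0 th K_nonneg IJ sets_gen_subset in \<open>auto simp: c_def\<close>)
  qed
  have split: "emp h \<omega> = (\<Sum>r<m. U 0 r h \<omega>) + (\<Sum>r<m. U 1 r h \<omega>)" for h \<omega>
    unfolding emp_def all[of "\<lambda>i. h (X i \<omega>) - (\<integral>\<omega>'. h (X i \<omega>') \<partial>M)", symmetric] even_odd_split distrib_left
    by (simp only: U_def sum_distrib_left add_0_right)
  have iX: "integrable M (U p r h)" if "h \<in> A" for p r h
  proof -
    have "integrable M (\<lambda>\<omega>. h (X i \<omega>))" if "i \<in> blk b" for i b
      using inth(1)[OF \<open>h \<in> A\<close>] that blk_sub by blast
    then show ?thesis
      unfolding U_def by (intro integrable_mult_right Bochner_Integration.integrable_sum Bochner_Integration.integrable_diff integrable_const)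
  qed
  note imax = integrable_Max_abs[OF A(1,2), of M]
  have iS: "integrable M (\<lambda>\<omega>. \<Sum>r<m. U p r h \<omega>)" if "h \<in> A" for p h
    using iX[OF that] by (intro Bochner_Integration.integrable_sum)
  have "(\<integral>\<omega>. max_emp A \<omega> \<partial>M) \<le>
    (\<integral>\<omega>. Max ((\<lambda>h. \<bar>\<Sum>r<m. U 0 r h \<omega>\<bar>) ` A) + Max ((\<lambda>h. \<bar>\<Sum>r<m. U 1 r h \<omega>\<bar>) ` A) \<partial>M)"
  proof (rule integral_mono)
    show "integrable M (\<lambda>\<omega>. max_emp A \<omega>)"
      unfolding split by (intro imax Bochner_Integration.integrable_add iS)
    show "integrable M (\<lambda>\<omega>. Max ((\<lambda>h. \<bar>\<Sum>r<m. U 0 r h \<omega>\<bar>) ` A) + Max ((\<lambda>h. \<bar>\<Sum>r<m. U 1 r h \<omega>\<bar>) ` A))"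
      by (intro Bochner_Integration.integrable_add imax iS)
    fix \<omega>
    show "max_emp A \<omega> \<le> Max ((\<lambda>h. \<bar>\<Sum>r<m. U 0 r h \<omega>\<bar>) ` A) + Max ((\<lambda>h. \<bar>\<Sum>r<m. U 1 r h \<omega>\<bar>) ` A)"
    proof (subst Max_le_iff, use A in simp, use A in simp, intro ballI, elim imageE)
      fix z h assume z: "z = \<bar>emp h \<omega>\<bar>" and h: "h \<in> A"
      have "z \<le> \<bar>\<Sum>r<m. U 0 r h \<omega>\<bar> + \<bar>\<Sum>r<m. U 1 r h \<omega>\<bar>" unfolding z split by (rule abs_triangle_ineq)
      also have "\<dots> \<le> Max ((\<lambda>h. \<bar>\<Sum>r<m. U 0 r h \<omega>\<bar>) ` A) + Max ((\<lambda>h. \<bar>\<Sum>r<m. U 1 r h \<omega>\<bar>) ` A)"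
        using h A by (intro add_mono Max_ge) auto
      finally show "z \<le> Max ((\<lambda>h. \<bar>\<Sum>r<m. U 0 r h \<omega>\<bar>) ` A) + Max ((\<lambda>h. \<bar>\<Sum>r<m. U 1 r h \<omega>\<bar>) ` A)" .
    qed
  qed
  also have "\<dots> = (\<integral>\<omega>. Max ((\<lambda>h. \<bar>\<Sum>r<m. U 0 r h \<omega>\<bar>) ` A) \<partial>M) + (\<integral>\<omega>. Max ((\<lambda>h. \<bar>\<Sum>r<m. U 1 r h \<omega>\<bar>) ` A) \<partial>M)"
    by (intro Bochner_Integration.integral_add imax iS)
  also have "\<dots> \<le> 2 * (ln (2 * real (card A)) / \<theta> + \<theta> * (Cvar * \<sigma>\<^sup>2) + 2 * c * real m * (K * real q powr - \<rho>))"
    using parity[of 0] parity[of 1] by simp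
  also have "\<dots> \<le> 2 * (ln (2 * real (card A)) / \<theta> + \<theta> * Cvar * \<sigma>\<^sup>2 + 8 * B * sqrt (real k) * (K * real q powr - \<rho>))"
  proof -
    have "2 * c * real m \<le> 2 * c * (2 * real k / real q)" using mle c0 by (intro mult_left_mono) auto
    also have "\<dots> = 8 * B * (real k / sqrt (real k))" using q by (simp add: c_def field_simps)
    also have "real k / sqrt (real k) = sqrt (real k)" by (simp add: real_div_sqrt)
    finally have "2 * c * real m * (K * real q powr - \<rho>) \<le> 8 * B * sqrt (real k) * (K * real q powr - \<rho>)"
      using K_nonneg by (intro mult_right_mono) auto
    then show ?thesis by simp
  qed
  finally show ?thesis .
qed

end

text \<open>
  Decoupling needs functions of finite range. Rounding toward zero, rather than down, cannot
  increase absolute values, so bounds and moments are inherited.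
\<close>

definition round_toward_zero :: "real \<Rightarrow> real \<Rightarrow> real" where
  "round_toward_zero \<epsilon> x = sgn x * (\<epsilon> * of_int \<lfloor>\<bar>x\<bar> / \<epsilon>\<rfloor>)"

lemma round_toward_zero_measurable [measurable]:
  "round_toward_zero \<epsilon> \<in> borel_measurable borel"
  unfolding round_toward_zero_def[abs_def] by measurable

lemma round_toward_zero_bounds:
  assumes "0 < \<epsilon>"
  shows "\<bar>round_toward_zero \<epsilon> x\<bar> \<le> \<bar>x\<bar>" and "\<bar>x - round_toward_zero \<epsilon> x\<bar> \<le> \<epsilon>"
proof -
  define y where "y = \<epsilon> * of_int \<lfloor>\<bar>x\<bar> / \<epsilon>\<rfloor>"
  have f: "of_int \<lfloor>\<bar>x\<bar> / \<epsilon>\<rfloor> \<le> \<bar>x\<bar> / \<epsilon>" "\<bar>x\<bar> / \<epsilon> < of_int \<lfloor>\<bar>x\<bar> / \<epsilon>\<rfloor> + 1" by linarith+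
  have "y \<le> \<epsilon> * (\<bar>x\<bar> / \<epsilon>)" unfolding y_def using f(1) assms by (intro mult_left_mono) auto
  then have 1: "y \<le> \<bar>x\<bar>" using assms by simp
  have "\<epsilon> * (\<bar>x\<bar> / \<epsilon>) \<le> \<epsilon> * (of_int \<lfloor>\<bar>x\<bar> / \<epsilon>\<rfloor> + 1)" using f(2) assms by (intro mult_left_mono) auto
  then have 2: "\<bar>x\<bar> \<le> y + \<epsilon>" using assms by (simp add: y_def distrib_left)
  have 0: "0 \<le> y" using assms by (simp add: y_def)
  show "\<bar>round_toward_zero \<epsilon> x\<bar> \<le> \<bar>x\<bar>"
    using 0 1 by (auto simp: round_toward_zero_def y_def[symmetric] abs_mult sgn_if)
  show "\<bar>x - round_toward_zero \<epsilon> x\<bar> \<le> \<epsilon>"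
    using 0 1 2 assms by (auto simp: round_toward_zero_def y_def[symmetric] sgn_if split: if_splits)
qed

lemma finite_range_round_toward_zero:
  assumes "0 < \<epsilon>" "\<And>x. \<bar>h x\<bar> \<le> B"
  shows "finite (range (\<lambda>x. round_toward_zero \<epsilon> (h x)))"
proof (rule finite_subset)
  show "range (\<lambda>x. round_toward_zero \<epsilon> (h x)) \<subseteq>
    (\<lambda>(s, n). s * (\<epsilon> * of_int n)) ` ({-1, 0, 1} \<times> {0..\<lfloor>B / \<epsilon>\<rfloor>})"
  proof safe
    fix x
    have "\<bar>h x\<bar> / \<epsilon> \<le> B / \<epsilon>" using assms by (intro divide_right_mono) auto
    then have "\<lfloor>\<bar>h x\<bar> / \<epsilon>\<rfloor> \<in> {0..\<lfloor>B / \<epsilon>\<rfloor>}" using assms(1) by (auto intro: floor_mono)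
    moreover have "sgn (h x) \<in> {-1, 0, 1}" by (auto simp: sgn_if)
    ultimately show "round_toward_zero \<epsilon> (h x) \<in> (\<lambda>(s, n). s * (\<epsilon> * of_int n)) ` ({-1, 0, 1} \<times> {0..\<lfloor>B / \<epsilon>\<rfloor>})"
      by (intro image_eqI[of _ _ "(sgn (h x), \<lfloor>\<bar>h x\<bar> / \<epsilon>\<rfloor>)"]) (auto simp: round_toward_zero_def)
  qed
qed auto

context mixing_row
begin

lemma emp_measurable:
  assumes "h \<in> borel_measurable borel"
  shows "emp h \<in> borel_measurable M"
proof -
  have "(\<lambda>\<omega>. h (X i \<omega>)) \<in> borel_measurable M" if "i \<in> {1..k}" for i
    using measurable_compose[OF X_measurable assms] that by blast
  then show ?thesis
    unfolding emp_def[abs_def]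
    by (intro borel_measurable_times borel_measurable_sum borel_measurable_diff borel_measurable_const)
qed

lemma emp_integrable:
  assumes "\<And>i. i \<in> {1..k} \<Longrightarrow> integrable M (\<lambda>\<omega>. h (X i \<omega>))"
  shows "integrable M (emp h)"
  unfolding emp_def[abs_def]
  by (intro integrable_mult_right Bochner_Integration.integrable_sum Bochner_Integration.integrable_diff integrable_const assms)

lemma emp_add:
  assumes "\<And>i. i \<in> {1..k} \<Longrightarrow> integrable M (\<lambda>\<omega>. g (X i \<omega>))" "\<And>i. i \<in> {1..k} \<Longrightarrow> integrable M (\<lambda>\<omega>. h (X i \<omega>))"
  shows "emp (\<lambda>x. g x + h x) \<omega> = emp g \<omega> + emp h \<omega>"
proof -
  have "(\<Sum>i=1..k. g (X i \<omega>) + h (X i \<omega>) - (\<integral>\<omega>'. g (X i \<omega>') + h (X i \<omega>') \<partial>M)) =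
    (\<Sum>i=1..k. (g (X i \<omega>) - (\<integral>\<omega>'. g (X i \<omega>') \<partial>M)) + (h (X i \<omega>) - (\<integral>\<omega>'. h (X i \<omega>') \<partial>M)))"
    using assms by (intro sum.cong) auto
  then show ?thesis unfolding emp_def sum.distrib by (simp add: distrib_left)
qed

lemma emp_diff:
  assumes "\<And>i. i \<in> {1..k} \<Longrightarrow> integrable M (\<lambda>\<omega>. g (X i \<omega>))" "\<And>i. i \<in> {1..k} \<Longrightarrow> integrable M (\<lambda>\<omega>. h (X i \<omega>))"
  shows "emp (\<lambda>x. g x - h x) \<omega> = emp g \<omega> - emp h \<omega>"
proof -
  have *: "(\<Sum>i=1..k. g (X i \<omega>) - h (X i \<omega>) - (\<integral>\<omega>'. g (X i \<omega>') - h (X i \<omega>') \<partial>M)) =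
    (\<Sum>i=1..k. (g (X i \<omega>) - (\<integral>\<omega>'. g (X i \<omega>') \<partial>M)) - (h (X i \<omega>) - (\<integral>\<omega>'. h (X i \<omega>') \<partial>M)))"
    using assms by (intro sum.cong) auto
  show ?thesis unfolding emp_def * right_diff_distrib[symmetric] sum_subtractf[symmetric] ..
qed

text \<open>
  A Bernstein-type bound: the first term is the Gaussian behaviour, the second the cost of
  decoupling. The condition \<open>bal\<close> is the one under which the bound on a block sum is small enough
  for the subgaussian regime at the log-cardinality \<open>L\<close>.
\<close>

lemma finite_class_maximal_ineq:
  fixes A :: "('x \<Rightarrow> real) set"
  assumes A: "finite A" "A \<noteq> {}" "\<And>h. h \<in> A \<Longrightarrow> h \<in> borel_measurable borel"
    and bd: "\<And>h x. h \<in> A \<Longrightarrow> \<bar>h x\<bar> \<le> B" and mom: "\<And>h. h \<in> A \<Longrightarrow> moment_le h \<sigma>" and s: "0 < \<sigma>"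
    and q: "1 \<le> q" "q \<le> k" and L: "ln (2 * real (card A)) \<le> L" "0 < L"
    and bal: "real q * B * sqrt L \<le> sqrt (real k) * \<sigma>"
  shows "(\<integral>\<omega>. max_emp A \<omega> \<partial>M) \<le>
     (4 + Cvar) * \<sigma> * sqrt L + 16 * sqrt (real k) * B * (K * real q powr - \<rho>)"
proof (rule field_le_epsilon)
  fix e :: real assume e: "0 < e"
  define \<epsilon> where "\<epsilon> = e / (2 * sqrt (real k))"
  have sk: "0 < sqrt (real k)" using k_pos by simp
  have eps: "0 < \<epsilon>" using e sk by (simp add: \<epsilon>_def)
  define R where "R h = (\<lambda>x. round_toward_zero \<epsilon> (h x))" for h :: "'x \<Rightarrow> real"
  \<comment> \<open>balances \<open>L / \<theta>\<close> against \<open>\<theta> *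
    \<sigma>\<^sup>2\<close>\<close>
  define \<theta> where "\<theta> = sqrt L / (2 * \<sigma>)"
  have th: "0 < \<theta>" using L s by (simp add: \<theta>_def)
  have Rm: "R h \<in> borel_measurable borel" if "h \<in> A" for h
    unfolding R_def using A(3)[OF that] by measurable
  have RA: "finite (R ` A)" "R ` A \<noteq> {}" using A by auto
  have card: "card (R ` A) \<le> card A" "0 < card (R ` A)" using A by (auto intro: card_image_le simp: card_gt_0_iff)
  have intA: "integrable M (\<lambda>\<omega>. h (X i \<omega>))" if "h \<in> A" "i \<in> {1..k}" for h i
    using moment_integrable(1)[OF mom A(3)] that by auto
  have momR: "moment_le (R h) \<sigma>" if "h \<in> A" for h
    using moment_le_mono[OF mom[OF that], of "R h" \<sigma>] s round_toward_zero_bounds(1)[OF eps] by (auto simp: R_def)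
  have intR: "integrable M (\<lambda>\<omega>. R h (X i \<omega>))" if "h \<in> A" "i \<in> {1..k}" for h i
    using moment_integrable(1)[OF momR Rm] that by auto
  have main: "(\<integral>\<omega>. max_emp (R ` A) \<omega> \<partial>M) \<le>
     2 * (ln (2 * real (card (R ` A))) / \<theta> + \<theta> * Cvar * \<sigma>\<^sup>2 + 8 * B * sqrt (real k) * (K * real q powr - \<rho>))"
  proof (rule block_maximal_ineq[OF RA])
    show "h \<in> borel_measurable borel" "finite (range h)" "moment_le h \<sigma>" if "h \<in> R ` A" for h
      using that Rm momR finite_range_round_toward_zero[OF eps bd] by (auto simp: R_def)
    show "\<bar>h x\<bar> \<le> B" if "h \<in> R ` A" for h x
      using that bd round_toward_zero_bounds(1)[OF eps] by (fastforce simp: R_def intro: order_trans)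
    have "\<theta> * (2 * real q * B / sqrt (real k)) = (real q * B * sqrt L) / (sqrt (real k) * \<sigma>)"
      using s sk by (simp add: \<theta>_def field_simps)
    also have "\<dots> \<le> 1" using bal sk s by (simp add: divide_le_eq)
    finally show "\<theta> * (2 * real q * B / sqrt (real k)) \<le> 1" .
  qed (use s q th in auto)
  have "ln (2 * real (card (R ` A))) \<le> L" using card L(1) by (intro order_trans[OF _ L(1)]) (subst ln_le_cancel_iff; simp)
  then have "ln (2 * real (card (R ` A))) / \<theta> \<le> L / \<theta>" using th by (intro divide_right_mono) auto
  also have "L / \<theta> = 2 * \<sigma> * sqrt L" using L s by (simp add: \<theta>_def field_simps)
  finally have 1: "2 * (ln (2 * real (card (R ` A))) / \<theta>) \<le> 4 * \<sigma> * sqrt L" by simp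
  have 2: "2 * (\<theta> * Cvar * \<sigma>\<^sup>2) = Cvar * \<sigma> * sqrt L" using s by (simp add: \<theta>_def power2_eq_square)
  have close: "\<bar>emp h \<omega>\<bar> \<le> \<bar>emp (R h) \<omega>\<bar> + e" if h: "h \<in> A" for h \<omega>
  proof -
    have E: "\<bar>\<integral>\<omega>'. h (X i \<omega>') - R h (X i \<omega>') \<partial>M\<bar> \<le> \<epsilon>" if i: "i \<in> {1..k}" for i
    proof -
      have "\<bar>\<integral>\<omega>'. h (X i \<omega>') - R h (X i \<omega>') \<partial>M\<bar> \<le> (\<integral>\<omega>'. \<bar>h (X i \<omega>') - R h (X i \<omega>')\<bar> \<partial>M)" by (rule integral_abs_bound)
      also have "\<dots> \<le> (\<integral>\<omega>'. \<epsilon> \<partial>M)"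
        using round_toward_zero_bounds(2)[OF eps] intA[OF h i] intR[OF h i]
        by (intro integral_mono integrable_abs Bochner_Integration.integrable_diff integrable_const) (auto simp: R_def)
      finally show ?thesis by (simp add: prob_space)
    qed
    have "\<bar>(h (X i \<omega>) - R h (X i \<omega>)) - (\<integral>\<omega>'. h (X i \<omega>') - R h (X i \<omega>') \<partial>M)\<bar> \<le> 2 * \<epsilon>" if i: "i \<in> {1..k}" for i
      using E[OF i] round_toward_zero_bounds(2)[OF eps, of "h (X i \<omega>)"] unfolding R_def by linarith
    then have "\<bar>\<Sum>i=1..k. (h (X i \<omega>) - R h (X i \<omega>)) - (\<integral>\<omega>'. h (X i \<omega>') - R h (X i \<omega>') \<partial>M)\<bar> \<le> (\<Sum>i=1..k. 2 * \<epsilon>)"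
      by (intro order_trans[OF sum_abs] sum_mono) auto
    also have "(\<Sum>i=1..k. 2 * \<epsilon>) = sqrt (real k) * e"
      using sk by (simp add: \<epsilon>_def field_simps)
    finally have "\<bar>emp (\<lambda>x. h x - R h x) \<omega>\<bar> \<le> e"
      unfolding emp_def using sk by (simp add: abs_mult divide_le_eq mult.commute)
    moreover have "emp (\<lambda>x. h x - R h x) \<omega> = emp h \<omega> - emp (R h) \<omega>"
      by (rule emp_diff) (use intA[OF h] intR[OF h] in auto)
    ultimately show ?thesis by linarith
  qed
  have "(\<integral>\<omega>. max_emp A \<omega> \<partial>M) \<le> (\<integral>\<omega>. max_emp (R ` A) \<omega> + e \<partial>M)"
  proof (rule integral_mono)
    show "integrable M (\<lambda>\<omega>. max_emp A \<omega>)"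
      by (intro integrable_Max_abs A emp_integrable intA)
    show "integrable M (\<lambda>\<omega>. max_emp (R ` A) \<omega> + e)"
      using intR by (intro Bochner_Integration.integrable_add integrable_const integrable_Max_abs RA emp_integrable) auto
    fix \<omega>
    show "max_emp A \<omega> \<le> max_emp (R ` A) \<omega> + e"
    proof (subst Max_le_iff, use A in simp, use A in simp, intro ballI, elim imageE)
      fix z h assume z: "z = \<bar>emp h \<omega>\<bar>" and h: "h \<in> A"
      have "\<bar>emp (R h) \<omega>\<bar> \<le> max_emp (R ` A) \<omega>" using h A(1) by (intro Max_ge) auto
      then show "z \<le> max_emp (R ` A) \<omega> + e" using close[OF h, of \<omega>] z by linarith
    qed
  qed
  also have "\<dots> = (\<integral>\<omega>. max_emp (R ` A) \<omega> \<partial>M) + e"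
    using intR by (subst Bochner_Integration.integral_add)
      (auto intro!: integrable_Max_abs RA emp_integrable simp: prob_space)
  moreover have "(4 + Cvar) * \<sigma> * sqrt L = 4 * \<sigma> * sqrt L + Cvar * \<sigma> * sqrt L"
    by (simp add: algebra_simps)
  moreover have "2 * (8 * B * sqrt (real k) * (K * real q powr - \<rho>)) = 16 * sqrt (real k) * B * (K * real q powr - \<rho>)"
    by simp
  ultimately show "(\<integral>\<omega>. max_emp A \<omega> \<partial>M) \<le>
     (4 + Cvar) * \<sigma> * sqrt L + 16 * sqrt (real k) * B * (K * real q powr - \<rho>) + e"
    using main 1 2 unfolding distrib_left by linarith
qed

end

section \<open>Chaining with adaptive truncation\<close>

text \<open>
  Functions attached to a chain depend on all cells up to a level, so they are counted by the
  product of the numbers of cells.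
\<close>

lemma card_range_le_prod:
  fixes h :: "'t \<Rightarrow> 'b" and c :: "nat \<Rightarrow> 't \<Rightarrow> nat"
  assumes det: "\<And>s t. (\<And>i. i \<le> j \<Longrightarrow> c i s = c i t) \<Longrightarrow> h s = h t" and c: "\<And>i t. c i t < \<nu> i"
  shows "finite (range h)" and "card (range h) \<le> (\<Prod>i\<le>j. \<nu> i)"
proof -
  define g where "g t = restrict (\<lambda>i. c i t) {..j}" for t
  have fac: "h t = h (inv g (g t))" for t
  proof (rule det)
    fix i assume i: "i \<le> j"
    have "g (inv g (g t)) = g t" by (rule f_inv_into_f) simp
    then have "g (inv g (g t)) i = g t i" by simp
    then show "c i t = c i (inv g (g t))" using i by (simp add: g_def)
  qed
  have sub: "range g \<subseteq> PiE {..j} (\<lambda>i. {..<\<nu> i})" using c by (intro image_subsetI) (simp add: g_def)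
  have fin: "finite (PiE {..j} (\<lambda>i. {..<\<nu> i}))" by (intro finite_PiE) auto
  have finr: "finite (range g)" using sub fin by (rule finite_subset)
  have r: "range h = (\<lambda>p. h (inv g p)) ` range g" using fac by (auto simp: image_image)
  show "finite (range h)" unfolding r using finr by simp
  have "card (range h) \<le> card (range g)" unfolding r using finr by (rule card_image_le)
  also have "\<dots> \<le> card (PiE {..j} (\<lambda>i. {..<\<nu> i}))" using sub fin by (intro card_mono)
  also have "\<dots> = (\<Prod>i\<le>j. \<nu> i)" by (simp add: card_PiE)
  finally show "card (range h) \<le> (\<Prod>i\<le>j. \<nu> i)" .
qed

text \<open>
  Summation by parts: a chain sees the accumulated entropy of all coarser levels, and the
  geometric weights make this no worse than twice the entropy sum itself.
\<close>

lemma geometric_double_sum: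
  fixes s :: "nat \<Rightarrow> real"
  shows "(\<Sum>j\<le>J. \<delta> / 2 ^ j * (\<Sum>i\<le>j. s i)) + \<delta> / 2 ^ J * (\<Sum>i\<le>J. s i) = 2 * (\<Sum>i\<le>J. \<delta> / 2 ^ i * s i)"
proof (induction J)
  case (Suc J)
  define c where "c = \<delta> / 2 ^ J"
  have e: "\<delta> / 2 ^ Suc J = c / 2" by (simp add: c_def)
  show ?case using Suc unfolding sum.atMost_Suc e c_def[symmetric] by (simp add: algebra_simps)
qed simp

text \<open>
  The mean of what lies above the truncation level \<open>a\<close>, after multiplication by \<open>sqrt k\<close>, is at
  most the left-hand side; the right-hand side compares it with the chaining increment \<open>\<delta> * sqrt
  L\<close>.
\<close>

lemma truncation_mean_bound:
  fixes \<delta> L q a \<gamma> \<rho> k :: real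
  assumes "0 < \<delta>" "1 \<le> L" "L \<le> k" "0 < q" "q \<le> 2 * (k / L) powr (1 / (1 + \<rho>))" "2 < \<gamma>" "0 < \<rho>"
    and a: "a = sqrt k * \<delta> / (q * sqrt L)"
  shows "sqrt k * \<delta> powr \<gamma> * a powr (1 - \<gamma>) \<le>
    2 powr (\<gamma> - 1) * \<delta> * sqrt L * (k / L) powr - ((\<gamma> - 2) / 2 - (\<gamma> - 1) / (1 + \<rho>))"
proof -
  define y where "y = k / L"
  have y: "1 \<le> y" using assms by (simp add: y_def)
  have k: "k = L * y" using assms by (simp add: y_def)
  have a': "a = \<delta> * (sqrt y / q)" unfolding a k using assms y by (simp add: real_sqrt_mult)
  have sy: "sqrt y = y powr (1/2)" using y by (simp add: powr_half_sqrt)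
  have "sqrt k * \<delta> powr \<gamma> * a powr (1 - \<gamma>) = sqrt L * sqrt y * (\<delta> powr \<gamma> * \<delta> powr (1 - \<gamma>)) * (sqrt y / q) powr (1 - \<gamma>)"
    unfolding a' k using assms y by (subst powr_mult) (auto simp: real_sqrt_mult)
  also have "\<delta> powr \<gamma> * \<delta> powr (1 - \<gamma>) = \<delta>" using assms by (simp flip: powr_add)
  also have "(sqrt y / q) powr (1 - \<gamma>) = (sqrt y) powr (1 - \<gamma>) * q powr (\<gamma> - 1)"
    using assms y by (simp add: powr_divide powr_minus_divide[of q "1 - \<gamma>"] powr_diff field_simps)
  also have "(sqrt y) powr (1 - \<gamma>) = y powr ((1 - \<gamma>) / 2)" using y by (simp add: sy powr_powr)
  also have "sqrt L * sqrt y * \<delta> * (y powr ((1 - \<gamma>) / 2) * q powr (\<gamma> - 1)) =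
    \<delta> * sqrt L * (y powr (1/2 + (1 - \<gamma>) / 2)) * q powr (\<gamma> - 1)"
    unfolding powr_add sy by simp
  also have "\<dots> \<le> \<delta> * sqrt L * (y powr (1/2 + (1 - \<gamma>) / 2)) * (2 * y powr (1 / (1 + \<rho>))) powr (\<gamma> - 1)"
    using assms by (intro mult_left_mono powr_mono2) (auto simp: y_def)
  also have "(2 * y powr (1 / (1 + \<rho>))) powr (\<gamma> - 1) = 2 powr (\<gamma> - 1) * y powr ((\<gamma> - 1) / (1 + \<rho>))"
    using y by (simp add: powr_mult powr_powr)
  also have "\<delta> * sqrt L * (y powr (1/2 + (1 - \<gamma>) / 2)) * (2 powr (\<gamma> - 1) * y powr ((\<gamma> - 1) / (1 + \<rho>))) =
    2 powr (\<gamma> - 1) * \<delta> * sqrt L * (y powr (1/2 + (1 - \<gamma>) / 2 + (\<gamma> - 1) / (1 + \<rho>)))"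
    by (simp add: powr_add)
  also have "1/2 + (1 - \<gamma>) / 2 + (\<gamma> - 1) / (1 + \<rho>) = - ((\<gamma> - 2) / 2 - (\<gamma> - 1) / (1 + \<rho>))"
    by (simp add: field_simps)
  finally show ?thesis by (simp add: y_def)
qed

context mixing_row
begin

definition kappa :: real where "kappa = (\<gamma> - 2) / 2 - (\<gamma> - 1) / (1 + \<rho>)"

text \<open>
  The inequality \<open>(\<gamma> - 1) / (1 + \<rho>) < (\<gamma> - 2) / 2\<close> is equivalent to \<open>\<gamma> / (\<gamma> - 2) < \<rho>\<close>.
\<close>

lemma kappa_pos: "0 < kappa"
proof -
  have "\<gamma> < \<rho> * (\<gamma> - 2)" using rho gamma by (simp add: divide_less_eq)
  then have "2 * (\<gamma> - 1) < (1 + \<rho>) * (\<gamma> - 2)" by (simp add: algebra_simps)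
  then have "(\<gamma> - 1) / (1 + \<rho>) < (\<gamma> - 2) / 2" using rho_pos by (simp add: divide_less_eq less_divide_eq mult.commute)
  then show ?thesis by (simp add: kappa_def)
qed

definition Cerr :: real where "Cerr = 4 + Cvar + 16 * K"

lemma Cerr_nonneg: "0 \<le> Cerr" using Cvar_nonneg K_nonneg by (simp add: Cerr_def)

text \<open>
  The block length \<open>q\<close> is the least for which the decoupling cost \<open>sqrt k * a * q powr - \<rho>\<close> is at
  most \<open>\<delta> * sqrt L\<close> when \<open>a\<close> is as large as the Bernstein condition permits: inserting \<open>a\<close> turns
  the requirement into \<open>k \<le> L * q powr (1 + \<rho>)\<close>.
\<close>

lemma level_block_length:
  assumes "1 \<le> L" "L \<le> real k" "0 < \<delta>"
  defines "q \<equiv> nat \<lceil>(real k / L) powr (1 / (1 + \<rho>))\<rceil>"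
  defines "a \<equiv> sqrt (real k) * \<delta> / (real q * sqrt L)"
  shows "1 \<le> q" "q \<le> k" "real q \<le> 2 * (real k / L) powr (1 / (1 + \<rho>))" "0 < a"
    "real q * a * sqrt L = sqrt (real k) * \<delta>"
    "sqrt (real k) * a * real q powr - \<rho> \<le> \<delta> * sqrt L"
proof -
  define y where "y = real k / L"
  define z where "z = y powr (1 / (1 + \<rho>))"
  have y: "1 \<le> y" using assms by (simp add: y_def)
  have yk: "y \<le> real k" using assms by (simp add: y_def divide_le_eq mult_le_cancel_left1)
  have z1: "1 \<le> z" unfolding z_def using y rho_pos by (intro ge_one_powr_ge_zero) auto
  have "z \<le> y powr 1" unfolding z_def using y rho_pos by (intro powr_mono) (auto simp: divide_le_eq)
  then have zk: "z \<le> real k" using y yk by simp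
  have q: "q = nat \<lceil>z\<rceil>" by (simp add: q_def z_def y_def)
  have qz: "z \<le> real q" "real q < z + 1" using z1 by (auto simp: q) linarith+
  show q1: "1 \<le> q" using z1 qz by linarith
  show "q \<le> k" unfolding q using zk by (simp add: ceiling_le_iff nat_le_iff)
  show "real q \<le> 2 * (real k / L) powr (1 / (1 + \<rho>))" using qz z1 by (simp add: z_def y_def)
  show a0: "0 < a" unfolding a_def using assms(1-3) q1 k_pos by (intro divide_pos_pos mult_pos_pos) auto
  show bal: "real q * a * sqrt L = sqrt (real k) * \<delta>" unfolding a_def using assms(1) q1 by simp
  have "y = z powr (1 + \<rho>)" unfolding z_def using y rho_pos by (simp add: powr_powr)
  also have "\<dots> \<le> real q powr (1 + \<rho>)" using qz z1 rho_pos by (intro powr_mono2) auto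
  finally have "real k \<le> L * real q powr (1 + \<rho>)" using assms(1) by (simp add: y_def divide_le_eq mult.commute)
  then have "real k / (real q powr (1 + \<rho>)) \<le> L" using q1 by (simp add: divide_le_eq)
  then have "\<delta> * (real k / (real q powr (1 + \<rho>))) / sqrt L \<le> \<delta> * L / sqrt L"
    using assms by (intro divide_right_mono mult_left_mono) auto
  also have "\<delta> * L / sqrt L = \<delta> * (L / sqrt L)" by simp
  also have "L / sqrt L = sqrt L" using assms(1) by (intro real_div_sqrt) simp
  also have "\<delta> * (real k / (real q powr (1 + \<rho>))) / sqrt L = sqrt (real k) * a * real q powr - \<rho>"
    unfolding a_def using q1 assms(1) by (simp add: powr_add powr_minus field_simps)
  finally show "sqrt (real k) * a * real q powr - \<rho> \<le> \<delta> * sqrt L" .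
qed

text \<open>
  With the choices of \<open>level_block_length\<close> the finite-class inequality takes the form that holds
  for independent variables.
\<close>

lemma level_maximal_ineq:
  fixes A :: "('x \<Rightarrow> real) set"
  assumes L: "1 \<le> L" "L \<le> real k" "0 < \<delta>"
  defines "q \<equiv> nat \<lceil>(real k / L) powr (1 / (1 + \<rho>))\<rceil>"
  defines "a \<equiv> sqrt (real k) * \<delta> / (real q * sqrt L)"
  assumes A: "finite A" "A \<noteq> {}" "\<And>h. h \<in> A \<Longrightarrow> h \<in> borel_measurable borel"
    and bd: "\<And>h x. h \<in> A \<Longrightarrow> \<bar>h x\<bar> \<le> a" and mom: "\<And>h. h \<in> A \<Longrightarrow> moment_le h \<delta>"
    and card: "ln (2 * real (card A)) \<le> L"
  shows "(\<integral>\<omega>. max_emp A \<omega> \<partial>M) \<le> Cerr * (\<delta> * sqrt L)"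
proof -
  note lev = level_block_length[OF L, folded q_def, folded a_def]
  have "(\<integral>\<omega>. max_emp A \<omega> \<partial>M) \<le>
     (4 + Cvar) * \<delta> * sqrt L + 16 * sqrt (real k) * a * (K * real q powr - \<rho>)"
    by (rule finite_class_maximal_ineq) (use A bd mom card lev L in auto)
  also have "16 * sqrt (real k) * a * (K * real q powr - \<rho>) = 16 * K * (sqrt (real k) * a * real q powr - \<rho>)" by simp
  also have "\<dots> \<le> 16 * K * (\<delta> * sqrt L)" using lev(6) K_nonneg by (intro mult_left_mono) auto
  also have "(4 + Cvar) * \<delta> * sqrt L + 16 * K * (\<delta> * sqrt L) = Cerr * (\<delta> * sqrt L)"
    by (simp add: Cerr_def algebra_simps)
  finally show ?thesis by simp
qed

text \<open>
  A remainder \<open>g\<close> that ranges over an infinite class is compared with one of finitely many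
  functions \<open>v\<close> dominating it. The price is the mean of \<open>v\<close>, which is why \<open>v\<close> has to be supported
  where the bracket is wide.
\<close>

lemma emp_dominated:
  assumes g: "\<And>x. 0 \<le> g x" "\<And>x. g x \<le> v x"
    and i: "\<And>i. i \<in> {1..k} \<Longrightarrow> integrable M (\<lambda>\<omega>. g (X i \<omega>))" "\<And>i. i \<in> {1..k} \<Longrightarrow> integrable M (\<lambda>\<omega>. v (X i \<omega>))"
  shows "\<bar>emp g \<omega>\<bar> \<le> \<bar>emp v \<omega>\<bar> + 1 / sqrt (real k) * (\<Sum>i=1..k. \<integral>\<omega>. v (X i \<omega>) \<partial>M)"
    and "\<bar>emp g \<omega>\<bar> \<le> 1 / sqrt (real k) * (\<Sum>i=1..k. v (X i \<omega>) + (\<integral>\<omega>. v (X i \<omega>) \<partial>M))"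
proof -
  define m where "m = 1 / sqrt (real k) * (\<Sum>i=1..k. \<integral>\<omega>. v (X i \<omega>) \<partial>M)"
  define n where "n = 1 / sqrt (real k) * (\<Sum>i=1..k. v (X i \<omega>))"
  have v0: "0 \<le> v x" for x using g order_trans by blast
  have Eg: "0 \<le> (\<integral>\<omega>. g (X i \<omega>) \<partial>M)" for i using g by simp
  have Egv: "(\<integral>\<omega>. g (X i \<omega>) \<partial>M) \<le> (\<integral>\<omega>. v (X i \<omega>) \<partial>M)" if "i \<in> {1..k}" for i
    using i[OF that] g by (intro integral_mono) auto
  have n0: "0 \<le> n" unfolding n_def using v0 by (intro mult_nonneg_nonneg sum_nonneg) auto
  have m0: "0 \<le> m" unfolding m_def using v0 by (intro mult_nonneg_nonneg sum_nonneg) auto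
  have "emp g \<omega> \<le> n"
    unfolding emp_def n_def using g Eg by (intro mult_left_mono sum_mono) (auto intro: order_trans[OF _ g(2)] simp: add_increasing2 diff_le_eq)
  moreover have "- m \<le> emp g \<omega>"
  proof -
    have "- m = 1 / sqrt (real k) * (\<Sum>i=1..k. 0 - (\<integral>\<omega>. v (X i \<omega>) \<partial>M))" by (simp add: m_def sum_negf)
    also have "\<dots> \<le> emp g \<omega>" unfolding emp_def using g Egv by (intro mult_left_mono sum_mono diff_mono) auto
    finally show ?thesis .
  qed
  moreover have "n = emp v \<omega> + m"
    by (simp add: emp_def n_def m_def sum_subtractf right_diff_distrib)
  moreover have "1 / sqrt (real k) * (\<Sum>i=1..k. v (X i \<omega>) + (\<integral>\<omega>. v (X i \<omega>) \<partial>M)) = n + m"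
    by (simp add: n_def m_def sum.distrib distrib_left)
  ultimately show "\<bar>emp g \<omega>\<bar> \<le> \<bar>emp v \<omega>\<bar> + 1 / sqrt (real k) * (\<Sum>i=1..k. \<integral>\<omega>. v (X i \<omega>) \<partial>M)"
    and "\<bar>emp g \<omega>\<bar> \<le> 1 / sqrt (real k) * (\<Sum>i=1..k. v (X i \<omega>) + (\<integral>\<omega>. v (X i \<omega>) \<partial>M))"
    using n0 m0 unfolding m_def[symmetric] by linarith+
qed

text \<open>
  On the set where \<open>D\<close> exceeds \<open>a\<close>, the inequality \<open>D \<le> a powr (1 - \<gamma>) * D powr \<gamma>\<close> holds.
\<close>

lemma truncated_mean_le:
  assumes D: "moment_le D \<delta>" "D \<in> borel_measurable borel" "\<And>x. 0 \<le> D x" and v: "v \<in> borel_measurable borel"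
    and a: "0 < a" and le: "\<And>x. v x \<le> (if a < D x then D x else 0)" "\<And>x. 0 \<le> v x"
  shows "1 / sqrt (real k) * (\<Sum>i=1..k. \<integral>\<omega>. v (X i \<omega>) \<partial>M) \<le> sqrt (real k) * \<delta> powr \<gamma> * a powr (1 - \<gamma>)"
proof -
  have pt: "v x \<le> a powr (1 - \<gamma>) * \<bar>D x\<bar> powr \<gamma>" for x
  proof (cases "a < D x")
    case True
    have "v x \<le> D x powr (1 - \<gamma>) * D x powr \<gamma>" using le(1)[of x] True a by (simp flip: powr_add)
    also have "\<dots> \<le> a powr (1 - \<gamma>) * D x powr \<gamma>" using True a gamma by (intro mult_right_mono powr_mono2') auto
    finally show ?thesis using D(3) by simp
  next
    case False
    then show ?thesis using le(1)[of x] by (simp add: order_trans[of _ 0])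
  qed
  have "(\<integral>\<omega>. v (X i \<omega>) \<partial>M) \<le> a powr (1 - \<gamma>) * (\<integral>\<omega>. \<bar>D (X i \<omega>)\<bar> powr \<gamma> \<partial>M)" if i: "i \<in> {1..k}" for i
  proof -
    have iD: "integrable M (\<lambda>\<omega>. a powr (1 - \<gamma>) * \<bar>D (X i \<omega>)\<bar> powr \<gamma>)"
      by (rule integrable_mult_right, rule moment_leD(1)[OF D(1,2) i])
    have "integrable M (\<lambda>\<omega>. v (X i \<omega>))"
      by (rule integrable_bound_real[OF iD]) (use pt le(2) measurable_compose[OF X_measurable[OF i] v] in auto)
    then have "(\<integral>\<omega>. v (X i \<omega>) \<partial>M) \<le> (\<integral>\<omega>. a powr (1 - \<gamma>) * \<bar>D (X i \<omega>)\<bar> powr \<gamma> \<partial>M)"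
      by (rule integral_mono[OF _ iD pt])
    then show ?thesis by simp
  qed
  then have "(\<Sum>i=1..k. \<integral>\<omega>. v (X i \<omega>) \<partial>M) \<le> (\<Sum>i=1..k. a powr (1 - \<gamma>) * (\<integral>\<omega>. \<bar>D (X i \<omega>)\<bar> powr \<gamma> \<partial>M))"
    by (intro sum_mono) auto
  also have "\<dots> = a powr (1 - \<gamma>) * (\<Sum>i=1..k. \<integral>\<omega>. \<bar>D (X i \<omega>)\<bar> powr \<gamma> \<partial>M)" by (simp add: sum_distrib_left)
  also have "\<dots> \<le> a powr (1 - \<gamma>) * (real k * \<delta> powr \<gamma>)" by (intro mult_left_mono moment_leD(2)[OF D(1,2)]) auto
  finally have "1 / sqrt (real k) * (\<Sum>i=1..k. \<integral>\<omega>. v (X i \<omega>) \<partial>M) \<le> 1 / sqrt (real k) * (a powr (1 - \<gamma>) * (real k * \<delta> powr \<gamma>))"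
    by (intro mult_left_mono) auto
  also have "\<dots> = (real k / sqrt (real k)) * \<delta> powr \<gamma> * a powr (1 - \<gamma>)" by simp
  also have "real k / sqrt (real k) = sqrt (real k)" by (simp add: real_div_sqrt)
  finally show ?thesis .
qed

lemma mean_le_moment:
  assumes D: "moment_le D \<delta>" "D \<in> borel_measurable borel" "\<And>x. 0 \<le> D x" and d: "0 < \<delta>"
  shows "1 / sqrt (real k) * (\<Sum>i=1..k. \<integral>\<omega>. D (X i \<omega>) \<partial>M) \<le> 2 * sqrt (real k) * \<delta>"
proof -
  have "(\<integral>\<omega>. D (X i \<omega>) \<partial>M) \<le> \<delta> + \<delta> powr (1 - \<gamma>) * (\<integral>\<omega>. \<bar>D (X i \<omega>)\<bar> powr \<gamma> \<partial>M)" if i: "i \<in> {1..k}" for i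
  proof -
    note [simp] = moment_leD(1)[OF D(1,2) i] moment_integrable(1)[OF D(1,2) i]
    have pt: "D x \<le> \<delta> + \<delta> powr (1 - \<gamma>) * \<bar>D x\<bar> powr \<gamma>" for x
    proof (cases "D x \<le> \<delta>")
      case True then show ?thesis by (simp add: add_increasing2)
    next
      case False
      have "D x = D x powr (1 - \<gamma>) * D x powr \<gamma>" using False d by (simp flip: powr_add)
      also have "\<dots> \<le> \<delta> powr (1 - \<gamma>) * D x powr \<gamma>" using False d gamma by (intro mult_right_mono powr_mono2') auto
      finally show ?thesis using False d by simp
    qed
    have "(\<integral>\<omega>. D (X i \<omega>) \<partial>M) \<le> (\<integral>\<omega>. \<delta> + \<delta> powr (1 - \<gamma>) * \<bar>D (X i \<omega>)\<bar> powr \<gamma> \<partial>M)"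
      using pt by (intro integral_mono) auto
    then show ?thesis by (simp add: prob_space)
  qed
  then have "(\<Sum>i=1..k. \<integral>\<omega>. D (X i \<omega>) \<partial>M) \<le> (\<Sum>i=1..k. \<delta> + \<delta> powr (1 - \<gamma>) * (\<integral>\<omega>. \<bar>D (X i \<omega>)\<bar> powr \<gamma> \<partial>M))"
    by (intro sum_mono) auto
  also have "\<dots> = real k * \<delta> + \<delta> powr (1 - \<gamma>) * (\<Sum>i=1..k. \<integral>\<omega>. \<bar>D (X i \<omega>)\<bar> powr \<gamma> \<partial>M)"
    by (simp add: sum.distrib sum_distrib_left)
  also have "\<dots> \<le> real k * \<delta> + \<delta> powr (1 - \<gamma>) * (real k * \<delta> powr \<gamma>)"
    by (intro add_left_mono mult_left_mono moment_leD(2)[OF D(1,2)]) auto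
  also have "\<delta> powr (1 - \<gamma>) * (real k * \<delta> powr \<gamma>) = real k * (\<delta> powr (1 - \<gamma>) * \<delta> powr \<gamma>)" by simp
  also have "\<delta> powr (1 - \<gamma>) * \<delta> powr \<gamma> = \<delta>" using d by (simp flip: powr_add)
  finally have "1 / sqrt (real k) * (\<Sum>i=1..k. \<integral>\<omega>. D (X i \<omega>) \<partial>M) \<le> 1 / sqrt (real k) * (real k * \<delta> + real k * \<delta>)"
    by (intro mult_left_mono) auto
  also have "\<dots> = 2 * (real k / sqrt (real k)) * \<delta>" by (simp add: add_divide_distrib)
  also have "real k / sqrt (real k) = sqrt (real k)" by (simp add: real_div_sqrt)
  finally show ?thesis .
qed

end

section \<open>Chaining along nested brackets\<close>

text \<open>
  For each level \<open>j\<close> the class \<open>f\<close> is covered by brackets \<open>[l j t, u j t]\<close> of size \<open>\<delta>0 / 2 ^ j\<close>,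
  where \<open>c j t\<close> is the number of the bracket chosen for \<open>t\<close> and \<open>\<nu> j\<close> the number of brackets. The
  number \<open>E\<close> bounds the entropy sum and \<open>\<eta>\<close> is the target. The condition \<open>small\<close> makes the
  chaining sum at most \<open>\<eta> / 2\<close>, \<open>start\<close> says that the chain has at least one link, and \<open>first\<close>
  that the union bound over the \<open>\<nu> 0\<close> coarsest brackets is absorbed by the gain \<open>kappa\<close>.
\<close>

locale bracket_chain = mixing_row M k X \<gamma> \<rho> K
  for M :: "'w measure" and k and X :: "nat \<Rightarrow> 'w \<Rightarrow> 'x::polish_space" and \<gamma> \<rho> K +
  fixes f :: "'t \<Rightarrow> 'x \<Rightarrow> real" and l u :: "nat \<Rightarrow> 't \<Rightarrow> 'x \<Rightarrow> real"
    and c :: "nat \<Rightarrow> 't \<Rightarrow> nat" and \<nu> :: "nat \<Rightarrow> nat" and \<delta>0 \<eta> E :: real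
  assumes f_measurable [measurable]: "\<And>t. f t \<in> borel_measurable borel"
    and l_measurable [measurable]: "\<And>j t. l j t \<in> borel_measurable borel"
    and u_measurable [measurable]: "\<And>j t. u j t \<in> borel_measurable borel"
    and l_le: "\<And>j t x. l j t x \<le> f t x" and u_ge: "\<And>j t x. f t x \<le> u j t x"
    and width: "\<And>j t. moment_le (\<lambda>x. u j t x - l j t x) (\<delta>0 / 2 ^ j)"
    and index: "\<And>j t. c j t < \<nu> j"
    and same_l: "\<And>j s t. c j s = c j t \<Longrightarrow> l j s = l j t"
    and same_u: "\<And>j s t. c j s = c j t \<Longrightarrow> u j s = u j t"
    and d0: "0 < \<delta>0"
    and entropy: "\<And>J. (\<Sum>j\<le>J. \<delta>0 / 2 ^ j * sqrt (ln (real (\<nu> j)))) \<le> E"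
    and small: "2 * \<delta>0 + 2 * E \<le> \<eta> / 2"
    and start: "\<eta> < sqrt (real k) * \<delta>0"
    and first: "real (\<nu> 0) * (real k / (1 + ln (real (\<nu> 0)) + ln (real (\<nu> 1)))) powr - kappa \<le> 1"
begin

text \<open>
  The chain stops at the level \<open>J\<close> at which the mean of a bracket, multiplied by \<open>sqrt k\<close>, is of
  the size of the target. The link between the levels \<open>j\<close> and \<open>j + 1\<close> depends on the cells up to
  level \<open>j + 1\<close>, hence \<open>Lg (Suc j)\<close> in the block length and in the truncation level.
\<close>

definition \<delta> :: "nat \<Rightarrow> real" where "\<delta> j = \<delta>0 / 2 ^ j"
definition Lg :: "nat \<Rightarrow> real" where "Lg j = 1 + (\<Sum>i\<le>j. ln (real (\<nu> i)))"
definition J :: nat where "J = (LEAST j. sqrt (real k) * \<delta> j \<le> \<eta>)"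
definition q :: "nat \<Rightarrow> nat" where "q j = nat \<lceil>(real k / Lg (Suc j)) powr (1 / (1 + \<rho>))\<rceil>"
definition a :: "nat \<Rightarrow> real" where "a j = sqrt (real k) * \<delta> j / (real (q j) * sqrt (Lg (Suc j)))"

text \<open>
  The brackets chosen at different levels need not be nested; the running maximum of the lower and
  the running minimum of the upper ends are, and they still enclose \<open>f t\<close>.
\<close>

primrec lo :: "nat \<Rightarrow> 't \<Rightarrow> 'x \<Rightarrow> real" where
  "lo 0 t = l 0 t"
| "lo (Suc j) t = (\<lambda>x. max (lo j t x) (l (Suc j) t x))"

primrec up :: "nat \<Rightarrow> 't \<Rightarrow> 'x \<Rightarrow> real" where
  "up 0 t = u 0 t"
| "up (Suc j) t = (\<lambda>x. min (up j t x) (u (Suc j) t x))"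

text \<open>
  Adaptive truncation. The chain for \<open>f t\<close> at the point \<open>x\<close> goes on while the bracket width \<open>D\<close> is
  below the truncation level (\<open>act\<close>) and is cut at the first level where it is not, or at \<open>J\<close>
  (\<open>cut\<close>). The links are \<open>w\<close>; after a cut the remainder \<open>g\<close> is left, and \<open>v\<close> is the bracket width
  there, which dominates \<open>g\<close> and depends on \<open>t\<close> through its cells only.
\<close>

definition D :: "nat \<Rightarrow> 't \<Rightarrow> 'x \<Rightarrow> real" where "D j t x = up j t x - lo j t x"
definition act :: "nat \<Rightarrow> 't \<Rightarrow> 'x \<Rightarrow> bool" where "act j t x \<longleftrightarrow> (\<forall>i\<in>{..<j}. D i t x \<le> a i)"
definition cut :: "nat \<Rightarrow> 't \<Rightarrow> 'x \<Rightarrow> bool" where "cut j t x \<longleftrightarrow> act j t x \<and> (j < J \<longrightarrow> a j < D j t x)"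
definition w :: "nat \<Rightarrow> 't \<Rightarrow> 'x \<Rightarrow> real" where
  "w j t x = (if act (Suc j) t x then lo (Suc j) t x - lo j t x else 0)"
definition v :: "nat \<Rightarrow> 't \<Rightarrow> 'x \<Rightarrow> real" where "v j t x = (if cut j t x then D j t x else 0)"
definition g :: "nat \<Rightarrow> 't \<Rightarrow> 'x \<Rightarrow> real" where "g j t x = (if cut j t x then f t x - lo j t x else 0)"
definition rest :: "nat \<Rightarrow> 't \<Rightarrow> 'x \<Rightarrow> real" where "rest j t x = (if act j t x then f t x - lo j t x else 0)"

lemma nu_pos: "1 \<le> \<nu> j" using index[of j undefined] by linarith

lemma ln_nu: "0 \<le> ln (real (\<nu> j))" using nu_pos[of j] by simp

lemma delta_pos: "0 < \<delta> j" using d0 by (simp add: \<delta>_def)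

lemma delta_Suc: "\<delta> j = 2 * \<delta> (Suc j)" by (simp add: \<delta>_def)

lemma Lg_ge: "1 \<le> Lg j" unfolding Lg_def using ln_nu by (simp add: sum_nonneg)

lemma sqrt_Lg_le: "sqrt (Lg j) \<le> 1 + (\<Sum>i\<le>j. sqrt (ln (real (\<nu> i))))"
proof (induction j)
  case 0
  then show ?case using sqrt_add_le_add_sqrt[of 1 "ln (real (\<nu> 0))"] ln_nu by (simp add: Lg_def)
next
  case (Suc j)
  have "sqrt (Lg (Suc j)) = sqrt (Lg j + ln (real (\<nu> (Suc j))))" by (simp add: Lg_def add.assoc)
  also have "\<dots> \<le> sqrt (Lg j) + sqrt (ln (real (\<nu> (Suc j))))"
    using Lg_ge[of j] ln_nu[of "Suc j"] by (intro sqrt_add_le_add_sqrt) auto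
  finally show ?case using Suc by simp
qed

lemma sum_delta_Lg: "(\<Sum>j\<le>m. \<delta> j * sqrt (Lg j)) \<le> \<eta> / 2"
proof -
  define s where "s i = (if i = 0 then 1 else 0) + sqrt (ln (real (\<nu> i)))" for i
  have s: "(\<Sum>i\<le>j. s i) = 1 + (\<Sum>i\<le>j. sqrt (ln (real (\<nu> i))))" for j
    by (simp add: s_def sum.distrib)
  have s0: "0 \<le> s i" for i using ln_nu by (simp add: s_def)
  have "(\<Sum>j\<le>m. \<delta> j * sqrt (Lg j)) \<le> (\<Sum>j\<le>m. \<delta>0 / 2 ^ j * (\<Sum>i\<le>j. s i))"
    unfolding s using delta_pos sqrt_Lg_le
    by (intro sum_mono) (auto simp: \<delta>_def[symmetric] intro!: mult_left_mono less_imp_le[OF delta_pos])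
  also have "\<dots> \<le> 2 * (\<Sum>i\<le>m. \<delta>0 / 2 ^ i * s i)"
  proof -
    have "0 \<le> \<delta>0 / 2 ^ m * (\<Sum>i\<le>m. s i)" using d0 s0 by (intro mult_nonneg_nonneg sum_nonneg) auto
    then show ?thesis using geometric_double_sum[of \<delta>0 s m] by linarith
  qed
  also have "(\<Sum>i\<le>m. \<delta>0 / 2 ^ i * s i) = (\<Sum>i\<le>m. if i = 0 then \<delta>0 else 0) + (\<Sum>i\<le>m. \<delta>0 / 2 ^ i * sqrt (ln (real (\<nu> i))))"
    unfolding sum.distrib[symmetric] by (intro sum.cong) (auto simp: s_def algebra_simps)
  also have "\<dots> \<le> \<delta>0 + E" using entropy[of m] by simp
  finally show ?thesis using small by simp
qed

lemma eta_pos: "0 < \<eta>"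
proof -
  have "0 < \<delta> 0 * sqrt (Lg 0)" using delta_pos[of 0] Lg_ge[of 0] by (intro mult_pos_pos) auto
  then show ?thesis using sum_delta_Lg[of 0] by simp
qed

lemma delta_Lg: "\<delta> j * sqrt (Lg j) \<le> \<eta> / 2"
proof -
  have "\<delta> j * sqrt (Lg j) \<le> (\<Sum>i\<le>j. \<delta> i * sqrt (Lg i))"
  proof (rule member_le_sum)
    show "0 \<le> \<delta> i * sqrt (Lg i)" for i
      using delta_pos[of i] Lg_ge[of i] by (intro mult_nonneg_nonneg) auto
  qed auto
  then show ?thesis using sum_delta_Lg[of j] by simp
qed

lemma J_props: "sqrt (real k) * \<delta> J \<le> \<eta>" "1 \<le> J" "\<And>j. j < J \<Longrightarrow> \<eta> < sqrt (real k) * \<delta> j"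
proof -
  have "\<exists>j. sqrt (real k) * \<delta> j \<le> \<eta>"
  proof -
    have "(\<lambda>j. sqrt (real k) * \<delta>0 * (1/2) ^ j) \<longlonglongrightarrow> sqrt (real k) * \<delta>0 * 0"
      by (intro tendsto_intros LIMSEQ_power_zero) auto
    then have "\<forall>\<^sub>F j in sequentially. sqrt (real k) * \<delta>0 * (1/2) ^ j < \<eta>"
      using eta_pos by (intro order_tendstoD) auto
    then obtain j where "sqrt (real k) * \<delta>0 * (1/2) ^ j < \<eta>"
      using eventually_happens'[OF sequentially_bot] by blast
    then show ?thesis by (intro exI[of _ j]) (simp add: \<delta>_def power_one_over)
  qed
  then show 1: "sqrt (real k) * \<delta> J \<le> \<eta>" unfolding J_def by (rule LeastI_ex)
  show 2: "\<eta> < sqrt (real k) * \<delta> j" if "j < J" for j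
    using not_less_Least[of j "\<lambda>j. sqrt (real k) * \<delta> j \<le> \<eta>"] that by (simp add: J_def)
  show "1 \<le> J" using 1 start by (cases J) (auto simp: \<delta>_def)
qed

text \<open>
  Before the chain stops \<open>sqrt k * \<delta> j\<close> exceeds \<open>\<eta>\<close>, whereas \<open>2 * (\<delta> (j + 1) * sqrt (Lg (j + 1)))\<close>
  is at most \<open>\<eta>\<close>.
\<close>

lemma Lg_le_k: "Lg (Suc j) \<le> real k" if "j < J"
proof -
  have "\<eta> < sqrt (real k) * (2 * \<delta> (Suc j))" using J_props(3)[OF that] by (simp only: delta_Suc[of j])
  moreover have "2 * (\<delta> (Suc j) * sqrt (Lg (Suc j))) \<le> \<eta>" using delta_Lg[of "Suc j"] by simp
  ultimately have "\<delta> (Suc j) * sqrt (Lg (Suc j)) \<le> \<delta> (Suc j) * sqrt (real k)" by (simp add: mult_ac)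
  then have "sqrt (Lg (Suc j)) \<le> sqrt (real k)" using delta_pos[of "Suc j"] by simp
  then show ?thesis by simp
qed

lemma block_length:
  assumes "j < J"
  shows "1 \<le> q j" "q j \<le> k" "real (q j) \<le> 2 * (real k / Lg (Suc j)) powr (1 / (1 + \<rho>))" "0 < a j"
  unfolding q_def a_def by (rule level_block_length[OF Lg_ge Lg_le_k[OF assms] delta_pos])+

lemma lo_measurable [measurable]: "lo j t \<in> borel_measurable borel"
  by (induction j) (auto intro!: borel_measurable_max)

lemma up_measurable [measurable]: "up j t \<in> borel_measurable borel"
  by (induction j) (auto intro!: borel_measurable_min)

lemma D_measurable [measurable]: "D j t \<in> borel_measurable borel"
  unfolding D_def[abs_def] by measurable

lemma act_measurable [measurable]: "Measurable.pred borel (act j t)"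
  unfolding act_def[abs_def] by measurable

lemma cut_measurable [measurable]: "Measurable.pred borel (cut j t)"
  unfolding cut_def[abs_def] by measurable

lemma wvg_measurable [measurable]:
  "w j t \<in> borel_measurable borel" "v j t \<in> borel_measurable borel"
  "g j t \<in> borel_measurable borel" "rest j t \<in> borel_measurable borel"
  unfolding w_def[abs_def] v_def[abs_def] g_def[abs_def] rest_def[abs_def] by measurable

lemma lo_le: "lo j t x \<le> f t x" by (induction j) (auto intro: l_le)
lemma up_ge: "f t x \<le> up j t x" by (induction j) (auto intro: u_ge)
lemma l_le_lo: "l j t x \<le> lo j t x" by (cases j) auto
lemma up_le_u: "up j t x \<le> u j t x" by (cases j) auto

lemma D_nonneg: "0 \<le> D j t x" using lo_le[of j t x] up_ge[of t x j] by (simp add: D_def)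
lemma D_le: "D j t x \<le> u j t x - l j t x" using l_le_lo[of j t x] up_le_u[of j t x] by (simp add: D_def)
lemma D_Suc_le: "D (Suc j) t x \<le> D j t x" by (simp add: D_def)

lemma D_moment: "moment_le (D j t) (\<delta> j)"
proof (rule moment_le_mono[OF width])
  show "\<bar>D j t x\<bar> \<le> \<bar>u j t x - l j t x\<bar>" for x
    using D_nonneg[of j t x] D_le[of j t x] by linarith
qed (use d0 in \<open>auto simp: \<delta>_def\<close>)

lemma w_bounds: "0 \<le> w j t x" "w j t x \<le> D j t x" "w j t x \<le> a j" if "0 < a j"
proof -
  have "lo (Suc j) t x \<le> up j t x" using lo_le[of "Suc j" t x] up_ge[of t x j] by linarith
  then have 1: "lo (Suc j) t x - lo j t x \<le> D j t x" by (simp add: D_def)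
  show "0 \<le> w j t x" by (simp add: w_def)
  show "w j t x \<le> D j t x" using 1 D_nonneg[of j t x] by (simp add: w_def)
  show "w j t x \<le> a j"
  proof (cases "act (Suc j) t x")
    case True
    then have "D j t x \<le> a j" by (simp add: act_def lessThan_Suc)
    then show ?thesis using 1 True by (simp add: w_def)
  qed (use that in \<open>simp add: w_def\<close>)
qed

lemma v_bounds: "0 \<le> v j t x" "v j t x \<le> D j t x" using D_nonneg[of j t x] by (auto simp: v_def)

text \<open>
  At a level after the first the bracket was still narrow one level before, so the width is
  bounded even on the set where the chain is cut.
\<close>

lemma v_Suc_le: "v (Suc j) t x \<le> a j" if "0 < a j"
  using that D_Suc_le[of j t x] by (auto simp: v_def cut_def act_def intro: order_trans)

lemma g_bounds: "0 \<le> g j t x" "g j t x \<le> v j t x"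
  using lo_le[of j t x] up_ge[of t x j] by (auto simp: g_def v_def D_def)

lemma g_le_D: "g j t x \<le> D j t x"
  by (rule order_trans[OF g_bounds(2) v_bounds(2)])

lemma rest_bounds: "0 \<le> rest j t x" "rest j t x \<le> D j t x"
  using lo_le[of j t x] up_ge[of t x j] by (auto simp: rest_def D_def)

lemma moment_of_le_D: "moment_le h (\<delta> j)" if "\<And>x. 0 \<le> h x" "\<And>x. h x \<le> D j t x"
  using moment_le_mono[OF D_moment, of h j t "\<delta> j"] that D_nonneg[of j t] delta_pos[of j]
  by (auto intro: less_imp_le)

lemma integrable_of_le_D: "integrable M (\<lambda>\<omega>. h (X i \<omega>))"
  if "h \<in> borel_measurable borel" "\<And>x. 0 \<le> h x" "\<And>x. h x \<le> D j t x" "i \<in> {1..k}"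
  by (rule moment_integrable(1)[OF moment_of_le_D[OF that(2,3)] that(1,4)])

text \<open>
  At an active point either the chain is cut, and then the rest is \<open>g\<close>, or it is continued by the
  link \<open>w\<close>. At level \<open>J\<close> every active point is cut, so nothing is left over.
\<close>

lemma rest_step: "j < J \<Longrightarrow> rest j t x = (g j t x + w j t x) + rest (Suc j) t x"
  by (auto simp: rest_def g_def w_def cut_def act_def lessThan_Suc not_less)

lemma rest_J: "rest J t = g J t"
  by (auto simp: rest_def g_def cut_def fun_eq_iff)

lemma emp_rest_step:
  assumes j: "j < J"
  shows "emp (rest j t) \<omega> = emp (g j t) \<omega> + emp (w j t) \<omega> + emp (rest (Suc j) t) \<omega>"
proof -
  have aj: "0 < a j" using block_length(4)[OF j] .
  have ig: "integrable M (\<lambda>\<omega>. g j t (X i \<omega>))" if "i \<in> {1..k}" for i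
    by (rule integrable_of_le_D[of _ j t]) (use that g_bounds g_le_D in auto)
  have iw: "integrable M (\<lambda>\<omega>. w j t (X i \<omega>))" if "i \<in> {1..k}" for i
    by (rule integrable_of_le_D[of _ j t]) (use that w_bounds[OF aj] in auto)
  have ir: "integrable M (\<lambda>\<omega>. rest (Suc j) t (X i \<omega>))" if "i \<in> {1..k}" for i
    by (rule integrable_of_le_D[of _ "Suc j" t]) (use that rest_bounds in auto)
  have "rest j t = (\<lambda>x. (g j t x + w j t x) + rest (Suc j) t x)" using rest_step[OF j] by (simp add: fun_eq_iff)
  then have "emp (rest j t) \<omega> = emp (\<lambda>x. (g j t x + w j t x) + rest (Suc j) t x) \<omega>" by simp
  also have "\<dots> = emp (\<lambda>x. g j t x + w j t x) \<omega> + emp (rest (Suc j) t) \<omega>"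
    using ig iw ir by (intro emp_add Bochner_Integration.integrable_add) auto
  also have "emp (\<lambda>x. g j t x + w j t x) \<omega> = emp (g j t) \<omega> + emp (w j t) \<omega>"
    using ig iw by (intro emp_add) auto
  finally show ?thesis .
qed

lemma emp_rest_le:
  assumes "j \<le> J"
  shows "\<bar>emp (rest j t) \<omega>\<bar> \<le> (\<Sum>i=j..J. \<bar>emp (g i t) \<omega>\<bar>) + (\<Sum>i=j..<J. \<bar>emp (w i t) \<omega>\<bar>)"
  using assms
proof (induction rule: inc_induct)
  case base
  then show ?case by (simp add: rest_J)
next
  case (step n)
  have "\<bar>emp (rest n t) \<omega>\<bar> \<le> \<bar>emp (g n t) \<omega>\<bar> + \<bar>emp (w n t) \<omega>\<bar> + \<bar>emp (rest (Suc n) t) \<omega>\<bar>"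
    using emp_rest_step[OF step(2), of t \<omega>] by linarith
  moreover have "(\<Sum>i=n..J. \<bar>emp (g i t) \<omega>\<bar>) = \<bar>emp (g n t) \<omega>\<bar> + (\<Sum>i=Suc n..J. \<bar>emp (g i t) \<omega>\<bar>)"
    using step by (intro sum.atLeast_Suc_atMost) auto
  moreover have "(\<Sum>i=n..<J. \<bar>emp (w i t) \<omega>\<bar>) = \<bar>emp (w n t) \<omega>\<bar> + (\<Sum>i=Suc n..<J. \<bar>emp (w i t) \<omega>\<bar>)"
    using step by (intro sum.atLeast_Suc_lessThan) auto
  ultimately show ?case using step.IH by linarith
qed

text \<open>
  The objects of level \<open>j\<close> depend on the index only through its cells up to level \<open>j\<close>, so each of
  the classes of links and widths is finite.
\<close>

lemma lo_cong: "(\<And>i. i \<le> j \<Longrightarrow> c i s = c i t) \<Longrightarrow> lo j s = lo j t"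
proof (induction j)
  case (Suc j)
  have "lo j s = lo j t" by (rule Suc.IH) (simp add: Suc.prems)
  moreover have "l (Suc j) s = l (Suc j) t" by (rule same_l) (simp add: Suc.prems)
  ultimately show ?case by simp
next
  case 0
  show ?case unfolding lo.simps by (rule same_l) (simp add: 0)
qed

lemma up_cong: "(\<And>i. i \<le> j \<Longrightarrow> c i s = c i t) \<Longrightarrow> up j s = up j t"
proof (induction j)
  case (Suc j)
  have "up j s = up j t" by (rule Suc.IH) (simp add: Suc.prems)
  moreover have "u (Suc j) s = u (Suc j) t" by (rule same_u) (simp add: Suc.prems)
  ultimately show ?case by simp
next
  case 0
  show ?case unfolding up.simps by (rule same_u) (simp add: 0)
qed

lemma D_cong: "(\<And>i. i \<le> j \<Longrightarrow> c i s = c i t) \<Longrightarrow> D j s = D j t"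
  using lo_cong[of j s t] up_cong[of j s t] by (simp add: D_def fun_eq_iff)

lemma act_cong: "(\<And>i. i < j \<Longrightarrow> c i s = c i t) \<Longrightarrow> act j s = act j t"
proof -
  assume c: "\<And>i. i < j \<Longrightarrow> c i s = c i t"
  have "D i s = D i t" if "i \<in> {..<j}" for i using that by (intro D_cong c) auto
  then show ?thesis by (simp add: act_def fun_eq_iff)
qed

lemma v_cong: "v j s = v j t" if "\<And>i. i \<le> j \<Longrightarrow> c i s = c i t"
proof -
  have "act j s = act j t" using that by (intro act_cong) simp
  moreover have "D j s = D j t" using that by (intro D_cong) simp
  ultimately show ?thesis by (simp add: v_def[abs_def] cut_def[abs_def] cong: if_cong)
qed

lemma w_cong: "w j s = w j t" if "\<And>i. i \<le> Suc j \<Longrightarrow> c i s = c i t"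
proof -
  have "act (Suc j) s = act (Suc j) t" using that by (intro act_cong) simp
  moreover have "lo (Suc j) s = lo (Suc j) t" using that by (intro lo_cong) simp
  moreover have "lo j s = lo j t" using that by (intro lo_cong) simp
  ultimately show ?thesis by (simp add: w_def[abs_def] del: lo.simps cong: if_cong)
qed

lemma ln_card_le:
  assumes "\<And>s t. (\<And>i. i \<le> j \<Longrightarrow> c i s = c i t) \<Longrightarrow> h s = h t"
  shows "finite (range h)" "ln (2 * real (card (range h))) \<le> Lg j"
proof -
  note cr = card_range_le_prod[where j = j and c = c and h = h and \<nu> = \<nu>, OF assms index]
  show "finite (range h)" by (rule cr)
  then have "0 < card (range h)" by (simp add: card_gt_0_iff)
  then have "ln (2 * real (card (range h))) \<le> ln (2 * (\<Prod>i\<le>j. real (\<nu> i)))"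
  proof (subst ln_le_cancel_iff)
    show "2 * real (card (range h)) \<le> 2 * (\<Prod>i\<le>j. real (\<nu> i))"
      using cr(2) by (simp flip: of_nat_prod)
    show "0 < 2 * (\<Prod>i\<le>j. real (\<nu> i))" using nu_pos by (auto intro!: prod_pos simp: Suc_le_eq)
  qed (use \<open>0 < card (range h)\<close> in simp)
  also have "\<dots> = ln 2 + (\<Sum>i\<le>j. ln (real (\<nu> i)))"
    using nu_pos by (subst ln_mult_pos) (auto intro!: prod_pos simp: ln_prod Suc_le_eq)
  also have "ln 2 \<le> (1::real)" using ln_2_less_1 by simp
  finally show "ln (2 * real (card (range h))) \<le> Lg j" by (simp add: Lg_def)
qed

text \<open>
  The increment that one level contributes to the maximal inequality.
\<close>

definition dl :: "nat \<Rightarrow> real" where "dl j = \<delta> j * sqrt (Lg (Suc j))"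

lemma sum_dl: "(\<Sum>j<m. dl j) \<le> \<eta>"
proof -
  have "(\<Sum>j<m. dl j) = 2 * (\<Sum>j<m. \<delta> (Suc j) * sqrt (Lg (Suc j)))"
  proof -
    have "dl j = 2 * (\<delta> (Suc j) * sqrt (Lg (Suc j)))" for j
      using delta_Suc[of j] by (simp add: dl_def)
    then show ?thesis by (simp add: sum_distrib_left)
  qed
  also have "(\<Sum>j<m. \<delta> (Suc j) * sqrt (Lg (Suc j))) = (\<Sum>j\<in>Suc ` {..<m}. \<delta> j * sqrt (Lg j))"
    by (subst sum.reindex) auto
  also have "\<dots> \<le> (\<Sum>j\<le>m. \<delta> j * sqrt (Lg j))"
  proof (rule sum_mono2)
    show "0 \<le> \<delta> i * sqrt (Lg i)" for i
      using delta_pos[of i] Lg_ge[of i] by (intro mult_nonneg_nonneg) auto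
  qed auto
  finally show ?thesis using sum_delta_Lg[of m] by simp
qed

lemma dl_nonneg: "0 \<le> dl j"
  using Lg_ge[of "Suc j"] delta_pos[of j] by (simp add: dl_def)

lemma w_maximal: "(\<integral>\<omega>. max_emp (range (w j)) \<omega> \<partial>M) \<le> Cerr * dl j" if j: "j < J"
  unfolding dl_def
proof (rule level_maximal_ineq[OF Lg_ge Lg_le_k[OF j] delta_pos])
  have aj: "0 < a j" using block_length(4)[OF j] .
  show "finite (range (w j))" "ln (2 * real (card (range (w j)))) \<le> Lg (Suc j)"
    using ln_card_le[of "Suc j" "w j", OF w_cong] by auto
  show "\<bar>h x\<bar> \<le> sqrt (real k) * \<delta> j / (real (nat \<lceil>(real k / Lg (Suc j)) powr (1 / (1 + \<rho>))\<rceil>) * sqrt (Lg (Suc j)))"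
    if "h \<in> range (w j)" for h x
    unfolding q_def[symmetric] a_def[symmetric] using that w_bounds[OF aj] by auto
  show "moment_le h (\<delta> j)" if "h \<in> range (w j)" for h
    using that w_bounds[OF aj] by (auto intro!: moment_of_le_D)
qed auto

lemma v_maximal: "(\<integral>\<omega>. max_emp (range (v (Suc j))) \<omega> \<partial>M) \<le> Cerr * dl j" if j: "j < J"
  unfolding dl_def
proof (rule level_maximal_ineq[OF Lg_ge Lg_le_k[OF j] delta_pos])
  have aj: "0 < a j" using block_length(4)[OF j] .
  show "finite (range (v (Suc j)))" "ln (2 * real (card (range (v (Suc j))))) \<le> Lg (Suc j)"
    using ln_card_le[of "Suc j" "v (Suc j)", OF v_cong] by auto
  show "\<bar>h x\<bar> \<le> sqrt (real k) * \<delta> j / (real (nat \<lceil>(real k / Lg (Suc j)) powr (1 / (1 + \<rho>))\<rceil>) * sqrt (Lg (Suc j)))"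
    if "h \<in> range (v (Suc j))" for h x
    unfolding q_def[symmetric] a_def[symmetric] using that v_bounds(1) v_Suc_le[OF aj] by auto
  show "moment_le h (\<delta> j)" if "h \<in> range (v (Suc j))" for h
    using that v_bounds(1)[of "Suc j"] order_trans[OF v_bounds(2)[of "Suc j"] D_Suc_le] by (auto intro!: moment_of_le_D)
qed auto

lemma v_mean: "1 / sqrt (real k) * (\<Sum>i=1..k. \<integral>\<omega>. v j t (X i \<omega>) \<partial>M) \<le>
    2 powr (\<gamma> - 1) * dl j * (real k / Lg (Suc j)) powr - kappa" if j: "j < J"
proof -
  have "1 / sqrt (real k) * (\<Sum>i=1..k. \<integral>\<omega>. v j t (X i \<omega>) \<partial>M) \<le> sqrt (real k) * \<delta> j powr \<gamma> * a j powr (1 - \<gamma>)"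
    by (rule truncated_mean_le[OF D_moment[of j t]])
      (use D_nonneg v_bounds block_length(4)[OF j] j in \<open>auto simp: v_def cut_def\<close>)
  also have "\<dots> \<le> 2 powr (\<gamma> - 1) * \<delta> j * sqrt (Lg (Suc j)) * (real k / Lg (Suc j)) powr - ((\<gamma> - 2) / 2 - (\<gamma> - 1) / (1 + \<rho>))"
    by (rule truncation_mean_bound[OF delta_pos Lg_ge Lg_le_k[OF j] _ block_length(3)[OF j] gamma rho_pos])
      (use block_length(1)[OF j] in \<open>auto simp: a_def\<close>)
  finally show ?thesis by (simp add: dl_def kappa_def mult.assoc)
qed

lemma ratio_powr_le: "(real k / Lg (Suc j)) powr - kappa \<le> 1" if "j < J"
proof -
  have "1 \<le> real k / Lg (Suc j)" using Lg_le_k[OF that] Lg_ge[of "Suc j"] by simp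
  then have "(real k / Lg (Suc j)) powr - kappa \<le> (real k / Lg (Suc j)) powr 0"
    using kappa_pos by (intro powr_mono) auto
  also have "\<dots> \<le> 1" by simp
  finally show ?thesis .
qed

text \<open>
  The mean of the cut width \<open>v j\<close>, multiplied by \<open>sqrt k\<close>: below \<open>J\<close> it is small because of
  truncation, at \<open>J\<close> because the bracket itself is small.
\<close>

definition mean_bound :: "nat \<Rightarrow> real" where
  "mean_bound j = (if j < J then 2 powr (\<gamma> - 1) * dl j else 2 * \<eta>)"

lemma emp_g_le: "\<bar>emp (g j t) \<omega>\<bar> \<le> max_emp (range (v j)) \<omega> + mean_bound j"
  if "j \<le> J"
proof -
  have iv: "integrable M (\<lambda>\<omega>. v j t (X i \<omega>))" if "i \<in> {1..k}" for i
    by (rule integrable_of_le_D[of _ j t]) (use that v_bounds in auto)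
  have ig: "integrable M (\<lambda>\<omega>. g j t (X i \<omega>))" if "i \<in> {1..k}" for i
    by (rule integrable_of_le_D[of _ j t]) (use that g_bounds g_le_D in auto)
  have "\<bar>emp (g j t) \<omega>\<bar> \<le> \<bar>emp (v j t) \<omega>\<bar> + 1 / sqrt (real k) * (\<Sum>i=1..k. \<integral>\<omega>. v j t (X i \<omega>) \<partial>M)"
    by (rule emp_dominated(1)[OF g_bounds ig iv])
  moreover have "\<bar>emp (v j t) \<omega>\<bar> \<le> max_emp (range (v j)) \<omega>"
    using ln_card_le(1)[of j "v j", OF v_cong] by (intro Max_ge) auto
  moreover have "1 / sqrt (real k) * (\<Sum>i=1..k. \<integral>\<omega>. v j t (X i \<omega>) \<partial>M) \<le> mean_bound j"
  proof (cases "j < J")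
    case True
    have "2 powr (\<gamma> - 1) * dl j * (real k / Lg (Suc j)) powr - kappa \<le> 2 powr (\<gamma> - 1) * dl j * 1"
      using ratio_powr_le[OF True] dl_nonneg[of j] by (intro mult_left_mono) auto
    then have "1 / sqrt (real k) * (\<Sum>i=1..k. \<integral>\<omega>. v j t (X i \<omega>) \<partial>M) \<le> 2 powr (\<gamma> - 1) * dl j"
      using v_mean[OF True, of t] by linarith
    then show ?thesis using True by (simp only: mean_bound_def if_True)
  next
    case False
    then have "j = J" using that by simp
    have "1 / sqrt (real k) * (\<Sum>i=1..k. \<integral>\<omega>. v j t (X i \<omega>) \<partial>M) \<le> 2 * sqrt (real k) * \<delta> j"
      by (rule mean_le_moment[OF moment_of_le_D[of "v j t" j t]]) (use v_bounds delta_pos in auto)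
    also have "\<dots> \<le> 2 * \<eta>" using J_props(1) \<open>j = J\<close> by simp
    finally show ?thesis using False by (simp add: mean_bound_def)
  qed
  ultimately show ?thesis by linarith
qed

text \<open>
  At level \<open>0\<close> the width is unbounded where the chain is cut, and no exponential inequality
  applies. The maximum over the class is bounded by the sum, and each \<open>emp (g 0 t)\<close> by the values
  and means of \<open>v 0 t\<close>.
\<close>

definition base :: "'w \<Rightarrow> real" where
  "base \<omega> = (\<Sum>h\<in>range (v 0). 1 / sqrt (real k) * (\<Sum>i=1..k. h (X i \<omega>) + (\<integral>\<omega>. h (X i \<omega>) \<partial>M)))"

lemma v_integrable: "h \<in> range (v j) \<Longrightarrow> i \<in> {1..k} \<Longrightarrow> integrable M (\<lambda>\<omega>. h (X i \<omega>))"
  by (elim imageE, hypsubst, rule integrable_of_le_D[of _ j]) (use v_bounds in auto)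

lemma base_integrable: "integrable M base"
  unfolding base_def[abs_def]
  by (intro Bochner_Integration.integrable_sum integrable_mult_right Bochner_Integration.integrable_add integrable_const v_integrable)

lemma emp_g0_le: "\<bar>emp (g 0 t) \<omega>\<bar> \<le> base \<omega>"
proof -
  have fin: "finite (range (v 0))" using ln_card_le(1)[of 0 "v 0", OF v_cong] by auto
  have "\<bar>emp (g 0 t) \<omega>\<bar> \<le> 1 / sqrt (real k) * (\<Sum>i=1..k. v 0 t (X i \<omega>) + (\<integral>\<omega>. v 0 t (X i \<omega>) \<partial>M))"
    by (rule emp_dominated(2)[OF g_bounds _ v_integrable])
      (auto intro!: integrable_of_le_D[of _ 0 t] g_bounds order_trans[OF g_bounds(2) v_bounds(2)])
  also have "\<dots> \<le> base \<omega>" unfolding base_def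
    by (rule member_le_sum[OF _ _ fin]) (auto intro!: mult_nonneg_nonneg sum_nonneg add_nonneg_nonneg v_bounds integral_nonneg_AE AE_I2 divide_nonneg_nonneg)
  finally show ?thesis .
qed

text \<open>
  The sum over \<open>\<nu> 0\<close> cells is affordable because each mean carries the factor \<open>(k / Lg 1) powr -
  kappa\<close>, which tends to zero.
\<close>

lemma base_mean: "(\<integral>\<omega>. base \<omega> \<partial>M) \<le> 2 powr \<gamma> * dl 0"
proof -
  have J0: "0 < J" using J_props(2) by simp
  have fin: "finite (range (v 0))" using ln_card_le(1)[of 0 "v 0", OF v_cong] by auto
  have card: "card (range (v 0)) \<le> \<nu> 0" using card_range_le_prod(2)[of 0 c "v 0" \<nu>, OF v_cong index] by simp
  define r where "r = (real k / Lg (Suc 0)) powr - kappa"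
  have r0: "0 \<le> r" by (simp add: r_def)
  have nr: "real (\<nu> 0) * r \<le> 1" using first by (simp add: r_def Lg_def add.assoc)
  have "(\<integral>\<omega>. base \<omega> \<partial>M) = (\<Sum>h\<in>range (v 0). 1 / sqrt (real k) * (\<Sum>i=1..k. (\<integral>\<omega>. h (X i \<omega>) \<partial>M) + (\<integral>\<omega>. h (X i \<omega>) \<partial>M)))"
  proof -
    define m where "m h i = (\<integral>\<omega>. h (X i \<omega>) \<partial>M)" for h :: "'x \<Rightarrow> real" and i
    have i: "integrable M (\<lambda>\<omega>. h (X i \<omega>) + m h i)" if "h \<in> range (v 0)" "i \<in> {1..k}" for h i
      using v_integrable[OF that] by simp
    have "(\<integral>\<omega>. base \<omega> \<partial>M) = (\<Sum>h\<in>range (v 0). \<integral>\<omega>. 1 / sqrt (real k) * (\<Sum>i=1..k. h (X i \<omega>) + m h i) \<partial>M)"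
      unfolding base_def m_def[symmetric]
      by (intro Bochner_Integration.integral_sum integrable_mult_right Bochner_Integration.integrable_sum i)
    also have "\<dots> = (\<Sum>h\<in>range (v 0). 1 / sqrt (real k) * (\<Sum>i=1..k. \<integral>\<omega>. h (X i \<omega>) + m h i \<partial>M))"
    proof (rule sum.cong[OF refl])
      fix h assume h: "h \<in> range (v 0)"
      have "(\<integral>\<omega>. (\<Sum>i=1..k. h (X i \<omega>) + m h i) \<partial>M) = (\<Sum>i=1..k. \<integral>\<omega>. h (X i \<omega>) + m h i \<partial>M)"
        by (intro Bochner_Integration.integral_sum i h)
      then show "(\<integral>\<omega>. 1 / sqrt (real k) * (\<Sum>i=1..k. h (X i \<omega>) + m h i) \<partial>M) =
        1 / sqrt (real k) * (\<Sum>i=1..k. \<integral>\<omega>. h (X i \<omega>) + m h i \<partial>M)" by simp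
    qed
    also have "\<dots> = (\<Sum>h\<in>range (v 0). 1 / sqrt (real k) * (\<Sum>i=1..k. m h i + m h i))"
    proof (intro sum.cong refl arg_cong2[where f = "(*)"])
      fix h i assume "h \<in> range (v 0)" "i \<in> {1..k}"
      then show "(\<integral>\<omega>. h (X i \<omega>) + m h i \<partial>M) = m h i + m h i"
        using v_integrable[of h 0 i] by (simp add: prob_space m_def)
    qed
    finally show ?thesis by (simp only: m_def)
  qed
  also have "\<dots> = (\<Sum>h\<in>range (v 0). 2 * (1 / sqrt (real k) * (\<Sum>i=1..k. (\<integral>\<omega>. h (X i \<omega>) \<partial>M))))"
    unfolding sum.distrib by (intro sum.cong) auto
  also have "\<dots> \<le> (\<Sum>h\<in>range (v 0). 2 * (2 powr (\<gamma> - 1) * dl 0 * r))"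
    using v_mean[OF J0] by (intro sum_mono mult_left_mono) (auto simp: r_def)
  also have "\<dots> = real (card (range (v 0))) * (2 * (2 powr (\<gamma> - 1) * dl 0 * r))" by simp
  also have "\<dots> \<le> real (\<nu> 0) * (2 * (2 powr (\<gamma> - 1) * dl 0 * r))"
    using card r0 dl_nonneg[of 0] by (intro mult_right_mono) auto
  also have "\<dots> = 2 powr \<gamma> * dl 0 * (real (\<nu> 0) * r)" by (simp add: powr_diff)
  also have "\<dots> \<le> 2 powr \<gamma> * dl 0 * 1" using nr dl_nonneg[of 0] by (intro mult_left_mono) auto
  finally show ?thesis by simp
qed

text \<open>
  The chaining bound for all functions \<open>f t - l 0 t\<close> at once. The majorant \<open>W\<close> is integrable, in
  particular measurable, whereas the supremum over \<open>t\<close> need not be.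
\<close>

lemma bracketing_maximal_ineq:
  "\<exists>W. integrable M W \<and> (\<integral>\<omega>. W \<omega> \<partial>M) \<le> (2 powr \<gamma> + 2 * Cerr + 2) * \<eta> \<and>
     (\<forall>t \<omega>. \<bar>emp (\<lambda>x. f t x - l 0 t x) \<omega>\<bar> \<le> W \<omega>)"
proof -
  obtain m where m: "J = Suc m" using J_props(2) by (cases J) auto
  define Mv where "Mv j \<omega> = max_emp (range (v j)) \<omega>" for j \<omega>
  define Mw where "Mw j \<omega> = max_emp (range (w j)) \<omega>" for j \<omega>
  define W where "W \<omega> = base \<omega> + (\<Sum>j<J. Mv (Suc j) \<omega> + mean_bound (Suc j)) + (\<Sum>j<J. Mw j \<omega>)" for \<omega>
  have finv: "finite (range (v j))" for j using ln_card_le(1)[of j "v j", OF v_cong] by auto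
  have finw: "finite (range (w j))" for j using ln_card_le(1)[of "Suc j" "w j", OF w_cong] by auto
  have iMv: "integrable M (Mv j)" for j
    unfolding Mv_def[abs_def] by (rule integrable_Max_abs[OF finv]) (auto intro!: emp_integrable v_integrable)
  have iMw: "integrable M (Mw j)" if j: "j < J" for j
    unfolding Mw_def[abs_def]
  proof (rule integrable_Max_abs[OF finw])
    fix h assume "h \<in> range (w j)"
    then obtain t where h: "h = w j t" by auto
    show "integrable M (emp h)" unfolding h
      by (rule emp_integrable, rule integrable_of_le_D[of _ j t]) (use w_bounds[OF block_length(4)[OF j]] in auto)
  qed auto
  have iW: "integrable M W"
    unfolding W_def[abs_def] using base_integrable iMv iMw
    by (intro Bochner_Integration.integrable_add Bochner_Integration.integrable_sum integrable_const) auto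
  have "(\<integral>\<omega>. W \<omega> \<partial>M) = (\<integral>\<omega>. base \<omega> \<partial>M) + (\<Sum>j<J. (\<integral>\<omega>. Mv (Suc j) \<omega> \<partial>M) + mean_bound (Suc j)) + (\<Sum>j<J. \<integral>\<omega>. Mw j \<omega> \<partial>M)"
  proof -
    have i2: "integrable M (\<lambda>\<omega>. Mv (Suc j) \<omega> + mean_bound (Suc j))" for j using iMv by simp
    have "(\<integral>\<omega>. W \<omega> \<partial>M) = (\<integral>\<omega>. base \<omega> \<partial>M) + (\<integral>\<omega>. (\<Sum>j<J. Mv (Suc j) \<omega> + mean_bound (Suc j)) \<partial>M) + (\<integral>\<omega>. (\<Sum>j<J. Mw j \<omega>) \<partial>M)"
      unfolding W_def using base_integrable i2 iMw
      by (subst Bochner_Integration.integral_add; (subst Bochner_Integration.integral_add)?)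
        (auto intro!: Bochner_Integration.integrable_add Bochner_Integration.integrable_sum)
    also have "(\<integral>\<omega>. (\<Sum>j<J. Mv (Suc j) \<omega> + mean_bound (Suc j)) \<partial>M) = (\<Sum>j<J. \<integral>\<omega>. Mv (Suc j) \<omega> + mean_bound (Suc j) \<partial>M)"
      by (intro Bochner_Integration.integral_sum i2)
    also have "\<dots> = (\<Sum>j<J. (\<integral>\<omega>. Mv (Suc j) \<omega> \<partial>M) + mean_bound (Suc j))"
      using iMv by (simp add: prob_space)
    also have "(\<integral>\<omega>. (\<Sum>j<J. Mw j \<omega>) \<partial>M) = (\<Sum>j<J. \<integral>\<omega>. Mw j \<omega> \<partial>M)"
      using iMw by (intro Bochner_Integration.integral_sum) auto
    finally show ?thesis .
  qed
  also have "\<dots> \<le> 2 powr \<gamma> * dl 0 + (\<Sum>j<J. Cerr * dl j + mean_bound (Suc j)) + (\<Sum>j<J. Cerr * dl j)"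
    using v_maximal w_maximal base_mean
    by (intro add_mono sum_mono) (auto simp: Mv_def Mw_def)
  also have "\<dots> = 2 powr \<gamma> * dl 0 + 2 * Cerr * (\<Sum>j<J. dl j) + (\<Sum>j<J. mean_bound (Suc j))"
    by (simp add: sum.distrib sum_distrib_left algebra_simps)
  also have "(\<Sum>j<J. mean_bound (Suc j)) = (\<Sum>j<m. 2 powr (\<gamma> - 1) * dl (Suc j)) + 2 * \<eta>"
    by (simp add: m mean_bound_def)
  also have "(\<Sum>j<m. 2 powr (\<gamma> - 1) * dl (Suc j)) \<le> (\<Sum>j<m. 2 powr \<gamma> * dl (Suc j))"
    using dl_nonneg by (intro sum_mono mult_right_mono powr_mono) auto
  also have "2 powr \<gamma> * dl 0 + 2 * Cerr * (\<Sum>j<J. dl j) + ((\<Sum>j<m. 2 powr \<gamma> * dl (Suc j)) + 2 * \<eta>) =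
     2 powr \<gamma> * (\<Sum>j<J. dl j) + 2 * Cerr * (\<Sum>j<J. dl j) + 2 * \<eta>"
    by (simp add: m sum.lessThan_Suc_shift distrib_left sum_distrib_left del: sum.lessThan_Suc)
  also have "\<dots> \<le> 2 powr \<gamma> * \<eta> + 2 * Cerr * \<eta> + 2 * \<eta>"
    using sum_dl[of J] Cerr_nonneg by (intro add_mono mult_left_mono) auto
  also have "\<dots> = (2 powr \<gamma> + 2 * Cerr + 2) * \<eta>" by (simp add: algebra_simps)
  finally have W1: "(\<integral>\<omega>. W \<omega> \<partial>M) \<le> (2 powr \<gamma> + 2 * Cerr + 2) * \<eta>" by simp
  have W2: "\<bar>emp (\<lambda>x. f t x - l 0 t x) \<omega>\<bar> \<le> W \<omega>" for t \<omega>
  proof -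
    have "rest 0 t = (\<lambda>x. f t x - l 0 t x)" by (simp add: rest_def act_def fun_eq_iff)
    then have "\<bar>emp (\<lambda>x. f t x - l 0 t x) \<omega>\<bar> = \<bar>emp (rest 0 t) \<omega>\<bar>" by simp
    also have "\<dots> \<le> (\<Sum>i=0..J. \<bar>emp (g i t) \<omega>\<bar>) + (\<Sum>i=0..<J. \<bar>emp (w i t) \<omega>\<bar>)"
      by (rule emp_rest_le) simp
    also have "(\<Sum>i=0..J. \<bar>emp (g i t) \<omega>\<bar>) = \<bar>emp (g 0 t) \<omega>\<bar> + (\<Sum>j<J. \<bar>emp (g (Suc j) t) \<omega>\<bar>)"
      unfolding atLeast0AtMost lessThan_Suc_atMost[symmetric] by (rule sum.lessThan_Suc_shift)
    also have "\<dots> \<le> base \<omega> + (\<Sum>j<J. Mv (Suc j) \<omega> + mean_bound (Suc j))"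
      unfolding Mv_def by (intro add_mono emp_g0_le sum_mono emp_g_le) auto
    also have "(\<Sum>i=0..<J. \<bar>emp (w i t) \<omega>\<bar>) \<le> (\<Sum>j<J. Mw j \<omega>)"
      unfolding atLeast0LessThan Mw_def using finw by (intro sum_mono Max_ge) auto
    finally show ?thesis by (simp add: W_def)
  qed
  show ?thesis using iW W1 W2 by blast
qed

end

section \<open>Asymptotic tightness in complete metric spaces\<close>

text \<open>
  A lower bound for the inner probability, in the form in which it is used: suprema over
  uncountable index sets need not be measurable, so a measurable event is named on which the
  property holds.
\<close>

abbreviation likely :: "'w measure \<Rightarrow> real \<Rightarrow> ('w \<Rightarrow> bool) \<Rightarrow> bool" where
  "likely M \<epsilon> p \<equiv> \<exists>B\<in>sets M. 1 - \<epsilon> \<le> measure M B \<and> (\<forall>\<omega>\<in>B. p \<omega>)"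

lemma (in prob_space) prob_Int_ge:
  assumes "A \<in> events" "B \<in> events" "1 - a \<le> prob A" "1 - b \<le> prob B"
  shows "1 - (a + b) \<le> prob (A \<inter> B)"
proof -
  have "prob (A \<union> B) = prob A + prob B - prob (A \<inter> B)" using assms by (intro measure_Un3) (auto simp: fmeasurable_eq_sets)
  moreover have "prob (A \<union> B) \<le> 1" by (rule prob_le_1)
  ultimately show ?thesis using assms by linarith
qed

lemma (in prob_space) prob_INT_ge:
  assumes "finite I" "\<And>i. i \<in> I \<Longrightarrow> A i \<in> events" "\<And>i. i \<in> I \<Longrightarrow> 1 - a i \<le> prob (A i)"
  shows "1 - (\<Sum>i\<in>I. a i) \<le> prob (space M \<inter> (\<Inter>i\<in>I. A i))"
  using assms
proof (induction I rule: finite_induct)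
  case empty
  then show ?case by (simp add: prob_space)
next
  case (insert x I)
  have ev: "space M \<inter> (\<Inter>i\<in>I. A i) \<in> events" using insert by (cases "I = {}") auto
  have "1 - (a x + (\<Sum>i\<in>I. a i)) \<le> prob (A x \<inter> (space M \<inter> (\<Inter>i\<in>I. A i)))"
    using insert ev by (intro prob_Int_ge) auto
  also have "A x \<inter> (space M \<inter> (\<Inter>i\<in>I. A i)) = space M \<inter> (\<Inter>i\<in>insert x I. A i)" by auto
  finally show ?case using insert by simp
qed

text \<open>
  It suffices to find, for each \<open>\<epsilon>\<close> and \<open>\<eta>\<close>, a compact set whose \<open>\<eta>\<close>-enlargement eventually has
  inner probability at least \<open>1 - \<epsilon>\<close>. With \<open>\<eta> = (1/2) ^ j\<close> and \<open>\<epsilon>\<close> split geometrically, the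
  intersection \<open>K\<close> of the closed enlargements \<open>N j\<close> is closed and totally bounded. The point is
  that every neighbourhood of \<open>K\<close> already contains a finite intersection of the \<open>N j\<close>, by a
  compactness argument for a sequence of points outside; so only finitely many of the eventual
  statements have to hold at the same \<open>n\<close>.
\<close>

lemma asymptotically_tightI:
  fixes X :: "nat \<Rightarrow> 'w \<Rightarrow> 'd::complete_space"
  assumes M: "\<And>n. prob_space (M n)"
    and approx: "\<And>\<epsilon> \<eta>. 0 < \<epsilon> \<Longrightarrow> 0 < \<eta> \<Longrightarrow> \<exists>C. compact C \<and> (\<forall>\<^sub>F n in sequentially.
      likely (M n) \<epsilon> (\<lambda>\<omega>. \<exists>x\<in>C. dist x (X n \<omega>) \<le> \<eta>))"
  shows "asymptotically_tight M X"
  unfolding asymptotically_tight_def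
proof (intro allI impI)
  fix \<epsilon> :: real assume e: "0 < \<epsilon>"
  define \<eta> :: "nat \<Rightarrow> real" where "\<eta> j = (1/2) ^ j" for j
  define \<epsilon>' where "\<epsilon>' j = \<epsilon> * (1/2) ^ Suc j" for j :: nat
  have eta_pos: "0 < \<eta> j" for j by (simp add: \<eta>_def)
  have eps_pos: "0 < \<epsilon>' j" for j using e by (simp add: \<epsilon>'_def)
  have eta0: "\<eta> \<longlonglongrightarrow> 0" unfolding \<eta>_def by (rule LIMSEQ_power_zero) simp
  have "\<forall>j. \<exists>C. compact C \<and> (\<forall>\<^sub>F n in sequentially.
      likely (M n) (\<epsilon>' j) (\<lambda>\<omega>. \<exists>x\<in>C. dist x (X n \<omega>) \<le> \<eta> j))"
    using approx[OF eps_pos eta_pos] by blast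
  from choice[OF this] obtain C0 where C0: "\<And>j. compact (C0 j)" "\<And>j. \<forall>\<^sub>F n in sequentially.
      likely (M n) (\<epsilon>' j) (\<lambda>\<omega>. \<exists>x\<in>C0 j. dist x (X n \<omega>) \<le> \<eta> j)" by blast
  \<comment> \<open>the distance \<open>infdist\<close> to an empty set is \<open>0\<close>, so the
    compact sets are made nonempty\<close>
  define C where "C j = insert undefined (C0 j)" for j
  have C: "compact (C j)" "C j \<noteq> {}" for j using C0(1) by (auto simp: C_def)
  have Cev: "\<forall>\<^sub>F n in sequentially.
      likely (M n) (\<epsilon>' j) (\<lambda>\<omega>. infdist (X n \<omega>) (C j) \<le> \<eta> j)" for j
    using C0(2)[of j]
  proof eventually_elim
    case (elim n)
    then obtain B where B: "B \<in> sets (M n)" "1 - \<epsilon>' j \<le> measure (M n) B" "\<forall>\<omega>\<in>B. \<exists>x\<in>C0 j. dist x (X n \<omega>) \<le> \<eta> j" by blast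
    have "infdist (X n \<omega>) (C j) \<le> \<eta> j" if w: "\<omega> \<in> B" for \<omega>
    proof -
      obtain x where "x \<in> C0 j" "dist x (X n \<omega>) \<le> \<eta> j" using B(3) w by blast
      then show ?thesis unfolding C_def
        by (intro infdist_le2[of x]) (auto simp: dist_commute)
    qed
    then show ?case using B by blast
  qed
  define N where "N j = {y. infdist y (C j) \<le> \<eta> j}" for j
  have clN: "closed (N j)" for j
    unfolding N_def by (intro closed_Collect_le continuous_intros)
  have near: "\<exists>x\<in>C j. dist y x < 2 * \<eta> j" if "y \<in> N j" for j y
  proof (rule ccontr)
    assume "\<not> ?thesis"
    then have "2 * \<eta> j \<le> infdist y (C j)" using C(2)[of j]
      by (auto simp: infdist_notempty not_less intro!: cINF_greatest)
    then show False using that eta_pos[of j] by (simp add: N_def)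
  qed
  have cover: "\<exists>F. finite F \<and> N j \<subseteq> (\<Union>x\<in>F. ball x r)" if "3 * \<eta> j \<le> r" for j r
  proof -
    have "\<exists>F. finite F \<and> C j \<subseteq> (\<Union>x\<in>F. ball x (\<eta> j))"
      using C(1)[of j] eta_pos[of j] unfolding compact_eq_totally_bounded by blast
    then obtain F where F: "finite F" "C j \<subseteq> (\<Union>x\<in>F. ball x (\<eta> j))" by blast
    have "N j \<subseteq> (\<Union>x\<in>F. ball x r)"
    proof
      fix y assume "y \<in> N j"
      then obtain x where x: "x \<in> C j" "dist y x < 2 * \<eta> j" using near by blast
      then obtain z where z: "z \<in> F" "dist z x < \<eta> j" using F(2) by auto
      have "dist z y \<le> dist z x + dist y x" by (rule dist_triangle2)
      then have "dist z y < r" using x z that by linarith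
      then show "y \<in> (\<Union>x\<in>F. ball x r)" using z by auto
    qed
    then show ?thesis using F by blast
  qed
  have small: "\<exists>j. 3 * \<eta> j \<le> r" if "0 < r" for r
  proof -
    have "\<forall>\<^sub>F j in sequentially. 3 * \<eta> j < r"
      using order_tendstoD(2)[OF tendsto_mult_right_zero[OF eta0, of 3]] that by auto
    then show ?thesis using eventually_happens'[OF sequentially_bot] less_imp_le by blast
  qed
  define K where "K = (\<Inter>j. N j)"
  have Kcl: "closed K" unfolding K_def using clN by auto
  have Kcomp: "compact K"
    unfolding compact_eq_totally_bounded complete_eq_closed
  proof (intro conjI allI impI)
    show "closed K" by (rule Kcl)
    fix r :: real assume "0 < r"
    then obtain j where "3 * \<eta> j \<le> r" using small by blast
    from cover[OF this] obtain F where F: "finite F" "N j \<subseteq> (\<Union>x\<in>F. ball x r)" by blast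
    have "K \<subseteq> N j" by (auto simp: K_def)
    then show "\<exists>F. finite F \<and> K \<subseteq> (\<Union>x\<in>F. ball x r)" using F by (intro exI[of _ F]) auto
  qed
  have capture: "\<exists>J. (\<Inter>j\<in>{..J}. N j) \<subseteq> (\<Union>x\<in>K. ball x \<delta>)" if d: "0 < \<delta>" for \<delta>
  proof (rule ccontr)
    assume "\<not> ?thesis"
    then have "\<forall>J. \<exists>y. y \<in> (\<Inter>j\<in>{..J}. N j) \<and> y \<notin> (\<Union>x\<in>K. ball x \<delta>)" by blast
    then obtain y where y: "\<And>J. y J \<in> (\<Inter>j\<in>{..J}. N j)" "\<And>J. y J \<notin> (\<Union>x\<in>K. ball x \<delta>)" by metis
    have yN: "y J \<in> N j" if "j \<le> J" for j J using y(1)[of J] that by auto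
    have "compact (closure (range y))"
      unfolding compact_eq_totally_bounded complete_eq_closed
    proof (intro conjI allI impI)
      show "closed (closure (range y))" by simp
      fix r :: real assume r: "0 < r"
      then obtain j where "3 * \<eta> j \<le> r / 2" using small[of "r / 2"] by auto
      from cover[OF this] obtain F where F: "finite F" "N j \<subseteq> (\<Union>x\<in>F. ball x (r / 2))" by blast
      have "closure (range y) \<subseteq> (\<Union>x\<in>F \<union> y ` {..j}. ball x r)"
      proof
        fix z assume "z \<in> closure (range y)"
        then have "\<exists>y'\<in>range y. dist y' z < r / 2" unfolding closure_approachable using r half_gt_zero by blast
        then obtain J where J: "dist (y J) z < r / 2" by blast
        show "z \<in> (\<Union>x\<in>F \<union> y ` {..j}. ball x r)"
        proof (cases "J \<le> j")
          case True
          then show ?thesis using J r by (intro UN_I[of "y J"]) auto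
        next
          case False
          then have "y J \<in> N j" by (intro yN) simp
          then obtain x where x: "x \<in> F" "dist x (y J) < r / 2" using F(2) by auto
          have "dist x z \<le> dist x (y J) + dist (y J) z" by (rule dist_triangle)
          then show ?thesis using x J by (intro UN_I[of x]) auto
        qed
      qed
      moreover have "finite (F \<union> y ` {..j})" using F(1) by simp
      ultimately show "\<exists>F. finite F \<and> closure (range y) \<subseteq> (\<Union>x\<in>F. ball x r)" by blast
    qed
    then have "seq_compact (closure (range y))" by (rule compact_imp_seq_compact)
    moreover have "\<forall>n. y n \<in> closure (range y)" using closure_subset[of "range y"] by auto
    ultimately obtain z s where zs: "strict_mono s" "(y \<circ> s) \<longlonglongrightarrow> z"
      by (rule seq_compactE)
    have "z \<in> N j" for j
    proof (rule closed_sequentially[OF clN])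
      show "(\<lambda>n. y (s (n + j))) \<longlonglongrightarrow> z" using LIMSEQ_ignore_initial_segment[OF zs(2), of j] by (simp add: o_def)
      show "y (s (n + j)) \<in> N j" for n
        using seq_suble[OF zs(1), of "n + j"] by (intro yN) simp
    qed
    then have "z \<in> K" by (simp add: K_def)
    moreover obtain n where "dist (y (s n)) z < \<delta>"
      using zs(2) d unfolding lim_sequentially o_def by blast
    ultimately show False using y(2)[of "s n"] by (auto simp: dist_commute)
  qed
  show "\<exists>K. compact K \<and> (\<forall>\<delta>>0. ennreal (1 - \<epsilon>) \<le>
       liminf (\<lambda>n. inner_measure_of (M n) {\<omega> \<in> space (M n). X n \<omega> \<in> (\<Union>x\<in>K. ball x \<delta>)}))"
  proof (intro exI conjI allI impI)
    show "compact K" by (rule Kcomp)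
    fix \<delta> :: real assume "0 < \<delta>"
    then obtain J where J: "(\<Inter>j\<in>{..J}. N j) \<subseteq> (\<Union>x\<in>K. ball x \<delta>)" using capture by blast
    have "\<forall>\<^sub>F n in sequentially. \<forall>j\<in>{..J}. likely (M n) (\<epsilon>' j) (\<lambda>\<omega>. infdist (X n \<omega>) (C j) \<le> \<eta> j)"
      using Cev by (intro eventually_ball_finite) auto
    then have "\<forall>\<^sub>F n in sequentially. ennreal (1 - \<epsilon>) \<le> inner_measure_of (M n) {\<omega> \<in> space (M n). X n \<omega> \<in> (\<Union>x\<in>K. ball x \<delta>)}"
    proof eventually_elim
      case (elim n)
      interpret prob_space "M n" by (rule M)
      from elim obtain B where B: "\<And>j. j \<le> J \<Longrightarrow> B j \<in> sets (M n)" "\<And>j. j \<le> J \<Longrightarrow> 1 - \<epsilon>' j \<le> prob (B j)"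
        "\<And>j \<omega>. j \<le> J \<Longrightarrow> \<omega> \<in> B j \<Longrightarrow> infdist (X n \<omega>) (C j) \<le> \<eta> j" by (metis atMost_iff)
      define A where "A = space (M n) \<inter> (\<Inter>j\<in>{..J}. B j)"
      have A: "A \<in> sets (M n)" unfolding A_def using B(1) by (intro sets.Int sets.finite_INT) auto
      have "1 - (\<Sum>j\<le>J. \<epsilon>' j) \<le> prob A" unfolding A_def using B by (intro prob_INT_ge) auto
      moreover have "(\<Sum>j\<le>J. \<epsilon>' j) \<le> \<epsilon>"
      proof -
        have "(\<Sum>j\<le>J. \<epsilon>' j) = \<epsilon> / 2 * (\<Sum>j<Suc J. (1/2) ^ j)"
          by (simp add: \<epsilon>'_def sum_distrib_left lessThan_Suc_atMost mult_ac)
        also have "(\<Sum>j<Suc J. (1/2::real) ^ j) = 2 * (1 - (1/2) ^ Suc J)" by (subst geometric_sum) (auto simp: field_simps)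
        also have "\<dots> \<le> 2" by simp
        finally show ?thesis using e by (simp add: mult_left_mono)
      qed
      ultimately have "1 - \<epsilon> \<le> prob A" by linarith
      then have "ennreal (1 - \<epsilon>) \<le> emeasure (M n) A" by (simp add: emeasure_eq_measure ennreal_leI)
      also have "\<dots> \<le> inner_measure_of (M n) {\<omega> \<in> space (M n). X n \<omega> \<in> (\<Union>x\<in>K. ball x \<delta>)}"
        unfolding inner_measure_of_def
      proof (rule SUP_upper)
        have "X n \<omega> \<in> (\<Union>x\<in>K. ball x \<delta>)" if "\<omega> \<in> A" for \<omega>
        proof -
          have "X n \<omega> \<in> (\<Inter>j\<in>{..J}. N j)" using that B(3) by (auto simp: A_def N_def)
          then show ?thesis using J by blast
        qed
        moreover have "A \<subseteq> space (M n)" by (auto simp: A_def)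
        ultimately show "A \<in> {B \<in> sets (M n). B \<subseteq> {\<omega> \<in> space (M n). X n \<omega> \<in> (\<Union>x\<in>K. ball x \<delta>)}}" using A by blast
      qed
      finally show ?case .
    qed
    then show "ennreal (1 - \<epsilon>) \<le> liminf (\<lambda>n. inner_measure_of (M n) {\<omega> \<in> space (M n). X n \<omega> \<in> (\<Union>x\<in>K. ball x \<delta>)})"
      by (rule Liminf_bounded)
  qed
qed

text \<open>
  For a constant sequence the open enlargements of the compact set can be shrunk to the set
  itself, by continuity of the law from above.
\<close>

lemma tight_borel_measurableI:
  fixes Y :: "'w \<Rightarrow> 'd::complete_space"
  assumes Q: "prob_space Q" and Y: "Y \<in> borel_measurable Q" and t: "asymptotically_tight (\<lambda>_. Q) (\<lambda>_. Y)"
  shows "tight_borel_measurable Q Y"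
  unfolding tight_borel_measurable_def
proof (intro conjI Y allI impI)
  interpret prob_space Q by fact
  fix \<epsilon> :: real assume "0 < \<epsilon>"
  with t obtain K where K: "compact K" "\<And>\<delta>. 0 < \<delta> \<Longrightarrow> ennreal (1 - \<epsilon>) \<le>
       inner_measure_of Q {\<omega> \<in> space Q. Y \<omega> \<in> (\<Union>x\<in>K. ball x \<delta>)}"
    unfolding asymptotically_tight_def by (auto simp: Liminf_const)
  define U where "U n = (\<Union>x\<in>K. ball x (1 / real (Suc n)))" for n
  have Uo: "open (U n)" for n unfolding U_def by auto
  have Up: "1 - \<epsilon> \<le> measure (distr Q borel Y) (U n)" for n
  proof -
    have S: "{\<omega> \<in> space Q. Y \<omega> \<in> U n} \<in> sets Q" using measurable_sets[OF Y, of "U n"] Uo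
      by (simp add: vimage_def Int_def conj_commute)
    have "ennreal (1 - \<epsilon>) \<le> inner_measure_of Q {\<omega> \<in> space Q. Y \<omega> \<in> U n}"
      unfolding U_def using K(2)[of "1 / real (Suc n)"] by simp
    also have "\<dots> \<le> emeasure Q {\<omega> \<in> space Q. Y \<omega> \<in> U n}"
      unfolding inner_measure_of_def by (rule SUP_least) (use S in \<open>auto intro: emeasure_mono\<close>)
    also have "\<dots> = ennreal (measure (distr Q borel Y) (U n))"
      using Y Uo by (subst measure_distr) (auto simp: emeasure_eq_measure vimage_def Int_def conj_commute)
    finally show ?thesis using measure_nonneg[of "distr Q borel Y" "U n"] by (auto simp: ennreal_le_iff2)
  qed
  have "K = (\<Inter>n. U n)"
  proof
    show "K \<subseteq> (\<Inter>n. U n)" by (auto simp: U_def intro!: bexI)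
    show "(\<Inter>n. U n) \<subseteq> K"
    proof
      fix y assume y: "y \<in> (\<Inter>n. U n)"
      have "y \<in> closure K"
        unfolding closure_approachable
      proof (intro allI impI)
        fix e :: real assume "0 < e"
        then obtain n where n: "1 / real (Suc n) < e" using nat_approx_posE by blast
        obtain x where "x \<in> K" "dist x y < 1 / real (Suc n)" using y by (auto simp: U_def)
        then show "\<exists>x\<in>K. dist x y < e" using n by (intro bexI[of _ x]) auto
      qed
      then show "y \<in> K" using K(1) by (simp add: compact_imp_closed closure_closed)
    qed
  qed
  moreover interpret D: prob_space "distr Q borel Y" using Y by (rule prob_space_distr)
  have "(\<lambda>n. measure (distr Q borel Y) (U n)) \<longlonglongrightarrow> measure (distr Q borel Y) (\<Inter>n. U n)"
  proof (rule D.finite_Lim_measure_decseq)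
    show "range U \<subseteq> sets (distr Q borel Y)" using Uo by auto
    show "decseq U"
    proof (rule decseq_SucI)
      fix n
      have "1 / real (Suc (Suc n)) \<le> 1 / real (Suc n)" by (simp add: frac_le)
      then show "U (Suc n) \<subseteq> U n" unfolding U_def by (intro UN_mono subset_refl subset_ball)
    qed
  qed
  then have "1 - \<epsilon> \<le> measure (distr Q borel Y) (\<Inter>n. U n)" using Up by (intro LIMSEQ_le_const) auto
  ultimately show "\<exists>K. compact K \<and> 1 - \<epsilon> \<le> measure (distr Q borel Y) K" using K(1) by auto
qed

section \<open>Asymptotic tightness in the space of bounded functions\<close>

lemma dist_linf_le:
  assumes "\<And>t. \<bar>linf_eval x t - linf_eval y t\<bar> \<le> \<eta>"
  shows "dist x y \<le> \<eta>"
  unfolding dist_linf using assms by (intro cSUP_least) auto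

lemma dist_linf_ge: "\<bar>linf_eval x t - linf_eval y t\<bar> \<le> dist x y"
proof -
  have "\<bar>linf_eval x t - linf_eval y t\<bar> = dist (apply_bcontfun x (discrete t)) (apply_bcontfun y (discrete t))"
    by (simp add: linf_eval_def dist_real_def)
  also have "\<dots> \<le> dist x y" by (rule dist_bounded)
  finally show ?thesis .
qed

lemma linf_eval_add: "linf_eval (x + y) t = linf_eval x t + linf_eval y t"
  by (simp add: linf_eval_def plus_bcontfun.rep_eq)

lemma linf_eval_scaleR: "linf_eval (r *\<^sub>R x) t = r * linf_eval x t"
  by (simp add: linf_eval_def scaleR_bcontfun.rep_eq)

lemma linf_eval_zero: "linf_eval 0 t = 0"
  by (simp add: linf_eval_def zero_bcontfun.rep_eq)

lemma linf_eval_sum: "linf_eval (\<Sum>i\<in>I. x i) t = (\<Sum>i\<in>I. linf_eval (x i) t)"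
  by (induction I rule: infinite_finite_induct) (auto simp: linf_eval_add linf_eval_zero)

definition linf_ind :: "'t set \<Rightarrow> 't linf" where
  "linf_ind A = to_linf (indicator A)"

lemma linf_eval_ind: "linf_eval (linf_ind A) t = indicator A t"
  unfolding linf_ind_def
  by (rule linf_eval_to_linf) (auto intro!: boundedI[of _ 1] simp: indicator_def)

text \<open>
  The functions that are constant on each of finitely many cells, with values in a bounded
  interval, form a compact set of bounded functions.
\<close>

lemma compact_box_sums:
  fixes e :: "'s \<Rightarrow> 'd::real_normed_vector"
  assumes "finite S"
  shows "compact ((\<lambda>v. \<Sum>s\<in>S. v s *\<^sub>R e s) ` {v. \<forall>s. \<bar>v s\<bar> \<le> R})"
  using assms
proof (induction S rule: finite_induct)
  case empty
  have "(\<lambda>v. \<Sum>s\<in>{}. v s *\<^sub>R e s) ` {v. \<forall>s. \<bar>v s\<bar> \<le> R} \<subseteq> {0}" by auto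
  from subset_singletonD[OF this] show ?case by (elim disjE) (simp_all only: compact_empty compact_sing)
next
  case (insert a S)
  let ?Z = "\<lambda>S. (\<lambda>v. \<Sum>s\<in>S. v s *\<^sub>R e s) ` {v. \<forall>s. \<bar>v s\<bar> \<le> R}"
  have "?Z (insert a S) = {x + y | x y. x \<in> (\<lambda>r. r *\<^sub>R e a) ` {-R..R} \<and> y \<in> ?Z S}" (is "_ = ?W")
  proof
    show "?Z (insert a S) \<subseteq> ?W"
    proof (rule image_subsetI)
      fix v :: "'s \<Rightarrow> real" assume v: "v \<in> {v. \<forall>s. \<bar>v s\<bar> \<le> R}"
      then have "v a \<in> {-R..R}" by (auto simp: abs_le_iff minus_le_iff)
      then have "v a *\<^sub>R e a \<in> (\<lambda>r. r *\<^sub>R e a) ` {-R..R}" by (rule imageI)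
      moreover have "(\<Sum>s\<in>S. v s *\<^sub>R e s) \<in> ?Z S" using v by (rule imageI)
      moreover have "(\<Sum>s\<in>insert a S. v s *\<^sub>R e s) = v a *\<^sub>R e a + (\<Sum>s\<in>S. v s *\<^sub>R e s)" using insert by simp
      ultimately show "(\<Sum>s\<in>insert a S. v s *\<^sub>R e s) \<in> ?W" by blast
    qed
    show "?W \<subseteq> ?Z (insert a S)"
    proof
      fix z assume "z \<in> ?W"
      then obtain r v where rv: "r \<in> {-R..R}" "\<forall>s. \<bar>v s\<bar> \<le> R" "z = r *\<^sub>R e a + (\<Sum>s\<in>S. v s *\<^sub>R e s)" by auto
      have "(\<Sum>s\<in>S. v s *\<^sub>R e s) = (\<Sum>s\<in>S. (v(a := r)) s *\<^sub>R e s)" using insert by (intro sum.cong) auto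
      then have "z = (\<Sum>s\<in>insert a S. (v(a := r)) s *\<^sub>R e s)" using rv insert by simp
      moreover have "v(a := r) \<in> {v. \<forall>s. \<bar>v s\<bar> \<le> R}" using rv by (auto simp: abs_le_iff)
      ultimately show "z \<in> ?Z (insert a S)" by blast
    qed
  qed
  moreover have "compact ((\<lambda>r. r *\<^sub>R e a) ` {-R..R})"
    by (intro compact_continuous_image continuous_intros compact_Icc)
  ultimately show ?case using insert.IH by (simp only: compact_sums)
qed

text \<open>
  A function that oscillates little on the cells \<open>p t = s\<close> is close to the step function with its
  values at the points \<open>s\<close>, and the values at finitely many points are bounded with large
  probability.
\<close>

lemma linf_asymptotically_tightI:
  fixes X :: "nat \<Rightarrow> 'w \<Rightarrow> 't linf"
  assumes M: "\<And>n. prob_space (M n)"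
    and equi: "\<And>\<epsilon> \<eta>. 0 < \<epsilon> \<Longrightarrow> 0 < \<eta> \<Longrightarrow> \<exists>S p. finite S \<and> range p \<subseteq> S \<and> (\<forall>\<^sub>F n in sequentially.
      likely (M n) \<epsilon> (\<lambda>\<omega>. \<forall>t. \<bar>linf_eval (X n \<omega>) t - linf_eval (X n \<omega>) (p t)\<bar> \<le> \<eta>))"
    and marg: "\<And>\<epsilon> t. 0 < \<epsilon> \<Longrightarrow> \<exists>R. \<forall>\<^sub>F n in sequentially.
      likely (M n) \<epsilon> (\<lambda>\<omega>. \<bar>linf_eval (X n \<omega>) t\<bar> \<le> R)"
  shows "asymptotically_tight M X"
proof (rule asymptotically_tightI[OF M])
  fix \<epsilon> \<eta> :: real assume e: "0 < \<epsilon>" and h: "0 < \<eta>"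
  obtain S p where S: "finite S" "range p \<subseteq> S" and equi': "\<forall>\<^sub>F n in sequentially.
      likely (M n) (\<epsilon> / 2) (\<lambda>\<omega>. \<forall>t. \<bar>linf_eval (X n \<omega>) t - linf_eval (X n \<omega>) (p t)\<bar> \<le> \<eta>)"
    using equi[of "\<epsilon> / 2" \<eta>] e h by auto
  define m where "m = 2 * real (card S)"
  have m0: "0 < m" using S by (auto simp: m_def card_gt_0_iff)
  have "\<forall>t. \<exists>R. \<forall>\<^sub>F n in sequentially. likely (M n) (\<epsilon> / m) (\<lambda>\<omega>. \<bar>linf_eval (X n \<omega>) t\<bar> \<le> R)"
    using marg[of "\<epsilon> / m"] e m0 by auto
  from choice[OF this] obtain R where R: "\<And>t. \<forall>\<^sub>F n in sequentially. likely (M n) (\<epsilon> / m) (\<lambda>\<omega>. \<bar>linf_eval (X n \<omega>) t\<bar> \<le> R t)"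
    by blast
  define r where "r = (\<Sum>s\<in>S. \<bar>R s\<bar>)"
  have rR: "R s \<le> r" if "s \<in> S" for s
  proof -
    have "\<bar>R s\<bar> \<le> r" unfolding r_def using S that by (intro member_le_sum) auto
    then show ?thesis by linarith
  qed
  have r0: "0 \<le> r" by (simp add: r_def sum_nonneg)
  define C where "C = (\<lambda>v. \<Sum>s\<in>S. v s *\<^sub>R linf_ind {t. p t = s}) ` {v. \<forall>s. \<bar>v s\<bar> \<le> r}"
  have "\<forall>\<^sub>F n in sequentially. \<forall>s\<in>S. likely (M n) (\<epsilon> / m) (\<lambda>\<omega>. \<bar>linf_eval (X n \<omega>) s\<bar> \<le> R s)"
    using R S by (intro eventually_ball_finite) auto
  with equi' have "\<forall>\<^sub>F n in sequentially. likely (M n) \<epsilon> (\<lambda>\<omega>. \<exists>x\<in>C. dist x (X n \<omega>) \<le> \<eta>)"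
  proof eventually_elim
    case (elim n)
    interpret prob_space "M n" by (rule M)
    obtain B where B: "B \<in> sets (M n)" "1 - \<epsilon> / 2 \<le> prob B" "\<And>\<omega> t. \<omega> \<in> B \<Longrightarrow> \<bar>linf_eval (X n \<omega>) t - linf_eval (X n \<omega>) (p t)\<bar> \<le> \<eta>"
      using elim by blast
    obtain A where A: "\<And>s. s \<in> S \<Longrightarrow> A s \<in> sets (M n)" "\<And>s. s \<in> S \<Longrightarrow> 1 - \<epsilon> / m \<le> prob (A s)"
      "\<And>s \<omega>. s \<in> S \<Longrightarrow> \<omega> \<in> A s \<Longrightarrow> \<bar>linf_eval (X n \<omega>) s\<bar> \<le> R s" using elim by metis
    define A' where "A' = space (M n) \<inter> (\<Inter>s\<in>S. A s)"
    have A': "A' \<in> sets (M n)" unfolding A'_def using A S by (cases "S = {}") (auto intro!: sets.Int sets.finite_INT)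
    have "1 - (\<Sum>s\<in>S. \<epsilon> / m) \<le> prob A'" unfolding A'_def using A S by (intro prob_INT_ge) auto
    also have "(\<Sum>s\<in>S. \<epsilon> / m) = \<epsilon> / 2" using m0 by (simp add: m_def)
    finally have p: "1 - (\<epsilon> / 2 + \<epsilon> / 2) \<le> prob (B \<inter> A')" using B A' by (intro prob_Int_ge) auto
    have "\<exists>x\<in>C. dist x (X n \<omega>) \<le> \<eta>" if w: "\<omega> \<in> B \<inter> A'" for \<omega>
    proof -
      define v where "v s = (if s \<in> S then linf_eval (X n \<omega>) s else 0)" for s
      define x where "x = (\<Sum>s\<in>S. v s *\<^sub>R linf_ind {t. p t = s})"
      have "\<bar>v s\<bar> \<le> r" for s
      proof (cases "s \<in> S")
        case True
        then have "\<bar>linf_eval (X n \<omega>) s\<bar> \<le> R s" using w A(3) by (auto simp: A'_def)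
        then show ?thesis using rR[OF True] True by (simp add: v_def)
      qed (simp add: v_def r0)
      then have "x \<in> C" by (auto simp: C_def x_def)
      moreover have "dist x (X n \<omega>) \<le> \<eta>"
      proof (rule dist_linf_le)
        fix t
        have pt: "p t \<in> S" using S by auto
        have "linf_eval x t = (\<Sum>s\<in>S. if s = p t then v s else 0)"
          unfolding x_def linf_eval_sum linf_eval_scaleR linf_eval_ind by (intro sum.cong) (auto simp: indicator_def)
        also have "\<dots> = linf_eval (X n \<omega>) (p t)" using S pt by (simp add: v_def)
        finally show "\<bar>linf_eval x t - linf_eval (X n \<omega>) t\<bar> \<le> \<eta>" using B(3)[of \<omega> t] w by (simp add: abs_minus_commute)
      qed
      ultimately show ?thesis by blast
    qed
    then show ?case using p B A' by (intro bexI[of _ "B \<inter> A'"]) auto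
  qed
  moreover have "compact C" unfolding C_def by (rule compact_box_sums[OF S(1)])
  ultimately show "\<exists>C. compact C \<and> (\<forall>\<^sub>F n in sequentially.
      likely (M n) \<epsilon> (\<lambda>\<omega>. \<exists>x\<in>C. dist x (X n \<omega>) \<le> \<eta>))" by blast
qed

lemma linf_asymptotically_tightI_semimetric:
  fixes X :: "nat \<Rightarrow> 'w \<Rightarrow> 't linf" and d :: "'t \<Rightarrow> 't \<Rightarrow> real"
  assumes M: "\<And>n. prob_space (M n)" and d: "semimetric d" "semimetric_totally_bounded d"
    and equi: "\<And>\<epsilon> \<eta>. 0 < \<epsilon> \<Longrightarrow> 0 < \<eta> \<Longrightarrow> \<exists>\<delta>>0. \<forall>\<^sub>F n in sequentially.
      likely (M n) \<epsilon> (\<lambda>\<omega>. \<forall>s t. d s t < \<delta> \<longrightarrow> \<bar>linf_eval (X n \<omega>) s - linf_eval (X n \<omega>) t\<bar> \<le> \<eta>)"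
    and marg: "\<And>\<epsilon> t. 0 < \<epsilon> \<Longrightarrow> \<exists>R. \<forall>\<^sub>F n in sequentially.
      likely (M n) \<epsilon> (\<lambda>\<omega>. \<bar>linf_eval (X n \<omega>) t\<bar> \<le> R)"
  shows "asymptotically_tight M X"
proof (rule linf_asymptotically_tightI[OF M _ marg])
  fix \<epsilon> \<eta> :: real assume "0 < \<epsilon>" "0 < \<eta>"
  from equi[OF this] obtain \<delta> where \<delta>: "0 < \<delta>" "\<forall>\<^sub>F n in sequentially.
      likely (M n) \<epsilon> (\<lambda>\<omega>. \<forall>s t. d s t < \<delta> \<longrightarrow> \<bar>linf_eval (X n \<omega>) s - linf_eval (X n \<omega>) t\<bar> \<le> \<eta>)" by blast
  obtain S where S: "finite S" "\<And>t. \<exists>s\<in>S. d s t < \<delta>"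
    using d(2) \<delta>(1) unfolding semimetric_totally_bounded_def by blast
  then obtain p where p: "\<And>t. p t \<in> S" "\<And>t. d (p t) t < \<delta>" by metis
  have p': "d t (p t) < \<delta>" for t using p(2)[of t] d(1) by (simp add: semimetric_def)
  show "\<exists>S p. finite S \<and> range p \<subseteq> S \<and> (\<forall>\<^sub>F n in sequentially.
      likely (M n) \<epsilon> (\<lambda>\<omega>. \<forall>t. \<bar>linf_eval (X n \<omega>) t - linf_eval (X n \<omega>) (p t)\<bar> \<le> \<eta>))"
  proof (intro exI conjI)
    show "finite S" by fact
    show "range p \<subseteq> S" using p by auto
    show "\<forall>\<^sub>F n in sequentially. likely (M n) \<epsilon> (\<lambda>\<omega>. \<forall>t. \<bar>linf_eval (X n \<omega>) t - linf_eval (X n \<omega>) (p t)\<bar> \<le> \<eta>)"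
      using \<delta>(2) by (rule eventually_mono) (use p' in blast)
  qed
qed

section \<open>From cells to the semimetric\<close>

text \<open>
  Markov's inequality for an extended-valued \<open>V\<close>, in the form used for majorants: it yields a
  measurable event on which the majorant is at most \<open>\<eta>\<close>.
\<close>

lemma (in prob_space) markov_event:
  assumes V: "V \<in> borel_measurable M" and e: "(\<integral>\<^sup>+\<omega>. V \<omega> \<partial>M) \<le> ennreal e" "0 \<le> e" and h: "0 < \<eta>"
  shows "likely M (e / \<eta>) (\<lambda>\<omega>. \<omega> \<in> space M \<and> V \<omega> \<le> ennreal \<eta>)"
proof -
  define B where "B = {\<omega> \<in> space M. V \<omega> < ennreal \<eta>}"
  have B: "B \<in> sets M" unfolding B_def using V by measurable
  have "emeasure M {\<omega> \<in> space M. 1 \<le> ennreal (1 / \<eta>) * V \<omega>} \<le> ennreal (1 / \<eta>) * (\<integral>\<^sup>+\<omega>. V \<omega> * indicator (space M) \<omega> \<partial>M)"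
    using V by (intro nn_integral_Markov_inequality) auto
  also have "(\<integral>\<^sup>+\<omega>. V \<omega> * indicator (space M) \<omega> \<partial>M) = (\<integral>\<^sup>+\<omega>. V \<omega> \<partial>M)"
    by (intro nn_integral_cong) simp
  also have "ennreal (1 / \<eta>) * (\<integral>\<^sup>+\<omega>. V \<omega> \<partial>M) \<le> ennreal (1 / \<eta>) * ennreal e" using e by (intro mult_left_mono) auto
  also have "\<dots> = ennreal (e / \<eta>)" using e h by (simp flip: ennreal_mult)
  also have "{\<omega> \<in> space M. 1 \<le> ennreal (1 / \<eta>) * V \<omega>} = space M - B"
  proof -
    have "1 \<le> ennreal (1 / \<eta>) * z \<longleftrightarrow> \<not> z < ennreal \<eta>" for z
    proof (cases z)
      case (real r)
      have "1 \<le> ennreal (1 / \<eta>) * z \<longleftrightarrow> ennreal 1 \<le> ennreal (r / \<eta>)"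
        using real h by (simp flip: ennreal_mult)
      also have "\<dots> \<longleftrightarrow> \<eta> \<le> r" using real h by (subst ennreal_le_iff) (auto simp: le_divide_eq)
      also have "\<dots> \<longleftrightarrow> \<not> z < ennreal \<eta>" using real h by (simp add: ennreal_less_iff not_less)
      finally show ?thesis .
    qed (use h in \<open>simp add: ennreal_mult_top\<close>)
    then show ?thesis by (auto simp: B_def)
  qed
  finally have "prob (space M - B) \<le> e / \<eta>"
    using e h by (simp add: emeasure_eq_measure ennreal_le_iff)
  then have "1 - e / \<eta> \<le> prob B" using B by (simp add: prob_compl)
  then show ?thesis using B by (intro bexI[of _ B]) (auto simp: B_def)
qed

text \<open>
  For each pair of cells that contains a \<open>d\<close>-close pair one such pair is chosen. Any other
  \<open>d\<close>-close pair in these cells differs from it by two oscillations within cells, which gives \<open>2 *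
  e\<close>, and there are at most \<open>m * m\<close> chosen pairs.
\<close>

lemma (in prob_space) cell_increments:
  fixes x :: "'t \<Rightarrow> 'a \<Rightarrow> real" and c :: "'t \<Rightarrow> nat" and d :: "'t \<Rightarrow> 't \<Rightarrow> real"
  assumes x: "\<And>t. x t \<in> borel_measurable M" and c: "\<And>t. c t < m"
    and W: "W \<in> borel_measurable M" "(\<integral>\<^sup>+\<omega>. W \<omega> \<partial>M) \<le> ennreal e" "0 \<le> e"
    and osc: "\<And>s t \<omega>. \<omega> \<in> space M \<Longrightarrow> c s = c t \<Longrightarrow> ennreal \<bar>x s \<omega> - x t \<omega>\<bar> \<le> W \<omega>"
    and inc: "\<And>s t. d s t < \<delta> \<Longrightarrow> (\<integral>\<^sup>+\<omega>. ennreal \<bar>x s \<omega> - x t \<omega>\<bar> \<partial>M) \<le> ennreal \<tau>" and t: "0 \<le> \<tau>" and h: "0 < \<eta>"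
  shows "likely M ((2 * e + real m * real m * \<tau>) / \<eta>) (\<lambda>\<omega>. \<forall>s t. d s t < \<delta> \<longrightarrow> \<bar>x s \<omega> - x t \<omega>\<bar> \<le> \<eta>)"
proof -
  define P where "P = {(c s, c t) | s t. d s t < \<delta>}"
  have Psub: "P \<subseteq> {..<m} \<times> {..<m}" using c by (auto simp: P_def)
  then have fin: "finite P" by (rule finite_subset) auto
  have "card P \<le> card ({..<m} \<times> {..<m})" using Psub by (intro card_mono) auto
  then have cardP: "card P \<le> m * m" by (simp add: card_cartesian_product)
  have "\<forall>p\<in>P. \<exists>st. p = (c (fst st), c (snd st)) \<and> d (fst st) (snd st) < \<delta>" by (auto simp: P_def)
  then obtain r where r: "\<And>p. p \<in> P \<Longrightarrow> p = (c (fst (r p)), c (snd (r p)))" "\<And>p. p \<in> P \<Longrightarrow> d (fst (r p)) (snd (r p)) < \<delta>"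
    by metis
  define Z where "Z p \<omega> = ennreal \<bar>x (fst (r p)) \<omega> - x (snd (r p)) \<omega>\<bar>" for p \<omega>
  have Zm[measurable]: "Z p \<in> borel_measurable M" for p unfolding Z_def[abs_def] using x by measurable
  note W(1)[measurable]
  define V where "V \<omega> = 2 * W \<omega> + (\<Sum>p\<in>P. Z p \<omega>)" for \<omega>
  have Vm: "V \<in> borel_measurable M" unfolding V_def[abs_def] by measurable
  have "(\<integral>\<^sup>+\<omega>. V \<omega> \<partial>M) = 2 * (\<integral>\<^sup>+\<omega>. W \<omega> \<partial>M) + (\<Sum>p\<in>P. \<integral>\<^sup>+\<omega>. Z p \<omega> \<partial>M)"
    unfolding V_def by (subst nn_integral_add) (auto simp: nn_integral_cmult nn_integral_sum)
  also have "\<dots> \<le> 2 * ennreal e + (\<Sum>p\<in>P. ennreal \<tau>)"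
    using W(2) inc r(2) by (intro add_mono mult_left_mono sum_mono) (auto simp: Z_def)
  also have "\<dots> = ennreal (2 * e + real (card P) * \<tau>)"
    using W(3) t by (simp add: ennreal_mult ennreal_of_nat_eq_real_of_nat ennreal_plus)
  also have "\<dots> \<le> ennreal (2 * e + real m * real m * \<tau>)"
    using cardP t by (intro ennreal_leI add_left_mono mult_right_mono) (auto simp flip: of_nat_mult)
  finally have EV: "(\<integral>\<^sup>+\<omega>. V \<omega> \<partial>M) \<le> ennreal (2 * e + real m * real m * \<tau>)" .
  have "likely M ((2 * e + real m * real m * \<tau>) / \<eta>) (\<lambda>\<omega>. \<omega> \<in> space M \<and> V \<omega> \<le> ennreal \<eta>)"
    by (rule markov_event[OF Vm EV _ h]) (use W(3) t in auto)
  then obtain B where B: "B \<in> sets M" "1 - (2 * e + real m * real m * \<tau>) / \<eta> \<le> prob B"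
    "\<And>\<omega>. \<omega> \<in> B \<Longrightarrow> \<omega> \<in> space M" "\<And>\<omega>. \<omega> \<in> B \<Longrightarrow> V \<omega> \<le> ennreal \<eta>" by blast
  have "\<bar>x s \<omega> - x t \<omega>\<bar> \<le> \<eta>" if w: "\<omega> \<in> B" and st: "d s t < \<delta>" for \<omega> s t
  proof -
    define p where "p = (c s, c t)"
    have p: "p \<in> P" using st by (auto simp: P_def p_def)
    define s' t' where "s' = fst (r p)" and "t' = snd (r p)"
    have ct: "c s = c s'" "c t' = c t" using r(1)[OF p] by (auto simp: p_def s'_def t'_def)
    have "ennreal \<bar>x s \<omega> - x t \<omega>\<bar> \<le> ennreal (\<bar>x s \<omega> - x s' \<omega>\<bar> + \<bar>x t' \<omega> - x t \<omega>\<bar> + \<bar>x s' \<omega> - x t' \<omega>\<bar>)"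
      by (intro ennreal_leI) linarith
    also have "\<dots> = ennreal \<bar>x s \<omega> - x s' \<omega>\<bar> + ennreal \<bar>x t' \<omega> - x t \<omega>\<bar> + ennreal \<bar>x s' \<omega> - x t' \<omega>\<bar>"
      by (simp add: ennreal_plus)
    also have "\<dots> \<le> W \<omega> + W \<omega> + (\<Sum>p\<in>P. Z p \<omega>)"
    proof (intro add_mono)
      show "ennreal \<bar>x s \<omega> - x s' \<omega>\<bar> \<le> W \<omega>" "ennreal \<bar>x t' \<omega> - x t \<omega>\<bar> \<le> W \<omega>"
        using osc ct B(3)[OF w] by auto
      show "ennreal \<bar>x s' \<omega> - x t' \<omega>\<bar> \<le> (\<Sum>p\<in>P. Z p \<omega>)"
        using fin p member_le_sum[of p P "\<lambda>p. Z p \<omega>"] by (auto simp: Z_def s'_def t'_def)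
    qed
    also have "\<dots> = V \<omega>" by (simp add: V_def mult_2)
    also have "\<dots> \<le> ennreal \<eta>" by (rule B(4)[OF w])
    finally show ?thesis using h by (simp add: ennreal_le_iff)
  qed
  then show ?thesis using B by blast
qed

section \<open>Centred normal laws\<close>

text \<open>
  Scaling the standard normal law includes the degenerate case \<open>\<sigma> = 0\<close>, which a density does not.
\<close>

lemma normal_law_eq_distr:
  assumes "0 \<le> \<sigma>"
  shows "normal_law 0 \<sigma> = distr std_normal_distribution borel (\<lambda>x. \<sigma> * x)"
proof (cases "\<sigma> = 0")
  case True
  interpret real_distribution std_normal_distribution by (rule real_dist_normal_dist)
  show ?thesis using True by (simp add: normal_law_def distr_const)
next
  case False
  then have s: "0 < \<sigma>" using assms by simp
  interpret real_distribution std_normal_distribution by (rule real_dist_normal_dist)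
  have "distributed std_normal_distribution lborel (\<lambda>x. x) std_normal_density"
    by (auto simp: distributed_def distr_id2)
  from normal_density_affine[OF this, of \<sigma> 0] s
  have "distributed std_normal_distribution lborel (\<lambda>x. \<sigma> * x) (normal_density 0 \<sigma>)" by simp
  then have "distr std_normal_distribution lborel (\<lambda>x. \<sigma> * x) = density lborel (normal_density 0 \<sigma>)"
    by (simp add: distributed_def)
  moreover have "distr std_normal_distribution lborel (\<lambda>x. \<sigma> * x) = distr std_normal_distribution borel (\<lambda>x. \<sigma> * x)"
    by (rule distr_cong) auto
  ultimately show ?thesis using s by (simp add: normal_law_def)
qed

lemma real_distribution_normal_law:
  assumes "0 \<le> \<sigma>" shows "real_distribution (normal_law 0 \<sigma>)"
proof -
  interpret real_distribution std_normal_distribution by (rule real_dist_normal_dist)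
  show ?thesis unfolding normal_law_eq_distr[OF assms] by (rule real_distribution_distr) simp
qed

lemma char_normal_law:
  assumes "0 \<le> \<sigma>"
  shows "char (normal_law 0 \<sigma>) t = complex_of_real (exp (- (\<sigma>\<^sup>2 * t\<^sup>2) / 2))"
proof -
  have "char (normal_law 0 \<sigma>) t = char std_normal_distribution (\<sigma> * t)"
    unfolding normal_law_eq_distr[OF assms] char_def
    by (subst integral_distr) (auto simp: mult_ac)
  then show ?thesis by (simp add: char_std_normal_distribution power_mult_distrib)
qed

lemma normal_lawI:
  assumes "real_distribution N" "0 \<le> \<sigma>" "\<And>t. char N t = complex_of_real (exp (- (\<sigma>\<^sup>2 * t\<^sup>2) / 2))"
  shows "N = normal_law 0 \<sigma>"
  using assms(3) char_normal_law[OF assms(2)]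
  by (intro Levy_uniqueness[OF assms(1) real_distribution_normal_law[OF assms(2)]]) auto

lemma std_normal_exp:
  "integrable std_normal_distribution (\<lambda>x. exp (a * x))"
  "(\<integral>x. exp (a * x) \<partial>std_normal_distribution) = exp (a\<^sup>2 / 2)"
proof -
  have e: "std_normal_density x * exp (a * x) = exp (a\<^sup>2 / 2) * normal_density a 1 x" for x
  proof -
    have "- (x\<^sup>2 / 2) + a * x = a\<^sup>2 / 2 + - ((x - a)\<^sup>2 / 2)"
      by (simp add: power2_eq_square field_simps)
    then have "exp (- (x\<^sup>2 / 2)) * exp (a * x) = exp (a\<^sup>2 / 2) * exp (- ((x - a)\<^sup>2 / 2))"
      by (simp add: exp_add[symmetric])
    then show ?thesis by (simp add: normal_density_def)
  qed
  interpret N: prob_space "density lborel (normal_density a 1)" by (rule prob_space_normal_density) simp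
  have "(\<integral>\<^sup>+x. ennreal (exp (a * x)) \<partial>std_normal_distribution) =
    (\<integral>\<^sup>+x. ennreal (std_normal_density x * exp (a * x)) \<partial>lborel)"
    by (subst nn_integral_density) (auto simp: ennreal_mult' normal_density_nonneg)
  also have "\<dots> = (\<integral>\<^sup>+x. ennreal (exp (a\<^sup>2 / 2)) * ennreal (normal_density a 1 x) \<partial>lborel)"
    unfolding e by (simp add: ennreal_mult')
  also have "\<dots> = ennreal (exp (a\<^sup>2 / 2)) * (\<integral>\<^sup>+x. ennreal (normal_density a 1 x) \<partial>lborel)"
    by (rule nn_integral_cmult) simp
  also have "(\<integral>\<^sup>+x. ennreal (normal_density a 1 x) \<partial>lborel) = 1"
    using N.emeasure_space_1 by (simp add: emeasure_density cong: nn_integral_cong)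
  finally have nn: "(\<integral>\<^sup>+x. ennreal (exp (a * x)) \<partial>std_normal_distribution) = ennreal (exp (a\<^sup>2 / 2))" by simp
  show "integrable std_normal_distribution (\<lambda>x. exp (a * x))"
    by (rule integrableI_nonneg) (auto simp: nn)
  show "(\<integral>x. exp (a * x) \<partial>std_normal_distribution) = exp (a\<^sup>2 / 2)"
    by (rule integral_eq_nn_integral[THEN trans]) (auto simp: nn)
qed

context prob_space
begin

lemma normal_law_moments:
  fixes Z :: "'a \<Rightarrow> real"
  assumes Z: "Z \<in> borel_measurable M" and law: "distr M borel Z = normal_law 0 \<sigma>" and s: "0 \<le> \<sigma>"
  shows "integrable M Z" "(\<integral>\<omega>. Z \<omega> \<partial>M) = 0" "integrable M (\<lambda>\<omega>. (Z \<omega>)\<^sup>2)" "(\<integral>\<omega>. (Z \<omega>)\<^sup>2 \<partial>M) = \<sigma>\<^sup>2"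
    "integrable M (\<lambda>\<omega>. exp (a * Z \<omega>))" "(\<integral>\<omega>. exp (a * Z \<omega>) \<partial>M) = exp (a\<^sup>2 * \<sigma>\<^sup>2 / 2)"
proof -
  have int: "integrable M (\<lambda>\<omega>. g (Z \<omega>)) \<longleftrightarrow> integrable std_normal_distribution (\<lambda>x. g (\<sigma> * x))"
    if [measurable]: "g \<in> borel_measurable borel" for g :: "real \<Rightarrow> real"
  proof -
    have "integrable M (\<lambda>\<omega>. g (Z \<omega>)) \<longleftrightarrow> integrable (distr M borel Z) g"
      using Z by (subst integrable_distr_eq) auto
    also have "\<dots> \<longleftrightarrow> integrable std_normal_distribution (\<lambda>x. g (\<sigma> * x))"
      unfolding law normal_law_eq_distr[OF s] by (subst integrable_distr_eq) auto
    finally show ?thesis .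
  qed
  have eq: "(\<integral>\<omega>. g (Z \<omega>) \<partial>M) = (\<integral>x. g (\<sigma> * x) \<partial>std_normal_distribution)"
    if [measurable]: "g \<in> borel_measurable borel" for g :: "real \<Rightarrow> real"
  proof -
    have "(\<integral>\<omega>. g (Z \<omega>) \<partial>M) = (\<integral>x. g x \<partial>distr M borel Z)"
      using Z by (subst integral_distr) auto
    also have "\<dots> = (\<integral>x. g (\<sigma> * x) \<partial>std_normal_distribution)"
      unfolding law normal_law_eq_distr[OF s] by (subst integral_distr) auto
    finally show ?thesis .
  qed
  have m1: "integrable std_normal_distribution (\<lambda>x. x)" using integrable_std_normal_distribution_moment[of 1] by simp
  have m1': "(\<integral>x. x \<partial>std_normal_distribution) = 0" using integral_std_normal_distribution_moment_odd[of 1] by simp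
  have m2: "integrable std_normal_distribution (\<lambda>x. x\<^sup>2)" using integrable_std_normal_distribution_moment[of 2] by simp
  have m2': "(\<integral>x. x\<^sup>2 \<partial>std_normal_distribution) = 1" using std_normal_distribution_even_moments(1)[of 1] by simp
  show "integrable M Z" using int[of "\<lambda>x. x"] integrable_mult_right[OF m1, of \<sigma>] by simp
  show "(\<integral>\<omega>. Z \<omega> \<partial>M) = 0" using eq[of "\<lambda>x. x"] m1' by simp
  show "integrable M (\<lambda>\<omega>. (Z \<omega>)\<^sup>2)"
    using int[of "\<lambda>x. x\<^sup>2"] integrable_mult_right[OF m2, of "\<sigma>\<^sup>2"] by (simp add: power_mult_distrib)
  show "(\<integral>\<omega>. (Z \<omega>)\<^sup>2 \<partial>M) = \<sigma>\<^sup>2" using eq[of "\<lambda>x. x\<^sup>2"] m2' by (simp add: power_mult_distrib)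
  show "integrable M (\<lambda>\<omega>. exp (a * Z \<omega>))"
    using int[of "\<lambda>x. exp (a * x)"] std_normal_exp(1)[of "a * \<sigma>"] by (simp add: mult.assoc)
  show "(\<integral>\<omega>. exp (a * Z \<omega>) \<partial>M) = exp (a\<^sup>2 * \<sigma>\<^sup>2 / 2)"
    using eq[of "\<lambda>x. exp (a * x)"] std_normal_exp(2)[of "a * \<sigma>"] by (simp add: mult.assoc power_mult_distrib)
qed

text \<open>
  The maximum is bounded through the sum \<open>S\<close> of all \<open>exp (\<plusminus> \<theta> * Z a)\<close> and the tangent of the
  logarithm at an upper bound \<open>c\<close> of the mean of \<open>S\<close>. Degenerate laws are admitted, since
  increments of the process may vanish.
\<close>

lemma gaussian_maximal_ineq:
  fixes Z :: "'i \<Rightarrow> 'a \<Rightarrow> real"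
  assumes A: "finite A" "A \<noteq> {}" and Z: "\<And>a. a \<in> A \<Longrightarrow> Z a \<in> borel_measurable M"
    and law: "\<And>a. a \<in> A \<Longrightarrow> \<exists>\<tau>. 0 \<le> \<tau> \<and> \<tau> \<le> \<sigma> \<and> distr M borel (Z a) = normal_law 0 \<tau>"
    and s: "0 < \<sigma>" and L: "ln (2 * real (card A)) \<le> L" "0 < L"
  shows "integrable M (\<lambda>\<omega>. Max ((\<lambda>a. \<bar>Z a \<omega>\<bar>) ` A))" "(\<integral>\<omega>. Max ((\<lambda>a. \<bar>Z a \<omega>\<bar>) ` A) \<partial>M) \<le> 2 * \<sigma> * sqrt L"
proof -
  define \<theta> where "\<theta> = sqrt L / \<sigma>"
  have th: "0 < \<theta>" using s L by (simp add: \<theta>_def)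
  define c where "c = 2 * real (card A) * exp (\<theta>\<^sup>2 * \<sigma>\<^sup>2 / 2)"
  have N: "0 < real (card A)" using A by (simp add: card_gt_0_iff)
  have c0: "0 < c" using N by (simp add: c_def)
  have iZ: "integrable M (Z a)" and iE: "integrable M (\<lambda>\<omega>. exp (t * Z a \<omega>))"
    and E: "t\<^sup>2 = \<theta>\<^sup>2 \<Longrightarrow> (\<integral>\<omega>. exp (t * Z a \<omega>) \<partial>M) \<le> exp (\<theta>\<^sup>2 * \<sigma>\<^sup>2 / 2)" if a: "a \<in> A" for a t
  proof -
    obtain \<tau> where t: "0 \<le> \<tau>" "\<tau> \<le> \<sigma>" "distr M borel (Z a) = normal_law 0 \<tau>" using law[OF a] by blast
    note mm = normal_law_moments[OF Z[OF a] t(3,1)]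
    show "integrable M (Z a)" "integrable M (\<lambda>\<omega>. exp (t * Z a \<omega>))" by (fact mm)+
    have "\<tau>\<^sup>2 \<le> \<sigma>\<^sup>2" using t by (intro power_mono) auto
    then show "(\<integral>\<omega>. exp (t * Z a \<omega>) \<partial>M) \<le> exp (\<theta>\<^sup>2 * \<sigma>\<^sup>2 / 2)" if "t\<^sup>2 = \<theta>\<^sup>2"
      unfolding mm(6) that by (simp add: mult_left_mono divide_right_mono)
  qed
  show iM: "integrable M (\<lambda>\<omega>. Max ((\<lambda>a. \<bar>Z a \<omega>\<bar>) ` A))"
    by (rule integrable_Max_abs[OF A iZ])
  define S where "S \<omega> = (\<Sum>a\<in>A. exp (\<theta> * Z a \<omega>) + exp (- \<theta> * Z a \<omega>))" for \<omega>
  have iS: "integrable M S" unfolding S_def using iE by (intro Bochner_Integration.integrable_sum Bochner_Integration.integrable_add)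
  have "(\<integral>\<omega>. S \<omega> \<partial>M) = (\<Sum>a\<in>A. (\<integral>\<omega>. exp (\<theta> * Z a \<omega>) \<partial>M) + (\<integral>\<omega>. exp (- \<theta> * Z a \<omega>) \<partial>M))"
    unfolding S_def using iE by (subst Bochner_Integration.integral_sum) (auto intro!: sum.cong Bochner_Integration.integral_add Bochner_Integration.integrable_add iE simp: iE[of _ "- \<theta>", simplified])
  also have "\<dots> \<le> (\<Sum>a\<in>A. exp (\<theta>\<^sup>2 * \<sigma>\<^sup>2 / 2) + exp (\<theta>\<^sup>2 * \<sigma>\<^sup>2 / 2))"
    using E[of _ \<theta>] E[of _ "- \<theta>"] by (intro sum_mono add_mono) auto
  also have "\<dots> = c" by (simp add: c_def)
  finally have ES: "(\<integral>\<omega>. S \<omega> \<partial>M) \<le> c" .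
  have pt: "Max ((\<lambda>a. \<bar>Z a \<omega>\<bar>) ` A) \<le> (ln c + (S \<omega> - c) / c) / \<theta>" for \<omega>
  proof (subst Max_le_iff, use A in simp, use A in simp, intro ballI, elim imageE)
    fix z a assume z: "z = \<bar>Z a \<omega>\<bar>" and a: "a \<in> A"
    have "exp (\<theta> * z) \<le> exp (\<theta> * Z a \<omega>) + exp (- \<theta> * Z a \<omega>)" by (auto simp: z abs_if)
    also have "\<dots> \<le> S \<omega>" unfolding S_def
      using A a by (intro member_le_sum) (auto intro: add_nonneg_nonneg)
    finally have e: "exp (\<theta> * z) \<le> S \<omega>" .
    have "ln (exp (\<theta> * z) / c) \<le> exp (\<theta> * z) / c - 1" using c0 by (intro ln_le_minus_one) auto
    then have "\<theta> * z - ln c \<le> exp (\<theta> * z) / c - 1" using c0 by (subst (asm) ln_div) auto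
    also have "\<dots> \<le> S \<omega> / c - 1" using e c0 by (simp add: divide_right_mono)
    also have "\<dots> = (S \<omega> - c) / c" using c0 by (simp add: diff_divide_distrib)
    finally have "\<theta> * z \<le> ln c + (S \<omega> - c) / c" by simp
    then show "z \<le> (ln c + (S \<omega> - c) / c) / \<theta>" using th by (simp add: le_divide_eq mult.commute)
  qed
  have "(\<integral>\<omega>. Max ((\<lambda>a. \<bar>Z a \<omega>\<bar>) ` A) \<partial>M) \<le> (\<integral>\<omega>. (ln c + (S \<omega> - c) / c) / \<theta> \<partial>M)"
    using iS by (intro integral_mono iM pt) auto
  also have "\<dots> = (ln c + ((\<integral>\<omega>. S \<omega> \<partial>M) - c) / c) / \<theta>" using iS by (simp add: prob_space)
  also have "\<dots> \<le> ln c / \<theta>" using ES c0 th by (intro divide_right_mono) (auto simp: divide_nonpos_pos)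
  also have "ln c = ln (2 * real (card A)) + L / 2"
    unfolding c_def using N s L by (subst ln_mult_pos) (auto simp: \<theta>_def power_divide)
  also have "(ln (2 * real (card A)) + L / 2) / \<theta> \<le> (L + L) / \<theta>" using L th by (intro divide_right_mono) auto
  also have "\<dots> = 2 * \<sigma> * sqrt L" using L s by (simp add: \<theta>_def field_simps)
  finally show "(\<integral>\<omega>. Max ((\<lambda>a. \<bar>Z a \<omega>\<bar>) ` A) \<partial>M) \<le> 2 * \<sigma> * sqrt L" .
qed

end

section \<open>Independent standard normal coordinates\<close>

definition gauss_space :: "(nat \<Rightarrow> real) measure" where
  "gauss_space = PiM UNIV (\<lambda>_. std_normal_distribution)"

lemma prob_space_gauss_space: "prob_space gauss_space"
  unfolding gauss_space_def using real_dist_normal_dist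
  by (intro prob_space_PiM) (simp add: real_distribution_def)

interpretation gauss_space: prob_space gauss_space by (rule prob_space_gauss_space)

lemma sets_gauss_space: "sets gauss_space = sets borel"
proof -
  have "sets gauss_space = sets (PiM UNIV (\<lambda>_::nat. borel :: real measure))"
    unfolding gauss_space_def by (intro sets_PiM_cong) auto
  then show ?thesis by (simp add: sets_PiM_equal_borel)
qed

lemma space_gauss_space [simp]: "space gauss_space = UNIV"
  by (simp add: gauss_space_def space_PiM)

lemma measurable_gauss_space: "continuous_on UNIV g \<Longrightarrow> g \<in> borel_measurable gauss_space"
  using borel_measurable_continuous_onI measurable_cong_sets[OF sets_gauss_space refl] by blast

lemma coordinate_measurable [measurable]: "(\<lambda>\<omega>. \<omega> i) \<in> borel_measurable gauss_space"
  by (rule measurable_gauss_space) simp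

text \<open>
  Characteristic functions of independent coordinates multiply, so that linear combinations are
  recognised as normal with the squared coefficients adding up.
\<close>

lemma gauss_space_linear_law:
  assumes "finite I"
  shows "distr gauss_space borel (\<lambda>\<omega>. \<Sum>i\<in>I. \<alpha> i * \<omega> i) = normal_law 0 (sqrt (\<Sum>i\<in>I. (\<alpha> i)\<^sup>2))"
proof (rule normal_lawI)
  show "real_distribution (distr gauss_space borel (\<lambda>\<omega>. \<Sum>i\<in>I. \<alpha> i * \<omega> i))"
    by (rule gauss_space.real_distribution_distr) measurable
  show "0 \<le> sqrt (\<Sum>i\<in>I. (\<alpha> i)\<^sup>2)" by (simp add: sum_nonneg)
  fix t :: real
  have comp: "distr gauss_space std_normal_distribution (\<lambda>\<omega>. \<omega> i) = std_normal_distribution" for i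
    unfolding gauss_space_def using real_dist_normal_dist
    by (intro distr_PiM_component) (auto simp: real_distribution_def)
  have "gauss_space.indep_vars (\<lambda>_. std_normal_distribution) (\<lambda>i \<omega>. \<omega> i) UNIV"
  proof (subst gauss_space.indep_vars_iff_distr_eq_PiM)
    show "(\<lambda>\<omega>. \<omega> i) \<in> measurable gauss_space std_normal_distribution" for i
      unfolding gauss_space_def by (rule measurable_component_singleton) simp
    have "distr gauss_space (PiM UNIV (\<lambda>i. std_normal_distribution)) (\<lambda>x. \<lambda>i\<in>UNIV. x i) = gauss_space"
      by (simp add: gauss_space_def[symmetric] restrict_def distr_id2)
    then show "distr gauss_space (PiM UNIV (\<lambda>i. std_normal_distribution)) (\<lambda>x. \<lambda>i\<in>UNIV. x i) =
      PiM UNIV (\<lambda>i. distr gauss_space std_normal_distribution (\<lambda>\<omega>. \<omega> i))"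
      unfolding comp by (simp add: gauss_space_def)
  qed simp
  then have "gauss_space.indep_vars (\<lambda>_. borel) (\<lambda>i \<omega>. \<alpha> i * \<omega> i) UNIV"
    by (rule gauss_space.indep_vars_compose2) auto
  then have ind: "gauss_space.indep_vars (\<lambda>_. borel) (\<lambda>i \<omega>. \<alpha> i * \<omega> i) I"
    by (rule gauss_space.indep_vars_subset) auto
  have one: "char (distr gauss_space borel (\<lambda>\<omega>. \<alpha> i * \<omega> i)) t = complex_of_real (exp (- ((\<alpha> i * t)\<^sup>2) / 2))" for i
  proof -
    have m: "(\<lambda>\<omega>. \<omega> i) \<in> measurable gauss_space std_normal_distribution"
      unfolding gauss_space_def by (rule measurable_component_singleton) simp
    have "char (distr gauss_space borel (\<lambda>\<omega>. \<alpha> i * \<omega> i)) t = (CLINT \<omega>|gauss_space. iexp ((\<alpha> i * t) * \<omega> i))"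
      unfolding char_def by (subst integral_distr) (auto simp: mult_ac)
    also have "\<dots> = (CLINT x|distr gauss_space std_normal_distribution (\<lambda>\<omega>. \<omega> i). iexp ((\<alpha> i * t) * x))"
      using m by (subst integral_distr) auto
    also have "\<dots> = char std_normal_distribution (\<alpha> i * t)" unfolding comp char_def ..
    finally show ?thesis by (simp add: char_std_normal_distribution)
  qed
  have "char (distr gauss_space borel (\<lambda>\<omega>. \<Sum>i\<in>I. \<alpha> i * \<omega> i)) t = (\<Prod>i\<in>I. char (distr gauss_space borel (\<lambda>\<omega>. \<alpha> i * \<omega> i)) t)"
    by (rule gauss_space.char_distr_sum[OF ind])
  also have "\<dots> = complex_of_real (\<Prod>i\<in>I. exp (- ((\<alpha> i * t)\<^sup>2) / 2))" by (simp add: one)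
  also have "(\<Prod>i\<in>I. exp (- ((\<alpha> i * t)\<^sup>2) / 2)) = exp (\<Sum>i\<in>I. - ((\<alpha> i * t)\<^sup>2) / 2)"
    using assms by (simp add: exp_sum)
  also have "(\<Sum>i\<in>I. - ((\<alpha> i * t)\<^sup>2) / 2) = - ((sqrt (\<Sum>i\<in>I. (\<alpha> i)\<^sup>2))\<^sup>2 * t\<^sup>2) / 2"
    by (simp add: sum_nonneg power_mult_distrib sum_negf sum_divide_distrib[symmetric] sum_distrib_right)
  finally show "char (distr gauss_space borel (\<lambda>\<omega>. \<Sum>i\<in>I. \<alpha> i * \<omega> i)) t =
    complex_of_real (exp (- ((sqrt (\<Sum>i\<in>I. (\<alpha> i)\<^sup>2))\<^sup>2 * t\<^sup>2) / 2))" .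
qed

section \<open>Square-integrable functions\<close>

text \<open>
  Square-integrable functions with their inner product, as functions rather than classes modulo
  null sets; the inner product is then only semidefinite.
\<close>

definition L2 :: "'w measure \<Rightarrow> ('w \<Rightarrow> real) set" where
  "L2 M = {f \<in> borel_measurable M. integrable M (\<lambda>\<omega>. (f \<omega>)\<^sup>2)}"

definition ip :: "'w measure \<Rightarrow> ('w \<Rightarrow> real) \<Rightarrow> ('w \<Rightarrow> real) \<Rightarrow> real" where
  "ip M f g = (\<integral>\<omega>. f \<omega> * g \<omega> \<partial>M)"

lemma L2_prod_integrable:
  assumes "f \<in> L2 M" "g \<in> L2 M"
  shows "integrable M (\<lambda>\<omega>. f \<omega> * g \<omega>)"
proof (rule Bochner_Integration.integrable_bound)
  show "integrable M (\<lambda>\<omega>. (f \<omega>)\<^sup>2 + (g \<omega>)\<^sup>2)" using assms by (simp add: L2_def)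
  show "AE \<omega> in M. norm (f \<omega> * g \<omega>) \<le> norm ((f \<omega>)\<^sup>2 + (g \<omega>)\<^sup>2)"
  proof (rule AE_I2)
    fix \<omega>
    have "2 * \<bar>f \<omega>\<bar> * \<bar>g \<omega>\<bar> \<le> \<bar>f \<omega>\<bar>\<^sup>2 + \<bar>g \<omega>\<bar>\<^sup>2" by (rule sum_squares_bound)
    moreover have "0 \<le> \<bar>f \<omega>\<bar> * \<bar>g \<omega>\<bar>" by simp
    ultimately have "\<bar>f \<omega>\<bar> * \<bar>g \<omega>\<bar> \<le> (f \<omega>)\<^sup>2 + (g \<omega>)\<^sup>2" unfolding power2_abs mult.assoc by linarith
    then show "norm (f \<omega> * g \<omega>) \<le> norm ((f \<omega>)\<^sup>2 + (g \<omega>)\<^sup>2)" by (simp add: abs_mult)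
  qed
qed (use assms in \<open>auto simp: L2_def\<close>)

lemma L2_add: "f \<in> L2 M \<Longrightarrow> g \<in> L2 M \<Longrightarrow> (\<lambda>\<omega>. f \<omega> + g \<omega>) \<in> L2 M"
  using L2_prod_integrable[of f M g] by (auto simp: L2_def power2_sum mult.assoc)

lemma L2_scale: "f \<in> L2 M \<Longrightarrow> (\<lambda>\<omega>. c * f \<omega>) \<in> L2 M"
  by (auto simp: L2_def power_mult_distrib)

lemma L2_zero: "(\<lambda>\<omega>. 0) \<in> L2 M" by (simp add: L2_def)

lemma L2_diff: "f \<in> L2 M \<Longrightarrow> g \<in> L2 M \<Longrightarrow> (\<lambda>\<omega>. f \<omega> - g \<omega>) \<in> L2 M"
  using L2_add[of f M "\<lambda>\<omega>. (-1) * g \<omega>"] L2_scale[of g M "-1"] by simp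

lemma L2_sum: "(\<And>i. i \<in> I \<Longrightarrow> f i \<in> L2 M) \<Longrightarrow> (\<lambda>\<omega>. \<Sum>i\<in>I. f i \<omega>) \<in> L2 M"
  by (induction I rule: infinite_finite_induct) (auto intro: L2_zero L2_add)

lemma ip_commute: "ip M f g = ip M g f" by (simp add: ip_def mult.commute)

lemma ip_add_left: "f \<in> L2 M \<Longrightarrow> g \<in> L2 M \<Longrightarrow> h \<in> L2 M \<Longrightarrow> ip M (\<lambda>\<omega>. f \<omega> + g \<omega>) h = ip M f h + ip M g h"
  using L2_prod_integrable[of f M h] L2_prod_integrable[of g M h] by (simp add: ip_def distrib_right)

lemma ip_diff_left: "f \<in> L2 M \<Longrightarrow> g \<in> L2 M \<Longrightarrow> h \<in> L2 M \<Longrightarrow> ip M (\<lambda>\<omega>. f \<omega> - g \<omega>) h = ip M f h - ip M g h"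
  using L2_prod_integrable[of f M h] L2_prod_integrable[of g M h] by (simp add: ip_def left_diff_distrib)

lemma ip_scale_left: "ip M (\<lambda>\<omega>. c * f \<omega>) h = c * ip M f h"
  by (simp add: ip_def mult.assoc)

lemma ip_sum_left:
  assumes "\<And>i. i \<in> I \<Longrightarrow> f i \<in> L2 M" "h \<in> L2 M"
  shows "ip M (\<lambda>\<omega>. \<Sum>i\<in>I. f i \<omega>) h = (\<Sum>i\<in>I. ip M (f i) h)"
  unfolding ip_def sum_distrib_right
  using L2_prod_integrable assms by (intro Bochner_Integration.integral_sum) blast

lemma ip_add_self:
  assumes fg: "f \<in> L2 M" "g \<in> L2 M"
  shows "ip M (\<lambda>\<omega>. f \<omega> + g \<omega>) (\<lambda>\<omega>. f \<omega> + g \<omega>) = ip M f f + 2 * ip M f g + ip M g g"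
  using ip_add_left[OF fg L2_add[OF fg]] ip_add_left[OF fg fg(1)] ip_add_left[OF fg fg(2)]
    ip_commute[of M f "\<lambda>\<omega>. f \<omega> + g \<omega>"] ip_commute[of M g "\<lambda>\<omega>. f \<omega> + g \<omega>"] ip_commute[of M g f]
  by simp

lemma ip_diff_self:
  assumes fg: "f \<in> L2 M" "g \<in> L2 M"
  shows "ip M (\<lambda>\<omega>. f \<omega> - g \<omega>) (\<lambda>\<omega>. f \<omega> - g \<omega>) = ip M f f - 2 * ip M f g + ip M g g"
  using ip_diff_left[OF fg L2_diff[OF fg]] ip_diff_left[OF fg fg(1)] ip_diff_left[OF fg fg(2)]
    ip_commute[of M f "\<lambda>\<omega>. f \<omega> - g \<omega>"] ip_commute[of M g "\<lambda>\<omega>. f \<omega> - g \<omega>"] ip_commute[of M g f]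
  by simp

lemma ip_self_nonneg: "0 \<le> ip M f f" by (simp add: ip_def)

lemma ip_Cauchy_Schwarz:
  assumes f: "f \<in> L2 M" and g: "g \<in> L2 M"
  shows "(ip M f g)\<^sup>2 \<le> ip M f f * ip M g g"
proof -
  have q: "0 \<le> ip M f f + 2 * t * ip M f g + t\<^sup>2 * ip M g g" for t
  proof -
    have tg: "(\<lambda>\<omega>. t * g \<omega>) \<in> L2 M" by (rule L2_scale[OF g])
    have "0 \<le> ip M (\<lambda>\<omega>. f \<omega> + t * g \<omega>) (\<lambda>\<omega>. f \<omega> + t * g \<omega>)" by (rule ip_self_nonneg)
    also have "\<dots> = ip M f (\<lambda>\<omega>. f \<omega> + t * g \<omega>) + t * ip M g (\<lambda>\<omega>. f \<omega> + t * g \<omega>)"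
      using ip_add_left[OF f tg L2_add[OF f tg]] by (simp add: ip_scale_left)
    also have "ip M f (\<lambda>\<omega>. f \<omega> + t * g \<omega>) = ip M f f + t * ip M f g"
      using ip_add_left[OF f tg f] by (simp add: ip_commute[of M f "\<lambda>\<omega>. f \<omega> + t * g \<omega>"] ip_scale_left ip_commute[of M g f])
    also have "ip M g (\<lambda>\<omega>. f \<omega> + t * g \<omega>) = ip M f g + t * ip M g g"
      using ip_add_left[OF f tg g] by (simp add: ip_commute[of M g "\<lambda>\<omega>. f \<omega> + t * g \<omega>"] ip_scale_left)
    finally show ?thesis by (simp add: algebra_simps power2_eq_square)
  qed
  show ?thesis
  proof (cases "ip M g g = 0")
    case True
    have "ip M f g = 0"
    proof (rule ccontr)
      assume n: "ip M f g \<noteq> 0"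
      have "0 \<le> ip M f f + 2 * (- (ip M f f + 1) / (2 * ip M f g)) * ip M f g"
        using q[of "- (ip M f f + 1) / (2 * ip M f g)"] True by simp
      also have "\<dots> = - 1" using n by (simp add: field_simps)
      finally show False by simp
    qed
    then show ?thesis using True by simp
  next
    case False
    then have g0: "0 < ip M g g" using ip_self_nonneg[of M g] by simp
    have "0 \<le> ip M f f - (ip M f g)\<^sup>2 / ip M g g"
      using q[of "- (ip M f g / ip M g g)"] g0 by (simp add: field_simps power2_eq_square)
    then show ?thesis using g0 by (simp add: field_simps)
  qed
qed

lemma ip_abs_le:
  assumes "f \<in> L2 M" "g \<in> L2 M"
  shows "\<bar>ip M f g\<bar> \<le> sqrt (ip M f f) * sqrt (ip M g g)"
  using real_sqrt_le_mono[OF ip_Cauchy_Schwarz[OF assms]] by (simp add: real_sqrt_mult)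

section \<open>Gram-Schmidt orthogonalisation\<close>

text \<open>
  A remainder \<open>r\<close> of norm zero gives the function \<open>0\<close>, as division by zero yields zero. So
  linearly dependent families need no separate treatment: the resulting functions are orthogonal
  and each of them has norm \<open>1\<close> or \<open>0\<close>.
\<close>

fun gram_schmidt :: "'w measure \<Rightarrow> (nat \<Rightarrow> 'w \<Rightarrow> real) \<Rightarrow> nat \<Rightarrow> 'w \<Rightarrow> real" where
  "gram_schmidt M Y j =
    (let r = (\<lambda>\<omega>. Y j \<omega> - (\<Sum>l<j. ip M (Y j) (gram_schmidt M Y l) * gram_schmidt M Y l \<omega>))
     in (\<lambda>\<omega>. r \<omega> / sqrt (ip M r r)))"

declare gram_schmidt.simps [simp del]

text \<open>
  The coefficients are those of \<open>Y j\<close> with respect to the orthogonalised family; a remainder of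
  norm zero has inner product zero with every function, by the Cauchy-Schwarz inequality, although
  it need not vanish everywhere. The matrix is a triangular square root of the Gram matrix, which
  makes it consistent for all \<open>n\<close>.
\<close>

lemma exists_gaussian_coefficients:
  fixes Y :: "nat \<Rightarrow> 'w \<Rightarrow> real"
  assumes Y: "\<And>j. Y j \<in> L2 M"
  shows "\<exists>b::nat \<Rightarrow> nat \<Rightarrow> real. (\<forall>j l. j < l \<longrightarrow> b j l = 0) \<and>
    (\<forall>i j n. i \<le> n \<longrightarrow> j \<le> n \<longrightarrow> ip M (Y i) (Y j) = (\<Sum>l\<le>n. b i l * b j l))"
proof -
  define e where "e = gram_schmidt M Y"
  define r where "r j = (\<lambda>\<omega>. Y j \<omega> - (\<Sum>l<j. ip M (Y j) (e l) * e l \<omega>))" for j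
  define s where "s j = sqrt (ip M (r j) (r j))" for j
  have e: "e j = (\<lambda>\<omega>. 1 / s j * r j \<omega>)" for j
    unfolding e_def s_def r_def by (subst gram_schmidt.simps) (simp add: Let_def)
  have eL: "e j \<in> L2 M" and rL: "r j \<in> L2 M" for j
  proof (induction j rule: less_induct)
    case (less j)
    show r: "r j \<in> L2 M" unfolding r_def using less Y by (intro L2_diff L2_sum L2_scale) auto
    show "e j \<in> L2 M" unfolding e by (rule L2_scale[OF r])
  qed
  define u where "u j = ip M (e j) (e j)" for j
  have s0: "0 \<le> s j" for j by (simp add: s_def ip_self_nonneg)
  have ssq: "ip M (r j) (r j) = s j * s j" for j by (simp add: s_def ip_self_nonneg)
  have u: "(s j = 0 \<and> e j = (\<lambda>\<omega>. 0) \<and> u j = 0) \<or> (s j \<noteq> 0 \<and> u j = 1)" for j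
  proof (cases "s j = 0")
    case True
    then have "e j = (\<lambda>\<omega>. 0)" by (simp add: e)
    then show ?thesis using True by (simp add: u_def ip_def)
  next
    case False
    have "u j = 1 / s j * (1 / s j * ip M (r j) (r j))"
      unfolding u_def by (simp only: e ip_scale_left ip_commute[of M "r j" "\<lambda>\<omega>. 1 / s j * r j \<omega>"])
    then show ?thesis using False by (simp add: ssq)
  qed
  have r_ip: "ip M (r j) g = s j * ip M (e j) g" if g: "g \<in> L2 M" for j g
  proof (cases "s j = 0")
    case True
    then have "ip M (r j) (r j) = 0" by (simp add: ssq)
    then have "ip M (r j) g = 0" using ip_Cauchy_Schwarz[OF rL g, of j] by simp
    then show ?thesis using True by simp
  next
    case False
    have "ip M (e j) g = 1 / s j * ip M (r j) g" by (simp only: e ip_scale_left)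
    then show ?thesis using False by simp
  qed
  have rexp: "ip M (r j) g = ip M (Y j) g - (\<Sum>l<j. ip M (Y j) (e l) * ip M (e l) g)" if g: "g \<in> L2 M" for j g
  proof -
    have "ip M (r j) g = ip M (Y j) g - ip M (\<lambda>\<omega>. \<Sum>l<j. ip M (Y j) (e l) * e l \<omega>) g"
      unfolding r_def by (intro ip_diff_left Y L2_sum L2_scale eL g)
    also have "ip M (\<lambda>\<omega>. \<Sum>l<j. ip M (Y j) (e l) * e l \<omega>) g = (\<Sum>l<j. ip M (\<lambda>\<omega>. ip M (Y j) (e l) * e l \<omega>) g)"
      by (intro ip_sum_left L2_scale eL g)
    finally show ?thesis by (simp add: ip_scale_left)
  qed
  have orth: "ip M (e j) (e l) = 0" if "l < j" for j l
    using that
  proof (induction j arbitrary: l rule: less_induct)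
    case (less j)
    have o: "ip M (e m) (e l) = (if m = l then u l else 0)" if "m < j" for m
    proof (cases m l rule: linorder_cases)
      case greater
      then show ?thesis using less.IH[OF that, of l] by simp
    next
      case 3: less
      then show ?thesis using less.IH[OF less.prems, of m] by (simp add: ip_commute)
    qed (simp add: u_def)
    have "(\<Sum>m<j. ip M (Y j) (e m) * ip M (e m) (e l)) = (\<Sum>m<j. if m = l then ip M (Y j) (e m) * u l else 0)"
      by (intro sum.cong) (auto simp: o)
    also have "\<dots> = ip M (Y j) (e l) * u l" using less.prems by simp
    finally have "ip M (r j) (e l) = ip M (Y j) (e l) * (1 - u l)"
      by (simp add: rexp[OF eL] algebra_simps)
    also have "\<dots> = 0" using u[of l] by (auto simp: ip_def)
    finally have "s j * ip M (e j) (e l) = 0" using r_ip[OF eL, of j l] by simp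
    then show ?case using u[of j] by (auto simp: ip_def)
  qed
  have on: "ip M (e m) (e l) = (if m = l then u l else 0)" for m l
    using orth[of l m] orth[of m l] by (cases m l rule: linorder_cases) (auto simp: u_def ip_commute)
  define a where "a j l = (if l < j then ip M (Y j) (e l) else if l = j then s j else 0)" for j l
  have Yexp: "ip M (Y j) g = (\<Sum>l\<le>n. a j l * ip M (e l) g)" if g: "g \<in> L2 M" and n: "j \<le> n" for j g n
  proof -
    have "(\<Sum>l\<le>n. a j l * ip M (e l) g) = (\<Sum>l\<le>j. a j l * ip M (e l) g)"
      using n by (intro sum.mono_neutral_right) (auto simp: a_def)
    also have "\<dots> = (\<Sum>l<j. ip M (Y j) (e l) * ip M (e l) g) + s j * ip M (e j) g"
      by (simp add: lessThan_Suc_atMost[symmetric] a_def)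
    also have "\<dots> = ip M (Y j) g" using rexp[OF g, of j] r_ip[OF g, of j] by simp
    finally show ?thesis by simp
  qed
  \<comment> \<open>\<open>u l\<close> is \<open>1\<close> or \<open>0\<close>: the columns of
    vanishing \<open>e l\<close> are removed\<close>
  define b where "b j l = a j l * u l" for j l
  have "ip M (Y i) (Y j) = (\<Sum>l\<le>n. b i l * b j l)" if "i \<le> n" "j \<le> n" for i j n
  proof -
    have "ip M (Y i) (Y j) = (\<Sum>l\<le>n. a i l * ip M (Y j) (e l))"
      using Yexp[OF Y that(1), of j] by (simp add: ip_commute)
    also have "\<dots> = (\<Sum>l\<le>n. a i l * (\<Sum>m\<le>n. a j m * ip M (e m) (e l)))"
      using Yexp[OF eL that(2)] by simp
    also have "\<dots> = (\<Sum>l\<le>n. b i l * b j l)"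
    proof (intro sum.cong refl)
      fix l assume "l \<in> {..n}"
      have "(\<Sum>m\<le>n. a j m * ip M (e m) (e l)) = (\<Sum>m\<le>n. if m = l then a j m * u l else 0)"
        by (intro sum.cong) (auto simp: on)
      also have "\<dots> = a j l * u l" using \<open>l \<in> {..n}\<close> by simp
      finally show "a i l * (\<Sum>m\<le>n. a j m * ip M (e m) (e l)) = b i l * b j l"
        using u[of l] by (auto simp: b_def)
    qed
    finally show ?thesis .
  qed
  moreover have "\<forall>j l. j < l \<longrightarrow> b j l = 0" by (simp add: b_def a_def)
  ultimately show ?thesis by blast
qed

section \<open>Gaussian processes by chaining\<close>

lemma continuous_on_linf_eval: "continuous_on UNIV (\<lambda>x. linf_eval x t)"
  unfolding continuous_on_iff
proof (intro ballI allI impI)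
  fix x and e :: real assume e: "0 < e"
  show "\<exists>d>0. \<forall>x'\<in>UNIV. dist x' x < d \<longrightarrow> dist (linf_eval x' t) (linf_eval x t) < e"
    using e dist_linf_ge[of _ t x] by (intro exI[of _ e]) (auto simp: dist_real_def intro: le_less_trans)
qed

text \<open>
  Given square-integrable \<open>Y\<close> and partitions into \<open>\<nu> j\<close> cells of \<open>L2\<close>-diameter at most \<open>C / 2 ^ j\<close>
  with finite entropy sums, a Gaussian process \<open>N\<close> with the second moments of \<open>Y\<close> and with bounded
  sample paths is constructed on the standard Gaussian space. The bounds \<open>E i\<close> on the tails of the
  entropy sum control the oscillation of \<open>N\<close> over the cells of level \<open>i\<close>.
\<close>

locale gaussian_chain = prob_space M for M :: "'w measure" +
  fixes Y :: "'t \<Rightarrow> 'w \<Rightarrow> real" and c :: "nat \<Rightarrow> 't \<Rightarrow> nat" and \<nu> :: "nat \<Rightarrow> nat" and C :: real and E :: "nat \<Rightarrow> real"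
  assumes Y: "\<And>t. Y t \<in> L2 M"
    and index: "\<And>j t. c j t < \<nu> j"
    and close: "\<And>j s t. c j s = c j t \<Longrightarrow> ip M (\<lambda>\<omega>. Y s \<omega> - Y t \<omega>) (\<lambda>\<omega>. Y s \<omega> - Y t \<omega>) \<le> (C / 2 ^ j)\<^sup>2"
    and C: "0 < C"
    and entropy: "\<And>i J. (\<Sum>j=i..J. 1 / 2 ^ j * sqrt (ln (real (\<nu> j)))) \<le> E i"
begin

text \<open>
  The process \<open>Z\<close> lives on the countable set \<open>D\<close> of representatives, enumerated by \<open>\<tau>\<close> and with
  index \<open>ix\<close>. It is a finite linear combination of the coordinates, with the coefficients of
  \<open>exists_gaussian_coefficients\<close>.
\<close>

definition rep :: "nat \<Rightarrow> 't \<Rightarrow> 't" where "rep j t = (SOME s. c j s = c j t)"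
definition D :: "'t set" where "D = (\<Union>j. range (rep j))"
definition \<tau> :: "nat \<Rightarrow> 't" where "\<tau> = from_nat_into D"
definition ix :: "'t \<Rightarrow> nat" where "ix t = (SOME i. \<tau> i = t)"
definition b :: "nat \<Rightarrow> nat \<Rightarrow> real" where
  "b = (SOME b. (\<forall>j l. j < l \<longrightarrow> b j l = 0) \<and>
    (\<forall>i j n. i \<le> n \<longrightarrow> j \<le> n \<longrightarrow> ip M (Y (\<tau> i)) (Y (\<tau> j)) = (\<Sum>l\<le>n. b i l * b j l)))"
definition Z :: "'t \<Rightarrow> (nat \<Rightarrow> real) \<Rightarrow> real" where "Z t \<omega> = (\<Sum>l\<le>ix t. b (ix t) l * \<omega> l)"
definition dsq :: "'t \<Rightarrow> 't \<Rightarrow> real" where "dsq s t = ip M (\<lambda>\<omega>. Y s \<omega> - Y t \<omega>) (\<lambda>\<omega>. Y s \<omega> - Y t \<omega>)"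

lemma c_rep [simp]: "c j (rep j t) = c j t"
  unfolding rep_def by (rule someI[of _ t]) simp

lemma rep_cong: "c j s = c j t \<Longrightarrow> rep j s = rep j t" by (simp add: rep_def)

lemma range_rep: "finite (range (rep j))" "card (range (rep j)) \<le> \<nu> j"
proof -
  have sub: "range (rep j) \<subseteq> (\<lambda>i. SOME s. c j s = i) ` {..<\<nu> j}" using index by (auto simp: rep_def)
  show "finite (range (rep j))" using sub by (rule finite_subset) simp
  have "card (range (rep j)) \<le> card ((\<lambda>i. SOME s. c j s = i) ` {..<\<nu> j})" using sub by (intro card_mono) auto
  also have "\<dots> \<le> card {..<\<nu> j}" by (rule card_image_le) simp
  finally show "card (range (rep j)) \<le> \<nu> j" by simp
qed

lemma rep_in_D: "rep j t \<in> D" by (auto simp: D_def)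

lemma tau_ix: "t \<in> D \<Longrightarrow> \<tau> (ix t) = t"
proof -
  assume t: "t \<in> D"
  have "countable D" unfolding D_def using range_rep(1) by (intro countable_UN) (auto intro: countable_finite)
  then have "range \<tau> = D" unfolding \<tau>_def using t by (intro range_from_nat_into) auto
  then obtain i where "\<tau> i = t" using t by (metis imageE)
  then show "\<tau> (ix t) = t" unfolding ix_def by (rule someI)
qed

lemma b_props: "j < l \<Longrightarrow> b j l = 0"
    "i \<le> n \<Longrightarrow> j \<le> n \<Longrightarrow> ip M (Y (\<tau> i)) (Y (\<tau> j)) = (\<Sum>l\<le>n. b i l * b j l)"
proof -
  have "\<exists>b::nat \<Rightarrow> nat \<Rightarrow> real. (\<forall>j l. j < l \<longrightarrow> b j l = 0) \<and>
    (\<forall>i j n. i \<le> n \<longrightarrow> j \<le> n \<longrightarrow> ip M (Y (\<tau> i)) (Y (\<tau> j)) = (\<Sum>l\<le>n. b i l * b j l))"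
    using exists_gaussian_coefficients[of "\<lambda>i. Y (\<tau> i)" M] Y by simp
  from someI_ex[OF this, folded b_def]
  show "j < l \<Longrightarrow> b j l = 0" "i \<le> n \<Longrightarrow> j \<le> n \<Longrightarrow> ip M (Y (\<tau> i)) (Y (\<tau> j)) = (\<Sum>l\<le>n. b i l * b j l)" by auto
qed

lemma continuous_on_Z: "continuous_on UNIV (Z t)"
  unfolding Z_def[abs_def] by (intro continuous_intros continuous_on_product_coordinates)

lemma Z_measurable [measurable]: "Z t \<in> borel_measurable gauss_space"
  by (rule measurable_gauss_space[OF continuous_on_Z])

lemma ip_sum_sum:
  assumes "finite I" "\<And>i. i \<in> I \<Longrightarrow> f i \<in> L2 M"
  shows "ip M (\<lambda>\<omega>. \<Sum>i\<in>I. \<alpha> i * f i \<omega>) (\<lambda>\<omega>. \<Sum>i\<in>I. \<alpha> i * f i \<omega>) = (\<Sum>i\<in>I. \<Sum>j\<in>I. \<alpha> i * \<alpha> j * ip M (f i) (f j))"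
proof -
  have L: "(\<lambda>\<omega>. \<Sum>i\<in>I. \<alpha> i * f i \<omega>) \<in> L2 M" using assms by (intro L2_sum L2_scale)
  have "ip M (\<lambda>\<omega>. \<Sum>i\<in>I. \<alpha> i * f i \<omega>) (\<lambda>\<omega>. \<Sum>i\<in>I. \<alpha> i * f i \<omega>) = (\<Sum>i\<in>I. \<alpha> i * ip M (f i) (\<lambda>\<omega>. \<Sum>i\<in>I. \<alpha> i * f i \<omega>))"
    using assms L by (subst ip_sum_left) (auto intro: L2_scale simp: ip_scale_left)
  also have "\<dots> = (\<Sum>i\<in>I. \<alpha> i * (\<Sum>j\<in>I. \<alpha> j * ip M (f j) (f i)))"
  proof (intro sum.cong refl arg_cong2[where f = "(*)"])
    fix i assume i: "i \<in> I"
    have "ip M (f i) (\<lambda>\<omega>. \<Sum>i\<in>I. \<alpha> i * f i \<omega>) = ip M (\<lambda>\<omega>. \<Sum>i\<in>I. \<alpha> i * f i \<omega>) (f i)" by (rule ip_commute)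
    also have "\<dots> = (\<Sum>j\<in>I. ip M (\<lambda>\<omega>. \<alpha> j * f j \<omega>) (f i))" using assms i by (intro ip_sum_left L2_scale) auto
    finally show "ip M (f i) (\<lambda>\<omega>. \<Sum>i\<in>I. \<alpha> i * f i \<omega>) = (\<Sum>j\<in>I. \<alpha> j * ip M (f j) (f i))" by (simp add: ip_scale_left)
  qed
  also have "\<dots> = (\<Sum>i\<in>I. \<Sum>j\<in>I. \<alpha> i * \<alpha> j * ip M (f i) (f j))"
    by (simp add: sum_distrib_left ip_commute mult.assoc)
  finally show ?thesis .
qed

text \<open>
  The coefficients have the same inner products as the variables \<open>Y\<close> on \<open>D\<close>, so a linear
  combination of values of \<open>Z\<close> is normal with the second moment of the corresponding combination
  of \<open>Y\<close>.
\<close>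

lemma Z_law:
  assumes I: "finite I" and t: "\<And>i. i \<in> I \<Longrightarrow> t i \<in> D"
  shows "distr gauss_space borel (\<lambda>\<omega>. \<Sum>i\<in>I. \<alpha> i * Z (t i) \<omega>) =
    normal_law 0 (sqrt (ip M (\<lambda>\<omega>. \<Sum>i\<in>I. \<alpha> i * Y (t i) \<omega>) (\<lambda>\<omega>. \<Sum>i\<in>I. \<alpha> i * Y (t i) \<omega>)))"
proof -
  define n where "n = (\<Sum>i\<in>I. ix (t i))"
  have n: "ix (t i) \<le> n" if "i \<in> I" for i unfolding n_def using I that by (intro member_le_sum) auto
  have Zn: "Z (t i) \<omega> = (\<Sum>l\<le>n. b (ix (t i)) l * \<omega> l)" if "i \<in> I" for i \<omega>
    unfolding Z_def using n[OF that] by (intro sum.mono_neutral_left) (auto simp: b_props(1))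
  have "(\<lambda>\<omega>. \<Sum>i\<in>I. \<alpha> i * Z (t i) \<omega>) = (\<lambda>\<omega>. \<Sum>l\<le>n. (\<Sum>i\<in>I. \<alpha> i * b (ix (t i)) l) * \<omega> l)"
  proof
    fix \<omega>
    have "(\<Sum>i\<in>I. \<alpha> i * Z (t i) \<omega>) = (\<Sum>i\<in>I. \<Sum>l\<le>n. \<alpha> i * b (ix (t i)) l * \<omega> l)"
      by (intro sum.cong) (auto simp: Zn sum_distrib_left mult.assoc)
    also have "\<dots> = (\<Sum>l\<le>n. \<Sum>i\<in>I. \<alpha> i * b (ix (t i)) l * \<omega> l)" by (rule sum.swap)
    finally show "(\<Sum>i\<in>I. \<alpha> i * Z (t i) \<omega>) = (\<Sum>l\<le>n. (\<Sum>i\<in>I. \<alpha> i * b (ix (t i)) l) * \<omega> l)"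
      by (simp add: sum_distrib_right)
  qed
  then have 1: "distr gauss_space borel (\<lambda>\<omega>. \<Sum>i\<in>I. \<alpha> i * Z (t i) \<omega>) =
     normal_law 0 (sqrt (\<Sum>l\<le>n. (\<Sum>i\<in>I. \<alpha> i * b (ix (t i)) l)\<^sup>2))"
    using gauss_space_linear_law[of "{..n}" "\<lambda>l. \<Sum>i\<in>I. \<alpha> i * b (ix (t i)) l"] by simp
  have "ip M (\<lambda>\<omega>. \<Sum>i\<in>I. \<alpha> i * Y (t i) \<omega>) (\<lambda>\<omega>. \<Sum>i\<in>I. \<alpha> i * Y (t i) \<omega>) =
     (\<Sum>i\<in>I. \<Sum>j\<in>I. \<alpha> i * \<alpha> j * ip M (Y (t i)) (Y (t j)))"
    by (rule ip_sum_sum[OF I Y])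
  also have "\<dots> = (\<Sum>i\<in>I. \<Sum>j\<in>I. \<Sum>l\<le>n. (\<alpha> i * b (ix (t i)) l) * (\<alpha> j * b (ix (t j)) l))"
  proof (intro sum.cong refl)
    fix i j assume "i \<in> I" "j \<in> I"
    then have "ip M (Y (t i)) (Y (t j)) = (\<Sum>l\<le>n. b (ix (t i)) l * b (ix (t j)) l)"
      using b_props(2)[OF n n, of i j] by (simp add: tau_ix t)
    then show "\<alpha> i * \<alpha> j * ip M (Y (t i)) (Y (t j)) = (\<Sum>l\<le>n. (\<alpha> i * b (ix (t i)) l) * (\<alpha> j * b (ix (t j)) l))"
      by (simp add: sum_distrib_left mult_ac)
  qed
  also have "\<dots> = (\<Sum>i\<in>I. \<Sum>l\<le>n. \<Sum>j\<in>I. (\<alpha> i * b (ix (t i)) l) * (\<alpha> j * b (ix (t j)) l))"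
    by (intro sum.cong refl sum.swap)
  also have "\<dots> = (\<Sum>l\<le>n. \<Sum>i\<in>I. \<Sum>j\<in>I. (\<alpha> i * b (ix (t i)) l) * (\<alpha> j * b (ix (t j)) l))"
    by (rule sum.swap)
  also have "\<dots> = (\<Sum>l\<le>n. (\<Sum>i\<in>I. \<alpha> i * b (ix (t i)) l)\<^sup>2)"
    by (simp add: power2_eq_square sum_product)
  finally show ?thesis using 1 by simp
qed

lemma dsq_triangle: "dsq r t \<le> 2 * dsq r s + 2 * dsq s t"
proof -
  define f g where "f = (\<lambda>\<omega>. Y r \<omega> - Y s \<omega>)" and "g = (\<lambda>\<omega>. Y s \<omega> - Y t \<omega>)"
  have fg: "f \<in> L2 M" "g \<in> L2 M" unfolding f_def g_def by (intro L2_diff Y)+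
  have "dsq r t = (\<integral>\<omega>. (f \<omega> + g \<omega>)\<^sup>2 \<partial>M)" by (simp add: dsq_def ip_def f_def g_def power2_eq_square)
  also have "\<dots> \<le> (\<integral>\<omega>. 2 * (f \<omega>)\<^sup>2 + 2 * (g \<omega>)\<^sup>2 \<partial>M)"
  proof (rule integral_mono)
    show "integrable M (\<lambda>\<omega>. (f \<omega> + g \<omega>)\<^sup>2)" using L2_add[OF fg] by (simp add: L2_def)
    show "integrable M (\<lambda>\<omega>. 2 * (f \<omega>)\<^sup>2 + 2 * (g \<omega>)\<^sup>2)" using fg by (simp add: L2_def)
    show "(f \<omega> + g \<omega>)\<^sup>2 \<le> 2 * (f \<omega>)\<^sup>2 + 2 * (g \<omega>)\<^sup>2" for \<omega>
      using sum_squares_bound[of "f \<omega>" "g \<omega>"] by (simp add: power2_sum)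
  qed
  also have "\<dots> = 2 * dsq r s + 2 * dsq s t" using fg by (simp add: dsq_def ip_def f_def g_def power2_eq_square L2_def)
  finally show ?thesis .
qed

lemma dsq_rep: "dsq (rep j t) t \<le> (C / 2 ^ j)\<^sup>2" "dsq t (rep j t) \<le> (C / 2 ^ j)\<^sup>2"
  unfolding dsq_def by (rule close; simp)+

text \<open>
  The links of the Gaussian chain. There are at most \<open>\<nu> j * \<nu> (Suc j)\<close> of them.
\<close>

definition P :: "nat \<Rightarrow> ('t \<times> 't) set" where "P j = range (\<lambda>t. (rep (Suc j) t, rep j t))"
definition inc :: "nat \<Rightarrow> (nat \<Rightarrow> real) \<Rightarrow> real" where
  "inc j \<omega> = Max ((\<lambda>p. \<bar>Z (fst p) \<omega> - Z (snd p) \<omega>\<bar>) ` P j)"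
definition Lg :: "nat \<Rightarrow> real" where "Lg j = 1 + ln (real (\<nu> j)) + ln (real (\<nu> (Suc j)))"

lemma nu_pos: "1 \<le> \<nu> j" using index[of j undefined] by linarith

lemma ln_nu: "0 \<le> ln (real (\<nu> j))" using nu_pos[of j] by simp

lemma P_card: "finite (P j)" "P j \<noteq> {}" "ln (2 * real (card (P j))) \<le> Lg j"
proof -
  have sub: "P j \<subseteq> range (rep (Suc j)) \<times> range (rep j)" by (auto simp: P_def)
  show fin: "finite (P j)" using sub by (rule finite_subset) (use range_rep in auto)
  show ne: "P j \<noteq> {}" by (simp add: P_def)
  have "card (P j) \<le> card (range (rep (Suc j)) \<times> range (rep j))" using sub range_rep by (intro card_mono) auto
  also have "\<dots> = card (range (rep (Suc j))) * card (range (rep j))" by (rule card_cartesian_product)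
  also have "\<dots> \<le> \<nu> (Suc j) * \<nu> j" using range_rep by (intro mult_le_mono) auto
  finally have "real (card (P j)) \<le> real (\<nu> (Suc j)) * real (\<nu> j)" by (simp flip: of_nat_mult)
  then have "ln (2 * real (card (P j))) \<le> ln (2 * (real (\<nu> (Suc j)) * real (\<nu> j)))"
    using fin ne nu_pos[of j] nu_pos[of "Suc j"] by (subst ln_le_cancel_iff) (auto simp: card_gt_0_iff)
  also have "\<dots> = ln 2 + (ln (real (\<nu> (Suc j))) + ln (real (\<nu> j)))"
    using nu_pos[of j] nu_pos[of "Suc j"] by (simp add: ln_mult_pos)
  also have "ln 2 \<le> (1::real)" using ln_2_less_1 by simp
  finally show "ln (2 * real (card (P j))) \<le> Lg j" by (simp add: Lg_def)
qed

lemma inc_bound: "integrable gauss_space (inc j)" "(\<integral>\<omega>. inc j \<omega> \<partial>gauss_space) \<le> 4 * C * (1 / 2 ^ j * sqrt (Lg j))"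
proof -
  define \<sigma> where "\<sigma> = 2 * C / 2 ^ j"
  have s: "0 < \<sigma>" using C by (simp add: \<sigma>_def)
  have L0: "0 < Lg j" using ln_nu[of j] ln_nu[of "Suc j"] by (simp add: Lg_def)
  have law: "\<exists>\<tau>. 0 \<le> \<tau> \<and> \<tau> \<le> \<sigma> \<and> distr gauss_space borel (\<lambda>\<omega>. Z (fst p) \<omega> - Z (snd p) \<omega>) = normal_law 0 \<tau>" if pP: "p \<in> P j" for p
  proof -
    obtain t where p: "p = (rep (Suc j) t, rep j t)" using pP by (auto simp: P_def)
    define \<alpha> where "\<alpha> i = (if i then 1 else - 1::real)" for i
    define q where "q i = (if i then fst p else snd p)" for i
    have "distr gauss_space borel (\<lambda>\<omega>. \<Sum>i\<in>{True, False}. \<alpha> i * Z (q i) \<omega>) =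
      normal_law 0 (sqrt (ip M (\<lambda>\<omega>. \<Sum>i\<in>{True, False}. \<alpha> i * Y (q i) \<omega>) (\<lambda>\<omega>. \<Sum>i\<in>{True, False}. \<alpha> i * Y (q i) \<omega>)))"
      by (rule Z_law) (auto simp: q_def p rep_in_D)
    then have "distr gauss_space borel (\<lambda>\<omega>. Z (fst p) \<omega> - Z (snd p) \<omega>) = normal_law 0 (sqrt (dsq (fst p) (snd p)))"
      by (simp add: \<alpha>_def q_def dsq_def)
    moreover have "sqrt (dsq (fst p) (snd p)) \<le> \<sigma>"
    proof (rule real_le_lsqrt)
      show "0 \<le> \<sigma>" using s by simp
      have "dsq (fst p) (snd p) \<le> 2 * dsq (rep (Suc j) t) t + 2 * dsq t (rep j t)"
        unfolding p fst_conv snd_conv by (rule dsq_triangle)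
      also have "\<dots> \<le> 2 * (C / 2 ^ Suc j)\<^sup>2 + 2 * (C / 2 ^ j)\<^sup>2" using dsq_rep(1)[of "Suc j" t] dsq_rep(2)[of t j] by simp
      also have "\<dots> \<le> \<sigma>\<^sup>2" by (simp add: \<sigma>_def power_divide field_simps)
      finally show "dsq (fst p) (snd p) \<le> \<sigma>\<^sup>2" .
    qed
    ultimately show ?thesis by (intro exI[of _ "sqrt (dsq (fst p) (snd p))"]) (auto simp: dsq_def ip_self_nonneg)
  qed
  have m: "(\<lambda>\<omega>. Z (fst p) \<omega> - Z (snd p) \<omega>) \<in> borel_measurable gauss_space" for p by measurable
  note g = gauss_space.gaussian_maximal_ineq[OF P_card(1,2) m law s P_card(3) L0]
  show "integrable gauss_space (inc j)" unfolding inc_def[abs_def] by (rule g(1))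
  show "(\<integral>\<omega>. inc j \<omega> \<partial>gauss_space) \<le> 4 * C * (1 / 2 ^ j * sqrt (Lg j))"
    unfolding inc_def using g(2) by (simp add: \<sigma>_def)
qed

lemma inc_measurable [measurable]: "inc j \<in> borel_measurable gauss_space"
  using inc_bound(1) by auto

lemma inc_ge: "\<bar>Z (rep (Suc j) t) \<omega> - Z (rep j t) \<omega>\<bar> \<le> inc j \<omega>"
  unfolding inc_def
proof (rule Max_ge)
  show "\<bar>Z (rep (Suc j) t) \<omega> - Z (rep j t) \<omega>\<bar> \<in> (\<lambda>p. \<bar>Z (fst p) \<omega> - Z (snd p) \<omega>\<bar>) ` P j"
    by (rule image_eqI[of _ _ "(rep (Suc j) t, rep j t)"]) (auto simp: P_def)
qed (use P_card(1) in simp)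

lemma inc_nonneg: "0 \<le> inc j \<omega>" using inc_ge[of j undefined \<omega>] by linarith

lemma sum_Lg_le: "(\<Sum>j=i..J. 1 / 2 ^ j * sqrt (Lg j)) \<le> 2 / 2 ^ i + 3 * E i"
proof -
  have "sqrt (Lg j) \<le> 1 + sqrt (ln (real (\<nu> j))) + sqrt (ln (real (\<nu> (Suc j))))" for j
  proof -
    have "sqrt (Lg j) \<le> sqrt (1 + ln (real (\<nu> j))) + sqrt (ln (real (\<nu> (Suc j))))"
      unfolding Lg_def using ln_nu by (intro sqrt_add_le_add_sqrt) (auto intro: add_nonneg_nonneg)
    also have "sqrt (1 + ln (real (\<nu> j))) \<le> sqrt 1 + sqrt (ln (real (\<nu> j)))"
      using ln_nu by (intro sqrt_add_le_add_sqrt) auto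
    finally show ?thesis by simp
  qed
  then have "(\<Sum>j=i..J. 1 / 2 ^ j * sqrt (Lg j)) \<le>
    (\<Sum>j=i..J. 1 / 2 ^ j * (1 + sqrt (ln (real (\<nu> j))) + sqrt (ln (real (\<nu> (Suc j))))))"
    by (intro sum_mono mult_left_mono) auto
  also have "\<dots> = (\<Sum>j=i..J. 1 / 2 ^ j) + (\<Sum>j=i..J. 1 / 2 ^ j * sqrt (ln (real (\<nu> j))))
      + 2 * (\<Sum>j=i..J. 1 / 2 ^ Suc j * sqrt (ln (real (\<nu> (Suc j)))))"
    by (simp add: sum.distrib[symmetric] sum_distrib_left) (intro sum.cong refl, simp add: field_simps)
  also have "(\<Sum>j=i..J. 1 / 2 ^ Suc j * sqrt (ln (real (\<nu> (Suc j))))) \<le> E i"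
  proof -
    have "(\<Sum>j=i..J. 1 / 2 ^ Suc j * sqrt (ln (real (\<nu> (Suc j))))) = (\<Sum>j=Suc i..Suc J. 1 / 2 ^ j * sqrt (ln (real (\<nu> j))))"
      by (rule sum.shift_bounds_cl_Suc_ivl[symmetric])
    also have "\<dots> \<le> (\<Sum>j=i..Suc J. 1 / 2 ^ j * sqrt (ln (real (\<nu> j))))"
      using ln_nu by (intro sum_mono2) auto
    also have "\<dots> \<le> E i" by (rule entropy)
    finally show ?thesis .
  qed
  also have "(\<Sum>j=i..J. 1 / 2 ^ j * sqrt (ln (real (\<nu> j)))) \<le> E i" by (rule entropy)
  also have "(\<Sum>j=i..J. 1 / 2 ^ j) \<le> (2::real) / 2 ^ i"
  proof (cases "i \<le> J")
    case True
    have "(\<Sum>j=i..J. (1::real) / 2 ^ j) = 2 / 2 ^ i - 1 / 2 ^ J"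
      using True
    proof (induction rule: dec_induct)
      case (step n)
      have "(\<Sum>j=i..Suc n. (1::real) / 2 ^ j) = (\<Sum>j=i..n. 1 / 2 ^ j) + 1 / 2 ^ Suc n" using step by simp
      also have "\<dots> = 2 / 2 ^ i - 1 / 2 ^ n + 1 / 2 ^ Suc n" by (simp only: step.IH)
      also have "\<dots> = 2 / 2 ^ i - 1 / 2 ^ Suc n" by (simp add: field_simps)
      finally show ?case .
    qed simp
    then show ?thesis by simp
  qed simp
  finally show ?thesis by simp
qed

definition tail :: "nat \<Rightarrow> (nat \<Rightarrow> real) \<Rightarrow> ennreal" where
  "tail i \<omega> = (\<Sum>j. ennreal (inc (j + i) \<omega>))"

lemma tail_measurable [measurable]: "tail i \<in> borel_measurable gauss_space"
  unfolding tail_def[abs_def] by measurable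

lemma tail_integral: "(\<integral>\<^sup>+\<omega>. tail i \<omega> \<partial>gauss_space) \<le> ennreal (4 * C * (2 / 2 ^ i + 3 * E i))"
proof -
  have "(\<integral>\<^sup>+\<omega>. tail i \<omega> \<partial>gauss_space) = (\<Sum>j. \<integral>\<^sup>+\<omega>. ennreal (inc (j + i) \<omega>) \<partial>gauss_space)"
    unfolding tail_def by (rule nn_integral_suminf) simp
  also have "\<dots> = (\<Sum>j. ennreal (\<integral>\<omega>. inc (j + i) \<omega> \<partial>gauss_space))"
    by (intro suminf_cong nn_integral_eq_integral inc_bound) (simp add: inc_nonneg)
  also have "\<dots> \<le> ennreal (4 * C * (2 / 2 ^ i + 3 * E i))"
  proof (rule suminf_le_const)
    fix n
    have "(\<Sum>j<n. ennreal (\<integral>\<omega>. inc (j + i) \<omega> \<partial>gauss_space)) = ennreal (\<Sum>j<n. \<integral>\<omega>. inc (j + i) \<omega> \<partial>gauss_space)"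
      by (rule sum_ennreal) (simp add: inc_nonneg integral_nonneg_AE)
    also have "\<dots> \<le> ennreal (4 * C * (2 / 2 ^ i + 3 * E i))"
    proof (rule ennreal_leI)
      have "(\<Sum>j<n. \<integral>\<omega>. inc (j + i) \<omega> \<partial>gauss_space) \<le> (\<Sum>j<n. 4 * C * (1 / 2 ^ (j + i) * sqrt (Lg (j + i))))"
        by (intro sum_mono inc_bound)
      also have "\<dots> = 4 * C * (\<Sum>j<n. 1 / 2 ^ (j + i) * sqrt (Lg (j + i)))"
        by (simp add: sum_distrib_left)
      also have "(\<Sum>j<n. 1 / 2 ^ (j + i) * sqrt (Lg (j + i))) = (\<Sum>j\<in>(\<lambda>j. j + i) ` {..<n}. 1 / 2 ^ j * sqrt (Lg j))"
        by (subst sum.reindex) auto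
      also have "\<dots> \<le> (\<Sum>j=i..n + i. 1 / 2 ^ j * sqrt (Lg j))"
      proof (rule sum_mono2)
        show "0 \<le> 1 / 2 ^ j * sqrt (Lg j)" for j using ln_nu[of j] ln_nu[of "Suc j"] by (simp add: Lg_def)
      qed auto
      also have "\<dots> \<le> 2 / 2 ^ i + 3 * E i" by (rule sum_Lg_le)
      finally show "(\<Sum>j<n. \<integral>\<omega>. inc (j + i) \<omega> \<partial>gauss_space) \<le> 4 * C * (2 / 2 ^ i + 3 * E i)" using C by simp
    qed
    finally show "(\<Sum>j<n. ennreal (\<integral>\<omega>. inc (j + i) \<omega> \<partial>gauss_space)) \<le> ennreal (4 * C * (2 / 2 ^ i + 3 * E i))" .
  qed (rule summableI)
  finally show ?thesis .
qed

text \<open>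
  The level-\<open>j\<close> approximation takes on each cell the value of \<open>Z\<close> at the representative. It is a
  linear combination of fixed functions with continuous coefficients, hence Borel measurable even
  where the space of bounded functions is not separable.
\<close>

definition step :: "nat \<Rightarrow> (nat \<Rightarrow> real) \<Rightarrow> 't linf" where
  "step j \<omega> = (\<Sum>s\<in>range (rep j). Z s \<omega> *\<^sub>R linf_ind {t. rep j t = s})"

lemma linf_eval_step: "linf_eval (step j \<omega>) t = Z (rep j t) \<omega>"
proof -
  have "linf_eval (step j \<omega>) t = (\<Sum>s\<in>range (rep j). if s = rep j t then Z s \<omega> else 0)"
    unfolding step_def linf_eval_sum linf_eval_scaleR linf_eval_ind by (intro sum.cong) (auto simp: indicator_def)
  then show ?thesis using range_rep(1)[of j] by simp
qed

lemma step_measurable [measurable]: "step j \<in> borel_measurable gauss_space"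
  unfolding step_def[abs_def]
  by (intro measurable_gauss_space continuous_on_sum continuous_on_scaleR continuous_on_const continuous_on_Z)

lemma dist_step: "dist (step (n + i) \<omega>) (step i \<omega>) \<le> (\<Sum>j<n. inc (j + i) \<omega>)"
proof (induction n)
  case (Suc n)
  have "dist (step (Suc (n + i)) \<omega>) (step (n + i) \<omega>) \<le> inc (n + i) \<omega>"
    by (rule dist_linf_le) (simp add: linf_eval_step inc_ge)
  then show ?case using Suc dist_triangle[of "step (Suc n + i) \<omega>" "step i \<omega>" "step (n + i) \<omega>"] by simp
qed simp

text \<open>
  On the event of probability one that the increments are summable, the step functions form a
  Cauchy sequence in the uniform metric; elsewhere \<open>N\<close> is set to \<open>0\<close>, so that \<open>N\<close> is a pointwise
  limit of Borel functions everywhere.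
\<close>

definition good :: "(nat \<Rightarrow> real) set" where "good = {\<omega>. tail 0 \<omega> \<noteq> \<infinity>}"
definition N :: "(nat \<Rightarrow> real) \<Rightarrow> 't linf" where
  "N \<omega> = (if \<omega> \<in> good then lim (\<lambda>j. step j \<omega>) else 0)"

lemma good_sets [measurable]: "good \<in> sets gauss_space"
proof -
  have "good = {\<omega> \<in> space gauss_space. tail 0 \<omega> \<noteq> \<infinity>}" by (auto simp: good_def)
  also have "\<dots> \<in> sets gauss_space" by measurable
  finally show ?thesis .
qed

lemma AE_good: "AE \<omega> in gauss_space. \<omega> \<in> good"
proof -
  have "(\<integral>\<^sup>+\<omega>. tail 0 \<omega> \<partial>gauss_space) \<noteq> \<infinity>" using tail_integral[of 0] by (auto simp: top_unique)
  then have "AE \<omega> in gauss_space. tail 0 \<omega> \<noteq> \<infinity>" by (intro nn_integral_PInf_AE) auto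
  then show ?thesis by (simp add: good_def)
qed

lemma inc_summable: "\<omega> \<in> good \<Longrightarrow> summable (\<lambda>j. inc j \<omega>)"
  using inc_nonneg by (intro summable_suminf_not_top) (auto simp: good_def tail_def)

lemma step_limit:
  assumes w: "\<omega> \<in> good"
  shows "(\<lambda>j. step j \<omega>) \<longlonglongrightarrow> N \<omega>"
proof -
  have "Cauchy (\<lambda>j. step j \<omega>)"
    unfolding Cauchy_altdef
  proof (intro allI impI)
    fix e :: real assume "0 < e"
    then obtain m0 where m0: "\<And>m n. m \<ge> m0 \<Longrightarrow> norm (sum (\<lambda>j. inc j \<omega>) {m..<n}) < e"
      using inc_summable[OF w] unfolding summable_Cauchy by blast
    have "dist (step m \<omega>) (step n \<omega>) < e" if mn: "m \<ge> m0" "n > m" for m n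
    proof -
      have "dist (step m \<omega>) (step n \<omega>) = dist (step ((n - m) + m) \<omega>) (step m \<omega>)" using mn by (simp add: dist_commute)
      also have "\<dots> \<le> (\<Sum>j<n - m. inc (j + m) \<omega>)" by (rule dist_step)
      also have "\<dots> = (\<Sum>j=m..<n. inc j \<omega>)"
        using mn sum.shift_bounds_nat_ivl[of "\<lambda>j. inc j \<omega>" 0 m "n - m"] by (simp add: atLeast0LessThan)
      also have "\<dots> < e" using m0[OF mn(1), of n] by simp
      finally show ?thesis .
    qed
    then show "\<exists>M. \<forall>m\<ge>M. \<forall>n>m. dist (step m \<omega>) (step n \<omega>) < e" by blast
  qed
  then show ?thesis using w by (simp add: N_def Cauchy_convergent_iff convergent_LIMSEQ_iff)
qed

lemma N_measurable [measurable]: "N \<in> borel_measurable gauss_space"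
proof (rule borel_measurable_LIMSEQ_metric)
  show "(\<lambda>\<omega>. if \<omega> \<in> good then step j \<omega> else 0) \<in> borel_measurable gauss_space" for j by measurable
  show "(\<lambda>j. if \<omega> \<in> good then step j \<omega> else 0) \<longlonglongrightarrow> N \<omega>" for \<omega>
    using step_limit[of \<omega>] by (auto simp: N_def)
qed

lemma N_eval_measurable [measurable]: "(\<lambda>\<omega>. linf_eval (N \<omega>) t) \<in> borel_measurable gauss_space"
  using measurable_compose[OF N_measurable borel_measurable_continuous_onI[OF continuous_on_linf_eval]] .

lemma dist_N_step:
  assumes w: "\<omega> \<in> good"
  shows "ennreal (dist (N \<omega>) (step i \<omega>)) \<le> tail i \<omega>"
proof -
  have sum: "summable (\<lambda>j. inc (j + i) \<omega>)" using inc_summable[OF w] by (rule summable_ignore_initial_segment)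
  have "(\<lambda>n. dist (step (n + i) \<omega>) (step i \<omega>)) \<longlonglongrightarrow> dist (N \<omega>) (step i \<omega>)"
    by (intro tendsto_intros LIMSEQ_ignore_initial_segment step_limit w)
  moreover have "dist (step (n + i) \<omega>) (step i \<omega>) \<le> (\<Sum>j. inc (j + i) \<omega>)" for n
    using dist_step[of n i \<omega>] sum_le_suminf[OF sum, of "{..<n}"] inc_nonneg by fastforce
  ultimately have "dist (N \<omega>) (step i \<omega>) \<le> (\<Sum>j. inc (j + i) \<omega>)" by (intro LIMSEQ_le_const2) auto
  then have "ennreal (dist (N \<omega>) (step i \<omega>)) \<le> ennreal (\<Sum>j. inc (j + i) \<omega>)" by (rule ennreal_leI)
  also have "\<dots> = tail i \<omega>" unfolding tail_def using sum inc_nonneg by (intro suminf_ennreal2[symmetric]) auto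
  finally show ?thesis .
qed

text \<open>
  Points of one cell share the value of \<open>step i\<close>, from which \<open>N\<close> differs by at most \<open>tail i\<close>.
\<close>

lemma N_oscillation:
  assumes "c i s = c i t"
  shows "ennreal \<bar>linf_eval (N \<omega>) s - linf_eval (N \<omega>) t\<bar> \<le> 2 * tail i \<omega>"
proof (cases "\<omega> \<in> good")
  case True
  have "\<bar>linf_eval (N \<omega>) s - linf_eval (N \<omega>) t\<bar> \<le>
    \<bar>linf_eval (N \<omega>) s - linf_eval (step i \<omega>) s\<bar> + \<bar>linf_eval (N \<omega>) t - linf_eval (step i \<omega>) t\<bar>"
    using rep_cong[OF assms] by (simp add: linf_eval_step)
  also have "\<dots> \<le> dist (N \<omega>) (step i \<omega>) + dist (N \<omega>) (step i \<omega>)" by (intro add_mono dist_linf_ge)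
  finally have "ennreal \<bar>linf_eval (N \<omega>) s - linf_eval (N \<omega>) t\<bar> \<le> ennreal (dist (N \<omega>) (step i \<omega>) + dist (N \<omega>) (step i \<omega>))"
    by (rule ennreal_leI)
  also have "\<dots> \<le> tail i \<omega> + tail i \<omega>" using dist_N_step[OF True, of i] by (subst ennreal_plus) (auto intro: add_mono)
  finally show ?thesis by (simp add: mult_2)
qed (simp add: N_def linf_eval_zero)

lemma ip_rep_limit: "(\<lambda>j. ip M (Y (rep j s)) (Y (rep j t))) \<longlonglongrightarrow> ip M (Y s) (Y t)"
proof -
  define f g where "f j = (\<lambda>\<omega>. Y (rep j s) \<omega> - Y s \<omega>)" and "g j = (\<lambda>\<omega>. Y (rep j t) \<omega> - Y t \<omega>)" for j
  have fg: "f j \<in> L2 M" "g j \<in> L2 M" for j unfolding f_def g_def by (intro L2_diff Y)+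
  have nf: "sqrt (ip M (f j) (f j)) \<le> C / 2 ^ j" and ng: "sqrt (ip M (g j) (g j)) \<le> C / 2 ^ j" for j
    using dsq_rep(1)[of j s] dsq_rep(1)[of j t] C by (auto simp: dsq_def f_def g_def intro!: real_le_lsqrt)
  have diff: "ip M (Y (rep j s)) (Y (rep j t)) - ip M (Y s) (Y t) = ip M (f j) (g j) + ip M (f j) (Y t) + ip M (g j) (Y s)" for j
  proof -
    have 1: "ip M (f j) h = ip M (Y (rep j s)) h - ip M (Y s) h" if "h \<in> L2 M" for h
      unfolding f_def by (intro ip_diff_left Y that)
    have 2: "ip M (g j) h = ip M (Y (rep j t)) h - ip M (Y t) h" if "h \<in> L2 M" for h
      unfolding g_def by (intro ip_diff_left Y that)
    show ?thesis
      using 1[OF fg(2)] 1[OF Y] 2[OF Y, of "rep j s"] 2[OF Y, of s]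
        ip_commute[of M "Y (rep j s)" "g j"] ip_commute[of M "Y s" "g j"]
        ip_commute[of M "Y (rep j t)" "Y (rep j s)"] ip_commute[of M "Y t" "Y (rep j s)"]
        ip_commute[of M "Y (rep j t)" "Y s"] ip_commute[of M "Y t" "Y s"]
      by simp
  qed
  define B where "B j = C / 2 ^ j * (C / 2 ^ j) + C / 2 ^ j * sqrt (ip M (Y t) (Y t)) + C / 2 ^ j * sqrt (ip M (Y s) (Y s))" for j :: nat
  have bd: "\<bar>ip M (Y (rep j s)) (Y (rep j t)) - ip M (Y s) (Y t)\<bar> \<le> B j" for j
  proof -
    have "\<bar>ip M (f j) (g j)\<bar> \<le> C / 2 ^ j * (C / 2 ^ j)"
      using ip_abs_le[OF fg] nf[of j] ng[of j] C by (intro order_trans[OF ip_abs_le[OF fg]] mult_mono) (auto simp: ip_self_nonneg)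
    moreover have "\<bar>ip M (f j) (Y t)\<bar> \<le> C / 2 ^ j * sqrt (ip M (Y t) (Y t))"
      using nf[of j] by (intro order_trans[OF ip_abs_le[OF fg(1) Y]] mult_right_mono) (auto simp: ip_self_nonneg)
    moreover have "\<bar>ip M (g j) (Y s)\<bar> \<le> C / 2 ^ j * sqrt (ip M (Y s) (Y s))"
      using ng[of j] by (intro order_trans[OF ip_abs_le[OF fg(2) Y]] mult_right_mono) (auto simp: ip_self_nonneg)
    ultimately show ?thesis unfolding diff B_def by linarith
  qed
  have B0: "B \<longlonglongrightarrow> 0"
  proof -
    have "(\<lambda>j. C * (1/2) ^ j) \<longlonglongrightarrow> C * 0" by (intro tendsto_intros LIMSEQ_power_zero) simp
    then have z: "(\<lambda>j. C / 2 ^ j) \<longlonglongrightarrow> 0" by (simp add: power_one_over)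
    have "B \<longlonglongrightarrow> 0 * 0 + 0 * sqrt (ip M (Y t) (Y t)) + 0 * sqrt (ip M (Y s) (Y s))"
      unfolding B_def[abs_def] by (intro tendsto_add tendsto_mult z tendsto_const)
    then show ?thesis by simp
  qed
  have "(\<lambda>j. ip M (Y (rep j s)) (Y (rep j t)) - ip M (Y s) (Y t)) \<longlonglongrightarrow> 0"
    by (rule Lim_null_comparison[OF always_eventually B0]) (simp add: bd)
  then show ?thesis by (rule LIM_zero_cancel)
qed

text \<open>
  The representatives converge in mean square, so the variances of the approximating normal
  combinations converge to the variance for \<open>Y\<close>; dominated convergence of the characteristic
  functions identifies the limit.
\<close>

lemma N_law:
  assumes I: "finite I"
  shows "distr gauss_space borel (\<lambda>\<omega>. \<Sum>t\<in>I. \<alpha> t * linf_eval (N \<omega>) t) =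
    normal_law 0 (sqrt (ip M (\<lambda>\<omega>. \<Sum>t\<in>I. \<alpha> t * Y t \<omega>) (\<lambda>\<omega>. \<Sum>t\<in>I. \<alpha> t * Y t \<omega>)))"
proof (rule normal_lawI)
  let ?v = "ip M (\<lambda>\<omega>. \<Sum>t\<in>I. \<alpha> t * Y t \<omega>) (\<lambda>\<omega>. \<Sum>t\<in>I. \<alpha> t * Y t \<omega>)"
  define v where "v j = ip M (\<lambda>\<omega>. \<Sum>t\<in>I. \<alpha> t * Y (rep j t) \<omega>) (\<lambda>\<omega>. \<Sum>t\<in>I. \<alpha> t * Y (rep j t) \<omega>)" for j
  define A where "A \<omega> = (\<Sum>t\<in>I. \<alpha> t * linf_eval (N \<omega>) t)" for \<omega>
  define A' where "A' j \<omega> = (\<Sum>t\<in>I. \<alpha> t * Z (rep j t) \<omega>)" for j \<omega>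
  have Am[measurable]: "A \<in> borel_measurable gauss_space" unfolding A_def[abs_def] by measurable
  have Am'[measurable]: "A' j \<in> borel_measurable gauss_space" for j unfolding A'_def[abs_def] by measurable
  show "real_distribution (distr gauss_space borel (\<lambda>\<omega>. \<Sum>t\<in>I. \<alpha> t * linf_eval (N \<omega>) t))"
    using Am unfolding A_def[abs_def] by (rule gauss_space.real_distribution_distr)
  show "0 \<le> sqrt ?v" by (simp add: ip_self_nonneg)
  fix u :: real
  have vlim: "v \<longlonglongrightarrow> ?v"
    unfolding v_def ip_sum_sum[OF I Y] by (intro tendsto_intros ip_rep_limit)
  have ch: "(CLINT \<omega>|gauss_space. iexp (u * A' j \<omega>)) = complex_of_real (exp (- (v j * u\<^sup>2) / 2))" for j
  proof -
    have "(CLINT \<omega>|gauss_space. iexp (u * A' j \<omega>)) = char (distr gauss_space borel (A' j)) u"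
      unfolding char_def by (subst integral_distr) auto
    also have "distr gauss_space borel (A' j) = normal_law 0 (sqrt (v j))"
      unfolding A'_def[abs_def] v_def by (rule Z_law[OF I rep_in_D])
    finally show ?thesis by (simp add: char_normal_law v_def ip_self_nonneg)
  qed
  have "(\<lambda>j. CLINT \<omega>|gauss_space. iexp (u * A' j \<omega>)) \<longlonglongrightarrow> (CLINT \<omega>|gauss_space. iexp (u * A \<omega>))"
  proof (rule integral_dominated_convergence[where w = "\<lambda>_. 1"])
    show "AE \<omega> in gauss_space. (\<lambda>j. iexp (u * A' j \<omega>)) \<longlonglongrightarrow> iexp (u * A \<omega>)"
      using AE_good
    proof eventually_elim
      case (elim \<omega>)
      have "(\<lambda>j. linf_eval (step j \<omega>) t) \<longlonglongrightarrow> linf_eval (N \<omega>) t" for t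
        using continuous_on_tendsto_compose[OF continuous_on_linf_eval step_limit[OF elim]] by simp
      then have "(\<lambda>j. A' j \<omega>) \<longlonglongrightarrow> A \<omega>"
        unfolding A'_def A_def linf_eval_step by (intro tendsto_intros) (simp add: linf_eval_step)
      then show ?case by (intro tendsto_intros)
    qed
  qed auto
  moreover have "(\<lambda>j. CLINT \<omega>|gauss_space. iexp (u * A' j \<omega>)) \<longlonglongrightarrow> complex_of_real (exp (- (?v * u\<^sup>2) / 2))"
    unfolding ch by (intro tendsto_intros vlim) simp
  ultimately have "(CLINT \<omega>|gauss_space. iexp (u * A \<omega>)) = complex_of_real (exp (- (?v * u\<^sup>2) / 2))"
    by (rule LIMSEQ_unique)
  moreover have "char (distr gauss_space borel A) u = (CLINT \<omega>|gauss_space. iexp (u * A \<omega>))"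
    unfolding char_def by (subst integral_distr) auto
  ultimately show "char (distr gauss_space borel (\<lambda>\<omega>. \<Sum>t\<in>I. \<alpha> t * linf_eval (N \<omega>) t)) u =
     complex_of_real (exp (- ((sqrt ?v)\<^sup>2 * u\<^sup>2) / 2))"
    by (simp add: A_def[abs_def] ip_self_nonneg)
qed

lemma N_gaussian: "gaussian_process gauss_space (\<lambda>t \<omega>. linf_eval (N \<omega>) t)"
  unfolding gaussian_process_def
proof (intro conjI allI impI)
  fix S :: "'t set" and a assume "finite S"
  from N_law[OF this, of a]
  show "\<exists>\<mu> \<sigma>. 0 \<le> \<sigma> \<and> distr gauss_space borel (\<lambda>\<omega>. \<Sum>t\<in>S. a t * linf_eval (N \<omega>) t) = normal_law \<mu> \<sigma>"
    by (intro exI[of _ 0] exI[of _ "sqrt (ip M (\<lambda>\<omega>. \<Sum>t\<in>S. a t * Y t \<omega>) (\<lambda>\<omega>. \<Sum>t\<in>S. a t * Y t \<omega>))"]) (simp add: ip_self_nonneg)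
qed simp

lemma N_combination_moments:
  assumes I: "finite I"
  shows "integrable gauss_space (\<lambda>\<omega>. \<Sum>t\<in>I. \<alpha> t * linf_eval (N \<omega>) t)"
    "(\<integral>\<omega>. (\<Sum>t\<in>I. \<alpha> t * linf_eval (N \<omega>) t) \<partial>gauss_space) = 0"
    "integrable gauss_space (\<lambda>\<omega>. (\<Sum>t\<in>I. \<alpha> t * linf_eval (N \<omega>) t)\<^sup>2)"
    "(\<integral>\<omega>. (\<Sum>t\<in>I. \<alpha> t * linf_eval (N \<omega>) t)\<^sup>2 \<partial>gauss_space) = ip M (\<lambda>\<omega>. \<Sum>t\<in>I. \<alpha> t * Y t \<omega>) (\<lambda>\<omega>. \<Sum>t\<in>I. \<alpha> t * Y t \<omega>)"
proof -
  have m: "(\<lambda>\<omega>. \<Sum>t\<in>I. \<alpha> t * linf_eval (N \<omega>) t) \<in> borel_measurable gauss_space" by measurable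
  note mm = gauss_space.normal_law_moments[OF m N_law[OF I]]
  show "integrable gauss_space (\<lambda>\<omega>. \<Sum>t\<in>I. \<alpha> t * linf_eval (N \<omega>) t)"
    "(\<integral>\<omega>. (\<Sum>t\<in>I. \<alpha> t * linf_eval (N \<omega>) t) \<partial>gauss_space) = 0"
    "integrable gauss_space (\<lambda>\<omega>. (\<Sum>t\<in>I. \<alpha> t * linf_eval (N \<omega>) t)\<^sup>2)"
    "(\<integral>\<omega>. (\<Sum>t\<in>I. \<alpha> t * linf_eval (N \<omega>) t)\<^sup>2 \<partial>gauss_space) = ip M (\<lambda>\<omega>. \<Sum>t\<in>I. \<alpha> t * Y t \<omega>) (\<lambda>\<omega>. \<Sum>t\<in>I. \<alpha> t * Y t \<omega>)"
    using mm(1-4) by (auto simp: ip_self_nonneg)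
qed

lemma N_L2: "(\<lambda>\<omega>. linf_eval (N \<omega>) t) \<in> L2 gauss_space"
  using N_combination_moments(3)[of "{t}" "\<lambda>_. 1"] by (simp add: L2_def)

lemma N_mean: "(\<integral>\<omega>. linf_eval (N \<omega>) t \<partial>gauss_space) = 0"
  using N_combination_moments(2)[of "{t}" "\<lambda>_. 1"] by simp

text \<open>
  Polarisation: the law of \<open>N s + N t\<close> determines the inner product.
\<close>

lemma N_ip: "ip gauss_space (\<lambda>\<omega>. linf_eval (N \<omega>) s) (\<lambda>\<omega>. linf_eval (N \<omega>) t) = ip M (Y s) (Y t)"
proof -
  let ?n = "\<lambda>t \<omega>. linf_eval (N \<omega>) t"
  have self: "ip gauss_space (?n t) (?n t) = ip M (Y t) (Y t)" for t
    using N_combination_moments(4)[of "{t}" "\<lambda>_. 1"] by (simp add: ip_def power2_eq_square)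
  show ?thesis
  proof (cases "s = t")
    case False
    have "ip gauss_space (\<lambda>\<omega>. ?n s \<omega> + ?n t \<omega>) (\<lambda>\<omega>. ?n s \<omega> + ?n t \<omega>) = ip M (\<lambda>\<omega>. Y s \<omega> + Y t \<omega>) (\<lambda>\<omega>. Y s \<omega> + Y t \<omega>)"
      using N_combination_moments(4)[of "{s, t}" "\<lambda>_. 1"] False by (simp add: ip_def power2_eq_square)
    then show ?thesis
      unfolding ip_add_self[OF N_L2 N_L2] ip_add_self[OF Y Y] self by simp
  qed (simp add: self)
qed

end

section \<open>Uniformity from sequences\<close>

text \<open>
  A condition required along every null sequence \<open>\<delta> n\<close> holds uniformly. Otherwise there are \<open>s m\<close>,
  increasing, with \<open>\<phi> (s m) (1 / (m + 1)) > \<eta>\<close>, and a slowly decreasing sequence that takes the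
  value \<open>1 / (m + 1)\<close> at \<open>s m\<close> contradicts the assumption.
\<close>

lemma uniformly_small_of_sequences:
  fixes \<phi> :: "nat \<Rightarrow> real \<Rightarrow> ennreal"
  assumes lim: "\<And>\<delta>. decreases_to_zero \<delta> \<Longrightarrow> (\<lambda>n. \<phi> n (\<delta> n)) \<longlonglongrightarrow> 0" and h: "0 < \<eta>"
  shows "\<exists>\<delta>>0. \<forall>\<^sub>F n in sequentially. \<phi> n \<delta> \<le> \<eta>"
proof (rule ccontr)
  assume n: "\<not> ?thesis"
  have big: "\<exists>n>N. \<eta> < \<phi> n (1 / real (Suc m))" for N m
  proof (rule ccontr)
    assume "\<not> ?thesis"
    then have "\<forall>n\<ge>Suc N. \<phi> n (1 / real (Suc m)) \<le> \<eta>" by (meson Suc_le_lessD not_le_imp_less)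
    then have "\<forall>\<^sub>F n in sequentially. \<phi> n (1 / real (Suc m)) \<le> \<eta>" by (auto simp: eventually_sequentially)
    moreover have "0 < 1 / real (Suc m)" by simp
    ultimately show False using n by blast
  qed
  have "\<exists>s. \<forall>m. \<eta> < \<phi> (s m) (1 / real (Suc m)) \<and> s m < s (Suc m)"
  proof (rule dependent_nat_choice)
    show "\<exists>n. \<eta> < \<phi> n (1 / real (Suc 0))" using big[of 0 0] by blast
    show "\<exists>y. \<eta> < \<phi> y (1 / real (Suc (Suc m))) \<and> x < y" for x m using big[of x "Suc m"] by blast
  qed
  then obtain s where s: "\<And>m. \<eta> < \<phi> (s m) (1 / real (Suc m))" "\<And>m. s m < s (Suc m)" by blast
  have sm: "strict_mono s" using s(2) by (simp add: strict_mono_Suc_iff)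
  \<comment> \<open>inverse of \<open>s\<close>: it takes the value \<open>m\<close> at \<open>s
    m\<close>\<close>
  define c where "c n = card {i. s i < n}" for n
  have fin: "finite {i. s i < n}" for n
    by (rule finite_subset[of _ "{..<n}"]) (use seq_suble[OF sm] in \<open>auto intro: le_less_trans\<close>)
  have cs: "c (s m) = m" for m
  proof -
    have "{i. s i < s m} = {..<m}" using sm by (auto simp: strict_mono_less)
    then show ?thesis by (simp add: c_def)
  qed
  have cmono: "c a \<le> c b" if "a \<le> b" for a b
    unfolding c_def using that by (intro card_mono fin) auto
  define \<delta> where "\<delta> n = 1 / real (Suc (c n))" for n
  have "decreases_to_zero \<delta>"
    unfolding decreases_to_zero_def
  proof (intro conjI allI)
    show "0 < \<delta> n" for n by (simp add: \<delta>_def)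
    show "decseq \<delta>"
      unfolding decseq_def \<delta>_def using cmono by (auto intro!: divide_left_mono)
    show "\<delta> \<longlonglongrightarrow> 0"
    proof (rule LIMSEQ_I)
      fix r :: real assume "0 < r"
      then obtain m where m: "1 / real (Suc m) < r" using nat_approx_posE by blast
      have "norm (\<delta> n - 0) < r" if "n \<ge> s m" for n
      proof -
        have "m \<le> c n" using cmono[OF that] cs[of m] by simp
        then have "\<delta> n \<le> 1 / real (Suc m)" unfolding \<delta>_def by (intro divide_left_mono) auto
        then show ?thesis using m by (simp add: \<delta>_def)
      qed
      then show "\<exists>no. \<forall>n\<ge>no. norm (\<delta> n - 0) < r" by blast
    qed
  qed
  then have "(\<lambda>n. \<phi> n (\<delta> n)) \<longlonglongrightarrow> 0" by (rule lim)
  then have "(\<lambda>m. \<phi> (s m) (\<delta> (s m))) \<longlonglongrightarrow> 0"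
    using LIMSEQ_subseq_LIMSEQ[OF _ sm, of "\<lambda>n. \<phi> n (\<delta> n)" 0] by (simp add: o_def)
  then have "\<forall>\<^sub>F m in sequentially. \<phi> (s m) (\<delta> (s m)) < \<eta>" using h by (rule order_tendstoD)
  then obtain m where "\<phi> (s m) (\<delta> (s m)) < \<eta>" using eventually_happens'[OF sequentially_bot] by blast
  then show False using s(1)[of m] by (simp add: \<delta>_def cs)
qed

text \<open>
  This transfers finiteness of the bracketing integrals along null sequences to every positive
  upper limit.
\<close>

lemma exists_decreasing_through:
  assumes "0 < (\<delta>::real)"
  shows "\<exists>\<delta>'. decreases_to_zero \<delta>' \<and> \<delta>' n = \<delta>"
proof -
  let ?d = "\<lambda>i. \<delta> * real (Suc n) / real (Suc i)"
  have "(\<lambda>i. \<delta> * real (Suc n) * (1 / real (Suc i))) \<longlonglongrightarrow> \<delta> * real (Suc n) * 0"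
    by (intro tendsto_mult tendsto_const LIMSEQ_Suc lim_1_over_n)
  then have "decreases_to_zero ?d"
    using assms by (auto simp: decreases_to_zero_def decseq_def intro!: divide_left_mono)
  then show ?thesis by (intro exI[of _ ?d]) simp
qed

section \<open>Bracketing numbers\<close>

lemma bracketing_number_antimono:
  assumes "\<epsilon> \<le> \<epsilon>'"
  shows "bracketing_number \<epsilon>' G nrm \<le> bracketing_number \<epsilon> G nrm"
  unfolding bracketing_number_def
proof (rule Inf_superset_mono, rule subsetI, elim CollectE exE conjE)
  fix z m l u assume z: "z = enat m" and *: "\<forall>i<m. l i \<in> borel_measurable borel \<and> u i \<in> borel_measurable borel \<and>
      nrm (\<lambda>x. l i x - u i x) \<le> ennreal \<epsilon>" "(\<Union>i<m. bracket G (l i) (u i)) = G"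
  have "\<forall>i<m. l i \<in> borel_measurable borel \<and> u i \<in> borel_measurable borel \<and> nrm (\<lambda>x. l i x - u i x) \<le> ennreal \<epsilon>'"
    using *(1) assms by (meson ennreal_leI order_trans)
  then show "z \<in> {enat m |m. \<exists>l u. (\<forall>i<m. l i \<in> borel_measurable borel \<and> u i \<in> borel_measurable borel \<and>
      nrm (\<lambda>x. l i x - u i x) \<le> ennreal \<epsilon>') \<and> (\<Union>i<m. bracket G (l i) (u i)) = G}"
    using z *(2) by blast
qed

lemma bracketing_integral_mono:
  assumes "\<delta> \<le> \<delta>'"
  shows "bracketing_integral \<delta> G nrm \<le> bracketing_integral \<delta>' G nrm"
  unfolding bracketing_integral_def using assms
  by (intro nn_integral_mono mult_left_mono) (auto simp: indicator_def)

text \<open>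
  Bracketing numbers decrease in the size of the brackets, so an infinite one makes the integrand
  infinite on the interval \<open>{0..\<epsilon>}\<close>.
\<close>

lemma bracketing_number_finite:
  assumes "bracketing_integral \<epsilon> G nrm < \<infinity>" "0 < \<epsilon>"
  shows "bracketing_number \<epsilon> G nrm \<noteq> \<infinity>"
proof
  assume inf: "bracketing_number \<epsilon> G nrm = \<infinity>"
  have "(\<integral>\<^sup>+ z. \<infinity> * indicator {0..\<epsilon>} z \<partial>lborel) \<le> bracketing_integral \<epsilon> G nrm"
    unfolding bracketing_integral_def
  proof (rule nn_integral_mono)
    fix z :: real
    show "\<infinity> * indicator {0..\<epsilon>} z \<le> sqrt_ln (bracketing_number z G nrm) * indicator {0..\<epsilon>} z"
    proof (cases "z \<in> {0..\<epsilon>}")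
      case True
      then have "bracketing_number z G nrm = \<infinity>"
        using bracketing_number_antimono[of z \<epsilon> G nrm] inf by auto
      then show ?thesis by (simp add: sqrt_ln_def)
    qed simp
  qed
  moreover have "(\<integral>\<^sup>+ z. \<infinity> * indicator {0..\<epsilon>} z \<partial>lborel) = \<infinity>"
    using assms(2) by (subst nn_integral_cmult_indicator) (auto simp: ennreal_top_mult)
  ultimately show False using assms(1) by simp
qed

lemma obtain_brackets:
  fixes f :: "'t \<Rightarrow> 'x::topological_space \<Rightarrow> real"
  assumes "bracketing_number \<epsilon> (range f) nrm = enat m"
  obtains c l u where "\<And>t. c t < m" "\<And>i. i < m \<Longrightarrow> l i \<in> borel_measurable borel" "\<And>i. i < m \<Longrightarrow> u i \<in> borel_measurable borel"
    "\<And>i. i < m \<Longrightarrow> nrm (\<lambda>x. l i x - u i x) \<le> ennreal \<epsilon>"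
    "\<And>t x. l (c t) x \<le> f t x" "\<And>t x. f t x \<le> u (c t) x"
proof -
  let ?S = "{enat m | m. \<exists>l u. (\<forall>i<m. l i \<in> borel_measurable borel \<and> u i \<in> borel_measurable borel \<and>
                   nrm (\<lambda>x. l i x - u i x) \<le> ennreal \<epsilon>) \<and> (\<Union>i<m. bracket (range f) (l i) (u i)) = range f}"
  have I: "Inf ?S = enat m" using assms by (simp add: bracketing_number_def)
  have "?S \<noteq> {}" using I by (metis Inf_empty enat.distinct(1) top_enat_def)
  then obtain z where "z \<in> ?S" by (meson ex_in_conv)
  then have "Inf ?S \<in> ?S" by (rule wellorder_InfI)
  then obtain l u where lu: "\<forall>i<m. l i \<in> borel_measurable borel \<and> u i \<in> borel_measurable borel \<and>
        nrm (\<lambda>x. l i x - u i x) \<le> ennreal \<epsilon>" "(\<Union>i<m. bracket (range f) (l i) (u i)) = range f"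
    unfolding I by auto
  have "\<exists>i<m. f t \<in> bracket (range f) (l i) (u i)" for t
  proof -
    have "f t \<in> (\<Union>i<m. bracket (range f) (l i) (u i))" unfolding lu(2) by simp
    then show ?thesis by auto
  qed
  then have "\<forall>t. \<exists>i. i < m \<and> f t \<in> bracket (range f) (l i) (u i)" by blast
  from choice[OF this] obtain c where c: "\<And>t. c t < m" "\<And>t. f t \<in> bracket (range f) (l (c t)) (u (c t))" by blast
  show ?thesis by (rule that[of c l u]) (use c lu(1) in \<open>auto simp: bracket_def\<close>)
qed

lemma sqrt_ln_mono: "enat m \<le> N \<Longrightarrow> 1 \<le> m \<Longrightarrow> ennreal (sqrt (ln (real m))) \<le> sqrt_ln N"
  by (cases N) (auto simp: sqrt_ln_def intro!: ennreal_leI)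

text \<open>
  The intervals between consecutive dyadic points are disjoint, on each the integrand is at least
  its value at the right end, and the length is half of that end; hence the factor \<open>2\<close>.
\<close>

lemma dyadic_sum_le_bracketing_integral:
  assumes B: "bracketing_integral (\<delta> / 2 ^ i) G nrm \<le> ennreal B" "0 \<le> B" and d: "0 < \<delta>"
    and m: "\<And>j. bracketing_number (\<delta> / 2 ^ j) G nrm = enat (m j)" "\<And>j. 1 \<le> m j"
  shows "(\<Sum>j=i..J. \<delta> / 2 ^ j * sqrt (ln (real (m j)))) \<le> 2 * B"
proof -
  define I where "I j = {\<delta> / 2 ^ Suc j <.. \<delta> / 2 ^ j}" for j
  define a where "a j = sqrt (ln (real (m j)))" for j
  have a0: "0 \<le> a j" for j using m(2)[of j] by (simp add: a_def)
  have pow: "\<delta> / 2 ^ j' \<le> \<delta> / 2 ^ j" if "j \<le> j'" for j j'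
    using that d by (intro divide_left_mono) (auto intro: power_increasing)
  have disj: "j = j'" if "z \<in> I j" "z \<in> I j'" for z j j'
  proof (rule ccontr)
    assume "j \<noteq> j'"
    then consider "Suc j \<le> j'" | "Suc j' \<le> j" by linarith
    then show False
    proof cases
      case 1 then show ?thesis using pow[OF 1] that by (simp add: I_def)
    next
      case 2 then show ?thesis using pow[OF 2] that by (simp add: I_def)
    qed
  qed
  have pt: "(\<Sum>j=i..J. ennreal (a j) * indicator (I j) z) \<le> sqrt_ln (bracketing_number z G nrm) * indicator {0..\<delta> / 2 ^ i} z" for z
  proof (cases "\<exists>j\<in>{i..J}. z \<in> I j")
    case True
    then obtain j where j: "j \<in> {i..J}" "z \<in> I j" by blast
    have "(\<Sum>j=i..J. ennreal (a j) * indicator (I j) z) = (\<Sum>j'=i..J. if j' = j then ennreal (a j) else 0)"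
    proof (rule sum.cong[OF refl])
      fix j'
      have "indicator (I j') z = (if j' = j then 1 else 0 :: ennreal)"
      proof (cases "j' = j")
        case False
        then have "z \<notin> I j'" using disj[OF j(2), of j'] by blast
        then show ?thesis using False by simp
      qed (use j(2) in simp)
      then show "ennreal (a j') * indicator (I j') z = (if j' = j then ennreal (a j) else 0)" by simp
    qed
    also have "\<dots> = ennreal (a j)" using j(1) by simp
    also have "\<dots> \<le> sqrt_ln (bracketing_number z G nrm)"
      unfolding a_def
    proof (rule sqrt_ln_mono[OF _ m(2)])
      show "enat (m j) \<le> bracketing_number z G nrm"
        unfolding m(1)[of j, symmetric] using j(2) by (intro bracketing_number_antimono) (simp add: I_def)
    qed
    also have "\<dots> = sqrt_ln (bracketing_number z G nrm) * indicator {0..\<delta> / 2 ^ i} z"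
    proof -
      have "0 < \<delta> / 2 ^ Suc j" using d by simp
      then have "z \<in> {0..\<delta> / 2 ^ i}" using j pow[of i j] by (auto simp: I_def)
      then show ?thesis by simp
    qed
    finally show ?thesis .
  next
    case False
    then have "(\<Sum>j=i..J. ennreal (a j) * indicator (I j) z) = 0" by (intro sum.neutral) (auto simp: indicator_def)
    then show ?thesis by simp
  qed
  have "(\<Sum>j=i..J. ennreal (a j) * ennreal (\<delta> / 2 ^ Suc j)) = (\<Sum>j=i..J. \<integral>\<^sup>+z. ennreal (a j) * indicator (I j) z \<partial>lborel)"
  proof (rule sum.cong[OF refl])
    fix j
    have "emeasure lborel (I j) = ennreal (\<delta> / 2 ^ j - \<delta> / 2 ^ Suc j)" unfolding I_def using pow[of j "Suc j"] by simp
    also have "\<delta> / 2 ^ j - \<delta> / 2 ^ Suc j = \<delta> / 2 ^ Suc j" by (simp add: field_simps)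
    finally show "ennreal (a j) * ennreal (\<delta> / 2 ^ Suc j) = (\<integral>\<^sup>+z. ennreal (a j) * indicator (I j) z \<partial>lborel)"
      by (subst nn_integral_cmult_indicator) (auto simp: I_def)
  qed
  also have "\<dots> = (\<integral>\<^sup>+z. (\<Sum>j=i..J. ennreal (a j) * indicator (I j) z) \<partial>lborel)"
    by (subst nn_integral_sum) (auto simp: I_def)
  also have "\<dots> \<le> bracketing_integral (\<delta> / 2 ^ i) G nrm"
    unfolding bracketing_integral_def by (intro nn_integral_mono pt)
  also have "\<dots> \<le> ennreal B" by fact
  also have "(\<Sum>j=i..J. ennreal (a j) * ennreal (\<delta> / 2 ^ Suc j)) = ennreal (\<Sum>j=i..J. a j * (\<delta> / 2 ^ Suc j))"
    using a0 d by (simp add: sum_ennreal flip: ennreal_mult)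
  finally have "(\<Sum>j=i..J. a j * (\<delta> / 2 ^ Suc j)) \<le> B" using B(2) by (simp add: ennreal_le_iff)
  moreover have "(\<Sum>j=i..J. \<delta> / 2 ^ j * sqrt (ln (real (m j)))) = 2 * (\<Sum>j=i..J. a j * (\<delta> / 2 ^ Suc j))"
    by (simp add: sum_distrib_left a_def mult_ac)
  ultimately show ?thesis by simp
qed

section \<open>Row seminorms\<close>

lemma row_seminorm_leD:
  assumes le: "row_seminorm M k X \<gamma> h \<le> ennreal \<sigma>" and "0 \<le> \<sigma>" "0 < k" "0 < \<gamma>"
  shows "(\<Sum>i=1..k. \<integral>\<^sup>+\<omega>. ennreal (\<bar>h (X i \<omega>)\<bar> powr \<gamma>) \<partial>M) \<le> ennreal (real k * \<sigma> powr \<gamma>)"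
proof -
  define S where "S = (\<Sum>i=1..k. \<integral>\<^sup>+\<omega>. ennreal (\<bar>h (X i \<omega>)\<bar> powr \<gamma>) \<partial>M)"
  have rs: "row_seminorm M k X \<gamma> h = ennreal_powr (S / of_nat k) (1 / \<gamma>)" by (simp add: row_seminorm_def S_def)
  have nt: "S / of_nat k \<noteq> \<infinity>" using le unfolding rs ennreal_powr_def by (auto simp: top_unique split: if_splits)
  define y where "y = enn2real (S / of_nat k)"
  have y: "S / of_nat k = ennreal y" "0 \<le> y" using nt by (auto simp: y_def less_top)
  have "ennreal (y powr (1 / \<gamma>)) \<le> ennreal \<sigma>" using le nt unfolding rs ennreal_powr_def by (simp add: y_def)
  then have "y powr (1 / \<gamma>) \<le> \<sigma>" using assms(2) by (simp add: ennreal_le_iff)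
  then have "(y powr (1 / \<gamma>)) powr \<gamma> \<le> \<sigma> powr \<gamma>" using assms by (intro powr_mono2) auto
  then have "y \<le> \<sigma> powr \<gamma>" using y assms by (simp add: powr_powr)
  have "S = of_nat k * (S / of_nat k)" using assms(3)
    by (simp add: ennreal_times_divide mult_divide_eq_ennreal mult.commute)
  also have "\<dots> = ennreal (real k * y)" unfolding y(1) using y(2)
    by (simp add: ennreal_of_nat_eq_real_of_nat flip: ennreal_mult)
  also have "\<dots> \<le> ennreal (real k * \<sigma> powr \<gamma>)" using \<open>y \<le> \<sigma> powr \<gamma>\<close> by (intro ennreal_leI mult_left_mono) auto
  finally show ?thesis by (simp add: S_def)
qed

section \<open>Both processes have small oscillation on bracket cells\<close>

text \<open>
  The index set splits into \<open>m\<close> cells on each of which the process oscillates little, uniformly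
  over the cell: the oscillation has a measurable majorant with small mean.
\<close>

abbreviation small_on_cells :: "'w measure \<Rightarrow> ('t \<Rightarrow> 'w \<Rightarrow> real) \<Rightarrow> nat \<Rightarrow> real \<Rightarrow> bool" where
  "small_on_cells M x m e \<equiv> \<exists>(c :: 't \<Rightarrow> nat) W. (\<forall>t. c t < m) \<and> W \<in> borel_measurable M \<and>
    (\<integral>\<^sup>+\<omega>. W \<omega> \<partial>M) \<le> ennreal e \<and> (\<forall>s t \<omega>. c s = c t \<longrightarrow> ennreal \<bar>x s \<omega> - x t \<omega>\<bar> \<le> W \<omega>)"

text \<open>
  Integrating \<open>\<bar>z\<bar> \<le> \<tau> + z\<^sup>2 / \<tau>\<close> gives the Cauchy-Schwarz bound up to the constant.
\<close>

lemma (in prob_space) abs_mean_le: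
  assumes Z: "Z \<in> L2 M" and v: "ip M Z Z \<le> v * \<tau>\<^sup>2" and t: "0 < \<tau>"
  shows "(\<integral>\<^sup>+\<omega>. ennreal \<bar>Z \<omega>\<bar> \<partial>M) \<le> ennreal ((1 + v) * \<tau>)"
proof -
  have pt: "\<bar>z\<bar> \<le> \<tau> + z\<^sup>2 / \<tau>" for z
  proof (cases "\<bar>z\<bar> \<le> \<tau>")
    case True
    then show ?thesis using t by (simp add: add_increasing2)
  next
    case False
    then have "\<bar>z\<bar> * \<tau> \<le> \<bar>z\<bar> * \<bar>z\<bar>" by (intro mult_left_mono) auto
    then have "\<bar>z\<bar> \<le> z\<^sup>2 / \<tau>" using t by (simp add: le_divide_eq power2_eq_square)
    then show ?thesis using t by simp
  qed
  have i: "integrable M (\<lambda>\<omega>. \<tau> + (Z \<omega>)\<^sup>2 / \<tau>)" using Z by (simp add: L2_def)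
  have "(\<integral>\<^sup>+\<omega>. ennreal \<bar>Z \<omega>\<bar> \<partial>M) \<le> (\<integral>\<^sup>+\<omega>. ennreal (\<tau> + (Z \<omega>)\<^sup>2 / \<tau>) \<partial>M)"
    by (intro nn_integral_mono ennreal_leI pt)
  also have "\<dots> = ennreal (\<integral>\<omega>. \<tau> + (Z \<omega>)\<^sup>2 / \<tau> \<partial>M)"
    using t by (intro nn_integral_eq_integral i AE_I2) simp
  also have "(\<integral>\<omega>. \<tau> + (Z \<omega>)\<^sup>2 / \<tau> \<partial>M) = \<tau> + ip M Z Z / \<tau>"
    using Z by (simp add: L2_def ip_def power2_eq_square prob_space)
  also have "\<dots> \<le> \<tau> + (v * \<tau>\<^sup>2) / \<tau>" using v t by (intro add_left_mono divide_right_mono) auto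
  also have "\<dots> = (1 + v) * \<tau>" using t by (simp add: power2_eq_square algebra_simps)
  finally show ?thesis by (simp add: ennreal_leI)
qed

context mixing_row
begin

lemma emp_mean:
  assumes "\<And>i. i \<in> {1..k} \<Longrightarrow> integrable M (\<lambda>\<omega>. h (X i \<omega>))"
  shows "(\<integral>\<omega>. emp h \<omega> \<partial>M) = 0"
proof -
  have "(\<integral>\<omega>. (\<Sum>i=1..k. h (X i \<omega>) - (\<integral>\<omega>'. h (X i \<omega>') \<partial>M)) \<partial>M) =
    (\<Sum>i=1..k. \<integral>\<omega>. h (X i \<omega>) - (\<integral>\<omega>'. h (X i \<omega>') \<partial>M) \<partial>M)"
    using assms by (intro Bochner_Integration.integral_sum) auto
  also have "\<dots> = 0" using assms by (intro sum.neutral) (simp add: prob_space)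
  finally show ?thesis by (simp add: emp_def[abs_def])
qed

lemma emp_second_moment:
  assumes h: "moment_le h \<tau>" "h \<in> borel_measurable borel" and t: "0 < \<tau>"
  shows "emp h \<in> L2 M" "ip M (emp h) (emp h) \<le> Cvar * \<tau>\<^sup>2"
proof -
  note sq = sum_square_cov[OF h(2) moment_integrable(1)[OF h] moment_integrable(2)[OF h] subset_refl]
  have e: "(emp h \<omega>)\<^sup>2 = (1 / real k) * (\<Sum>i=1..k. h (X i \<omega>) - (\<integral>\<omega>'. h (X i \<omega>') \<partial>M))\<^sup>2" for \<omega>
    by (simp add: emp_def power_mult_distrib power_divide)
  show "emp h \<in> L2 M"
  proof -
    have "integrable M (\<lambda>\<omega>. (emp h \<omega>)\<^sup>2)" unfolding e by (rule integrable_mult_right[OF sq(1)])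
    then show ?thesis using emp_measurable[OF h(2)] by (simp add: L2_def)
  qed
  have "ip M (emp h) (emp h) = (\<integral>\<omega>. (emp h \<omega>)\<^sup>2 \<partial>M)" by (simp add: ip_def power2_eq_square)
  also have "\<dots> = (1 / real k) * (\<Sum>i=1..k. \<Sum>j=1..k. cov h i j)"
    unfolding e using sq(2) by simp
  also have "\<dots> \<le> (1 / real k) * (\<Sum>i=1..k. \<Sum>j=1..k. \<bar>cov h i j\<bar>)"
    by (intro mult_left_mono sum_mono) auto
  also have "\<dots> \<le> (1 / real k) * (Cvar * real k * \<tau>\<^sup>2)"
    by (intro mult_left_mono sum_cov_le[OF h t]) auto
  also have "\<dots> = Cvar * \<tau>\<^sup>2" using k_pos by simp
  finally show "ip M (emp h) (emp h) \<le> Cvar * \<tau>\<^sup>2" .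
qed

lemma moment_le_of_row_seminorm:
  assumes "row_seminorm M k X \<gamma> h \<le> ennreal \<sigma>" "0 \<le> \<sigma>"
  shows "moment_le h \<sigma>"
  unfolding moment_le_def using row_seminorm_leD[OF assms k_pos] gamma by simp

text \<open>
  One minimal family of brackets is fixed for every dyadic size, together with a bracket for each
  index.
\<close>

lemma bracket_selection:
  fixes f :: "'t \<Rightarrow> 'x \<Rightarrow> real" and \<nu> :: "nat \<Rightarrow> nat" and \<delta> :: real
  assumes number: "\<And>j. bracketing_number (\<delta> / 2 ^ j) (range f) (row_seminorm M k X \<gamma>) = enat (\<nu> j)" and d: "0 < \<delta>"
  shows "\<exists>c l u. (\<forall>j t. c j t < \<nu> j) \<and> (\<forall>j i. i < \<nu> j \<longrightarrow> l j i \<in> borel_measurable borel \<and> u j i \<in> borel_measurable borel \<and>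
      moment_le (\<lambda>x. u j i x - l j i x) (\<delta> / 2 ^ j)) \<and>
      (\<forall>j t x. l j (c j t) x \<le> f t x \<and> f t x \<le> u j (c j t) x)"
proof -
  have "\<forall>j. \<exists>z. (\<forall>t. fst z t < \<nu> j) \<and> (\<forall>i<\<nu> j. fst (snd z) i \<in> borel_measurable borel \<and> snd (snd z) i \<in> borel_measurable borel \<and>
      moment_le (\<lambda>x. snd (snd z) i x - fst (snd z) i x) (\<delta> / 2 ^ j)) \<and>
      (\<forall>t x. fst (snd z) (fst z t) x \<le> f t x \<and> f t x \<le> snd (snd z) (fst z t) x)"
  proof
    fix j
    obtain c l u where clu: "\<And>t. c t < \<nu> j" "\<And>i. i < \<nu> j \<Longrightarrow> l i \<in> borel_measurable borel" "\<And>i. i < \<nu> j \<Longrightarrow> u i \<in> borel_measurable borel"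
      "\<And>i. i < \<nu> j \<Longrightarrow> row_seminorm M k X \<gamma> (\<lambda>x. l i x - u i x) \<le> ennreal (\<delta> / 2 ^ j)"
      "\<And>t x. l (c t) x \<le> f t x" "\<And>t x. f t x \<le> u (c t) x"
      by (rule obtain_brackets[OF number]) blast
    have "moment_le (\<lambda>x. u i x - l i x) (\<delta> / 2 ^ j)" if "i < \<nu> j" for i
      by (rule moment_le_mono[OF moment_le_of_row_seminorm[OF clu(4)[OF that]]]) (use d in \<open>auto simp: abs_minus_commute\<close>)
    then show "\<exists>z. (\<forall>t. fst z t < \<nu> j) \<and> (\<forall>i<\<nu> j. fst (snd z) i \<in> borel_measurable borel \<and> snd (snd z) i \<in> borel_measurable borel \<and>
      moment_le (\<lambda>x. snd (snd z) i x - fst (snd z) i x) (\<delta> / 2 ^ j)) \<and>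
      (\<forall>t x. fst (snd z) (fst z t) x \<le> f t x \<and> f t x \<le> snd (snd z) (fst z t) x)"
      using clu by (intro exI[of _ "(c, l, u)"]) auto
  qed
  from choice[OF this] obtain z where z: "\<forall>j. (\<forall>t. fst (z j) t < \<nu> j) \<and> (\<forall>i<\<nu> j. fst (snd (z j)) i \<in> borel_measurable borel \<and> snd (snd (z j)) i \<in> borel_measurable borel \<and>
      moment_le (\<lambda>x. snd (snd (z j)) i x - fst (snd (z j)) i x) (\<delta> / 2 ^ j)) \<and>
      (\<forall>t x. fst (snd (z j)) (fst (z j) t) x \<le> f t x \<and> f t x \<le> snd (snd (z j)) (fst (z j) t) x)" by blast
  show ?thesis
    by (rule exI[of _ "\<lambda>j. fst (z j)"], rule exI[of _ "\<lambda>j. fst (snd (z j))"], rule exI[of _ "\<lambda>j. snd (snd (z j))"])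
      (use z in simp)
qed

text \<open>
  Functions in the same coarsest bracket have the same lower end \<open>l 0\<close>, and the chaining bound
  applies to the difference of each from it; this doubles the majorant.
\<close>

lemma empirical_cells:
  fixes f :: "'t \<Rightarrow> 'x \<Rightarrow> real" and \<nu> :: "nat \<Rightarrow> nat" and \<delta> B \<eta> :: real
  assumes f: "\<And>t. f t \<in> borel_measurable borel" "\<And>t i. i \<in> {1..k} \<Longrightarrow> integrable M (\<lambda>\<omega>. f t (X i \<omega>))"
    and number: "\<And>j. bracketing_number (\<delta> / 2 ^ j) (range f) (row_seminorm M k X \<gamma>) = enat (\<nu> j)" and d: "0 < \<delta>"
    and B: "bracketing_integral \<delta> (range f) (row_seminorm M k X \<gamma>) \<le> ennreal B" "0 \<le> B"
    and small: "2 * \<delta> + 4 * B \<le> \<eta> / 2" and start: "\<eta> < sqrt (real k) * \<delta>"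
    and first: "real (\<nu> 0) * (real k / (1 + ln (real (\<nu> 0)) + ln (real (\<nu> 1)))) powr - kappa \<le> 1"
  shows "small_on_cells M (\<lambda>t \<omega>. emp (f t) \<omega>) (\<nu> 0) (2 * (2 powr \<gamma> + 2 * Cerr + 2) * \<eta>)"
proof -
  obtain c l u where clu: "\<And>j t. c j t < \<nu> j" "\<And>j i. i < \<nu> j \<Longrightarrow> l j i \<in> borel_measurable borel"
      "\<And>j i. i < \<nu> j \<Longrightarrow> u j i \<in> borel_measurable borel"
      "\<And>j i. i < \<nu> j \<Longrightarrow> moment_le (\<lambda>x. u j i x - l j i x) (\<delta> / 2 ^ j)"
      "\<And>j t x. l j (c j t) x \<le> f t x" "\<And>j t x. f t x \<le> u j (c j t) x"
    using bracket_selection[OF number d] by blast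
  have nu: "1 \<le> \<nu> j" for j using clu(1)[of j undefined] by linarith
  interpret bracket_chain M k X \<gamma> \<rho> K f "\<lambda>j t. l j (c j t)" "\<lambda>j t. u j (c j t)" c \<nu> \<delta> \<eta> "2 * B"
  proof
    show "(\<Sum>j\<le>J. \<delta> / 2 ^ j * sqrt (ln (real (\<nu> j)))) \<le> 2 * B" for J
      using dyadic_sum_le_bracketing_integral[of \<delta> 0 "range f" "row_seminorm M k X \<gamma>" B \<nu> J] B d number nu
      by (simp add: atLeast0AtMost)
  qed (use f clu d small start first in auto)
  obtain W where W: "integrable M W" "(\<integral>\<omega>. W \<omega> \<partial>M) \<le> (2 powr \<gamma> + 2 * Cerr + 2) * \<eta>"
    "\<And>t \<omega>. \<bar>emp (\<lambda>x. f t x - l 0 (c 0 t) x) \<omega>\<bar> \<le> W \<omega>"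
    using bracketing_maximal_ineq by blast
  have W0: "0 \<le> W \<omega>" for \<omega> using W(3)[of undefined \<omega>] by linarith
  have fl: "integrable M (\<lambda>\<omega>. f t (X i \<omega>) - l 0 (c 0 t) (X i \<omega>))" if "i \<in> {1..k}" for t i
  proof (rule integrable_of_le_D[of "\<lambda>x. f t x - l 0 (c 0 t) x" 0 t, OF _ _ _ that])
    show "f t x - l 0 (c 0 t) x \<le> D 0 t x" for x using clu(6)[of t x 0] by (simp add: D_def)
  qed (use clu(5)[of 0 t] in auto)
  have osc: "\<bar>emp (f s) \<omega> - emp (f t) \<omega>\<bar> \<le> 2 * W \<omega>" if "c 0 s = c 0 t" for s t \<omega>
  proof -
    have "emp (f s) \<omega> - emp (f t) \<omega> = emp (\<lambda>x. f s x - f t x) \<omega>"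
      by (rule emp_diff[symmetric]) (use f in auto)
    also have "(\<lambda>x. f s x - f t x) = (\<lambda>x. (f s x - l 0 (c 0 s) x) - (f t x - l 0 (c 0 t) x))" using that by auto
    also have "emp \<dots> \<omega> = emp (\<lambda>x. f s x - l 0 (c 0 s) x) \<omega> - emp (\<lambda>x. f t x - l 0 (c 0 t) x) \<omega>"
      by (rule emp_diff) (use fl in auto)
    finally show ?thesis using W(3)[of s \<omega>] W(3)[of t \<omega>] by linarith
  qed
  show ?thesis
  proof (intro exI conjI allI impI)
    show "c 0 t < \<nu> 0" for t by (rule clu(1))
    show "(\<lambda>\<omega>. ennreal (2 * W \<omega>)) \<in> borel_measurable M" using W(1) by simp
    have "(\<integral>\<^sup>+\<omega>. ennreal (2 * W \<omega>) \<partial>M) = ennreal (\<integral>\<omega>. 2 * W \<omega> \<partial>M)"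
      using W(1) W0 by (intro nn_integral_eq_integral) auto
    also have "\<dots> \<le> ennreal (2 * (2 powr \<gamma> + 2 * Cerr + 2) * \<eta>)" using W(2) by (intro ennreal_leI) (simp add: algebra_simps)
    finally show "(\<integral>\<^sup>+\<omega>. ennreal (2 * W \<omega>) \<partial>M) \<le> ennreal (2 * (2 powr \<gamma> + 2 * Cerr + 2) * \<eta>)" .
    show "ennreal \<bar>emp (f s) \<omega> - emp (f t) \<omega>\<bar> \<le> ennreal (2 * W \<omega>)" if "c 0 s = c 0 t" for s t \<omega>
      using osc[OF that] by (rule ennreal_leI)
  qed
qed

end

context gaussian_chain
begin

text \<open>
  The means of the increments are summable by the bound for \<open>tail 0\<close>, so their tails vanish, even
  if the bounds \<open>E i\<close> do not tend to zero.
\<close>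

lemma tail_integral_small:
  assumes "0 < e"
  shows "\<exists>i. (\<integral>\<^sup>+\<omega>. tail i \<omega> \<partial>gauss_space) \<le> ennreal e"
proof -
  define a where "a j = (\<integral>\<omega>. inc j \<omega> \<partial>gauss_space)" for j
  have a0: "0 \<le> a j" for j unfolding a_def by (simp add: inc_nonneg integral_nonneg_AE)
  have eq: "(\<integral>\<^sup>+\<omega>. tail i \<omega> \<partial>gauss_space) = (\<Sum>j. ennreal (a (j + i)))" for i
  proof -
    have "(\<integral>\<^sup>+\<omega>. tail i \<omega> \<partial>gauss_space) = (\<Sum>j. \<integral>\<^sup>+\<omega>. ennreal (inc (j + i) \<omega>) \<partial>gauss_space)"
      unfolding tail_def by (rule nn_integral_suminf) simp
    also have "\<dots> = (\<Sum>j. ennreal (a (j + i)))"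
      unfolding a_def by (intro suminf_cong nn_integral_eq_integral inc_bound) (simp add: inc_nonneg)
    finally show ?thesis .
  qed
  have "(\<Sum>j. ennreal (a j)) \<noteq> \<infinity>" using eq[of 0] tail_integral[of 0] by (auto simp: top_unique)
  then have sa: "summable a" using a0 by (intro summable_suminf_not_top) auto
  then obtain i where "norm (\<Sum>j. a (j + i)) < e" using suminf_exist_split[OF assms sa] by blast
  then have "ennreal (\<Sum>j. a (j + i)) \<le> ennreal e" by (intro ennreal_leI) simp
  moreover have "ennreal (\<Sum>j. a (j + i)) = (\<Sum>j. ennreal (a (j + i)))"
    using summable_ignore_initial_segment[OF sa, of i] a0 by (intro suminf_ennreal2[symmetric]) auto
  ultimately show ?thesis using eq by auto
qed

lemma N_tight: "tight_borel_measurable gauss_space N"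
proof (rule tight_borel_measurableI[OF prob_space_gauss_space N_measurable])
  show "asymptotically_tight (\<lambda>_. gauss_space) (\<lambda>_. N)"
  proof (rule linf_asymptotically_tightI[OF prob_space_gauss_space])
    fix \<epsilon> \<eta> :: real assume e: "0 < \<epsilon>" and h: "0 < \<eta>"
    define r where "r = \<epsilon> * \<eta> / 2"
    have r: "0 < r" using e h by (simp add: r_def)
    obtain i where i: "(\<integral>\<^sup>+\<omega>. tail i \<omega> \<partial>gauss_space) \<le> ennreal r" using tail_integral_small[OF r] by blast
    have "(\<integral>\<^sup>+\<omega>. 2 * tail i \<omega> \<partial>gauss_space) = 2 * (\<integral>\<^sup>+\<omega>. tail i \<omega> \<partial>gauss_space)" by (rule nn_integral_cmult) simp
    also have "\<dots> \<le> 2 * ennreal r" using i by (intro mult_left_mono) auto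
    also have "\<dots> = ennreal (\<epsilon> * \<eta>)" using r by (simp add: r_def flip: ennreal_numeral ennreal_mult)
    finally have "likely gauss_space (\<epsilon> * \<eta> / \<eta>) (\<lambda>\<omega>. \<omega> \<in> space gauss_space \<and> 2 * tail i \<omega> \<le> ennreal \<eta>)"
      using e h by (intro gauss_space.markov_event) auto
    then obtain B where B: "B \<in> sets gauss_space" "1 - \<epsilon> \<le> gauss_space.prob B" "\<And>\<omega>. \<omega> \<in> B \<Longrightarrow> 2 * tail i \<omega> \<le> ennreal \<eta>"
      using h by auto
    have "\<bar>linf_eval (N \<omega>) t - linf_eval (N \<omega>) (rep i t)\<bar> \<le> \<eta>" if "\<omega> \<in> B" for \<omega> t
    proof -
      have "ennreal \<bar>linf_eval (N \<omega>) t - linf_eval (N \<omega>) (rep i t)\<bar> \<le> 2 * tail i \<omega>" by (rule N_oscillation) simp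
      also have "\<dots> \<le> ennreal \<eta>" by (rule B(3)[OF that])
      finally show ?thesis using h by (simp add: ennreal_le_iff)
    qed
    then have "likely gauss_space \<epsilon> (\<lambda>\<omega>. \<forall>t. \<bar>linf_eval (N \<omega>) t - linf_eval (N \<omega>) (rep i t)\<bar> \<le> \<eta>)"
      using B by blast
    then show "\<exists>S p. finite S \<and> range p \<subseteq> S \<and> (\<forall>\<^sub>F n in sequentially.
      likely gauss_space \<epsilon> (\<lambda>\<omega>. \<forall>t. \<bar>linf_eval (N \<omega>) t - linf_eval (N \<omega>) (p t)\<bar> \<le> \<eta>))"
      by (intro exI[of _ "range (rep i)"] exI[of _ "rep i"]) (simp add: range_rep)
  next
    fix \<epsilon> :: real and t assume e: "0 < \<epsilon>"
    define v where "v = 1 + ip M (Y t) (Y t)"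
    have v: "0 < v" by (simp add: v_def ip_self_nonneg add_pos_nonneg)
    have "(\<integral>\<^sup>+\<omega>. ennreal \<bar>linf_eval (N \<omega>) t\<bar> \<partial>gauss_space) \<le> ennreal ((1 + ip M (Y t) (Y t)) * 1)"
      by (rule gauss_space.abs_mean_le[OF N_L2]) (simp_all add: N_ip)
    then have "likely gauss_space (v / (v / \<epsilon>)) (\<lambda>\<omega>. \<omega> \<in> space gauss_space \<and> ennreal \<bar>linf_eval (N \<omega>) t\<bar> \<le> ennreal (v / \<epsilon>))"
      using e v by (intro gauss_space.markov_event) (auto simp: v_def)
    then show "\<exists>R. \<forall>\<^sub>F n in sequentially. likely gauss_space \<epsilon> (\<lambda>\<omega>. \<bar>linf_eval (N \<omega>) t\<bar> \<le> R)"
      using e v by (intro exI[of _ "v / \<epsilon>"] always_eventually) (auto simp: ennreal_le_iff)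
  qed
qed

end

text \<open>
  Two functions in one bracket of size \<open>1 / 2 ^ j\<close> differ by at most its width, so the variance
  bound of the row gives cells of \<open>L2\<close>-diameter \<open>sqrt Cvar / 2 ^ j\<close>. The number \<open>sqrt Cvar + 1\<close> is
  used in place of \<open>sqrt Cvar\<close> because it is positive.
\<close>

lemma (in mixing_row) gaussian_cells:
  fixes f :: "'t \<Rightarrow> 'x \<Rightarrow> real" and \<nu> :: "nat \<Rightarrow> nat" and B :: "nat \<Rightarrow> real"
  assumes f: "\<And>t. f t \<in> borel_measurable borel" "\<And>t. moment_le (f t) \<sigma>" "0 < \<sigma>"
    and number: "\<And>j. bracketing_number (1 / 2 ^ j) (range f) (row_seminorm M k X \<gamma>) = enat (\<nu> j)"
    and B: "\<And>i. bracketing_integral (1 / 2 ^ i) (range f) (row_seminorm M k X \<gamma>) \<le> ennreal (B i)" "\<And>i. 0 \<le> B i"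
  shows "\<exists>N :: (nat \<Rightarrow> real) \<Rightarrow> 't linf. N \<in> borel_measurable gauss_space \<and> tight_borel_measurable gauss_space N \<and>
     gaussian_process gauss_space (\<lambda>t \<omega>. linf_eval (N \<omega>) t) \<and>
     (\<forall>t. (\<integral>\<omega>. linf_eval (N \<omega>) t \<partial>gauss_space) = 0 \<and> (\<lambda>\<omega>. linf_eval (N \<omega>) t) \<in> L2 gauss_space) \<and>
     (\<forall>s t. ip gauss_space (\<lambda>\<omega>. linf_eval (N \<omega>) s) (\<lambda>\<omega>. linf_eval (N \<omega>) t) = ip M (emp (f s)) (emp (f t))) \<and>
     (\<forall>i. small_on_cells gauss_space (\<lambda>t \<omega>. linf_eval (N \<omega>) t) (\<nu> i) (8 * (sqrt Cvar + 1) * (2 / 2 ^ i + 6 * B i)))"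
proof -
  obtain c l u where clu: "\<And>j t. c j t < \<nu> j" "\<And>j i. i < \<nu> j \<Longrightarrow> l j i \<in> borel_measurable borel"
      "\<And>j i. i < \<nu> j \<Longrightarrow> u j i \<in> borel_measurable borel"
      "\<And>j i. i < \<nu> j \<Longrightarrow> moment_le (\<lambda>x. u j i x - l j i x) (1 / 2 ^ j)"
      "\<And>j t x. l j (c j t) x \<le> f t x" "\<And>j t x. f t x \<le> u j (c j t) x"
  proof -
    have "\<exists>c l u. (\<forall>j t. c j t < \<nu> j) \<and> (\<forall>j i. i < \<nu> j \<longrightarrow> l j i \<in> borel_measurable borel \<and> u j i \<in> borel_measurable borel \<and>
      moment_le (\<lambda>x. u j i x - l j i x) (1 / 2 ^ j)) \<and>
      (\<forall>j t x. l j (c j t) x \<le> f t x \<and> f t x \<le> u j (c j t) x)"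
      by (rule bracket_selection[OF number]) simp
    then show ?thesis using that by blast
  qed
  have nu: "1 \<le> \<nu> j" for j using clu(1)[of j undefined] by linarith
  have fint: "integrable M (\<lambda>\<omega>. f t (X i \<omega>))" if "i \<in> {1..k}" for t i
    using moment_integrable(1)[OF f(2,1) that] .
  interpret gaussian_chain M "\<lambda>t. emp (f t)" c \<nu> "sqrt Cvar + 1" "\<lambda>i. 2 * B i"
  proof
    show "emp (f t) \<in> L2 M" for t by (rule emp_second_moment(1)[OF f(2,1,3)])
    show "0 < sqrt Cvar + 1" using Cvar_nonneg by (simp add: add_nonneg_pos)
    show "(\<Sum>j=i..J. 1 / 2 ^ j * sqrt (ln (real (\<nu> j)))) \<le> 2 * B i" for i J
      using dyadic_sum_le_bracketing_integral[of 1 i "range f" "row_seminorm M k X \<gamma>" "B i" \<nu> J] B number nu by simp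
    show "ip M (\<lambda>\<omega>. emp (f s) \<omega> - emp (f t) \<omega>) (\<lambda>\<omega>. emp (f s) \<omega> - emp (f t) \<omega>) \<le> ((sqrt Cvar + 1) / 2 ^ j)\<^sup>2"
      if st: "c j s = c j t" for j s t
    proof -
      have "moment_le (\<lambda>x. f s x - f t x) (1 / 2 ^ j)"
      proof (rule moment_le_mono[OF clu(4)[OF clu(1)]])
        show "\<bar>f s x - f t x\<bar> \<le> \<bar>u j (c j s) x - l j (c j s) x\<bar>" for x
          using clu(5)[of j s x] clu(6)[of s x j] clu(5)[of j t x] clu(6)[of t x j] st by auto
      qed auto
      then have "ip M (emp (\<lambda>x. f s x - f t x)) (emp (\<lambda>x. f s x - f t x)) \<le> Cvar * (1 / 2 ^ j)\<^sup>2"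
        using f(1) by (intro emp_second_moment(2)) auto
      moreover have "emp (\<lambda>x. f s x - f t x) = (\<lambda>\<omega>. emp (f s) \<omega> - emp (f t) \<omega>)"
        using fint by (intro ext emp_diff) auto
      moreover have "Cvar * (1 / 2 ^ j)\<^sup>2 \<le> ((sqrt Cvar + 1) / 2 ^ j)\<^sup>2"
      proof -
        have "(sqrt Cvar)\<^sup>2 \<le> (sqrt Cvar + 1)\<^sup>2" using Cvar_nonneg by (intro power_mono) auto
        then have "Cvar \<le> (sqrt Cvar + 1)\<^sup>2" using Cvar_nonneg by simp
        then have "Cvar * (1 / 2 ^ j)\<^sup>2 \<le> (sqrt Cvar + 1)\<^sup>2 * (1 / 2 ^ j)\<^sup>2" by (intro mult_right_mono) auto
        then show ?thesis by (simp add: power_divide)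
      qed
      ultimately show ?thesis by simp
    qed
  qed (rule clu(1))
  have cells: "small_on_cells gauss_space (\<lambda>t \<omega>. linf_eval (N \<omega>) t) (\<nu> i) (8 * (sqrt Cvar + 1) * (2 / 2 ^ i + 6 * B i))" for i
  proof (intro exI conjI allI impI)
    show "c i t < \<nu> i" for t by (rule clu(1))
    show "(\<lambda>\<omega>. 2 * tail i \<omega>) \<in> borel_measurable gauss_space" by measurable
    have "(\<integral>\<^sup>+\<omega>. 2 * tail i \<omega> \<partial>gauss_space) = 2 * (\<integral>\<^sup>+\<omega>. tail i \<omega> \<partial>gauss_space)" by (rule nn_integral_cmult) simp
    also have "\<dots> \<le> 2 * ennreal (4 * (sqrt Cvar + 1) * (2 / 2 ^ i + 3 * (2 * B i)))"
      by (intro mult_left_mono tail_integral) auto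
    also have "\<dots> = ennreal (8 * (sqrt Cvar + 1) * (2 / 2 ^ i + 6 * B i))"
      using B(2)[of i] Cvar_nonneg by (subst ennreal_numeral[symmetric], subst ennreal_mult[symmetric]) auto
    finally show "(\<integral>\<^sup>+\<omega>. 2 * tail i \<omega> \<partial>gauss_space) \<le> ennreal (8 * (sqrt Cvar + 1) * (2 / 2 ^ i + 6 * B i))" .
    show "ennreal \<bar>linf_eval (N \<omega>) s - linf_eval (N \<omega>) t\<bar> \<le> 2 * tail i \<omega>" if "c i s = c i t" for s t \<omega>
      by (rule N_oscillation[OF that])
  qed
  show ?thesis
    using N_measurable N_tight N_gaussian N_mean N_L2 N_ip cells by blast
qed

text \<open>
  The number \<open>m\<close> of cells is fixed first, from the required oscillation within the cells; then the
  increments over \<open>d\<close>-close pairs are made small compared with \<open>1 / m\<^sup>2\<close>.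
\<close>

lemma equicontinuity_of_cells:
  fixes x :: "nat \<Rightarrow> 't \<Rightarrow> 'w \<Rightarrow> real" and d :: "'t \<Rightarrow> 't \<Rightarrow> real"
  assumes M: "\<And>n. prob_space (M n)" and x: "\<And>n t. x n t \<in> borel_measurable (M n)"
    and cells: "\<And>e. 0 < e \<Longrightarrow> \<exists>m. \<forall>\<^sub>F n in sequentially. small_on_cells (M n) (x n) m e"
    and inc: "\<And>\<tau>. 0 < \<tau> \<Longrightarrow> \<exists>\<delta>>0. \<forall>\<^sub>F n in sequentially. \<forall>s t. d s t < \<delta> \<longrightarrow> (\<integral>\<^sup>+\<omega>. ennreal \<bar>x n s \<omega> - x n t \<omega>\<bar> \<partial>M n) \<le> ennreal \<tau>"
    and e: "0 < \<epsilon>" and h: "0 < \<eta>"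
  shows "\<exists>\<delta>>0. \<forall>\<^sub>F n in sequentially. likely (M n) \<epsilon> (\<lambda>\<omega>. \<forall>s t. d s t < \<delta> \<longrightarrow> \<bar>x n s \<omega> - x n t \<omega>\<bar> \<le> \<eta>)"
proof -
  define e' where "e' = \<epsilon> * \<eta> / 4"
  have e': "0 < e'" using e h by (simp add: e'_def)
  obtain m where m: "\<forall>\<^sub>F n in sequentially. small_on_cells (M n) (x n) m e'"
    using cells[OF e'] by blast
  define \<tau> where "\<tau> = \<epsilon> * \<eta> / (2 * (real m * real m + 1))"
  have mm: "0 < real m * real m + 1" by (simp add: add_nonneg_pos)
  have t: "0 < \<tau>" unfolding \<tau>_def using e h mm by (intro divide_pos_pos) auto
  obtain \<delta> where d: "0 < \<delta>" "\<forall>\<^sub>F n in sequentially. \<forall>s t. d s t < \<delta> \<longrightarrow> (\<integral>\<^sup>+\<omega>. ennreal \<bar>x n s \<omega> - x n t \<omega>\<bar> \<partial>M n) \<le> ennreal \<tau>"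
    using inc[OF t] by blast
  have "real m * real m * \<tau> \<le> (real m * real m + 1) * \<tau>" using t by (intro mult_right_mono) auto
  also have "\<dots> = \<epsilon> * \<eta> / 2"
  proof -
    define r where "r = real m * real m + 1"
    have "0 < r" using mm by (simp add: r_def)
    then show ?thesis unfolding \<tau>_def r_def[symmetric] by simp
  qed
  finally have "2 * e' + real m * real m * \<tau> \<le> \<epsilon> * \<eta>" by (simp add: e'_def)
  then have bound: "(2 * e' + real m * real m * \<tau>) / \<eta> \<le> \<epsilon>" using h by (simp add: divide_le_eq)
  from m d(2) have "\<forall>\<^sub>F n in sequentially. likely (M n) \<epsilon> (\<lambda>\<omega>. \<forall>s t. d s t < \<delta> \<longrightarrow> \<bar>x n s \<omega> - x n t \<omega>\<bar> \<le> \<eta>)"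
  proof eventually_elim
    case (elim n)
    interpret prob_space "M n" by (rule M)
    obtain c :: "'t \<Rightarrow> nat" and W where cW: "\<And>t. c t < m" "W \<in> borel_measurable (M n)"
      "(\<integral>\<^sup>+\<omega>. W \<omega> \<partial>M n) \<le> ennreal e'" "\<And>s t \<omega>. c s = c t \<Longrightarrow> ennreal \<bar>x n s \<omega> - x n t \<omega>\<bar> \<le> W \<omega>"
      using elim(1) by blast
    have "likely (M n) ((2 * e' + real m * real m * \<tau>) / \<eta>) (\<lambda>\<omega>. \<forall>s t. d s t < \<delta> \<longrightarrow> \<bar>x n s \<omega> - x n t \<omega>\<bar> \<le> \<eta>)"
      by (rule cell_increments[where W = W and c = c]) (use x cW e' elim(2) t h in auto)
    then obtain B where "B \<in> sets (M n)" "1 - (2 * e' + real m * real m * \<tau>) / \<eta> \<le> prob B"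
     "\<forall>\<omega>\<in>B. \<forall>s t. d s t < \<delta> \<longrightarrow> \<bar>x n s \<omega> - x n t \<omega>\<bar> \<le> \<eta>" by blast
    then show ?case using bound by (intro bexI[of _ B]) auto
  qed
  then show ?thesis using d(1) by blast
qed

lemma nat_le_of_ln_le:
  assumes "1 \<le> m" "0 < r" "r * sqrt (ln (real m)) \<le> B"
  shows "ln (real m) \<le> (B / r)\<^sup>2" "real m \<le> exp ((B / r)\<^sup>2)"
proof -
  have "sqrt (ln (real m)) \<le> B / r" using assms by (simp add: le_divide_eq mult.commute)
  then have "(sqrt (ln (real m)))\<^sup>2 \<le> (B / r)\<^sup>2" using assms by (intro power_mono) auto
  then show 1: "ln (real m) \<le> (B / r)\<^sup>2" using assms by simp
  have "real m = exp (ln (real m))" using assms by simp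
  also have "\<dots> \<le> exp ((B / r)\<^sup>2)" using 1 by simp
  finally show "real m \<le> exp ((B / r)\<^sup>2)" .
qed

section \<open>Transport to a common probability space\<close>

lemma inner_measure_of_sets: "A \<in> sets M \<Longrightarrow> inner_measure_of M A = emeasure M A"
  unfolding inner_measure_of_def
  by (intro antisym SUP_least SUP_upper) (auto intro: emeasure_mono)

lemma bounded_in_probability:
  assumes P: "\<And>n. prob_space (P n)" and x: "\<And>n. x n \<in> L2 (P n)" "\<And>n. ip (P n) (x n) (x n) \<le> v * \<sigma>\<^sup>2"
    and v: "0 \<le> v" and s: "0 < \<sigma>" and e: "0 < \<epsilon>"
  shows "\<exists>R. \<forall>\<^sub>F n in sequentially. likely (P n) \<epsilon> (\<lambda>\<omega>. \<bar>x n \<omega>\<bar> \<le> R)"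
proof -
  define w where "w = (1 + v) * \<sigma>"
  have w: "0 < w" using v s by (simp add: w_def)
  have "likely (P n) \<epsilon> (\<lambda>\<omega>. \<bar>x n \<omega>\<bar> \<le> w / \<epsilon>)" for n
  proof -
    interpret prob_space "P n" by (rule P)
    have [measurable]: "x n \<in> borel_measurable (P n)" using x(1)[of n] by (simp add: L2_def)
    have m: "(\<lambda>\<omega>. ennreal \<bar>x n \<omega>\<bar>) \<in> borel_measurable (P n)" by measurable
    have "likely (P n) (w / (w / \<epsilon>)) (\<lambda>\<omega>. \<omega> \<in> space (P n) \<and> ennreal \<bar>x n \<omega>\<bar> \<le> ennreal (w / \<epsilon>))"
      by (rule markov_event[OF m]) (use abs_mean_le[OF x s] w e in \<open>auto simp: w_def\<close>)
    then show ?thesis using w e by (auto simp: ennreal_le_iff)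
  qed
  then show ?thesis by (intro exI[of _ "w / \<epsilon>"] always_eventually allI)
qed

text \<open>
  The image measure on sequences of bounded functions, under which the processes are the
  coordinates. All properties asserted are properties of the individual laws; this includes
  asymptotic tightness, because the inner probability is taken of preimages of open sets.
\<close>

lemma joint_space:
  fixes N :: "nat \<Rightarrow> 'v \<Rightarrow> 't linf"
  assumes P: "prob_space P" and N: "\<And>n. N n \<in> borel_measurable P"
    and tight: "\<And>n. tight_borel_measurable P (N n)"
    and corr: "\<And>n. corresponding_gaussian_process P (N n) (M n) (G n)"
    and at: "asymptotically_tight (\<lambda>_. P) N"
  shows "\<exists>(Q :: (nat \<Rightarrow> 't linf) measure) N'. prob_space Q \<and>
       (\<forall>n. tight_borel_measurable Q (N' n) \<and> corresponding_gaussian_process Q (N' n) (M n) (G n)) \<and>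
       asymptotically_tight (\<lambda>_. Q) N'"
proof -
  interpret P: prob_space P by (rule P)
  define T where "T = (\<lambda>\<omega> n. N n \<omega>)"
  define Q where "Q = distr P (PiM UNIV (\<lambda>_::nat. borel :: 't linf measure)) T"
  define N' where "N' = (\<lambda>n (\<omega> :: nat \<Rightarrow> 't linf). \<omega> n)"
  have T: "T \<in> measurable P (PiM UNIV (\<lambda>_::nat. borel :: 't linf measure))"
    unfolding T_def using N by (intro measurable_PiM_single') (auto simp: space_PiM)
  have N'm: "N' n \<in> borel_measurable Q" for n
    unfolding Q_def N'_def measurable_distr_eq1 by (rule measurable_component_singleton) simp
  have N'T: "N' n (T \<omega>) = N n \<omega>" for n \<omega> by (simp add: N'_def T_def)
  have N'm': "N' n \<in> measurable (PiM UNIV (\<lambda>_::nat. borel :: 't linf measure)) borel" for n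
    using N'm by (simp add: Q_def)
  have law: "distr Q borel (\<lambda>\<omega>. g (N' n \<omega>)) = distr P borel (\<lambda>\<omega>. g (N n \<omega>))" if g: "g \<in> measurable borel borel" for g :: "'t linf \<Rightarrow> real" and n
    unfolding Q_def using T measurable_compose[OF N'm' g] by (subst distr_distr) (auto simp: o_def N'T)
  have lawN: "distr Q borel (N' n) = distr P borel (N n)" for n
    unfolding Q_def using T N'm' by (subst distr_distr) (auto simp: o_def N'T)
  have integ: "(\<integral>\<omega>. g (N' n \<omega>) \<partial>Q) = (\<integral>\<omega>. g (N n \<omega>) \<partial>P)" if g: "g \<in> borel_measurable borel" for g :: "'t linf \<Rightarrow> real" and n
    unfolding Q_def using T measurable_compose[OF N'm' g] by (subst integral_distr) (auto simp: N'T)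
  have ev: "(\<lambda>x. linf_eval x t) \<in> borel_measurable borel" for t :: 't
    by (rule borel_measurable_continuous_onI[OF continuous_on_linf_eval])
  note [measurable] = ev
  have Qp: "prob_space Q" unfolding Q_def using T by (rule P.prob_space_distr)
  moreover have "tight_borel_measurable Q (N' n)" for n
    using tight[of n] N'm by (simp add: tight_borel_measurable_def lawN)
  moreover have "corresponding_gaussian_process Q (N' n) (M n) (G n)" for n
  proof -
    note c = corr[of n, unfolded corresponding_gaussian_process_def]
    have mean: "(\<integral>\<omega>. linf_eval (N' n \<omega>) t \<partial>Q) = (\<integral>\<omega>. linf_eval (N n \<omega>) t \<partial>P)" for t by (rule integ[OF ev])
    have "gaussian_process Q (\<lambda>t \<omega>. linf_eval (N' n \<omega>) t)"
      unfolding gaussian_process_def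
    proof (intro conjI allI impI)
      show "(\<lambda>\<omega>. linf_eval (N' n \<omega>) t) \<in> borel_measurable Q" for t using measurable_compose[OF N'm ev] .
      fix S :: "'t set" and a assume S: "finite S"
      have "distr Q borel (\<lambda>\<omega>. \<Sum>t\<in>S. a t * linf_eval (N' n \<omega>) t) = distr P borel (\<lambda>\<omega>. \<Sum>t\<in>S. a t * linf_eval (N n \<omega>) t)"
        by (rule law[of "\<lambda>x. \<Sum>t\<in>S. a t * linf_eval x t"]) measurable
      then show "\<exists>\<mu> \<sigma>. 0 \<le> \<sigma> \<and> distr Q borel (\<lambda>\<omega>. \<Sum>t\<in>S. a t * linf_eval (N' n \<omega>) t) = normal_law \<mu> \<sigma>"
        using c S unfolding gaussian_process_def by simp
    qed
    moreover have "covariance Q (\<lambda>\<omega>. linf_eval (N' n \<omega>) s) (\<lambda>\<omega>. linf_eval (N' n \<omega>) t) =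
      covariance P (\<lambda>\<omega>. linf_eval (N n \<omega>) s) (\<lambda>\<omega>. linf_eval (N n \<omega>) t)" for s t
      unfolding covariance_def mean
      by (rule integ[of "\<lambda>x. (linf_eval x s - _) * (linf_eval x t - _)"]) measurable
    ultimately show ?thesis using c unfolding corresponding_gaussian_process_def mean by simp
  qed
  moreover have "asymptotically_tight (\<lambda>_. Q) N'"
  proof -
    have "inner_measure_of Q {\<omega> \<in> space Q. N' n \<omega> \<in> (\<Union>x\<in>K. ball x \<delta>)} =
      inner_measure_of P {\<omega> \<in> space P. N n \<omega> \<in> (\<Union>x\<in>K. ball x \<delta>)}" for n K \<delta>
    proof -
      have U: "(\<Union>x\<in>K. ball x \<delta>) \<in> sets borel" by (intro borel_open) auto
      have A: "{\<omega> \<in> space Q. N' n \<omega> \<in> (\<Union>x\<in>K. ball x \<delta>)} = N' n -` (\<Union>x\<in>K. ball x \<delta>) \<inter> space Q" by auto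
      have B: "{\<omega> \<in> space P. N n \<omega> \<in> (\<Union>x\<in>K. ball x \<delta>)} = N n -` (\<Union>x\<in>K. ball x \<delta>) \<inter> space P" by auto
      show ?thesis
        unfolding A B inner_measure_of_sets[OF measurable_sets[OF N'm U]] inner_measure_of_sets[OF measurable_sets[OF N U]]
        by (simp only: emeasure_distr[OF N'm U, symmetric] emeasure_distr[OF N U, symmetric] lawN)
    qed
    then show ?thesis using at by (simp add: asymptotically_tight_def)
  qed
  ultimately show ?thesis by blast
qed

section \<open>Asymptotic tightness of the empirical and of the Gaussian processes\<close>

theorem theorem3p5:
  fixes M :: "nat \<Rightarrow> 'w measure"
    and k :: "nat \<Rightarrow> nat"
    and X :: "nat \<Rightarrow> nat \<Rightarrow> 'w \<Rightarrow> 'x::polish_space"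
    and f :: "nat \<Rightarrow> 't \<Rightarrow> 'x \<Rightarrow> real"
    and F :: "'x \<Rightarrow> real"
    and \<gamma> \<rho> :: real
    and d :: "'t \<Rightarrow> 't \<Rightarrow> real"
  assumes "\<And>n. prob_space (M n)"
    and "\<And>n. 0 < k n"
    and "filterlim k at_top sequentially"
    and "\<And>n i. i \<in> {1..k n} \<Longrightarrow> X n i \<in> borel_measurable (M n)"
    and "\<And>n t. f n t \<in> borel_measurable borel"
    and "F \<in> borel_measurable borel"
    and "\<And>n t x. \<bar>f n t x\<bar> \<le> F x"
    and "2 < \<gamma>"
    and "(SUP n. row_seminorm (M n) (k n) (X n) \<gamma> F) < \<infinity>"
    and "\<gamma> / (\<gamma> - 2) < \<rho>"
    and "(SUP n. MAX m\<in>{..k n}. ennreal (real m powr \<rho>) * row_beta (M n) (k n) (X n) m) < \<infinity>"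
    and "\<And>\<delta>. decreases_to_zero \<delta> \<Longrightarrow>
      (\<lambda>n. bracketing_integral (\<delta> n) (range (f n)) (row_seminorm (M n) (k n) (X n) \<gamma>))
        \<longlonglongrightarrow> 0"
    and "\<And>\<delta> n. decreases_to_zero \<delta> \<Longrightarrow>
      bracketing_integral (\<delta> n) (range (f n)) (row_seminorm (M n) (k n) (X n) \<gamma>) < \<infinity>"
    and "semimetric d"
    and "semimetric_totally_bounded d"
    and "\<And>\<delta>. decreases_to_zero \<delta> \<Longrightarrow>
      (\<lambda>n. SUP (s, t)\<in>{(s, t). d s t < \<delta> n}.
        row_seminorm (M n) (k n) (X n) \<gamma> (\<lambda>x. f n s x - f n t x)) \<longlonglongrightarrow> 0"
  defines "G \<equiv> \<lambda>n. empirical_process (M n) (k n) (X n) (f n)"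
  shows "asymptotically_tight M G \<and>
    (\<exists>(Q :: (nat \<Rightarrow> 't linf) measure) N.
       prob_space Q \<and>
       (\<forall>n. tight_borel_measurable Q (N n) \<and>
            corresponding_gaussian_process Q (N n) (M n) (G n)) \<and>
       asymptotically_tight (\<lambda>_. Q) N)"
proof -
  let ?rs = "\<lambda>n. row_seminorm (M n) (k n) (X n) \<gamma>"
  define b where "b n \<delta> = bracketing_integral \<delta> (range (f n)) (?rs n)" for n \<delta>
  have kpos: "0 < k n" for n by (rule assms(2))

  have F0: "0 \<le> F x" for x using assms(7)[of undefined undefined x] by linarith
  define \<sigma> where "\<sigma> = enn2real (SUP n. ?rs n F) + 1"
  have s: "0 < \<sigma>" by (simp add: \<sigma>_def add_nonneg_pos)
  have rsF: "?rs n F \<le> ennreal \<sigma>" for n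
  proof -
    have "?rs n F \<le> (SUP n. ?rs n F)" by (rule SUP_upper) simp
    also have "\<dots> = ennreal (enn2real (SUP n. ?rs n F))" using assms(9) by (simp add: less_top)
    also have "\<dots> \<le> ennreal \<sigma>" by (intro ennreal_leI) (simp add: \<sigma>_def)
    finally show ?thesis .
  qed

  define S where "S = (SUP n. MAX m\<in>{..k n}. ennreal (real m powr \<rho>) * row_beta (M n) (k n) (X n) m)"
  define K where "K = enn2real S"
  have K0: "0 \<le> K" by (simp add: K_def)
  have beta: "row_beta (M n) (k n) (X n) m \<le> ennreal (K * real m powr - \<rho>)" if m: "1 \<le> m" "m \<le> k n" for n m
  proof -
    let ?b = "row_beta (M n) (k n) (X n) m"
    have "ennreal (real m powr \<rho>) * ?b \<le> (MAX m\<in>{..k n}. ennreal (real m powr \<rho>) * row_beta (M n) (k n) (X n) m)"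
      using m by (intro Max_ge) auto
    also have "\<dots> \<le> S" unfolding S_def by (rule SUP_upper) simp
    also have "S = ennreal K" using assms(11) by (simp add: K_def S_def less_top)
    finally have "ennreal (real m powr - \<rho>) * (ennreal (real m powr \<rho>) * ?b) \<le> ennreal (real m powr - \<rho>) * ennreal K"
      by (intro mult_left_mono) auto
    also have "ennreal (real m powr - \<rho>) * (ennreal (real m powr \<rho>) * ?b) =
      ennreal (real m powr - \<rho> * real m powr \<rho>) * ?b" by (simp add: ennreal_mult mult.assoc)
    also have "real m powr - \<rho> * real m powr \<rho> = 1" using m by (simp flip: powr_add)
    finally show ?thesis using K0 by (simp add: mult.commute flip: ennreal_mult)
  qed
  have row: "mixing_row (M n) (k n) (X n) \<gamma> \<rho> K" for n
  proof -
    interpret prob_space "M n" by (rule assms(1))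
    show ?thesis by unfold_locales (use assms(2,4,8,10) K0 beta in auto)
  qed
  define em where "em n = mixing_row.emp (M n) (k n) (X n)" for n
  define V where "V = mixing_row.Cvar \<gamma> \<rho> K"
  have V0: "0 \<le> V" unfolding V_def by (rule mixing_row.Cvar_nonneg[OF row])

  have fmom: "mixing_row.moment_le (M n) (k n) (X n) \<gamma> (f n t) \<sigma>" for n t
    by (rule mixing_row.moment_le_mono[OF row mixing_row.moment_le_of_row_seminorm[OF row rsF]])
      (use assms(7) F0 s in \<open>auto intro: less_imp_le\<close>)
  have Fint: "integrable (M n) (\<lambda>\<omega>. F (X n i \<omega>))" if "i \<in> {1..k n}" for n i
    by (rule mixing_row.moment_integrable(1)[OF row mixing_row.moment_le_of_row_seminorm[OF row rsF] assms(6) that])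
      (use s in simp)
  have fint: "integrable (M n) (\<lambda>\<omega>. f n t (X n i \<omega>))" if "i \<in> {1..k n}" for n t i
    by (rule mixing_row.moment_integrable(1)[OF row fmom assms(5) that])
  have eval: "linf_eval (G n \<omega>) t = em n (f n t) \<omega>" for n \<omega> t
    unfolding G_def em_def mixing_row.emp_def[OF row]
    by (rule linf_eval_empirical_process[OF assms(7,5,4) Fint])
  have em_L2: "em n (f n t) \<in> L2 (M n)" "ip (M n) (em n (f n t)) (em n (f n t)) \<le> V * \<sigma>\<^sup>2" for n t
    unfolding em_def V_def by (rule mixing_row.emp_second_moment[OF row fmom assms(5) s])+
  have em_meas: "em n (f n t) \<in> borel_measurable (M n)" for n t using em_L2(1) by (simp add: L2_def)

  \<comment> \<open>the variance bound of the rows: the distance \<open>d_n\<close> controls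
    increments in mean square, with a constant independent of \<open>n\<close>\<close>
  have em_inc: "(\<lambda>\<omega>. em n (f n s) \<omega> - em n (f n t) \<omega>) \<in> L2 (M n)"
      "ip (M n) (\<lambda>\<omega>. em n (f n s) \<omega> - em n (f n t) \<omega>) (\<lambda>\<omega>. em n (f n s) \<omega> - em n (f n t) \<omega>) \<le> V * \<tau>\<^sup>2"
    if \<tau>: "0 < \<tau>" and le: "?rs n (\<lambda>x. f n s x - f n t x) \<le> ennreal \<tau>" for n s t \<tau>
  proof -
    have m: "mixing_row.moment_le (M n) (k n) (X n) \<gamma> (\<lambda>x. f n s x - f n t x) \<tau>"
      by (rule mixing_row.moment_le_of_row_seminorm[OF row le]) (use \<tau> in simp)
    have e: "em n (\<lambda>x. f n s x - f n t x) = (\<lambda>\<omega>. em n (f n s) \<omega> - em n (f n t) \<omega>)"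
      unfolding em_def by (intro ext mixing_row.emp_diff[OF row] fint)
    have meas: "(\<lambda>x. f n s x - f n t x) \<in> borel_measurable borel" using assms(5) by measurable
    show "(\<lambda>\<omega>. em n (f n s) \<omega> - em n (f n t) \<omega>) \<in> L2 (M n)"
      "ip (M n) (\<lambda>\<omega>. em n (f n s) \<omega> - em n (f n t) \<omega>) (\<lambda>\<omega>. em n (f n s) \<omega> - em n (f n t) \<omega>) \<le> V * \<tau>\<^sup>2"
      using mixing_row.emp_second_moment[OF row m meas \<tau>, folded em_def V_def] unfolding e by auto
  qed
  have dsmall: "\<exists>\<delta>>0. \<forall>\<^sub>F n in sequentially. \<forall>s t. d s t < \<delta> \<longrightarrow> ?rs n (\<lambda>x. f n s x - f n t x) \<le> ennreal \<tau>"
    if \<tau>: "0 < \<tau>" for \<tau>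
  proof -
    have "\<exists>\<delta>>0. \<forall>\<^sub>F n in sequentially. (SUP (s, t)\<in>{(s, t). d s t < \<delta>}. ?rs n (\<lambda>x. f n s x - f n t x)) \<le> ennreal \<tau>"
      by (rule uniformly_small_of_sequences[OF assms(16)]) (use \<tau> in simp_all)
    then obtain \<delta> where \<delta>: "0 < \<delta>" "\<forall>\<^sub>F n in sequentially. (SUP (s, t)\<in>{(s, t). d s t < \<delta>}. ?rs n (\<lambda>x. f n s x - f n t x)) \<le> ennreal \<tau>"
      by blast
    have "\<forall>\<^sub>F n in sequentially. \<forall>s t. d s t < \<delta> \<longrightarrow> ?rs n (\<lambda>x. f n s x - f n t x) \<le> ennreal \<tau>"
      using \<delta>(2)
    proof eventually_elim
      case (elim n)
      show ?case
      proof (intro allI impI)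
        fix s t assume "d s t < \<delta>"
        then have "?rs n (\<lambda>x. f n s x - f n t x) \<le> (SUP (s, t)\<in>{(s, t). d s t < \<delta>}. ?rs n (\<lambda>x. f n s x - f n t x))"
          by (intro SUP_upper2[of "(s, t)"]) auto
        then show "?rs n (\<lambda>x. f n s x - f n t x) \<le> ennreal \<tau>" using elim by (rule order_trans)
      qed
    qed
    then show ?thesis using \<delta>(1) by blast
  qed

  have bfin: "b n \<delta> < \<infinity>" if d: "0 < \<delta>" for n \<delta>
  proof -
    obtain \<delta>' where "decreases_to_zero \<delta>'" "\<delta>' n = \<delta>" using exists_decreasing_through[OF d] by blast
    then show ?thesis using assms(13)[of \<delta>' n] by (simp add: b_def)
  qed
  have number: "bracketing_number \<delta> (range (f n)) (?rs n) = enat (the_enat (bracketing_number \<delta> (range (f n)) (?rs n)))"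
    if "0 < \<delta>" for n \<delta>
    using bracketing_number_finite[OF bfin[OF that, of n, unfolded b_def] that]
    by (cases "bracketing_number \<delta> (range (f n)) (?rs n)") auto
  have bsmall: "\<exists>\<delta>>0. \<forall>\<^sub>F n in sequentially. b n \<delta> \<le> ennreal \<eta>" if "0 < \<eta>" for \<eta>
    using uniformly_small_of_sequences[of b "ennreal \<eta>"] assms(12) that by (simp add: b_def)
  define \<nu> where "\<nu> n \<delta> = the_enat (bracketing_number \<delta> (range (f n)) (?rs n))" for n \<delta>
  have nu: "bracketing_number \<delta> (range (f n)) (?rs n) = enat (\<nu> n \<delta>)" if "0 < \<delta>" for n \<delta>
    using number[OF that] by (simp add: \<nu>_def)
  have nu1: "1 \<le> \<nu> n \<delta>" if d: "0 < \<delta>" for n \<delta>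
  proof -
    obtain c :: "'t \<Rightarrow> nat" where "\<And>t. c t < \<nu> n \<delta>" by (rule obtain_brackets[OF nu[OF d]]) blast
    from this[of undefined] show ?thesis by linarith
  qed
  have nu_le: "\<delta> / 2 ^ j * sqrt (ln (real (\<nu> n (\<delta> / 2 ^ j)))) \<le> 2 * B"
    if "0 < \<delta>" "b n (\<delta> / 2 ^ j) \<le> ennreal B" "0 \<le> B" for n \<delta> j B
  proof -
    have p: "0 < \<delta> / 2 ^ i" for i :: nat using that(1) by simp
    show ?thesis
      using dyadic_sum_le_bracketing_integral[OF that(2)[unfolded b_def] that(3,1) nu[OF p] nu1[OF p], of j] by simp
  qed

  have cellsG: "\<exists>m. \<forall>\<^sub>F n in sequentially. small_on_cells (M n) (\<lambda>t \<omega>. linf_eval (G n \<omega>) t) m e"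
    if e: "0 < e" for e
  proof -
    define A where "A = 2 * (2 powr \<gamma> + 2 * mixing_row.Cerr \<gamma> \<rho> K + 2)"
    have A0: "0 < A" unfolding A_def using mixing_row.Cerr_nonneg[OF row] by (simp add: add_nonneg_pos)
    \<comment> \<open>\<open>A\<close> is the constant of the maximal inequality, so the majorant
      has mean at most \<open>e\<close>\<close>
    define \<eta> where "\<eta> = e / A"
    have h: "0 < \<eta>" using e A0 by (simp add: \<eta>_def)
    obtain \<delta>1 where d1: "0 < \<delta>1" "\<forall>\<^sub>F n in sequentially. b n \<delta>1 \<le> ennreal (\<eta> / 32)"
      using bsmall[of "\<eta> / 32"] h by auto
    \<comment> \<open>with an entropy integral of at most \<open>\<eta> / 32\<close> this choice
      gives \<open>2 * \<delta> + 4 * (\<eta> / 32) \<le> \<eta> / 2\<close>, as the maximal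
      inequality requires\<close>
    define \<delta> where "\<delta> = min \<delta>1 (\<eta> / 16)"
    have d: "0 < \<delta>" "\<delta> \<le> \<delta>1" "\<delta> \<le> \<eta> / 16" using d1 h by (auto simp: \<delta>_def)
    \<comment> \<open>bounds, the same for all large \<open>n\<close>, on the logarithms of the
      bracketing numbers at \<open>\<delta>\<close> and \<open>\<delta> / 2\<close>\<close>
    define r0 where "r0 = (\<eta> / 16 / \<delta>)\<^sup>2"
    define r1 where "r1 = (\<eta> / 16 / (\<delta> / 2))\<^sup>2"
    define kap where "kap = mixing_row.kappa \<gamma> \<rho>"
    have kap: "0 < kap" unfolding kap_def by (rule mixing_row.kappa_pos[OF row])
    have r: "0 < 1 + r0 + r1" by (simp add: r0_def r1_def add_pos_nonneg)
    have kr: "filterlim (\<lambda>n. real (k n)) at_top sequentially"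
      by (rule filterlim_compose[OF filterlim_real_sequentially assms(3)])
    have "filterlim (\<lambda>n. (1 / (1 + r0 + r1)) * real (k n)) at_top sequentially"
      using r by (intro filterlim_tendsto_pos_mult_at_top[OF tendsto_const _ kr]) simp
    then have "((\<lambda>n. ((1 / (1 + r0 + r1)) * real (k n)) powr - kap) \<longlonglongrightarrow> 0)"
      using kap by (intro tendsto_neg_powr) auto
    then have "((\<lambda>n. exp r0 * ((1 / (1 + r0 + r1)) * real (k n)) powr - kap) \<longlonglongrightarrow> exp r0 * 0)"
      by (intro tendsto_mult tendsto_const)
    then have ev1: "\<forall>\<^sub>F n in sequentially. exp r0 * ((1 / (1 + r0 + r1)) * real (k n)) powr - kap < 1"
      by (rule order_tendstoD(2)) simp
    have ev2: "\<forall>\<^sub>F n in sequentially. \<eta> / \<delta> < sqrt (real (k n))"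
      using filterlim_compose[OF sqrt_at_top kr] by (simp add: filterlim_at_top_dense)
    have "\<forall>\<^sub>F n in sequentially. small_on_cells (M n) (\<lambda>t \<omega>. linf_eval (G n \<omega>) t) (nat \<lceil>exp r0\<rceil>) e"
      using d1(2) ev1 ev2
    proof eventually_elim
      case (elim n)
      have bB: "b n (\<delta> / 2 ^ j) \<le> ennreal (\<eta> / 32)" for j
      proof -
        have "\<delta> / 2 ^ j \<le> \<delta> / 1" using d(1) by (intro divide_left_mono) auto
        then have "\<delta> / 2 ^ j \<le> \<delta>1" using d(2) by simp
        then have "b n (\<delta> / 2 ^ j) \<le> b n \<delta>1" unfolding b_def by (rule bracketing_integral_mono)
        then show ?thesis using elim(1) by (rule order_trans)
      qed
      have p: "0 < \<delta> / 2 ^ j" for j :: nat using d by simp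
      define m where "m j = \<nu> n (\<delta> / 2 ^ j)" for j
      have m1: "1 \<le> m j" for j unfolding m_def by (rule nu1[OF p])
      have l0: "ln (real (m 0)) \<le> r0" "real (m 0) \<le> exp r0"
        using nat_le_of_ln_le[OF m1[of 0] d(1), of "\<eta> / 16"] nu_le[OF d(1) bB[of 0]] h by (auto simp: m_def r0_def)
      have l1: "ln (real (m 1)) \<le> r1"
        using nat_le_of_ln_le(1)[OF m1[of 1], of "\<delta> / 2" "\<eta> / 16"] nu_le[OF d(1) bB[of 1]] h d(1) by (auto simp: m_def r1_def)
      have first: "real (m 0) * (real (k n) / (1 + ln (real (m 0)) + ln (real (m 1)))) powr - kap \<le> 1"
      proof -
        have pos: "0 < 1 + ln (real (m 0)) + ln (real (m 1))" using m1[of 0] m1[of 1] by (simp add: add_pos_nonneg)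
        have "(1 / (1 + r0 + r1)) * real (k n) \<le> real (k n) / (1 + ln (real (m 0)) + ln (real (m 1)))"
          using l0 l1 pos r by (simp add: divide_left_mono)
        then have "(real (k n) / (1 + ln (real (m 0)) + ln (real (m 1)))) powr - kap \<le> ((1 / (1 + r0 + r1)) * real (k n)) powr - kap"
          using kap r kpos[of n] by (intro powr_mono2') auto
        then have "real (m 0) * (real (k n) / (1 + ln (real (m 0)) + ln (real (m 1)))) powr - kap \<le>
          exp r0 * ((1 / (1 + r0 + r1)) * real (k n)) powr - kap"
          using l0 by (intro mult_mono) auto
        then show ?thesis using elim(2) by linarith
      qed
      have "small_on_cells (M n) (\<lambda>t \<omega>. em n (f n t) \<omega>) (m 0) (2 * (2 powr \<gamma> + 2 * mixing_row.Cerr \<gamma> \<rho> K + 2) * \<eta>)"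
        unfolding em_def
      proof (rule mixing_row.empirical_cells[OF row assms(5) fint, where \<delta> = \<delta> and B = "\<eta> / 32"])
        show "bracketing_number (\<delta> / 2 ^ j) (range (f n)) (?rs n) = enat (m j)" for j
          unfolding m_def by (rule nu[OF p])
        show "bracketing_integral \<delta> (range (f n)) (?rs n) \<le> ennreal (\<eta> / 32)" using bB[of 0] by (simp add: b_def)
        show "2 * \<delta> + 4 * (\<eta> / 32) \<le> \<eta> / 2" using d(3) h by simp
        show "\<eta> < sqrt (real (k n)) * \<delta>" using elim(3) d(1) by (simp add: divide_less_eq)
        show "real (m 0) * (real (k n) / (1 + ln (real (m 0)) + ln (real (m 1)))) powr - mixing_row.kappa \<gamma> \<rho> \<le> 1"
          using first by (simp add: kap_def)
      qed (use d h in auto)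
      then obtain c :: "'t \<Rightarrow> nat" and W where cW: "\<And>t. c t < m 0" "W \<in> borel_measurable (M n)"
        "(\<integral>\<^sup>+\<omega>. W \<omega> \<partial>M n) \<le> ennreal (A * \<eta>)"
        "\<And>s t \<omega>. c s = c t \<Longrightarrow> ennreal \<bar>em n (f n s) \<omega> - em n (f n t) \<omega>\<bar> \<le> W \<omega>"
        unfolding A_def by blast
      have "m 0 \<le> nat \<lceil>exp r0\<rceil>" using l0(2) by linarith
      moreover have "A * \<eta> = e" using A0 by (simp add: \<eta>_def)
      ultimately show ?case
        using cW by (intro exI[of _ c] exI[of _ W]) (auto simp: eval intro: less_le_trans)
    qed
    then show ?thesis by blast
  qed
  have incG: "\<exists>\<delta>>0. \<forall>\<^sub>F n in sequentially. \<forall>s t. d s t < \<delta> \<longrightarrow>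
      (\<integral>\<^sup>+\<omega>. ennreal \<bar>linf_eval (G n \<omega>) s - linf_eval (G n \<omega>) t\<bar> \<partial>M n) \<le> ennreal \<tau>" if \<tau>: "0 < \<tau>" for \<tau>
  proof -
    define \<tau>' where "\<tau>' = \<tau> / (1 + V)"
    have t': "0 < \<tau>'" "(1 + V) * \<tau>' = \<tau>" using \<tau> V0 by (auto simp: \<tau>'_def)
    obtain \<delta> where \<delta>: "0 < \<delta>" "\<forall>\<^sub>F n in sequentially. \<forall>s t. d s t < \<delta> \<longrightarrow> ?rs n (\<lambda>x. f n s x - f n t x) \<le> ennreal \<tau>'"
      using dsmall[OF t'(1)] by blast
    have "\<forall>\<^sub>F n in sequentially. \<forall>s t. d s t < \<delta> \<longrightarrow>
      (\<integral>\<^sup>+\<omega>. ennreal \<bar>linf_eval (G n \<omega>) s - linf_eval (G n \<omega>) t\<bar> \<partial>M n) \<le> ennreal \<tau>"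
      using \<delta>(2)
    proof (rule eventually_mono, intro allI impI)
      fix n s t assume "\<forall>s t. d s t < \<delta> \<longrightarrow> ?rs n (\<lambda>x. f n s x - f n t x) \<le> ennreal \<tau>'" "d s t < \<delta>"
      then have "?rs n (\<lambda>x. f n s x - f n t x) \<le> ennreal \<tau>'" by blast
      from prob_space.abs_mean_le[OF assms(1) em_inc[OF t'(1) this] t'(1)]
      show "(\<integral>\<^sup>+\<omega>. ennreal \<bar>linf_eval (G n \<omega>) s - linf_eval (G n \<omega>) t\<bar> \<partial>M n) \<le> ennreal \<tau>"
        by (simp add: eval t'(2))
    qed
    then show ?thesis using \<delta>(1) by blast
  qed
  have tightG: "asymptotically_tight M G"
  proof (rule linf_asymptotically_tightI_semimetric[OF assms(1,14,15)])
    show "\<exists>\<delta>>0. \<forall>\<^sub>F n in sequentially. likely (M n) \<epsilon> (\<lambda>\<omega>. \<forall>s t. d s t < \<delta> \<longrightarrow> \<bar>linf_eval (G n \<omega>) s - linf_eval (G n \<omega>) t\<bar> \<le> \<eta>)"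
      if "0 < \<epsilon>" "0 < \<eta>" for \<epsilon> \<eta>
      by (rule equicontinuity_of_cells[where x = "\<lambda>n t \<omega>. linf_eval (G n \<omega>) t", OF assms(1) _ cellsG incG that])
        (simp add: eval em_meas)
    show "\<exists>R. \<forall>\<^sub>F n in sequentially. likely (M n) \<epsilon> (\<lambda>\<omega>. \<bar>linf_eval (G n \<omega>) t\<bar> \<le> R)"
      if "0 < \<epsilon>" for \<epsilon> t
      unfolding eval by (rule bounded_in_probability[OF assms(1) em_L2 V0 s that])
  qed

  \<comment> \<open>the constant that \<open>gaussian_cells\<close> uses\<close>
  define C where "C = sqrt V + 1"
  have C0: "0 < C" using V0 by (simp add: C_def add_nonneg_pos)
  define BB where "BB n i = enn2real (b n (1 / 2 ^ i))" for n and i :: nat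
  have bBB: "b n (1 / 2 ^ i) = ennreal (BB n i)" for n i using bfin[of "1 / 2 ^ i" n] by (simp add: BB_def less_top)
  have "\<forall>n. \<exists>N :: (nat \<Rightarrow> real) \<Rightarrow> 't linf. N \<in> borel_measurable gauss_space \<and> tight_borel_measurable gauss_space N \<and>
     gaussian_process gauss_space (\<lambda>t \<omega>. linf_eval (N \<omega>) t) \<and>
     (\<forall>t. (\<integral>\<omega>. linf_eval (N \<omega>) t \<partial>gauss_space) = 0 \<and> (\<lambda>\<omega>. linf_eval (N \<omega>) t) \<in> L2 gauss_space) \<and>
     (\<forall>s t. ip gauss_space (\<lambda>\<omega>. linf_eval (N \<omega>) s) (\<lambda>\<omega>. linf_eval (N \<omega>) t) = ip (M n) (em n (f n s)) (em n (f n t))) \<and>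
     (\<forall>i. small_on_cells gauss_space (\<lambda>t \<omega>. linf_eval (N \<omega>) t) (\<nu> n (1 / 2 ^ i)) (8 * C * (2 / 2 ^ i + 6 * BB n i)))"
    unfolding em_def C_def V_def
  proof (intro allI mixing_row.gaussian_cells[OF row assms(5) fmom s])
    show "bracketing_number (1 / 2 ^ j) (range (f n)) (?rs n) = enat (\<nu> n (1 / 2 ^ j))" for n and j :: nat
      by (rule nu) simp
    show "bracketing_integral (1 / 2 ^ i) (range (f n)) (?rs n) \<le> ennreal (BB n i)" for n and i :: nat
      using bBB[of n i] by (simp add: b_def)
    show "0 \<le> BB n i" for n i by (simp add: BB_def)
  qed
  from choice[OF this] obtain N :: "nat \<Rightarrow> (nat \<Rightarrow> real) \<Rightarrow> 't linf" where N: "\<forall>n. N n \<in> borel_measurable gauss_space \<and> tight_borel_measurable gauss_space (N n) \<and>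
     gaussian_process gauss_space (\<lambda>t \<omega>. linf_eval (N n \<omega>) t) \<and>
     (\<forall>t. (\<integral>\<omega>. linf_eval (N n \<omega>) t \<partial>gauss_space) = 0 \<and> (\<lambda>\<omega>. linf_eval (N n \<omega>) t) \<in> L2 gauss_space) \<and>
     (\<forall>s t. ip gauss_space (\<lambda>\<omega>. linf_eval (N n \<omega>) s) (\<lambda>\<omega>. linf_eval (N n \<omega>) t) = ip (M n) (em n (f n s)) (em n (f n t))) \<and>
     (\<forall>i. small_on_cells gauss_space (\<lambda>t \<omega>. linf_eval (N n \<omega>) t) (\<nu> n (1 / 2 ^ i)) (8 * C * (2 / 2 ^ i + 6 * BB n i)))" by blast
  have N_meas: "N n \<in> borel_measurable gauss_space" and N_tight: "tight_borel_measurable gauss_space (N n)"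
    and N_gauss: "gaussian_process gauss_space (\<lambda>t \<omega>. linf_eval (N n \<omega>) t)"
    and N_mean: "(\<integral>\<omega>. linf_eval (N n \<omega>) t \<partial>gauss_space) = 0"
    and N_L2: "(\<lambda>\<omega>. linf_eval (N n \<omega>) t) \<in> L2 gauss_space"
    and N_ip: "ip gauss_space (\<lambda>\<omega>. linf_eval (N n \<omega>) s) (\<lambda>\<omega>. linf_eval (N n \<omega>) t) = ip (M n) (em n (f n s)) (em n (f n t))"
    and N_cells: "small_on_cells gauss_space (\<lambda>t \<omega>. linf_eval (N n \<omega>) t) (\<nu> n (1 / 2 ^ i)) (8 * C * (2 / 2 ^ i + 6 * BB n i))" for n s t i
    using N by blast+
  have N_eval_meas: "(\<lambda>\<omega>. linf_eval (N n \<omega>) t) \<in> borel_measurable gauss_space" for n t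
    using N_L2[of n t] by (simp add: L2_def)
  have cellsN: "\<exists>m. \<forall>\<^sub>F n in sequentially. small_on_cells gauss_space (\<lambda>t \<omega>. linf_eval (N n \<omega>) t) m e"
    if e: "0 < e" for e
  proof -
    \<comment> \<open>the majorant has mean at most \<open>8 * C * (2 / 2 ^ i + 6 * B)\<close>;
      \<open>1 / 2 ^ i \<le> e / (32 * C)\<close> and \<open>B \<le> e / (96 * C)\<close> make each
      of the two terms at most \<open>e / 2\<close>\<close>
    define \<eta> where "\<eta> = e / (96 * C)"
    have h: "0 < \<eta>" using e C0 by (simp add: \<eta>_def)
    obtain \<delta>1 where d1: "0 < \<delta>1" "\<forall>\<^sub>F n in sequentially. b n \<delta>1 \<le> ennreal \<eta>" using bsmall[OF h] by blast
    have "0 < min \<delta>1 (e / (32 * C))" using d1 e C0 by simp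
    then obtain i where "(1 / 2) ^ i < min \<delta>1 (e / (32 * C))" using real_arch_pow_inv[of "min \<delta>1 (e / (32 * C))" "1 / 2"] by auto
    then have i: "1 / 2 ^ i \<le> \<delta>1" "1 / 2 ^ i \<le> e / (32 * C)" by (auto simp: power_one_over)
    have "\<forall>\<^sub>F n in sequentially. small_on_cells gauss_space (\<lambda>t \<omega>. linf_eval (N n \<omega>) t) (nat \<lceil>exp ((2 * \<eta> / (1 / 2 ^ i))\<^sup>2)\<rceil>) e"
      using d1(2)
    proof eventually_elim
      case (elim n)
      have "b n (1 / 2 ^ i) \<le> b n \<delta>1" unfolding b_def by (rule bracketing_integral_mono[OF i(1)])
      then have bi: "b n (1 / 2 ^ i) \<le> ennreal \<eta>" using elim by (rule order_trans)
      then have BBi: "BB n i \<le> \<eta>" using bBB[of n i] h by (simp add: ennreal_le_iff)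
      have "1 / 2 ^ i * sqrt (ln (real (\<nu> n (1 / 2 ^ i)))) \<le> 2 * \<eta>" using nu_le[of 1 n i \<eta>] bi h by simp
      then have "real (\<nu> n (1 / 2 ^ i)) \<le> exp ((2 * \<eta> / (1 / 2 ^ i))\<^sup>2)"
        by (intro nat_le_of_ln_le(2) nu1) auto
      then have num: "\<nu> n (1 / 2 ^ i) \<le> nat \<lceil>exp ((2 * \<eta> / (1 / 2 ^ i))\<^sup>2)\<rceil>" by linarith
      have "8 * C * (2 / 2 ^ i + 6 * BB n i) \<le> 8 * C * (2 * (e / (32 * C)) + 6 * (e / (96 * C)))"
        using i(2) BBi C0 by (intro mult_left_mono add_mono) (auto simp: \<eta>_def)
      also have "\<dots> = e" using C0 by (simp add: field_simps)
      finally have "ennreal (8 * C * (2 / 2 ^ i + 6 * BB n i)) \<le> ennreal e" by (rule ennreal_leI)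
      moreover obtain c :: "'t \<Rightarrow> nat" and W where "\<And>t. c t < \<nu> n (1 / 2 ^ i)" "W \<in> borel_measurable gauss_space"
        "(\<integral>\<^sup>+\<omega>. W \<omega> \<partial>gauss_space) \<le> ennreal (8 * C * (2 / 2 ^ i + 6 * BB n i))"
        "\<And>s t \<omega>. c s = c t \<Longrightarrow> ennreal \<bar>linf_eval (N n \<omega>) s - linf_eval (N n \<omega>) t\<bar> \<le> W \<omega>"
        using N_cells by blast
      ultimately show ?case using num
        by (intro exI[of _ c] exI[of _ W]) (auto intro: less_le_trans order_trans)
    qed
    then show ?thesis by blast
  qed
  have N_inc_ip: "(\<lambda>\<omega>. linf_eval (N n \<omega>) s - linf_eval (N n \<omega>) t) \<in> L2 gauss_space"
      "ip gauss_space (\<lambda>\<omega>. linf_eval (N n \<omega>) s - linf_eval (N n \<omega>) t) (\<lambda>\<omega>. linf_eval (N n \<omega>) s - linf_eval (N n \<omega>) t) =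
       ip (M n) (\<lambda>\<omega>. em n (f n s) \<omega> - em n (f n t) \<omega>) (\<lambda>\<omega>. em n (f n s) \<omega> - em n (f n t) \<omega>)" for n s t
  proof -
    show "(\<lambda>\<omega>. linf_eval (N n \<omega>) s - linf_eval (N n \<omega>) t) \<in> L2 gauss_space" by (intro L2_diff N_L2)
    show "ip gauss_space (\<lambda>\<omega>. linf_eval (N n \<omega>) s - linf_eval (N n \<omega>) t) (\<lambda>\<omega>. linf_eval (N n \<omega>) s - linf_eval (N n \<omega>) t) =
       ip (M n) (\<lambda>\<omega>. em n (f n s) \<omega> - em n (f n t) \<omega>) (\<lambda>\<omega>. em n (f n s) \<omega> - em n (f n t) \<omega>)"
      unfolding ip_diff_self[OF N_L2 N_L2] ip_diff_self[OF em_L2(1) em_L2(1)] N_ip ..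
  qed
  have incN: "\<exists>\<delta>>0. \<forall>\<^sub>F n in sequentially. \<forall>s t. d s t < \<delta> \<longrightarrow>
      (\<integral>\<^sup>+\<omega>. ennreal \<bar>linf_eval (N n \<omega>) s - linf_eval (N n \<omega>) t\<bar> \<partial>gauss_space) \<le> ennreal \<tau>" if \<tau>: "0 < \<tau>" for \<tau>
  proof -
    define \<tau>' where "\<tau>' = \<tau> / (1 + V)"
    have t': "0 < \<tau>'" "(1 + V) * \<tau>' = \<tau>" using \<tau> V0 by (auto simp: \<tau>'_def)
    obtain \<delta> where \<delta>: "0 < \<delta>" "\<forall>\<^sub>F n in sequentially. \<forall>s t. d s t < \<delta> \<longrightarrow> ?rs n (\<lambda>x. f n s x - f n t x) \<le> ennreal \<tau>'"
      using dsmall[OF t'(1)] by blast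
    have "\<forall>\<^sub>F n in sequentially. \<forall>s t. d s t < \<delta> \<longrightarrow>
      (\<integral>\<^sup>+\<omega>. ennreal \<bar>linf_eval (N n \<omega>) s - linf_eval (N n \<omega>) t\<bar> \<partial>gauss_space) \<le> ennreal \<tau>"
      using \<delta>(2)
    proof (rule eventually_mono, intro allI impI)
      fix n s t assume "\<forall>s t. d s t < \<delta> \<longrightarrow> ?rs n (\<lambda>x. f n s x - f n t x) \<le> ennreal \<tau>'" "d s t < \<delta>"
      then have "?rs n (\<lambda>x. f n s x - f n t x) \<le> ennreal \<tau>'" by blast
      from gauss_space.abs_mean_le[OF N_inc_ip(1) _ t'(1), of n s t V] em_inc(2)[OF t'(1) this]
      show "(\<integral>\<^sup>+\<omega>. ennreal \<bar>linf_eval (N n \<omega>) s - linf_eval (N n \<omega>) t\<bar> \<partial>gauss_space) \<le> ennreal \<tau>"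
        by (simp add: N_inc_ip(2) t'(2))
    qed
    then show ?thesis using \<delta>(1) by blast
  qed
  have tightN: "asymptotically_tight (\<lambda>_. gauss_space) N"
  proof (rule linf_asymptotically_tightI_semimetric[OF prob_space_gauss_space assms(14,15)])
    show "\<exists>\<delta>>0. \<forall>\<^sub>F n in sequentially. likely gauss_space \<epsilon> (\<lambda>\<omega>. \<forall>s t. d s t < \<delta> \<longrightarrow> \<bar>linf_eval (N n \<omega>) s - linf_eval (N n \<omega>) t\<bar> \<le> \<eta>)"
      if "0 < \<epsilon>" "0 < \<eta>" for \<epsilon> \<eta>
      by (rule equicontinuity_of_cells[where M = "\<lambda>_. gauss_space" and x = "\<lambda>n t \<omega>. linf_eval (N n \<omega>) t",
            OF prob_space_gauss_space N_eval_meas cellsN incN that])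
    show "\<exists>R. \<forall>\<^sub>F n in sequentially. likely gauss_space \<epsilon> (\<lambda>\<omega>. \<bar>linf_eval (N n \<omega>) t\<bar> \<le> R)"
      if "0 < \<epsilon>" for \<epsilon> t
      by (rule bounded_in_probability[where P = "\<lambda>_. gauss_space" and x = "\<lambda>n \<omega>. linf_eval (N n \<omega>) t", OF prob_space_gauss_space N_L2 _ V0 s that])
        (simp add: N_ip em_L2(2))
  qed
  have corr: "corresponding_gaussian_process gauss_space (N n) (M n) (G n)" for n
    unfolding corresponding_gaussian_process_def
  proof (intro conjI allI)
    show "(\<lambda>\<omega>. linf_eval (G n \<omega>) t) \<in> borel_measurable (M n)" for t by (simp add: eval em_meas)
    show "integrable (M n) (\<lambda>\<omega>. (linf_eval (G n \<omega>) t)\<^sup>2)" for t using em_L2(1)[of n t] by (simp add: eval L2_def)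
    show "gaussian_process gauss_space (\<lambda>t \<omega>. linf_eval (N n \<omega>) t)" by (rule N_gauss)
    show "(\<integral>\<omega>. linf_eval (N n \<omega>) t \<partial>gauss_space) = 0" for t by (rule N_mean)
    have "(\<integral>\<omega>. em n (f n t) \<omega> \<partial>M n) = 0" for t
      unfolding em_def by (rule mixing_row.emp_mean[OF row fint])
    then show "covariance gauss_space (\<lambda>\<omega>. linf_eval (N n \<omega>) s) (\<lambda>\<omega>. linf_eval (N n \<omega>) t) =
            covariance (M n) (\<lambda>\<omega>. linf_eval (G n \<omega>) s) (\<lambda>\<omega>. linf_eval (G n \<omega>) t)" for s t
      using N_ip[of n s t] by (simp add: covariance_def N_mean eval ip_def)
  qed
  show ?thesis
    using tightG joint_space[OF prob_space_gauss_space N_meas N_tight corr tightN] by blast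
qed

end
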